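(* Let $n\ge 1$. There is a bijection between the set of cyclotomic spin Hecke algebras $\mathcal{H}_n^{I,-}$ (as quotients of $\widehat{\mathcal{H}}_n^-$) and the set of cyclotomic Hecke-Clifford algebras $\mathcal{H}c_n^F$ (as quotients of $\widehat{\mathcal{H}c}_n$). More explicitly, every cyclotomic Hecke-Clifford algebra $\mathcal{H}c_n^F$ is isomorphic, via the map induced by $\Phi$, to $\mathcal{C}_n\otimes\mathcal{H}_n^{I,-}$ for some cyclotomic spin Hecke algebra $\mathcal{H}_n^{I,-}$. Conversely, for each cyclotomic spin Hecke algebra $\mathcal{H}_n^{I,-}$, the algebra $\mathcal{C}_n\otimes\mathcal{H}_n^{I,-}$ is isomorphic, via the map induced by $\Psi$, to some cyclotomic Hecke-Clifford algebra.
   Context: Let $q$ be a formal parameter and $\varepsilon=q-q^{-1}$ (the parameter $q$ is not to be confused with the generators $q_i$). Algebras are unital and associative. The Clifford algebra $\mathcal{C}_n$ is the $\mathbb{C}$-superalgebra generated by odd elements $c_1,\dots,c_n$ with $c_i^2=1$ and $c_ic_j=-c_jc_i$ $(i\ne j)$. The affine Hecke-Clifford algebra $\widehat{\mathcal{H}c}_n$ is the $\mathbb{C}(q)$-algebra generated by $T_i$ $(1\le i\le n-1)$ and $c_i, X_i^{\pm1}$ $(1\le i\le n)$ subject to: $(T_i-q)(T_i+q^{-1})=0$; $T_iT_{i+1}T_i=T_{i+1}T_iT_{i+1}$; $T_iT_j=T_jT_i$ for $|i-j|>1$; $T_ic_i=c_{i+1}T_i$; $T_ic_j=c_jT_i$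 for $j\ne i,i+1$; $c_i^2=1$; $c_ic_j=-c_jc_i$ for $i\neq j$; $X_iX_i^{-1}=X_i^{-1}X_i=1$; $(T_i+\varepsilon c_ic_{i+1})X_iT_i=X_{i+1}$; $T_iX_j=X_jT_i$ for $j\ne i,i+1$; $X_iX_j=X_jX_i$; $X_ic_i=c_iX_i^{-1}$; $X_ic_j=c_jX_i$ for $i\ne j$. It is a superalgebra with $T_i,X_i$ even and $c_i$ odd. The spin affine Hecke algebra $\widehat{\mathcal{H}}_n^-$ is the $\mathbb{C}(q)$-algebra generated by $R_i$ $(1\le i\le n-1)$ and $p_i,q_i$ $(1\le i\le n)$ subject to: $R_i^2=-\varepsilon^2-2$; $R_iR_j=-R_jR_i$ for $|i-j|>1$; $R_iR_{i+1}R_i-R_{i+1}R_iR_{i+1}=\varepsilon^2(R_{i+1}-R_i)$; $p_ip_j=p_jp_i$ and $q_iq_j=-q_jq_i$ for $i\ne j$; $p_i^2+q_i^2=1$; $p_iq_j=q_jp_i$ for all $i,j$; $R_ip_j=p_jR_i$ and $R_iq_j=-q_jR_i$ for $j\ne i,i+1$; $R_ip_i=p_{i+1}R_i+\varepsilon(q_i-q_{i+1})$; $R_iq_i=-q_{i+1}R_i-\varepsilon(p_i+p_{i+1})$. It is a superalgebra with $p_i$ even and $q_i,R_i$ odd. Tensor products of superalgebras use the multiplication $(c'\otimes b')(c\otimes b)=(-1)^{|b'||c|}c'c\otimes b'b$ (over $\mathbb{C}$, or equivalently over $\mathbb{C}(q)$ after extending $\mathcal{C}_n$ to $\mathbb{C}(q)$),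 and one writes $c=c\otimes1$, $b=1\otimes b$, $cb=c\otimes b$. There is an isomorphism of superalgebras $\Phi:\widehat{\mathcal{H}c}_n\to\mathcal{C}_n\otimes\widehat{\mathcal{H}}_n^-$ that is the identity on $\mathcal{C}_n$, with $\Phi(T_i)=-\frac12R_i(c_i-c_{i+1})+\frac{\varepsilon}{2}(1-c_ic_{i+1})$, $\Phi(X_i^{\pm1})=p_i\mp c_iq_i$; its inverse $\Psi$ is the identity on $\mathcal{C}_n$ with $\Psi(R_i)=(c_i-c_{i+1})T_i+\varepsilon c_{i+1}$, $\Psi(p_i)=\frac12(X_i+X_i^{-1})$, $\Psi(q_i)=\frac12(X_i-X_i^{-1})c_i$. Cyclotomic spin Hecke algebras: let $\mathcal{A}_1=\mathbb{C}(q)[p_1,q_1]/\langle p_1^2+q_1^2-1\rangle$, viewed as the commutative subalgebra of $\widehat{\mathcal{H}}_n^-$ generated by $p_1$ (even) and $q_1$ (odd). For a nonzero $\mathbb{Z}_2$-homogeneous ideal $I_1\subset\mathcal{A}_1$ let $I=\langle I_1\rangle$ be the two-sided ideal of $\widehat{\mathcal{H}}_n^-$ generated by $I_1$; then $\mathcal{H}_n^{I,-}:=\widehat{\mathcal{H}}_n^-/I$, with the inherited superalgebra structure. Cyclotomic Hecke-Clifford algebras: let $F(X_1)=a_dX_1^d+a_{d-1}X_1^{d-1}+\cdots+a_1X_1+a_0$ be a polynomial with coefficients in $\mathbb{C}(q)$ such that $a_d=1$ and $a_i=a_0a_{d-i}$ for all $0\le i\le d$; then $\mathcal{H}c_n^F:=\widehat{\mathcal{H}c}_n/\langle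 F(X_1)\rangle$. *)

theory Defs
  imports
    "HOL-Computational_Algebra.Polynomial"
    "HOL-Computational_Algebra.Fraction_Field"
    "HOL-Library.Poly_Mapping"
    "HOL-Algebra.Module"
    "HOL-Algebra.QuotRing"
begin

section \<open>Superalgebras over \<open>\<complex>(q)\<close>\<close>

type_synonym cq = "complex poly fract"

definition qpar :: cq where
  "qpar = Fract [:0, 1:] 1"

definition eps :: cq where
  "eps = qpar - inverse qpar"

text \<open>A record for (not necessarily commutative) algebras with a \<open>\<int>/2\<close>-grading:
  \<open>grade A False\<close> is the even part and \<open>grade A True\<close> the odd part.\<close>

record 'a superalg = "(cq, 'a) module" +
  grade :: "bool \<Rightarrow> 'a set"

text \<open>The component of parity \<open>s\<close> of an element.\<close>

definition hcomp :: "'a superalg \<Rightarrow> bool \<Rightarrow> 'a \<Rightarrow> 'a" where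
  "hcomp A s x = (THE y. y \<in> grade A s \<and> (\<exists>z\<in>grade A (\<not> s). x = y \<oplus>\<^bsub>A\<^esub> z))"

definition homogeneous_ideal :: "'a set \<Rightarrow> 'a superalg \<Rightarrow> bool" where
  "homogeneous_ideal I A \<longleftrightarrow> ideal I A \<and> (\<forall>x\<in>I. \<forall>s. hcomp A s x \<in> I)"

definition superalg_iso :: "'a superalg \<Rightarrow> 'b superalg \<Rightarrow> ('a \<Rightarrow> 'b) set" where
  "superalg_iso A B = {\<theta> \<in> ring_iso A B.
     (\<forall>k. \<forall>x\<in>carrier A. \<theta> (k \<odot>\<^bsub>A\<^esub> x) = k \<odot>\<^bsub>B\<^esub> \<theta> x) \<and>
     (\<forall>s. \<theta> ` grade A s = grade B s)}"

text \<open>Quotient of a superalgebra by an ideal: the quotient ring of the library, with the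
  inherited scalar multiplication and grading.\<close>

definition superquot :: "'a superalg \<Rightarrow> 'a set \<Rightarrow> 'a set superalg" where
  "superquot A I = \<lparr>
     carrier = carrier (A Quot I), mult = mult (A Quot I), one = one (A Quot I),
     zero = zero (A Quot I), add = add (A Quot I),
     smult = (\<lambda>k U. \<Union>u\<in>U. I +>\<^bsub>A\<^esub> (k \<odot>\<^bsub>A\<^esub> u)),
     grade = (\<lambda>s. (\<lambda>x. I +>\<^bsub>A\<^esub> x) ` grade A s)\<rparr>"

text \<open>The class of \<open>x\<close> in an algebra \<open>Q\<close> whose elements are cosets, i.e. the value at \<open>x\<close> of
  the quotient map onto \<open>Q\<close>.\<close>

definition cls :: "'a set superalg \<Rightarrow> 'a \<Rightarrow> 'a set" where
  "cls Q x = (THE U. U \<in> carrier Q \<and> x \<in> U)"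

text \<open>\<open>lin_ext D \<beta>\<close> is the linear map to \<open>D\<close> sending the basis vector \<open>b\<close> to \<open>\<beta> b\<close>;
  \<open>lift D \<beta>\<close> is the map it induces on cosets (provided it is constant on them).\<close>

definition lin_ext :: "'d superalg \<Rightarrow> ('b \<Rightarrow> 'd) \<Rightarrow> ('b \<Rightarrow>\<^sub>0 cq) \<Rightarrow> 'd" where
  "lin_ext D \<beta> x = (\<Oplus>\<^bsub>D\<^esub>b\<in>Poly_Mapping.keys x. Poly_Mapping.lookup x b \<odot>\<^bsub>D\<^esub> \<beta> b)"

definition lift :: "'d superalg \<Rightarrow> ('b \<Rightarrow> 'd) \<Rightarrow> ('b \<Rightarrow>\<^sub>0 cq) set \<Rightarrow> 'd" where
  "lift D \<beta> U = the_elem (lin_ext D \<beta> ` U)"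

definition scale :: "cq \<Rightarrow> ('b \<Rightarrow>\<^sub>0 cq) \<Rightarrow> ('b \<Rightarrow>\<^sub>0 cq)" where
  "scale k f = Poly_Mapping.map (\<lambda>c. k * c) f"


section \<open>Superalgebras given by generators and relations\<close>

text \<open>With concatenation as addition, \<open>'g list \<Rightarrow>\<^sub>0 cq\<close> with its library multiplication
  (convolution) is the free unital associative algebra on \<open>'g\<close>.\<close>

instantiation list :: (type) monoid_add
begin
definition zero_list :: "'a list" where "zero_list = []"
definition plus_list :: "'a list \<Rightarrow> 'a list \<Rightarrow> 'a list" where "plus_list = (@)"
instance by standard (simp_all add: zero_list_def plus_list_def)
end

abbreviation gen :: "'g \<Rightarrow> ('g list \<Rightarrow>\<^sub>0 cq)" where
  "gen g \<equiv> Poly_Mapping.single [g] 1"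

abbreviation scal :: "cq \<Rightarrow> ('g list \<Rightarrow>\<^sub>0 cq)" where
  "scal k \<equiv> Poly_Mapping.single [] k"

text \<open>Free superalgebra on the generators in \<open>G\<close>; \<open>par g\<close> holds iff \<open>g\<close> is odd.\<close>

definition free_superalg :: "'g set \<Rightarrow> ('g \<Rightarrow> bool) \<Rightarrow> ('g list \<Rightarrow>\<^sub>0 cq) superalg" where
  "free_superalg G par = \<lparr>
     carrier = {f. Poly_Mapping.keys f \<subseteq> lists G},
     mult = (*), one = 1, zero = 0, add = (+), smult = scale,
     grade = (\<lambda>s. {f. Poly_Mapping.keys f \<subseteq> {w \<in> lists G. odd (length (filter par w)) = s}})\<rparr>"

definition presented ::
  "'g set \<Rightarrow> ('g \<Rightarrow> bool) \<Rightarrow> ('g list \<Rightarrow>\<^sub>0 cq) set \<Rightarrow> ('g list \<Rightarrow>\<^sub>0 cq) set superalg" where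
  "presented G par Rel =
     superquot (free_superalg G par) (genideal (free_superalg G par) Rel)"

text \<open>The homomorphism from a presented algebra to \<open>D\<close> with prescribed values \<open>\<phi>\<close> on the
  generators.\<close>

definition gen_hom :: "'d superalg \<Rightarrow> ('g \<Rightarrow> 'd) \<Rightarrow> ('g list \<Rightarrow>\<^sub>0 cq) set \<Rightarrow> 'd" where
  "gen_hom D \<phi> = lift D (\<lambda>w. foldr (\<lambda>g a. \<phi> g \<otimes>\<^bsub>D\<^esub> a) w \<one>\<^bsub>D\<^esub>)"


section \<open>Tensor products of superalgebras\<close>

text \<open>The vector space \<open>A \<otimes> B\<close> is the free vector space on \<open>carrier A \<times> carrier B\<close> modulo the
  span of the bilinearity relations. The free vector space already carries the bilinear product
  (in general neither associative nor unital) with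
  \<open>(a', b') \<cdot> (a, b) = (-1)\<^bsup>|b'||a|\<^esup> (a'a, b'b)\<close> for homogeneous \<open>b'\<close> and \<open>a\<close>; for
  general \<open>b'\<close> and \<open>a\<close> one sums over their homogeneous components.\<close>

definition koszul :: "bool \<Rightarrow> bool \<Rightarrow> cq" where
  "koszul s t = (if s \<and> t then - 1 else 1)"

definition pretensor :: "'a superalg \<Rightarrow> 'b superalg \<Rightarrow> ('a \<times> 'b \<Rightarrow>\<^sub>0 cq) superalg" where
  "pretensor A B = \<lparr>
     carrier = {f. Poly_Mapping.keys f \<subseteq> carrier A \<times> carrier B},
     mult = (\<lambda>f g. \<Sum>(a', b')\<in>Poly_Mapping.keys f. \<Sum>(a, b)\<in>Poly_Mapping.keys g.
               \<Sum>s\<in>UNIV. \<Sum>t\<in>UNIV.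
                 Poly_Mapping.single (a' \<otimes>\<^bsub>A\<^esub> hcomp A t a, hcomp B s b' \<otimes>\<^bsub>B\<^esub> b)
                   (koszul s t * Poly_Mapping.lookup f (a', b') * Poly_Mapping.lookup g (a, b))),
     one = Poly_Mapping.single (\<one>\<^bsub>A\<^esub>, \<one>\<^bsub>B\<^esub>) 1,
     zero = 0, add = (+), smult = scale,
     grade = (\<lambda>s. {f. Poly_Mapping.keys f \<subseteq>
                      (\<Union>t. grade A t \<times> grade B (t \<noteq> s))})\<rparr>"

definition bilinear_rels :: "'a superalg \<Rightarrow> 'b superalg \<Rightarrow> ('a \<times> 'b \<Rightarrow>\<^sub>0 cq) set" where
  "bilinear_rels A B =
     {Poly_Mapping.single (a \<oplus>\<^bsub>A\<^esub> a', b) 1 - Poly_Mapping.single (a, b) 1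
        - Poly_Mapping.single (a', b) 1 | a a' b. a \<in> carrier A \<and> a' \<in> carrier A \<and> b \<in> carrier B} \<union>
     {Poly_Mapping.single (a, b \<oplus>\<^bsub>B\<^esub> b') 1 - Poly_Mapping.single (a, b) 1
        - Poly_Mapping.single (a, b') 1 | a b b'. a \<in> carrier A \<and> b \<in> carrier B \<and> b' \<in> carrier B} \<union>
     {Poly_Mapping.single (k \<odot>\<^bsub>A\<^esub> a, b) 1 - Poly_Mapping.single (a, b) k
        | k a b. a \<in> carrier A \<and> b \<in> carrier B} \<union>
     {Poly_Mapping.single (a, k \<odot>\<^bsub>B\<^esub> b) 1 - Poly_Mapping.single (a, b) k
        | k a b. a \<in> carrier A \<and> b \<in> carrier B}"

definition stensor :: "'a superalg \<Rightarrow> 'b superalg \<Rightarrow> ('a \<times> 'b \<Rightarrow>\<^sub>0 cq) set superalg" where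
  "stensor A B = superquot (pretensor A B) (Modules.module.span scale (bilinear_rels A B))"

definition pure_tensor ::
  "'a superalg \<Rightarrow> 'b superalg \<Rightarrow> 'a \<Rightarrow> 'b \<Rightarrow> ('a \<times> 'b \<Rightarrow>\<^sub>0 cq) set" where
  "pure_tensor A B a b = cls (stensor A B) (Poly_Mapping.single (a, b) 1)"

text \<open>\<open>f \<otimes> g\<close> for linear maps \<open>f\<close> to \<open>A\<close> and \<open>g\<close> to \<open>B\<close>.\<close>

definition tensor_map ::
  "'a superalg \<Rightarrow> 'b superalg \<Rightarrow> ('c \<Rightarrow> 'a) \<Rightarrow> ('d \<Rightarrow> 'b)
    \<Rightarrow> ('c \<times> 'd \<Rightarrow>\<^sub>0 cq) set \<Rightarrow> ('a \<times> 'b \<Rightarrow>\<^sub>0 cq) set" where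
  "tensor_map A B f g = lift (stensor A B) (\<lambda>(c, d). pure_tensor A B (f c) (g d))"


section \<open>The Clifford, affine Hecke-Clifford and spin affine Hecke algebras\<close>

text \<open>Each relation \<open>l = r\<close> is entered as the element \<open>l - r\<close> of the free algebra.
  The Clifford algebra is taken over \<open>\<complex>(q)\<close>.\<close>

datatype clifford_gen = ClC nat

definition clifford_rels :: "nat \<Rightarrow> (clifford_gen list \<Rightarrow>\<^sub>0 cq) set" where
  "clifford_rels n = (let c = (\<lambda>i. gen (ClC i)) in
     {c i * c i - 1 | i. i \<in> {1..n}} \<union>
     {c i * c j + c j * c i | i j. i \<in> {1..n} \<and> j \<in> {1..n} \<and> i \<noteq> j})"

definition clifford :: "nat \<Rightarrow> (clifford_gen list \<Rightarrow>\<^sub>0 cq) set superalg" where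
  "clifford n = presented (ClC ` {1..n}) (\<lambda>_. True) (clifford_rels n)"

text \<open>\<open>HcXi i\<close> is the generator \<open>X\<^sub>i\<close> inverse.\<close>

datatype hc_gen = HcT nat | HcC nat | HcX nat | HcXi nat

fun hc_par :: "hc_gen \<Rightarrow> bool" where
  "hc_par (HcC _) = True"
| "hc_par _ = False"

definition hc_gens :: "nat \<Rightarrow> hc_gen set" where
  "hc_gens n = HcT ` {1..<n} \<union> HcC ` {1..n} \<union> HcX ` {1..n} \<union> HcXi ` {1..n}"

definition hc_rels :: "nat \<Rightarrow> (hc_gen list \<Rightarrow>\<^sub>0 cq) set" where
  "hc_rels n = (let T = (\<lambda>i. gen (HcT i)); c = (\<lambda>i. gen (HcC i));
                    x = (\<lambda>i. gen (HcX i)); x' = (\<lambda>i. gen (HcXi i)) in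
     {(T i - scal qpar) * (T i + scal (inverse qpar)) | i. i \<in> {1..<n}} \<union>
     {T i * T (i + 1) * T i - T (i + 1) * T i * T (i + 1) | i. i \<in> {1..<n} \<and> i + 1 \<in> {1..<n}} \<union>
     {T i * T j - T j * T i | i j. i \<in> {1..<n} \<and> j \<in> {1..<n} \<and> (i + 1 < j \<or> j + 1 < i)} \<union>
     {T i * c i - c (i + 1) * T i | i. i \<in> {1..<n}} \<union>
     {T i * c j - c j * T i | i j. i \<in> {1..<n} \<and> j \<in> {1..n} \<and> j \<noteq> i \<and> j \<noteq> i + 1} \<union>
     {c i * c i - 1 | i. i \<in> {1..n}} \<union>
     {c i * c j + c j * c i | i j. i \<in> {1..n} \<and> j \<in> {1..n} \<and> i \<noteq> j} \<union>
     {x i * x' i - 1 | i. i \<in> {1..n}} \<union>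
     {x' i * x i - 1 | i. i \<in> {1..n}} \<union>
     {(T i + scal eps * c i * c (i + 1)) * x i * T i - x (i + 1) | i. i \<in> {1..<n}} \<union>
     {T i * x j - x j * T i | i j. i \<in> {1..<n} \<and> j \<in> {1..n} \<and> j \<noteq> i \<and> j \<noteq> i + 1} \<union>
     {x i * x j - x j * x i | i j. i \<in> {1..n} \<and> j \<in> {1..n}} \<union>
     {x i * c i - c i * x' i | i. i \<in> {1..n}} \<union>
     {x i * c j - c j * x i | i j. i \<in> {1..n} \<and> j \<in> {1..n} \<and> i \<noteq> j})"

definition affine_hc :: "nat \<Rightarrow> (hc_gen list \<Rightarrow>\<^sub>0 cq) set superalg" where
  "affine_hc n = presented (hc_gens n) hc_par (hc_rels n)"

datatype spin_gen = SpR nat | SpP nat | SpQ nat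

fun spin_par :: "spin_gen \<Rightarrow> bool" where
  "spin_par (SpP _) = False"
| "spin_par _ = True"

definition spin_gens :: "nat \<Rightarrow> spin_gen set" where
  "spin_gens n = SpR ` {1..<n} \<union> SpP ` {1..n} \<union> SpQ ` {1..n}"

definition spin_rels :: "nat \<Rightarrow> (spin_gen list \<Rightarrow>\<^sub>0 cq) set" where
  "spin_rels n = (let R = (\<lambda>i. gen (SpR i)); p = (\<lambda>i. gen (SpP i)); q = (\<lambda>i. gen (SpQ i)) in
     {R i * R i - scal (- (eps ^ 2) - 2) | i. i \<in> {1..<n}} \<union>
     {R i * R j + R j * R i | i j. i \<in> {1..<n} \<and> j \<in> {1..<n} \<and> (i + 1 < j \<or> j + 1 < i)} \<union>
     {R i * R (i + 1) * R i - R (i + 1) * R i * R (i + 1) - scal (eps ^ 2) * (R (i + 1) - R i)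
        | i. i \<in> {1..<n} \<and> i + 1 \<in> {1..<n}} \<union>
     {p i * p j - p j * p i | i j. i \<in> {1..n} \<and> j \<in> {1..n} \<and> i \<noteq> j} \<union>
     {q i * q j + q j * q i | i j. i \<in> {1..n} \<and> j \<in> {1..n} \<and> i \<noteq> j} \<union>
     {p i * p i + q i * q i - 1 | i. i \<in> {1..n}} \<union>
     {p i * q j - q j * p i | i j. i \<in> {1..n} \<and> j \<in> {1..n}} \<union>
     {R i * p j - p j * R i | i j. i \<in> {1..<n} \<and> j \<in> {1..n} \<and> j \<noteq> i \<and> j \<noteq> i + 1} \<union>
     {R i * q j + q j * R i | i j. i \<in> {1..<n} \<and> j \<in> {1..n} \<and> j \<noteq> i \<and> j \<noteq> i + 1} \<union>
     {R i * p i - p (i + 1) * R i - scal eps * (q i - q (i + 1)) | i. i \<in> {1..<n}} \<union>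
     {R i * q i + q (i + 1) * R i + scal eps * (p i + p (i + 1)) | i. i \<in> {1..<n}})"

definition affine_spin :: "nat \<Rightarrow> (spin_gen list \<Rightarrow>\<^sub>0 cq) set superalg" where
  "affine_spin n = presented (spin_gens n) spin_par (spin_rels n)"


section \<open>The maps \<open>\<Phi>\<close> and \<open>\<Psi>\<close>\<close>

definition Phi :: "nat \<Rightarrow> (hc_gen list \<Rightarrow>\<^sub>0 cq) set \<Rightarrow>
    ((clifford_gen list \<Rightarrow>\<^sub>0 cq) set \<times> (spin_gen list \<Rightarrow>\<^sub>0 cq) set \<Rightarrow>\<^sub>0 cq) set" where
  "Phi n = (let C = clifford n; H = affine_spin n; D = stensor C H;
      c = (\<lambda>i. pure_tensor C H (cls C (gen (ClC i))) \<one>\<^bsub>H\<^esub>);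
      b = (\<lambda>g. pure_tensor C H \<one>\<^bsub>C\<^esub> (cls H (gen g)))
    in gen_hom D (\<lambda>g. case g of
        HcT i \<Rightarrow> (- (1 / 2)) \<odot>\<^bsub>D\<^esub> (b (SpR i) \<otimes>\<^bsub>D\<^esub> (c i \<ominus>\<^bsub>D\<^esub> c (i + 1)))
                  \<oplus>\<^bsub>D\<^esub> (eps / 2) \<odot>\<^bsub>D\<^esub> (\<one>\<^bsub>D\<^esub> \<ominus>\<^bsub>D\<^esub> c i \<otimes>\<^bsub>D\<^esub> c (i + 1))
      | HcC i \<Rightarrow> c i
      | HcX i \<Rightarrow> b (SpP i) \<ominus>\<^bsub>D\<^esub> c i \<otimes>\<^bsub>D\<^esub> b (SpQ i)
      | HcXi i \<Rightarrow> b (SpP i) \<oplus>\<^bsub>D\<^esub> c i \<otimes>\<^bsub>D\<^esub> b (SpQ i)))"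

definition Psi :: "nat \<Rightarrow>
    ((clifford_gen list \<Rightarrow>\<^sub>0 cq) set \<times> (spin_gen list \<Rightarrow>\<^sub>0 cq) set \<Rightarrow>\<^sub>0 cq) set \<Rightarrow>
    (hc_gen list \<Rightarrow>\<^sub>0 cq) set" where
  "Psi n = (let A = affine_hc n;
      T = (\<lambda>i. cls A (gen (HcT i))); c = (\<lambda>i. cls A (gen (HcC i)));
      x = (\<lambda>i. cls A (gen (HcX i))); x' = (\<lambda>i. cls A (gen (HcXi i)));
      psiC = gen_hom A (\<lambda>g. case g of ClC i \<Rightarrow> c i);
      psiH = gen_hom A (\<lambda>g. case g of
          SpR i \<Rightarrow> (c i \<ominus>\<^bsub>A\<^esub> c (i + 1)) \<otimes>\<^bsub>A\<^esub> T i \<oplus>\<^bsub>A\<^esub> eps \<odot>\<^bsub>A\<^esub> c (i + 1)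
        | SpP i \<Rightarrow> (1 / 2) \<odot>\<^bsub>A\<^esub> (x i \<oplus>\<^bsub>A\<^esub> x' i)
        | SpQ i \<Rightarrow> (1 / 2) \<odot>\<^bsub>A\<^esub> ((x i \<ominus>\<^bsub>A\<^esub> x' i) \<otimes>\<^bsub>A\<^esub> c i))
    in lift A (\<lambda>(a, b). psiC a \<otimes>\<^bsub>A\<^esub> psiH b))"


section \<open>Cyclotomic quotients\<close>

text \<open>\<open>\<complex>(q)[p\<^sub>1, q\<^sub>1] / \<langle>p\<^sub>1\<^sup>2 + q\<^sub>1\<^sup>2 - 1\<rangle>\<close>, the polynomial ring being presented as the free
  algebra modulo the commutator of \<open>p\<^sub>1\<close> and \<open>q\<^sub>1\<close>. It is viewed as a subalgebra of
  \<open>affine_spin n\<close> through the map \<open>circle_emb n\<close> below.\<close>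

definition circle_alg :: "(spin_gen list \<Rightarrow>\<^sub>0 cq) set superalg" where
  "circle_alg = (let p = gen (SpP 1); q = gen (SpQ 1) in
     presented {SpP 1, SpQ 1} spin_par {p * q - q * p, p * p + q * q - 1})"

definition circle_emb ::
  "nat \<Rightarrow> (spin_gen list \<Rightarrow>\<^sub>0 cq) set \<Rightarrow> (spin_gen list \<Rightarrow>\<^sub>0 cq) set" where
  "circle_emb n = gen_hom (affine_spin n) (\<lambda>g. cls (affine_spin n) (gen g))"

definition spin_quotient ::
  "nat \<Rightarrow> (spin_gen list \<Rightarrow>\<^sub>0 cq) set set \<Rightarrow> (spin_gen list \<Rightarrow>\<^sub>0 cq) set set superalg" where
  "spin_quotient n I1 =
     superquot (affine_spin n) (genideal (affine_spin n) (circle_emb n ` I1))"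

text \<open>The sets of all cyclotomic quotients of a given affine algebra. As the elements of a
  quotient are cosets, two of them are equal iff the ideals divided out are.\<close>

definition cyclotomic_spin :: "nat \<Rightarrow> (spin_gen list \<Rightarrow>\<^sub>0 cq) set set superalg set" where
  "cyclotomic_spin n =
     {spin_quotient n I1 | I1. homogeneous_ideal I1 circle_alg \<and> I1 \<noteq> {\<zero>\<^bsub>circle_alg\<^esub>}}"

definition eval_poly :: "'a superalg \<Rightarrow> cq poly \<Rightarrow> 'a \<Rightarrow> 'a" where
  "eval_poly A F x = (\<Oplus>\<^bsub>A\<^esub>i\<in>{..degree F}. coeff F i \<odot>\<^bsub>A\<^esub> (x [^]\<^bsub>A\<^esub> i))"

definition admissible :: "cq poly \<Rightarrow> bool" where
  "admissible F \<longleftrightarrow> coeff F (degree F) = 1 \<and>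
     (\<forall>i\<le>degree F. coeff F i = coeff F 0 * coeff F (degree F - i))"

definition hc_quotient :: "nat \<Rightarrow> cq poly \<Rightarrow> (hc_gen list \<Rightarrow>\<^sub>0 cq) set set superalg" where
  "hc_quotient n F = superquot (affine_hc n)
     (genideal (affine_hc n) {eval_poly (affine_hc n) F (cls (affine_hc n) (gen (HcX 1)))})"

definition cyclotomic_hc :: "nat \<Rightarrow> (hc_gen list \<Rightarrow>\<^sub>0 cq) set set superalg set" where
  "cyclotomic_hc n = {hc_quotient n F | F. admissible F}"


section \<open>Isomorphisms induced by \<open>\<Phi>\<close> and \<open>\<Psi>\<close>\<close>

text \<open>For a quotient \<open>A\<close> of \<open>affine_hc n\<close> and a quotient \<open>B\<close> of \<open>affine_spin n\<close>, the maps
  \<open>cls A\<close> and \<open>cls B\<close> are the two projections.\<close>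

definition iso_via_Phi :: "nat \<Rightarrow> (hc_gen list \<Rightarrow>\<^sub>0 cq) set set superalg
    \<Rightarrow> (spin_gen list \<Rightarrow>\<^sub>0 cq) set set superalg \<Rightarrow> bool" where
  "iso_via_Phi n A B \<longleftrightarrow> (\<exists>\<theta>\<in>superalg_iso A (stensor (clifford n) B).
     \<forall>x\<in>carrier (affine_hc n).
       \<theta> (cls A x) = tensor_map (clifford n) B id (cls B) (Phi n x))"

definition iso_via_Psi :: "nat \<Rightarrow> (spin_gen list \<Rightarrow>\<^sub>0 cq) set set superalg
    \<Rightarrow> (hc_gen list \<Rightarrow>\<^sub>0 cq) set set superalg \<Rightarrow> bool" where
  "iso_via_Psi n B A \<longleftrightarrow> (\<exists>\<theta>\<in>superalg_iso (stensor (clifford n) B) A.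
     \<forall>y\<in>carrier (stensor (clifford n) (affine_spin n)).
       \<theta> (tensor_map (clifford n) B id (cls B) y) = cls A (Psi n y))"

end

theory Submission
  imports Defs
begin

text \<open>
  Both families of quotients are quotients by ideals, and \<open>\<Phi>\<close>, \<open>\<Psi>\<close> are mutually inverse. So if
  \<open>\<Phi>\<close> maps a homogeneous ideal \<open>J\<close> of the affine Hecke-Clifford algebra into the kernel of
  \<open>C \<otimes> H \<rightarrow> C \<otimes> H / I\<close>, and \<open>\<Psi>\<close> maps \<open>I\<close> into \<open>J\<close>, then \<open>\<Phi>\<close> and \<open>\<Psi>\<close> descend to mutually
  inverse isomorphisms between the quotient by \<open>J\<close> and \<open>C \<otimes> H / I\<close>. Each of the two ideals then
  determines the other one: \<open>J\<close> is the kernel of the composite to \<open>C \<otimes> H / I\<close>, and \<open>I\<close> consists of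
  the \<open>b \<in> H\<close> with \<open>\<Psi>(1 \<otimes> b) \<in> J\<close>, because \<open>b \<mapsto> 1 \<otimes> b\<close> is injective on \<open>H / I\<close>
  (\<open>C\<close> is not zero). This is lemma \<open>matching_ideals\<close>.

  It remains to see which ideals of the circle algebra correspond to which polynomials. As
  \<open>\<complex>\<close> contains a square root \<open>i\<close> of \<open>-1\<close>, the element \<open>z = p\<^sub>1 + i q\<^sub>1\<close> is invertible with inverse
  \<open>p\<^sub>1 - i q\<^sub>1\<close>, and the circle algebra is the ring of Laurent polynomials in \<open>z\<close>. The parity
  automorphism exchanges \<open>z\<close> with its inverse. Hence a nonzero homogeneous ideal is generated by
  \<open>F(z)\<close> for a monic polynomial \<open>F\<close> with \<open>F(0) \<noteq> 0\<close> whose reflection is a multiple of \<open>F\<close>, and these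
  are the admissible polynomials (\<open>admissible_of_homogeneous\<close>, \<open>homogeneous_of_admissible\<close>).

  On the other side, \<open>\<Phi>(X\<^sub>1) = p\<^sub>1 - c\<^sub>1 q\<^sub>1\<close>, and \<open>- c\<^sub>1 q\<^sub>1\<close> behaves like \<open>i q\<^sub>1\<close>: it commutes with
  \<open>p\<^sub>1\<close> and has the square \<open>- q\<^sub>1\<^sup>2\<close>. More precisely \<open>y \<mapsto> y\<^sub>0 + i c\<^sub>1 y\<^sub>1\<close>, where \<open>y\<^sub>0\<close> and \<open>y\<^sub>1\<close> are
  the parity components of \<open>y\<close>, is a homomorphism on the circle algebra which maps \<open>z\<close> to
  \<open>\<Phi>(X\<^sub>1)\<close>, hence \<open>F(z)\<close> to \<open>\<Phi>(F(X\<^sub>1))\<close> (lemma \<open>twist\<close>). Since it multiplies the odd component by a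
  unit only, a homogeneous ideal and its image generate the same ideal
  (\<open>matching_generators\<close>).

  Most of the text below constructs the objects: the free, presented and quotient superalgebras,
  the tensor product of superalgebras with its universal property, and the proof that \<open>\<Phi>\<close> and
  \<open>\<Psi>\<close> respect the defining relations. Each of these relations involves two distant or at most
  three neighbouring indices, so everything reduces to finitely many identities between words in a
  few letters.
\<close>

section \<open>Vector spaces and linear maps with explicit carriers\<close>

locale vspace = abelian_group V for V :: "'a superalg" (structure) +
  assumes smult_closed [simp, intro]: "x \<in> carrier V \<Longrightarrow> k \<odot> x \<in> carrier V"
    and smult_l_distr: "x \<in> carrier V \<Longrightarrow> (k + l) \<odot> x = k \<odot> x \<oplus> l \<odot> x"
    and smult_r_distr: "x \<in> carrier V \<Longrightarrow> y \<in> carrier V \<Longrightarrow> k \<odot> (x \<oplus> y) = k \<odot> x \<oplus> k \<odot> y"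
    and smult_assoc: "x \<in> carrier V \<Longrightarrow> (k * l) \<odot> x = k \<odot> (l \<odot> x)"
    and smult_one [simp]: "x \<in> carrier V \<Longrightarrow> 1 \<odot> x = x"
begin

lemma smult_0_left [simp]: "x \<in> carrier V \<Longrightarrow> 0 \<odot> x = \<zero>"
  using smult_l_distr[of x 0 0] by (metis add.l_cancel_one add_0 smult_closed)

lemma smult_0_right [simp]: "k \<odot> \<zero> = \<zero>"
  using smult_r_distr[of \<zero> \<zero> k] by (metis add.l_cancel_one l_zero smult_closed zero_closed)

lemma smult_minus_left: "x \<in> carrier V \<Longrightarrow> (- k) \<odot> x = \<ominus> (k \<odot> x)"
  using smult_l_distr[of x "-k" k] by (metis add.inv_equality add.left_inverse smult_0_left smult_closed)

lemma smult_minus_right: "x \<in> carrier V \<Longrightarrow> k \<odot> (\<ominus> x) = \<ominus> (k \<odot> x)"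
  using smult_r_distr[of x "\<ominus> x" k]
  by (metis a_inv_closed minus_equality r_neg2 smult_0_right smult_closed local.add.l_inv a_comm)

lemma smult_neg_one: "x \<in> carrier V \<Longrightarrow> (- 1) \<odot> x = \<ominus> x"
  using smult_minus_left[of x 1] by simp

lemma smult_diff: "x \<in> carrier V \<Longrightarrow> y \<in> carrier V \<Longrightarrow> k \<odot> (x \<ominus> y) = k \<odot> x \<ominus> k \<odot> y"
  by (simp add: minus_eq smult_r_distr smult_minus_right)

lemma smult_finsum: 
  "finite S \<Longrightarrow> f \<in> S \<rightarrow> carrier V \<Longrightarrow> k \<odot> (\<Oplus>i\<in>S. f i) = (\<Oplus>i\<in>S. k \<odot> f i)"
  by (induction S rule: finite_induct) (auto simp: smult_r_distr Pi_iff)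

end

lemma vspaceI:
  fixes V :: "'a superalg" (structure)
  assumes "\<And>x y. x \<in> carrier V \<Longrightarrow> y \<in> carrier V \<Longrightarrow> x \<oplus> y \<in> carrier V" "\<zero> \<in> carrier V"
    "\<And>x y z. x \<in> carrier V \<Longrightarrow> y \<in> carrier V \<Longrightarrow> z \<in> carrier V \<Longrightarrow> (x \<oplus> y) \<oplus> z = x \<oplus> (y \<oplus> z)"
    "\<And>x y. x \<in> carrier V \<Longrightarrow> y \<in> carrier V \<Longrightarrow> x \<oplus> y = y \<oplus> x"
    "\<And>x. x \<in> carrier V \<Longrightarrow> \<zero> \<oplus> x = x"
    "\<And>k x. x \<in> carrier V \<Longrightarrow> k \<odot> x \<in> carrier V"
    "\<And>k l x. x \<in> carrier V \<Longrightarrow> (k + l) \<odot> x = k \<odot> x \<oplus> l \<odot> x"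
    "\<And>k x y. x \<in> carrier V \<Longrightarrow> y \<in> carrier V \<Longrightarrow> k \<odot> (x \<oplus> y) = k \<odot> x \<oplus> k \<odot> y"
    "\<And>k l x. x \<in> carrier V \<Longrightarrow> (k * l) \<odot> x = k \<odot> (l \<odot> x)"
    "\<And>x. x \<in> carrier V \<Longrightarrow> 1 \<odot> x = x" "\<And>x. x \<in> carrier V \<Longrightarrow> 0 \<odot> x = \<zero>"
  shows "vspace V"
proof -
  have "abelian_group V"
  proof (rule abelian_groupI)
    fix x assume x: "x \<in> carrier V"
    have "(-1) \<odot> x \<oplus> x = \<zero>"
      using assms(7)[OF x, of "-1" 1] assms(10,11) x by simp
    then show "\<exists>y\<in>carrier V. y \<oplus> x = \<zero>" using assms(6) x by blast
  qed (use assms in auto)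
  then show ?thesis
    using assms by (simp add: vspace_def vspace_axioms_def)
qed

definition lin_map :: "'a superalg \<Rightarrow> 'b superalg \<Rightarrow> ('a \<Rightarrow> 'b) set" where
  "lin_map V W = {h \<in> carrier V \<rightarrow> carrier W.
     (\<forall>x\<in>carrier V. \<forall>y\<in>carrier V. h (x \<oplus>\<^bsub>V\<^esub> y) = h x \<oplus>\<^bsub>W\<^esub> h y) \<and>
     (\<forall>k. \<forall>x\<in>carrier V. h (k \<odot>\<^bsub>V\<^esub> x) = k \<odot>\<^bsub>W\<^esub> h x)}"

lemma lin_mapI:
  assumes "\<And>x. x \<in> carrier V \<Longrightarrow> h x \<in> carrier W"
    "\<And>x y. x \<in> carrier V \<Longrightarrow> y \<in> carrier V \<Longrightarrow> h (x \<oplus>\<^bsub>V\<^esub> y) = h x \<oplus>\<^bsub>W\<^esub> h y"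
    "\<And>k x. x \<in> carrier V \<Longrightarrow> h (k \<odot>\<^bsub>V\<^esub> x) = k \<odot>\<^bsub>W\<^esub> h x"
  shows "h \<in> lin_map V W"
  using assms by (auto simp: lin_map_def)

lemma lin_mapD:
  assumes "h \<in> lin_map V W" "x \<in> carrier V"
  shows "h x \<in> carrier W" "h (k \<odot>\<^bsub>V\<^esub> x) = k \<odot>\<^bsub>W\<^esub> h x"
    "y \<in> carrier V \<Longrightarrow> h (x \<oplus>\<^bsub>V\<^esub> y) = h x \<oplus>\<^bsub>W\<^esub> h y"
  using assms by (auto simp: lin_map_def)

lemma lin_map_more:
  assumes h: "h \<in> lin_map V W" and V: "vspace V" and W: "vspace W"
  shows "h \<zero>\<^bsub>V\<^esub> = \<zero>\<^bsub>W\<^esub>"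
    "x \<in> carrier V \<Longrightarrow> h (\<ominus>\<^bsub>V\<^esub> x) = \<ominus>\<^bsub>W\<^esub> h x"
    "x \<in> carrier V \<Longrightarrow> y \<in> carrier V \<Longrightarrow> h (x \<ominus>\<^bsub>V\<^esub> y) = h x \<ominus>\<^bsub>W\<^esub> h y"
    "finite S \<Longrightarrow> f \<in> S \<rightarrow> carrier V \<Longrightarrow> h (\<Oplus>\<^bsub>V\<^esub>i\<in>S. f i) = (\<Oplus>\<^bsub>W\<^esub>i\<in>S. h (f i))"
proof -
  interpret V: vspace V by fact
  interpret W: vspace W by fact
  note hD = lin_mapD[OF h]
  show z: "h \<zero>\<^bsub>V\<^esub> = \<zero>\<^bsub>W\<^esub>"
    using hD(2)[of "\<zero>\<^bsub>V\<^esub>" 0] hD(1)[of "\<zero>\<^bsub>V\<^esub>"] by simp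
  show m: "h (\<ominus>\<^bsub>V\<^esub> x) = \<ominus>\<^bsub>W\<^esub> h x" if "x \<in> carrier V" for x
    using hD(2)[OF that, of "-1"] that hD(1)[OF that] by (simp add: V.smult_neg_one W.smult_neg_one)
  show "x \<in> carrier V \<Longrightarrow> y \<in> carrier V \<Longrightarrow> h (x \<ominus>\<^bsub>V\<^esub> y) = h x \<ominus>\<^bsub>W\<^esub> h y"
    by (simp add: V.minus_eq W.minus_eq hD m)
  show "finite S \<Longrightarrow> f \<in> S \<rightarrow> carrier V \<Longrightarrow> h (\<Oplus>\<^bsub>V\<^esub>i\<in>S. f i) = (\<Oplus>\<^bsub>W\<^esub>i\<in>S. h (f i))"
    by (induction S rule: finite_induct) (auto simp: z hD Pi_iff)
qed

lemma lin_map_comp: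
  "h \<in> lin_map V W \<Longrightarrow> g \<in> lin_map U V \<Longrightarrow> (\<lambda>x. h (g x)) \<in> lin_map U W"
  by (auto simp: lin_map_def Pi_iff)

section \<open>Spaces of finitely supported functions\<close>

abbreviation lookup :: "('b \<Rightarrow>\<^sub>0 cq) \<Rightarrow> 'b \<Rightarrow> cq" where "lookup \<equiv> Poly_Mapping.lookup"
abbreviation keys :: "('b \<Rightarrow>\<^sub>0 cq) \<Rightarrow> 'b set" where "keys \<equiv> Poly_Mapping.keys"

lemma lookup_scale [simp]: "lookup (scale k f) x = k * lookup f x"
  by (simp add: scale_def Poly_Mapping.map.rep_eq when_def)

lemma scale_single [simp]: "scale k (Poly_Mapping.single x l) = Poly_Mapping.single x (k * l)"
  by (rule poly_mapping_eqI) (simp add: lookup_single when_def)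

lemma keys_scale_subset: "keys (scale k f) \<subseteq> keys f"
  by (auto simp: in_keys_iff)

lemma scale_vector_space: "vector_space (scale :: cq \<Rightarrow> ('b \<Rightarrow>\<^sub>0 cq) \<Rightarrow> _)"
  by unfold_locales (auto intro!: poly_mapping_eqI simp: lookup_add algebra_simps)

interpretation pmvs: vector_space "scale :: cq \<Rightarrow> ('b \<Rightarrow>\<^sub>0 cq) \<Rightarrow> _"
  by (rule scale_vector_space)

lemma keys_add_subset: "keys f \<subseteq> X \<Longrightarrow> keys g \<subseteq> X \<Longrightarrow> keys (f + g) \<subseteq> X"
  using Poly_Mapping.keys_add[of f g] by blast

text \<open>
  The carriers of free superalgebras and of pretensors are spaces of all functions supported in a given
  set, with the operations of the type; their linear structure is treated once, here.
\<close>

locale fspace =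
  fixes P :: "('b \<Rightarrow>\<^sub>0 cq) superalg" and X :: "'b set"
  assumes carrier_eq: "carrier P = {f. keys f \<subseteq> X}" and zero_eq: "zero P = 0"
    and add_eq: "add P = (+)" and smult_eq: "smult P = scale"
begin

lemmas fspace_simps = carrier_eq zero_eq add_eq smult_eq

sublocale vspace P
proof (rule vspaceI, goal_cases)
  case 1 then show ?case by (simp add: fspace_simps keys_add_subset)
next
  case (6 k x) then show ?case using keys_scale_subset[of k x] by (auto simp: fspace_simps)
qed (auto simp: fspace_simps algebra_simps pmvs.scale_left_distrib pmvs.scale_right_distrib)

lemma single_closed [simp]: "x \<in> X \<Longrightarrow> Poly_Mapping.single x k \<in> carrier P"
  by (simp add: carrier_eq)

lemma fspace_induct [consumes 1, case_names zero single add]: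
  assumes "f \<in> carrier P" and "Q 0" and "\<And>x k. x \<in> X \<Longrightarrow> Q (Poly_Mapping.single x k)"
    and "\<And>f g. f \<in> carrier P \<Longrightarrow> g \<in> carrier P \<Longrightarrow> Q f \<Longrightarrow> Q g \<Longrightarrow> Q (f + g)"
  shows "Q f"
proof -
  have "Q f \<and> True" if "finite K" "keys f \<subseteq> K" "K \<subseteq> X" for K f
    using that
  proof (induction K arbitrary: f rule: finite_induct)
    case (insert x K)
    define g where "g = f - Poly_Mapping.single x (lookup f x)"
    have "keys g \<subseteq> K"
    proof
      fix y assume "y \<in> keys g"
      then have *: "lookup f y \<noteq> lookup (Poly_Mapping.single x (lookup f x)) y"
        by (simp add: g_def in_keys_iff lookup_minus)
      then have "y \<noteq> x" by auto
      with * have "y \<in> keys f" by (auto simp: in_keys_iff lookup_single when_def)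
      note this \<open>y \<noteq> x\<close>
      then show "y \<in> K" using insert.prems by auto
    qed
    then have g: "Q g" "g \<in> carrier P" using insert by (auto simp: carrier_eq)
    have "Q (Poly_Mapping.single x (lookup f x) + g)"
      using insert.prems g assms(3,4) by auto
    then show ?case by (simp add: g_def)
  qed (use assms(2) in auto)
  from this[of "keys f" f] show ?thesis using assms(1) by (auto simp: carrier_eq)
qed

end

context vspace
begin

lemma lin_ext_superset:
  assumes "finite S" "keys f \<subseteq> S" "\<And>b. b \<in> S \<Longrightarrow> \<beta> b \<in> carrier V"
  shows "lin_ext V \<beta> f = (\<Oplus>b\<in>S. lookup f b \<odot> \<beta> b)"
  unfolding lin_ext_def
  by (rule add.finprod_mono_neutral_cong_left) (use assms in \<open>auto simp: in_keys_iff\<close>)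

lemma lin_ext_single [simp]:
  "\<beta> b \<in> carrier V \<Longrightarrow> lin_ext V \<beta> (Poly_Mapping.single b k) = k \<odot> \<beta> b"
  by (subst lin_ext_superset[of "{b}"]) auto

lemma lin_ext_zero [simp]: "lin_ext V \<beta> 0 = \<zero>"
  by (simp add: lin_ext_def)

lemma lin_ext_lin_map:
  assumes "fspace P X" "\<And>b. b \<in> X \<Longrightarrow> \<beta> b \<in> carrier V"
  shows "lin_ext V \<beta> \<in> lin_map P V"
proof -
  interpret P: fspace P X by fact
  show ?thesis
  proof (rule lin_mapI)
    fix f g k assume f: "f \<in> carrier P"
    then have kf: "keys f \<subseteq> X" by (simp add: P.carrier_eq)
    note sm = assms(2)[OF subsetD[OF kf]] 
    show "lin_ext V \<beta> f \<in> carrier V"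
      unfolding lin_ext_def using sm by (auto intro!: finsum_closed)
    have "lin_ext V \<beta> (scale k f) = (\<Oplus>b\<in>keys f. lookup (scale k f) b \<odot> \<beta> b)"
      by (rule lin_ext_superset) (use sm keys_scale_subset[of k f] in auto)
    also have "\<dots> = (\<Oplus>b\<in>keys f. k \<odot> (lookup f b \<odot> \<beta> b))"
      by (rule add.finprod_cong) (use sm in \<open>auto simp: smult_assoc simp_implies_def\<close>)
    also have "\<dots> = k \<odot> lin_ext V \<beta> f"
      unfolding lin_ext_def by (rule smult_finsum[symmetric]) (use sm in auto)
    finally show "lin_ext V \<beta> (k \<odot>\<^bsub>P\<^esub> f) = k \<odot> lin_ext V \<beta> f" by (simp add: P.smult_eq)
    assume g: "g \<in> carrier P"
    then have kg: "keys g \<subseteq> X" by (simp add: P.carrier_eq)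
    let ?S = "keys f \<union> keys g"
    have S: "finite ?S" "\<And>b. b \<in> ?S \<Longrightarrow> \<beta> b \<in> carrier V"
      using kf kg assms(2) by auto
    have "lin_ext V \<beta> (f + g) = (\<Oplus>b\<in>?S. lookup (f + g) b \<odot> \<beta> b)"
      by (rule lin_ext_superset) (use S Poly_Mapping.keys_add[of f g] in auto)
    also have "\<dots> = (\<Oplus>b\<in>?S. lookup f b \<odot> \<beta> b \<oplus> lookup g b \<odot> \<beta> b)"
      by (rule add.finprod_cong) (use S in \<open>auto simp: smult_l_distr lookup_add simp_implies_def\<close>)
    also have "\<dots> = (\<Oplus>b\<in>?S. lookup f b \<odot> \<beta> b) \<oplus> (\<Oplus>b\<in>?S. lookup g b \<odot> \<beta> b)"
      by (rule finsum_addf) (use S in auto)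
    also have "\<dots> = lin_ext V \<beta> f \<oplus> lin_ext V \<beta> g"
      using lin_ext_superset[of ?S f \<beta>] lin_ext_superset[of ?S g \<beta>] S by simp
    finally show "lin_ext V \<beta> (f \<oplus>\<^bsub>P\<^esub> g) = lin_ext V \<beta> f \<oplus> lin_ext V \<beta> g"
      by (simp add: P.add_eq)
  qed
qed

end

lemma lin_map_eq_on_singles:
  assumes "fspace P X" "vspace W" "h \<in> lin_map P W" "g \<in> lin_map P W"
    and "\<And>b. b \<in> X \<Longrightarrow> h (Poly_Mapping.single b 1) = g (Poly_Mapping.single b 1)"
    and "f \<in> carrier P"
  shows "h f = g f"
proof -
  interpret P: fspace P X by fact
  interpret W: vspace W by fact
  note hD = lin_mapD[OF assms(3)] and gD = lin_mapD[OF assms(4)]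
  show ?thesis using assms(6)
  proof (induction rule: P.fspace_induct)
    case zero
    show ?case using lin_map_more(1)[OF assms(3) P.vspace_axioms assms(2)] 
      lin_map_more(1)[OF assms(4) P.vspace_axioms assms(2)] by (simp add: P.zero_eq)
  next
    case (single x k)
    have "Poly_Mapping.single x k = k \<odot>\<^bsub>P\<^esub> Poly_Mapping.single x 1" by (simp add: P.smult_eq)
    then show ?case using assms(5)[OF single] hD(2) gD(2) single by simp
  next
    case (add f g)
    then show ?case using hD(3) gD(3) by (simp add: P.add_eq)
  qed
qed

section \<open>Quotients\<close>

text \<open>
  Spans that are divided out to form tensor products are not yet known to be ideals, so quotients
  are first studied for linear subspaces.
\<close>

locale linear_subspace = vspace V for V :: "'a superalg" (structure) +
  fixes I :: "'a set"
  assumes I_sub: "I \<subseteq> carrier V" and I_zero: "\<zero> \<in> I"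
    and I_add: "x \<in> I \<Longrightarrow> y \<in> I \<Longrightarrow> x \<oplus> y \<in> I"
    and I_smult: "x \<in> I \<Longrightarrow> k \<odot> x \<in> I"
begin

lemma I_carr: "x \<in> I \<Longrightarrow> x \<in> carrier V" using I_sub by auto

lemma I_minus: "x \<in> I \<Longrightarrow> \<ominus> x \<in> I"
  using I_smult[of x "-1"] I_carr[of x] by (simp add: smult_neg_one)

lemma I_diff: "x \<in> I \<Longrightarrow> y \<in> I \<Longrightarrow> x \<ominus> y \<in> I"
  by (simp add: minus_eq I_add I_minus)

sublocale abelian_subgroup I V
proof (rule abelian_subgroupI3)
  show "additive_subgroup I V"
    by (intro additive_subgroupI subgroup.intro)
      (use I_sub I_zero I_add I_minus in \<open>auto simp: a_inv_def[symmetric]\<close>)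
qed (rule abelian_group_axioms)

abbreviation "Q \<equiv> superquot V I"
abbreviation proj ("\<pi>") where "\<pi> x \<equiv> I +> x"

lemma coset_eq: "\<pi> x = {i \<oplus> x | i. i \<in> I}"
  by (auto simp: a_r_coset_def')

lemma coset_memD: "u \<in> \<pi> x \<Longrightarrow> \<exists>i\<in>I. u = i \<oplus> x"
  by (auto simp: a_r_coset_def')

lemma proj_eq_iff: "x \<in> carrier V \<Longrightarrow> y \<in> carrier V \<Longrightarrow> \<pi> x = \<pi> y \<longleftrightarrow> x \<ominus> y \<in> I"
proof -
  assume xy: "x \<in> carrier V" "y \<in> carrier V"
  have "\<pi> x = \<pi> y \<longleftrightarrow> x \<in> \<pi> y"
    using a_rcos_self[OF xy(1)] a_repr_independence'[OF _ xy(2)] by blast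
  also have "\<dots> \<longleftrightarrow> x \<ominus> y \<in> I"
    unfolding a_minus_def by (rule a_rcos_module[OF xy(2,1)])
  finally show ?thesis .
qed

lemma quot_carrier: "carrier Q = \<pi> ` carrier V"
  by (auto simp: superquot_def FactRing_def A_RCOSETS_def')

lemma quot_zero: "\<zero>\<^bsub>Q\<^esub> = \<pi> \<zero>"
  by (simp add: superquot_def FactRing_def I_sub)

lemma quot_one: "\<one>\<^bsub>Q\<^esub> = \<pi> \<one>"
  by (simp add: superquot_def FactRing_def)

lemma quot_add: "x \<in> carrier V \<Longrightarrow> y \<in> carrier V \<Longrightarrow> \<pi> x \<oplus>\<^bsub>Q\<^esub> \<pi> y = \<pi> (x \<oplus> y)"
  by (simp add: superquot_def FactRing_def a_rcos_sum)

lemma quot_smult: "x \<in> carrier V \<Longrightarrow> k \<odot>\<^bsub>Q\<^esub> \<pi> x = \<pi> (k \<odot> x)"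
proof -
  assume x: "x \<in> carrier V"
  have "\<pi> (k \<odot> u) = \<pi> (k \<odot> x)" if "u \<in> \<pi> x" for u
  proof -
    from that obtain i where i: "i \<in> I" "u = i \<oplus> x" by (auto simp: coset_eq)
    then have "k \<odot> u \<ominus> k \<odot> x = k \<odot> i"
      using x I_carr[of i] by (simp add: smult_r_distr minus_eq a_assoc r_neg)
    then show ?thesis using i x I_carr[of i] I_smult by (subst proj_eq_iff) auto
  qed
  moreover have "x \<in> \<pi> x" using x by (rule a_rcos_self)
  ultimately have "(\<Union>u\<in>\<pi> x. \<pi> (k \<odot> u)) = \<pi> (k \<odot> x)" by blast
  then show ?thesis by (simp add: superquot_def)
qed

lemma quot_grade: "grade Q s = \<pi> ` grade V s"
  by (simp add: superquot_def)

lemma proj_zero: "x \<in> carrier V \<Longrightarrow> \<pi> x = \<zero>\<^bsub>Q\<^esub> \<longleftrightarrow> x \<in> I"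
  using proj_eq_iff[of x \<zero>] minus_equality[of \<zero> \<zero>] by (simp add: quot_zero a_minus_def)

lemma proj_closed [simp]: "x \<in> carrier V \<Longrightarrow> \<pi> x \<in> carrier Q"
  by (simp add: quot_carrier)

lemma quot_vspace: "vspace Q"
proof (rule vspaceI, goal_cases)
  case (1 x y) then show ?case by (auto simp: quot_carrier quot_add)
next
  case 2 then show ?case by (simp add: quot_carrier quot_zero)
next
  case (3 x y z) then show ?case by (auto simp: quot_carrier quot_add a_assoc)
next
  case (4 x y) then show ?case by (auto simp: quot_carrier quot_add a_comm)
next
  case (5 x) then show ?case by (auto simp: quot_carrier quot_zero quot_add)
next
  case (6 k x) then show ?case by (auto simp: quot_carrier quot_smult)
next
  case (7 k l x) then show ?case by (auto simp: quot_carrier quot_smult quot_add smult_l_distr)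
next
  case (8 k x y) then show ?case by (auto simp: quot_carrier quot_smult quot_add smult_r_distr)
next
  case (9 k l x) then show ?case by (auto simp: quot_carrier quot_smult smult_assoc)
next
  case (10 x) then show ?case by (auto simp: quot_carrier quot_smult)
next
  case (11 x) then show ?case by (auto simp: quot_carrier quot_smult quot_zero)
qed

lemma proj_lin_map: "\<pi> \<in> lin_map V Q"
  by (rule lin_mapI) (auto simp: quot_add quot_smult)

lemma cls_quot: "x \<in> carrier V \<Longrightarrow> cls Q x = \<pi> x"
  unfolding cls_def 
proof (rule the_equality)
  fix U assume x: "x \<in> carrier V" and U: "U \<in> carrier Q \<and> x \<in> U"
  then obtain y where y: "y \<in> carrier V" "U = \<pi> y" by (auto simp: quot_carrier)
  have "\<pi> y = \<pi> x" using U y(2) by (intro a_repr_independence' y(1)) (simp only: y(2))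
  then show "U = \<pi> x" by (simp only: y(2))
qed (simp add: a_rcos_self)

end

locale fspace_subspace = fspace P X + linear_subspace P I for P :: "('b \<Rightarrow>\<^sub>0 cq) superalg" and X I
begin

text \<open>
  The choice made by \<open>the_elem\<close> in \<open>lift\<close> is forced: a linear map that kills \<open>I\<close> is constant on
  cosets.
\<close>

lemma lift_lin_map:
  assumes "vspace D" "\<And>b. b \<in> X \<Longrightarrow> \<beta> b \<in> carrier D"
    and kill: "\<And>i. i \<in> I \<Longrightarrow> lin_ext D \<beta> i = \<zero>\<^bsub>D\<^esub>"
  shows "f \<in> carrier P \<Longrightarrow> lift D \<beta> (proj f) = lin_ext D \<beta> f"
    and "lift D \<beta> \<in> lin_map Q D"
proof -
  interpret D: vspace D by fact
  have l: "lin_ext D \<beta> \<in> lin_map P D"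
    using fspace_axioms assms(2) by (rule D.lin_ext_lin_map)
  note lD = lin_mapD[OF l]
  show *: "lift D \<beta> (proj f) = lin_ext D \<beta> f" if f: "f \<in> carrier P" for f
  proof -
    have eq: "lin_ext D \<beta> u = lin_ext D \<beta> f" if "u \<in> proj f" for u
    proof -
      from coset_memD[OF that] obtain i where i: "i \<in> I" "u = i \<oplus>\<^bsub>P\<^esub> f" by (elim bexE)
      have "lin_ext D \<beta> u = lin_ext D \<beta> i \<oplus>\<^bsub>D\<^esub> lin_ext D \<beta> f"
        unfolding i(2) by (rule lD(3)[OF I_carr[OF i(1)] f])
      then show ?thesis using lD(1)[OF f] by (simp only: kill[OF i(1)] D.l_zero)
    qed
    have "lin_ext D \<beta> ` proj f = (\<lambda>_. lin_ext D \<beta> f) ` proj f"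
      by (rule image_cong[OF refl eq])
    also have "\<dots> = {lin_ext D \<beta> f}" by (rule image_constant[OF a_rcos_self[OF f]])
    finally show ?thesis by (simp add: lift_def)
  qed
  show "lift D \<beta> \<in> lin_map Q D"
  proof (rule lin_mapI)
    fix x y k assume "x \<in> carrier Q"
    then obtain f where f: "f \<in> carrier P" "x = proj f" unfolding quot_carrier by blast
    show "lift D \<beta> x \<in> carrier D" unfolding f *[OF f(1)] by (rule lD(1)[OF f(1)])
    show "lift D \<beta> (k \<odot>\<^bsub>Q\<^esub> x) = k \<odot>\<^bsub>D\<^esub> lift D \<beta> x" 
      unfolding f quot_smult[OF f(1)] *[OF f(1)] *[OF smult_closed[OF f(1)]] by (rule lD(2)[OF f(1)])
    assume "y \<in> carrier Q"
    then obtain g where g: "g \<in> carrier P" "y = proj g" unfolding quot_carrier by blast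
    show "lift D \<beta> (x \<oplus>\<^bsub>Q\<^esub> y) = lift D \<beta> x \<oplus>\<^bsub>D\<^esub> lift D \<beta> y" 
      unfolding f g quot_add[OF f(1) g(1)] *[OF f(1)] *[OF g(1)] *[OF add.m_closed[OF f(1) g(1)]] 
      by (rule lD(3)[OF f(1) g(1)])
  qed
qed

end

section \<open>Superalgebras, their homomorphisms and quotients\<close>

lemma (in abelian_group) diff_zero_iff:
  assumes "x \<in> carrier G" "y \<in> carrier G"
  shows "x \<ominus> y = \<zero> \<longleftrightarrow> x = y"
proof
  assume "x \<ominus> y = \<zero>"
  then have "x \<oplus> (\<ominus> y \<oplus> y) = y" using assms by (simp add: a_minus_def a_assoc[symmetric])
  then show "x = y" using assms by (simp add: l_neg)
qed (use assms in \<open>simp add: a_minus_def r_neg\<close>)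

text \<open>
  The product of a pretensor is bilinear but neither associative nor unital. Ideals and quotients
  of such algebras are what the construction of the tensor product rests on.
\<close>

locale nonassoc_alg = vspace A for A :: "'a superalg" (structure) +
  assumes mult_closed [simp, intro]: "x \<in> carrier A \<Longrightarrow> y \<in> carrier A \<Longrightarrow> x \<otimes> y \<in> carrier A"
    and mult_add_l: "x \<in> carrier A \<Longrightarrow> y \<in> carrier A \<Longrightarrow> z \<in> carrier A \<Longrightarrow> (x \<oplus> y) \<otimes> z = x \<otimes> z \<oplus> y \<otimes> z"
    and mult_add_r: "x \<in> carrier A \<Longrightarrow> y \<in> carrier A \<Longrightarrow> z \<in> carrier A \<Longrightarrow> z \<otimes> (x \<oplus> y) = z \<otimes> x \<oplus> z \<otimes> y"
    and smult_mult_l: "x \<in> carrier A \<Longrightarrow> y \<in> carrier A \<Longrightarrow> (k \<odot> x) \<otimes> y = k \<odot> (x \<otimes> y)"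
    and smult_mult_r: "x \<in> carrier A \<Longrightarrow> y \<in> carrier A \<Longrightarrow> x \<otimes> (k \<odot> y) = k \<odot> (x \<otimes> y)"

locale two_sided_ideal = nonassoc_alg A + linear_subspace A I for A :: "'a superalg" (structure) and I +
  assumes absorb_l: "a \<in> I \<Longrightarrow> x \<in> carrier A \<Longrightarrow> x \<otimes> a \<in> I"
    and absorb_r: "a \<in> I \<Longrightarrow> x \<in> carrier A \<Longrightarrow> a \<otimes> x \<in> I"
begin

lemma quot_mult:
  assumes x: "x \<in> carrier A" and y: "y \<in> carrier A"
  shows "proj x \<otimes>\<^bsub>Q\<^esub> proj y = proj (x \<otimes> y)"
proof -
  have "proj (u \<otimes> v) = proj (x \<otimes> y)" if uv: "u \<in> proj x" "v \<in> proj y" for u v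
  proof -
    from coset_memD[OF uv(1)] obtain i where i: "i \<in> I" "u = i \<oplus> x" by (elim bexE)
    from coset_memD[OF uv(2)] obtain j where j: "j \<in> I" "v = j \<oplus> y" by (elim bexE)
    note ij = I_carr[OF i(1)] I_carr[OF j(1)]
    have "u \<otimes> v \<ominus> x \<otimes> y = i \<otimes> v \<oplus> x \<otimes> j"
      using x y ij by (simp add: i(2) j(2) mult_add_l mult_add_r a_minus_def a_assoc r_neg r_neg2 a_comm[of "x \<otimes> j"])
    also have "\<dots> \<in> I"
      by (rule I_add[OF absorb_r[OF i(1)] absorb_l[OF j(1) x]]) (use ij y in \<open>simp add: j(2)\<close>)
    finally show ?thesis using x y ij by (subst proj_eq_iff) (simp_all add: i(2) j(2))
  qed
  moreover have "x \<in> proj x" "y \<in> proj y" by (rule a_rcos_self[OF x], rule a_rcos_self[OF y])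
  ultimately have "(\<Union>u\<in>proj x. \<Union>v\<in>proj y. proj (u \<otimes> v)) = proj (x \<otimes> y)" by blast
  then show ?thesis by (simp add: superquot_def FactRing_def rcoset_mult_def)
qed

lemma quot_nonassoc_alg: "nonassoc_alg Q"
proof -
  interpret Q: vspace Q by (rule quot_vspace)
  show ?thesis
  proof (unfold_locales, goal_cases)
    case (1 x y) then show ?case by (auto simp: quot_carrier quot_mult)
  next
    case (2 x y z) then show ?case by (auto simp: quot_carrier quot_mult quot_add mult_add_l)
  next
    case (3 x y z) then show ?case by (auto simp: quot_carrier quot_mult quot_add mult_add_r)
  next
    case (4 x y k) then show ?case by (auto simp: quot_carrier quot_mult quot_smult smult_mult_l)
  next
    case (5 x y k) then show ?case by (auto simp: quot_carrier quot_mult quot_smult smult_mult_r)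
  qed
qed

end

locale superalgebra = nonassoc_alg A for A :: "'a superalg" (structure) +
  assumes mult_assoc: "x \<in> carrier A \<Longrightarrow> y \<in> carrier A \<Longrightarrow> z \<in> carrier A \<Longrightarrow> (x \<otimes> y) \<otimes> z = x \<otimes> (y \<otimes> z)"
    and unit_closed: "\<one> \<in> carrier A"
    and unit_l: "x \<in> carrier A \<Longrightarrow> \<one> \<otimes> x = x"
    and unit_r: "x \<in> carrier A \<Longrightarrow> x \<otimes> \<one> = x"
    and grade_carr: "x \<in> grade A s \<Longrightarrow> x \<in> carrier A"
    and grade_zero: "\<zero> \<in> grade A s"
    and grade_add: "x \<in> grade A s \<Longrightarrow> y \<in> grade A s \<Longrightarrow> x \<oplus> y \<in> grade A s"
    and grade_smult: "x \<in> grade A s \<Longrightarrow> k \<odot> x \<in> grade A s"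
    and grade_span: "x \<in> carrier A \<Longrightarrow> \<exists>y\<in>grade A False. \<exists>z\<in>grade A True. x = y \<oplus> z"
    and grade_disj: "x \<in> grade A False \<Longrightarrow> x \<in> grade A True \<Longrightarrow> x = \<zero>"
    and grade_mult: "x \<in> grade A s \<Longrightarrow> y \<in> grade A t \<Longrightarrow> x \<otimes> y \<in> grade A (s \<noteq> t)"
    and grade_one: "\<one> \<in> grade A False"
begin

sublocale ring A
proof (rule ringI)
  show "monoid A" by (rule monoidI) (auto simp: mult_assoc unit_closed unit_l unit_r)
qed (auto simp: mult_add_l mult_add_r intro: abelian_group_axioms)

lemma grade_minus: "x \<in> grade A s \<Longrightarrow> \<ominus> x \<in> grade A s"
  using grade_smult[of x s "-1"] grade_carr by (simp add: smult_neg_one)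

lemma grade_diff: "x \<in> grade A s \<Longrightarrow> y \<in> grade A s \<Longrightarrow> x \<ominus> y \<in> grade A s"
  by (simp add: a_minus_def grade_add grade_minus)

lemma hcomp_unique:
  assumes y: "y \<in> grade A s" and z: "z \<in> grade A (\<not> s)"
  shows "hcomp A s (y \<oplus> z) = y"
  unfolding hcomp_def
proof (rule the_equality)
  show "y \<in> grade A s \<and> (\<exists>z'\<in>grade A (\<not> s). y \<oplus> z = y \<oplus> z')" using y z by blast
next
  fix y' assume "y' \<in> grade A s \<and> (\<exists>z'\<in>grade A (\<not> s). y \<oplus> z = y' \<oplus> z')"
  then obtain z' where y': "y' \<in> grade A s" and z': "z' \<in> grade A (\<not> s)" and eq: "y \<oplus> z = y' \<oplus> z'" by blast
  note c = grade_carr[OF y] grade_carr[OF z] grade_carr[OF y'] grade_carr[OF z']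
  have "y \<ominus> y' = z' \<ominus> z"
  proof -
    have "y \<ominus> y' = (y \<oplus> z) \<oplus> (\<ominus> y' \<ominus> z)" using c by algebra
    also have "\<dots> = z' \<ominus> z" unfolding eq using c by algebra
    finally show ?thesis .
  qed
  moreover have "y \<ominus> y' \<in> grade A s" "z' \<ominus> z \<in> grade A (\<not> s)"
    using y z y' z' by (auto intro: grade_diff)
  ultimately have "y \<ominus> y' = \<zero>" by (cases s) (auto intro: grade_disj)
  then show "y' = y" using c diff_zero_iff[of y y'] by simp
qed

lemma hcomp_decomp:
  assumes "x \<in> carrier A"
  shows "hcomp A s x \<in> grade A s" "x = hcomp A s x \<oplus> hcomp A (\<not> s) x"
proof -
  obtain y z where yz: "y \<in> grade A False" "z \<in> grade A True" and x: "x = y \<oplus> z"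
    using grade_span[OF assms] by blast
  have xs: "x = z \<oplus> y" using x yz grade_carr a_comm by blast
  have h: "hcomp A False x = y" "hcomp A True x = z"
    using hcomp_unique[of y False z] hcomp_unique[of z True y] yz by (simp_all add: x, simp add: x[symmetric] xs)
  show "hcomp A s x \<in> grade A s" "x = hcomp A s x \<oplus> hcomp A (\<not> s) x"
    by (cases s; use h yz x xs in simp)+
qed

lemma hcomp_closed [simp]: "x \<in> carrier A \<Longrightarrow> hcomp A s x \<in> carrier A"
  using hcomp_decomp(1) grade_carr by blast

lemma hcomp_homog: "x \<in> grade A s \<Longrightarrow> hcomp A t x = (if t = s then x else \<zero>)"
  using hcomp_unique[of x s \<zero>] hcomp_unique[of \<zero> "\<not> s" x] grade_zero grade_carr[of x s]
  by (cases s; cases t) simp_all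

lemma hcomp_add: 
  assumes x: "x \<in> carrier A" and y: "y \<in> carrier A"
  shows "hcomp A s (x \<oplus> y) = hcomp A s x \<oplus> hcomp A s y"
proof -
  have "x \<oplus> y = (hcomp A s x \<oplus> hcomp A (\<not> s) x) \<oplus> (hcomp A s y \<oplus> hcomp A (\<not> s) y)"
    using hcomp_decomp(2)[OF x, of s] hcomp_decomp(2)[OF y, of s] by simp
  also have "\<dots> = (hcomp A s x \<oplus> hcomp A s y) \<oplus> (hcomp A (\<not> s) x \<oplus> hcomp A (\<not> s) y)"
    using x y hcomp_closed by (simp add: a_ac)
  finally show ?thesis 
    using hcomp_unique[OF grade_add grade_add, OF hcomp_decomp(1)[OF x] hcomp_decomp(1)[OF y] hcomp_decomp(1)[OF x] hcomp_decomp(1)[OF y]]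
    by simp
qed

lemma hcomp_smult: 
  assumes x: "x \<in> carrier A"
  shows "hcomp A s (k \<odot> x) = k \<odot> hcomp A s x"
proof -
  have "k \<odot> x = k \<odot> hcomp A s x \<oplus> k \<odot> hcomp A (\<not> s) x"
    using hcomp_decomp(2)[OF x, of s] x hcomp_closed smult_r_distr by metis
  then show ?thesis 
    using hcomp_unique[OF grade_smult grade_smult, OF hcomp_decomp(1)[OF x] hcomp_decomp(1)[OF x]]
    by simp
qed

lemma hcomp_mult:
  assumes a: "a \<in> carrier A" and x: "x \<in> carrier A"
  shows "hcomp A s (a \<otimes> x) = hcomp A False a \<otimes> hcomp A s x \<oplus> hcomp A True a \<otimes> hcomp A (\<not> s) x"
proof -
  let ?a0 = "hcomp A False a" and ?a1 = "hcomp A True a" and ?x0 = "hcomp A s x" and ?x1 = "hcomp A (\<not> s) x"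
  have e: "a = ?a0 \<oplus> ?a1" "x = ?x0 \<oplus> ?x1"
    using hcomp_decomp(2)[OF a, of False] hcomp_decomp(2)[OF x, of s] by simp_all
  have c: "?a0 \<in> carrier A" "?a1 \<in> carrier A" "?x0 \<in> carrier A" "?x1 \<in> carrier A" using a x by simp_all
  have "a \<otimes> x = (?a0 \<oplus> ?a1) \<otimes> (?x0 \<oplus> ?x1)" using e by simp
  also have "\<dots> = (?a0 \<otimes> ?x0 \<oplus> ?a1 \<otimes> ?x1) \<oplus> (?a0 \<otimes> ?x1 \<oplus> ?a1 \<otimes> ?x0)"
    using c by (simp add: mult_add_l mult_add_r a_ac)
  finally have "a \<otimes> x = (?a0 \<otimes> ?x0 \<oplus> ?a1 \<otimes> ?x1) \<oplus> (?a0 \<otimes> ?x1 \<oplus> ?a1 \<otimes> ?x0)" .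
  moreover have "?a0 \<otimes> ?x0 \<oplus> ?a1 \<otimes> ?x1 \<in> grade A s"
    using grade_mult[OF hcomp_decomp(1)[OF a, of False] hcomp_decomp(1)[OF x, of s]]
      grade_mult[OF hcomp_decomp(1)[OF a, of True] hcomp_decomp(1)[OF x, of "\<not> s"]] 
    by (auto intro: grade_add)
  moreover have "?a0 \<otimes> ?x1 \<oplus> ?a1 \<otimes> ?x0 \<in> grade A (\<not> s)"
    using grade_mult[OF hcomp_decomp(1)[OF a, of False] hcomp_decomp(1)[OF x, of "\<not> s"]]
      grade_mult[OF hcomp_decomp(1)[OF a, of True] hcomp_decomp(1)[OF x, of s]] 
    by (auto intro: grade_add)
  ultimately show ?thesis using hcomp_unique by simp
qed

lemma ideal_linear_subspace: "ideal I A \<Longrightarrow> linear_subspace A I"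
proof -
  assume "ideal I A"
  then interpret ideal I A .
  show ?thesis
  proof
    fix x k assume x: "x \<in> I"
    then have "k \<odot> x = (k \<odot> \<one>) \<otimes> x" by (simp add: smult_mult_l)
    then show "k \<odot> x \<in> I" using I_l_closed[OF x, of "k \<odot> \<one>"] by simp
  qed (use a_subset in auto)
qed

lemma ideal_two_sided: "ideal I A \<Longrightarrow> two_sided_ideal A I"
proof -
  assume i: "ideal I A"
  then interpret linear_subspace A I by (rule ideal_linear_subspace)
  show ?thesis by unfold_locales (use ideal.I_l_closed[OF i] ideal.I_r_closed[OF i] in auto)
qed

text \<open>
  Homogeneity of \<open>I\<close> is what makes the images of the even and of the odd part intersect trivially.
\<close>

lemma superquot_superalgebra:
  assumes I: "homogeneous_ideal I A"
  shows "superalgebra (superquot A I)"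
proof -
  interpret two_sided_ideal A I using I ideal_two_sided by (simp add: homogeneous_ideal_def)
  interpret Q: nonassoc_alg Q by (rule quot_nonassoc_alg)
  show ?thesis
  proof (unfold_locales, goal_cases)
    case (1 x y z) then show ?case by (auto simp: quot_carrier quot_mult mult_assoc)
  next
    case 2 then show ?case by (simp add: quot_one)
  next
    case (3 x) then show ?case by (auto simp: quot_carrier quot_one quot_mult)
  next
    case (4 x) then show ?case by (auto simp: quot_carrier quot_one quot_mult)
  next
    case (5 x s) then show ?case using grade_carr by (auto simp: quot_carrier quot_grade)
  next
    case (6 s) then show ?case using grade_zero by (auto simp: quot_zero quot_grade)
  next
    case (7 x s y) then show ?case using grade_carr grade_add by (auto simp: quot_add quot_grade)
  next
    case (8 x s k) then show ?case using grade_carr grade_smult by (auto simp: quot_smult quot_grade)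
  next
    case (9 x) 
    then obtain u where u: "u \<in> carrier A" "x = proj u" by (auto simp: quot_carrier)
    obtain y z where yz: "y \<in> grade A False" "z \<in> grade A True" "u = y \<oplus> z" using grade_span[OF u(1)] by blast
    then show ?case using u grade_carr by (auto simp: quot_grade quot_add)
  next
    case (10 x) 
    then obtain y z where yz: "y \<in> grade A False" "z \<in> grade A True" "x = proj y" "x = proj z" by (auto simp: quot_grade)
    have c: "y \<in> carrier A" "z \<in> carrier A" using yz grade_carr by auto
    have "y \<ominus> z \<in> I" using yz c proj_eq_iff by metis
    moreover have "hcomp A False (y \<ominus> z) = y"
      using hcomp_unique[of y False "\<ominus> z"] yz by (simp add: a_minus_def grade_minus)
    ultimately have "y \<in> I" using I unfolding homogeneous_ideal_def by metis
    then show ?case using proj_zero[OF c(1)] yz by simp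
  next
    case (11 x s y t) then show ?case using grade_carr grade_mult by (auto simp: quot_mult quot_grade)
  next
    case 12 then show ?case using grade_one by (auto simp: quot_one quot_grade)
  qed
qed

text \<open>
  Products of elements whose components lie in an ideal have components there, so the elements
  of the generated ideal with all components inside it form an ideal again, and it contains the
  generators.
\<close>

lemma homogeneous_genideal_components:
  assumes SA: "S \<subseteq> carrier A" and S: "\<And>x s. x \<in> S \<Longrightarrow> hcomp A s x \<in> genideal A S"
  shows "homogeneous_ideal (genideal A S) A"
proof -
  define I where "I = genideal A S"
  have I: "ideal I A" unfolding I_def by (rule genideal_ideal[OF SA])
  interpret I: two_sided_ideal A I by (rule ideal_two_sided[OF I])
  define H where "H = {x \<in> carrier A. \<forall>s. hcomp A s x \<in> I}"
  have h0: "hcomp A s \<zero> = \<zero>" for s using hcomp_homog[OF grade_zero[of s], of s] by simp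
  have hm: "hcomp A s (\<ominus> x) = \<ominus> hcomp A s x" if "x \<in> carrier A" for x s
    using hcomp_smult[OF that, of s "-1"] that by (simp add: smult_neg_one)
  have "ideal H A"
  proof (rule idealI)
    show "ring A" by (rule ring_axioms)
    show "subgroup H (add_monoid A)"
      by (rule subgroup.intro) (auto simp: H_def hcomp_add h0 hm I.I_add I.I_zero I.I_minus a_inv_def[symmetric])
  next
    fix a x assume a: "a \<in> H" and x: "x \<in> carrier A"
    then show "x \<otimes> a \<in> H" "a \<otimes> x \<in> H"
      unfolding H_def by (simp_all add: hcomp_mult I.I_add I.absorb_l I.absorb_r)
  qed
  moreover have "S \<subseteq> H"
    unfolding H_def I_def by (intro subsetI CollectI conjI allI S subsetD[OF SA])
  ultimately have "I \<subseteq> H" unfolding I_def by (rule genideal_minimal)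
  then show ?thesis using I by (auto simp: homogeneous_ideal_def H_def I_def)
qed

lemma homogeneous_genideal:
  assumes S: "\<And>x. x \<in> S \<Longrightarrow> \<exists>s. x \<in> grade A s"
  shows "homogeneous_ideal (genideal A S) A"
proof -
  have SA: "S \<subseteq> carrier A" using S grade_carr by blast
  interpret I: two_sided_ideal A "genideal A S" by (rule ideal_two_sided[OF genideal_ideal[OF SA]])
  show ?thesis
  proof (rule homogeneous_genideal_components[OF SA])
    fix x t assume x: "x \<in> S"
    then obtain s where s: "x \<in> grade A s" using S by blast
    have "x \<in> genideal A S" using genideal_self[OF SA] x by auto
    then show "hcomp A t x \<in> genideal A S" using hcomp_homog[OF s] I.I_zero by simp
  qed
qed

end

definition alg_hom :: "'a superalg \<Rightarrow> 'b superalg \<Rightarrow> ('a \<Rightarrow> 'b) set" where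
  "alg_hom A B = {h \<in> lin_map A B.
     (\<forall>x\<in>carrier A. \<forall>y\<in>carrier A. h (x \<otimes>\<^bsub>A\<^esub> y) = h x \<otimes>\<^bsub>B\<^esub> h y) \<and> h \<one>\<^bsub>A\<^esub> = \<one>\<^bsub>B\<^esub>}"

definition even_map :: "'a superalg \<Rightarrow> 'b superalg \<Rightarrow> ('a \<Rightarrow> 'b) set" where
  "even_map A B = {h. \<forall>s. \<forall>x\<in>grade A s. h x \<in> grade B s}"

lemma alg_homI:
  assumes "h \<in> lin_map A B" "\<And>x y. x \<in> carrier A \<Longrightarrow> y \<in> carrier A \<Longrightarrow> h (x \<otimes>\<^bsub>A\<^esub> y) = h x \<otimes>\<^bsub>B\<^esub> h y"
    "h \<one>\<^bsub>A\<^esub> = \<one>\<^bsub>B\<^esub>"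
  shows "h \<in> alg_hom A B"
  using assms by (auto simp: alg_hom_def)

lemma alg_homD:
  assumes "h \<in> alg_hom A B"
  shows "h \<in> lin_map A B" "x \<in> carrier A \<Longrightarrow> y \<in> carrier A \<Longrightarrow> h (x \<otimes>\<^bsub>A\<^esub> y) = h x \<otimes>\<^bsub>B\<^esub> h y"
    "h \<one>\<^bsub>A\<^esub> = \<one>\<^bsub>B\<^esub>" 
    "x \<in> carrier A \<Longrightarrow> h x \<in> carrier B" "x \<in> carrier A \<Longrightarrow> h (k \<odot>\<^bsub>A\<^esub> x) = k \<odot>\<^bsub>B\<^esub> h x"
    "x \<in> carrier A \<Longrightarrow> y \<in> carrier A \<Longrightarrow> h (x \<oplus>\<^bsub>A\<^esub> y) = h x \<oplus>\<^bsub>B\<^esub> h y"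
  using assms by (auto simp: alg_hom_def lin_mapD)

lemma alg_hom_comp:
  "h \<in> alg_hom V W \<Longrightarrow> g \<in> alg_hom U V \<Longrightarrow> (\<lambda>x. h (g x)) \<in> alg_hom U W"
  by (rule alg_homI) (auto simp: alg_homD intro: lin_map_comp[of h V W g U])

lemma alg_hom_id: "(\<lambda>x. x) \<in> alg_hom A A"
  by (auto simp: alg_hom_def lin_map_def)

lemma even_map_comp:
  "h \<in> even_map V W \<Longrightarrow> g \<in> even_map U V \<Longrightarrow> (\<lambda>x. h (g x)) \<in> even_map U W"
  by (auto simp: even_map_def)

lemma even_mapD: "h \<in> even_map V W \<Longrightarrow> x \<in> grade V s \<Longrightarrow> h x \<in> grade W s"
  by (auto simp: even_map_def)

lemma kernel_ideal:
  assumes "superalgebra A" "superalgebra B" "h \<in> alg_hom A B"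
  shows "ideal {x \<in> carrier A. h x = \<zero>\<^bsub>B\<^esub>} A"
proof -
  interpret A: superalgebra A by fact
  interpret B: superalgebra B by fact
  note h = alg_homD[OF assms(3)] lin_map_more[OF alg_homD(1)[OF assms(3)] A.vspace_axioms B.vspace_axioms]
  show ?thesis
  proof (rule idealI)
    show "ring A" by (rule A.ring_axioms)
    show "subgroup {x \<in> carrier A. h x = \<zero>\<^bsub>B\<^esub>} (add_monoid A)"
      by (rule subgroup.intro) (auto simp: h a_inv_def[symmetric])
  qed (auto simp: h)
qed

lemma vanish_genideal:
  assumes "superalgebra A" "superalgebra B" "h \<in> alg_hom A B" "S \<subseteq> carrier A"
    and "\<And>x. x \<in> S \<Longrightarrow> h x = \<zero>\<^bsub>B\<^esub>" "y \<in> genideal A S"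
  shows "h y = \<zero>\<^bsub>B\<^esub>"
proof -
  interpret A: superalgebra A by fact
  have "genideal A S \<subseteq> {x \<in> carrier A. h x = \<zero>\<^bsub>B\<^esub>}"
    by (rule A.genideal_minimal[OF kernel_ideal[OF assms(1-3)]]) (use assms(4,5) in auto)
  then show ?thesis using assms(6) by auto
qed

locale homogeneous_quotient = superalgebra A for A :: "'a superalg" (structure) +
  fixes I assumes hom_I: "homogeneous_ideal I A"
begin

sublocale two_sided_ideal A I using hom_I ideal_two_sided by (simp add: homogeneous_ideal_def)

lemma quot_superalgebra: "superalgebra Q" using superquot_superalgebra[OF hom_I] .

lemma proj_alg_hom: "proj \<in> alg_hom A Q"
  by (rule alg_homI) (auto simp: proj_lin_map quot_mult quot_one)

lemma proj_even: "proj \<in> even_map A Q" 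
  by (auto simp: even_map_def quot_grade)

lemma cls_alg_hom: "cls Q \<in> alg_hom A Q" and cls_even: "cls Q \<in> even_map A Q"
  using proj_alg_hom proj_even grade_carr
  by (auto simp: alg_hom_def lin_map_def even_map_def cls_quot)

lemma cls_zero: "x \<in> carrier A \<Longrightarrow> cls Q x = \<zero>\<^bsub>Q\<^esub> \<longleftrightarrow> x \<in> I"
  using cls_quot proj_zero by simp

lemma quot_carrierE: "y \<in> carrier Q \<Longrightarrow> \<exists>x\<in>carrier A. y = cls Q x"
  by (auto simp: quot_carrier cls_quot)

lemma induced_hom:
  assumes B: "superalgebra B" and h: "h \<in> alg_hom A B" and kill: "\<And>x. x \<in> I \<Longrightarrow> h x = \<zero>\<^bsub>B\<^esub>"
  shows "\<exists>g\<in>alg_hom Q B. (\<forall>x\<in>carrier A. g (cls Q x) = h x) \<and> (h \<in> even_map A B \<longrightarrow> g \<in> even_map Q B)"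
proof -
  interpret B: superalgebra B by fact
  note hD = alg_homD[OF h] lin_map_more[OF alg_homD(1)[OF h] vspace_axioms B.vspace_axioms]
  define g where "g U = h (SOME x. x \<in> carrier A \<and> proj x = U)" for U
  have g: "g (proj x) = h x" if x: "x \<in> carrier A" for x
  proof -
    define y where "y = (SOME y. y \<in> carrier A \<and> proj y = proj x)"
    have y: "y \<in> carrier A \<and> proj y = proj x" unfolding y_def by (rule someI[of _ x]) (use x in simp)
    then have "y \<ominus> x \<in> I" using proj_eq_iff[of y x] x by simp
    then have "h y \<ominus>\<^bsub>B\<^esub> h x = \<zero>\<^bsub>B\<^esub>" using kill hD y x by metis
    then have "h y = h x" using y x hD(4) B.diff_zero_iff[of "h y" "h x"] by simp
    then show ?thesis by (simp add: g_def y_def)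
  qed
  have "g \<in> alg_hom Q B"
  proof (intro alg_homI lin_mapI, goal_cases)
    case (1 x) then show ?case by (auto simp: quot_carrier g hD)
  next
    case (2 x y) then show ?case by (auto simp: quot_carrier quot_add g hD)
  next
    case (3 k x) then show ?case by (auto simp: quot_carrier quot_smult g hD)
  next
    case (4 x y) then show ?case by (auto simp: quot_carrier quot_mult g hD)
  next
    case 5 then show ?case by (simp add: quot_one g hD)
  qed
  moreover have "h \<in> even_map A B \<longrightarrow> g \<in> even_map Q B"
    using g grade_carr by (auto simp: even_map_def quot_grade)
  ultimately show ?thesis using g by (auto simp: cls_quot)
qed

end

section \<open>Superalgebras given by generators and relations\<close>

lemma free_fspace: "fspace (free_superalg G par) (lists G)"
  by (simp add: fspace_def free_superalg_def)

lemma free_vspace: "vspace (free_superalg G par)"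
proof -
  interpret fspace "free_superalg G par" "lists G" by (rule free_fspace)
  show ?thesis by (rule vspace_axioms)
qed

lemma free_simps: 
  "carrier (free_superalg G par) = {f. keys f \<subseteq> lists G}" "mult (free_superalg G par) = (*)"
  "one (free_superalg G par) = 1" "zero (free_superalg G par) = 0" "add (free_superalg G par) = (+)"
  "smult (free_superalg G par) = scale"
  "grade (free_superalg G par) s = {f. keys f \<subseteq> {w \<in> lists G. odd (length (filter par w)) = s}}"
  by (simp_all add: free_superalg_def)

lemma scale_eq_mult: "scale k f = Poly_Mapping.single [] k * f" 
  using mult_map_scale_conv_mult[of k f] by (simp add: scale_def zero_list_def)

lemma single_mult_commute: "f * Poly_Mapping.single [] k = Poly_Mapping.single [] k * f" for f :: "'g list \<Rightarrow>\<^sub>0 cq"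
proof -
  interpret fspace "free_superalg UNIV (\<lambda>_. True)" "lists (UNIV :: 'g set)" by (rule free_fspace)
  have "f \<in> carrier (free_superalg UNIV (\<lambda>_. True))" by (simp add: free_simps)
  then show ?thesis
  proof (induction rule: fspace_induct)
    case (single x l) then show ?case by (simp add: mult_single plus_list_def mult.commute)
  qed (simp_all add: algebra_simps)
qed

lemma one_eq_single: "(1 :: 'g list \<Rightarrow>\<^sub>0 cq) = Poly_Mapping.single [] 1"
  by (metis single_one zero_list_def)

lemma keys_mult_words:
  fixes f g :: "'g list \<Rightarrow>\<^sub>0 cq"
  assumes "\<And>u v. u \<in> keys f \<Longrightarrow> v \<in> keys g \<Longrightarrow> u @ v \<in> S"
  shows "keys (f * g) \<subseteq> S"
proof
  fix w assume "w \<in> keys (f * g)"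
  from subsetD[OF keys_mult this] obtain u v where "w = u + v" "u \<in> keys f" "v \<in> keys g" by blast
  then show "w \<in> S" using assms[of u v] by (simp add: plus_list_def)
qed

lemma free_superalgebra: "superalgebra (free_superalg G par)"
proof -
  let ?S = "\<lambda>s. {w \<in> lists G. odd (length (filter par w)) = s}"
  have S: "w \<in> ?S s \<longleftrightarrow> w \<in> lists G \<and> odd (length (filter par w)) = s" for w s by (rule mem_Collect_eq)
  show ?thesis
  proof (intro superalgebra.intro nonassoc_alg.intro superalgebra_axioms.intro nonassoc_alg_axioms.intro, goal_cases)
    case 1 show ?case by (rule free_vspace)
  next
    case (2 x y) then show ?case unfolding free_simps mem_Collect_eq 
      by (intro keys_mult_words) (simp add: subset_iff)
  next
    case (3 x y z) show ?case unfolding free_simps by (rule distrib_right)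
  next
    case (4 x y z) show ?case unfolding free_simps by (rule distrib_left)
  next
    case (5 x y k) show ?case unfolding free_simps scale_eq_mult by (rule mult.assoc)
  next
    case (6 x y k) 
    have "x * (Poly_Mapping.single [] k * y) = (x * Poly_Mapping.single [] k) * y" by (rule mult.assoc[symmetric])
    also have "\<dots> = (Poly_Mapping.single [] k * x) * y" unfolding single_mult_commute[of x] by (rule refl)
    also have "\<dots> = Poly_Mapping.single [] k * (x * y)" by (rule mult.assoc)
    finally show ?case unfolding free_simps scale_eq_mult .
  next
    case (7 x y z) show ?case unfolding free_simps by (rule mult.assoc)
  next
    case 8 show ?case unfolding free_simps by (simp add: zero_list_def)
  next
    case (9 x) show ?case unfolding free_simps by (rule mult_1_left)
  next
    case (10 x) show ?case unfolding free_simps by (rule mult_1_right)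
  next
    case (11 x s) then show ?case unfolding free_simps mem_Collect_eq by (rule subset_trans) (rule Collect_restrict)
  next
    case (12 s) show ?case unfolding free_simps mem_Collect_eq by simp
  next
    case (13 x s y) then show ?case unfolding free_simps mem_Collect_eq by (rule keys_add_subset)
  next
    case (14 x s k) then show ?case unfolding free_simps mem_Collect_eq by (rule subset_trans[OF keys_scale_subset])
  next
    case (15 x)
    define y where "y = Poly_Mapping.mapp (\<lambda>w c. c when even (length (filter par w))) x"
    define z where "z = Poly_Mapping.mapp (\<lambda>w c. c when odd (length (filter par w))) x"
    have x: "keys x \<subseteq> lists G" using 15 by (simp add: free_simps)
    have e: "x = y + z" 
      by (rule poly_mapping_eqI) (simp add: y_def z_def lookup_add lookup_mapp when_def in_keys_iff)
    have y: "keys y \<subseteq> ?S False"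
    proof
      fix w assume "w \<in> keys y"
      then have "lookup y w \<noteq> 0" by (simp add: in_keys_iff)
      then have "w \<in> keys x" "even (length (filter par w))" 
        by (auto simp: y_def lookup_mapp when_def in_keys_iff split: if_splits)
      then show "w \<in> ?S False" using x by auto
    qed
    have z: "keys z \<subseteq> ?S True"
    proof
      fix w assume "w \<in> keys z"
      then have "lookup z w \<noteq> 0" by (simp add: in_keys_iff)
      then have "w \<in> keys x" "odd (length (filter par w))" 
        by (auto simp: z_def lookup_mapp when_def in_keys_iff split: if_splits)
      then show "w \<in> ?S True" using x by auto
    qed
    show ?case unfolding free_simps
      by (rule bexI[of _ y], rule bexI[of _ z], rule e, unfold mem_Collect_eq, rule z, rule y)
  next
    case (16 x) 
    then have x: "keys x \<subseteq> ?S False" "keys x \<subseteq> ?S True" by (simp_all only: free_simps mem_Collect_eq)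
    have "keys x = {}"
    proof (rule equals0I)
      fix w assume "w \<in> keys x"
      from subsetD[OF x(1) this] subsetD[OF x(2) this] show False by simp
    qed
    then show ?case by (simp add: free_simps)
  next
    case (17 x s y t) 
    then have x: "keys x \<subseteq> ?S s" and y: "keys y \<subseteq> ?S t" by (simp_all only: free_simps mem_Collect_eq)
    have "keys (x * y) \<subseteq> ?S (s \<noteq> t)"
    proof (rule keys_mult_words)
      fix u v assume "u \<in> keys x" "v \<in> keys y"
      from subsetD[OF x this(1)] subsetD[OF y this(2)] 
      show "u @ v \<in> ?S (s \<noteq> t)" unfolding S by (cases s; cases t; simp)
    qed
    then show ?case by (simp only: free_simps mem_Collect_eq)
  next
    case 18 show ?case unfolding free_simps by (simp add: zero_list_def)
  qed
qed

lemma free_induct [consumes 1, case_names one gen smult add]: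
  assumes f: "f \<in> carrier (free_superalg G par)"
    and one: "Q 1" and gen: "\<And>g f. g \<in> G \<Longrightarrow> f \<in> carrier (free_superalg G par) \<Longrightarrow> Q f \<Longrightarrow> Q (gen g * f)"
    and smult: "\<And>k f. f \<in> carrier (free_superalg G par) \<Longrightarrow> Q f \<Longrightarrow> Q (scale k f)"
    and add: "\<And>f g. f \<in> carrier (free_superalg G par) \<Longrightarrow> g \<in> carrier (free_superalg G par) \<Longrightarrow> Q f \<Longrightarrow> Q g \<Longrightarrow> Q (f + g)"
  shows "Q f"
proof -
  interpret fspace "free_superalg G par" "lists G" by (rule free_fspace)
  have w: "Q (Poly_Mapping.single w 1) \<and> Poly_Mapping.single w 1 \<in> carrier (free_superalg G par)" if "w \<in> lists G" for w
    using that
  proof (induction w)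
    case Nil
    then show ?case using one by (metis lists.Nil single_closed single_one zero_list_def)
  next
    case (Cons g w)
    have "Poly_Mapping.single (g # w) 1 = gen g * Poly_Mapping.single w 1"
      by (simp add: mult_single plus_list_def)
    then show ?case using Cons gen[of g "Poly_Mapping.single w 1"] single_closed[of "g # w" 1] by simp
  qed
  show ?thesis using f
  proof (induction rule: fspace_induct)
    case zero
    have "scale 0 1 = (0 :: 'a list \<Rightarrow>\<^sub>0 cq)" by (rule poly_mapping_eqI) simp
    then show ?case using smult[of 1 0] one w[of "[]"] by (metis lists.Nil single_one zero_list_def)
  next
    case (single x k)
    then show ?case using smult[of "Poly_Mapping.single x 1" k] w[of x] by simp
  qed (use add in auto)
qed

definition word_val :: "'d superalg \<Rightarrow> ('g \<Rightarrow> 'd) \<Rightarrow> 'g list \<Rightarrow> 'd" where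
  "word_val D \<phi> w = foldr (\<lambda>g a. \<phi> g \<otimes>\<^bsub>D\<^esub> a) w \<one>\<^bsub>D\<^esub>"

lemma word_val_simps [simp]: 
  "word_val D \<phi> [] = \<one>\<^bsub>D\<^esub>" "word_val D \<phi> (g # w) = \<phi> g \<otimes>\<^bsub>D\<^esub> word_val D \<phi> w"
  by (simp_all add: word_val_def)

text \<open>
  Evaluation of noncommutative polynomials, before passing to a quotient.
\<close>

abbreviation evl :: "'d superalg \<Rightarrow> ('g \<Rightarrow> 'd) \<Rightarrow> ('g list \<Rightarrow>\<^sub>0 cq) \<Rightarrow> 'd" where
  "evl D \<phi> \<equiv> lin_ext D (word_val D \<phi>)"

lemma gen_hom_eq: "gen_hom D \<phi> = lift D (word_val D \<phi>)"
  by (simp add: gen_hom_def word_val_def[abs_def])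

locale evaluation = superalgebra D for D :: "'d superalg" (structure) +
  fixes G :: "'g set" and par :: "'g \<Rightarrow> bool" and \<phi> :: "'g \<Rightarrow> 'd"
  assumes \<phi>_closed: "g \<in> G \<Longrightarrow> \<phi> g \<in> carrier D"
begin

abbreviation "Fr \<equiv> free_superalg G par"

lemma word_val_closed: "w \<in> lists G \<Longrightarrow> word_val D \<phi> w \<in> carrier D"
  by (induction w) (auto simp: \<phi>_closed)

lemma word_val_append: "u \<in> lists G \<Longrightarrow> v \<in> lists G \<Longrightarrow> word_val D \<phi> (u @ v) = word_val D \<phi> u \<otimes> word_val D \<phi> v"
  by (induction u) (auto simp: word_val_closed \<phi>_closed m_assoc)

lemma evl_lin: "evl D \<phi> \<in> lin_map Fr D"
  by (rule lin_ext_lin_map[OF free_fspace]) (rule word_val_closed)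

lemma evl_gen [simp]: "g \<in> G \<Longrightarrow> evl D \<phi> (gen g) = \<phi> g"
  by (subst lin_ext_single) (auto simp: \<phi>_closed)

lemma evl_single: "w \<in> lists G \<Longrightarrow> evl D \<phi> (Poly_Mapping.single w k) = k \<odot> word_val D \<phi> w"
  by (simp add: word_val_closed)

lemma evl_hom: "evl D \<phi> \<in> alg_hom Fr D"
proof (rule alg_homI[OF evl_lin])
  interpret F: fspace Fr "lists G" by (rule free_fspace)
  interpret FA: superalgebra Fr by (rule free_superalgebra)
  note l = lin_mapD[OF evl_lin] lin_map_more(1)[OF evl_lin F.vspace_axioms vspace_axioms]
  show "evl D \<phi> \<one>\<^bsub>Fr\<^esub> = \<one>"
    using evl_single[of "[]" 1] by (simp add: free_simps one_eq_single)
  fix x y assume x: "x \<in> carrier Fr" and y: "y \<in> carrier Fr"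
  have "evl D \<phi> (x * y) = evl D \<phi> x \<otimes> evl D \<phi> y" using x
  proof (induction rule: F.fspace_induct)
    case zero show ?case using l y by (simp add: free_simps)
  next
    case (add f g)
    then show ?case using l(3)[OF FA.mult_closed[OF add(1) y] FA.mult_closed[OF add(2) y]] l(3)[OF add(1,2)] y
      by (simp add: distrib_right mult_add_l l(1)) (simp add: free_simps distrib_right mult_add_l l(1))
  next
    case (single u k)
    have su: "Poly_Mapping.single u k \<in> carrier Fr" using single by simp
    show ?case using y
    proof (induction rule: F.fspace_induct)
      case zero show ?case using l su by (simp add: free_simps)
    next
      case (add f g)
      then show ?case using l(3)[OF FA.mult_closed[OF su add(1)] FA.mult_closed[OF su add(2)]] l(3)[OF add(1,2)] su
        by (simp add: distrib_left mult_add_r l(1)) (simp add: free_simps distrib_left mult_add_r l(1))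
    next
      case (single v m)
      then show ?case using \<open>u \<in> lists G\<close>
        by (simp add: mult_single plus_list_def word_val_closed word_val_append smult_mult_l smult_mult_r smult_assoc[symmetric] mult.commute)
    qed
  qed
  then show "evl D \<phi> (x \<otimes>\<^bsub>Fr\<^esub> y) = evl D \<phi> x \<otimes> evl D \<phi> y" by (simp add: free_simps)
qed

lemma word_val_grade: 
  assumes "\<And>g. g \<in> G \<Longrightarrow> \<phi> g \<in> grade D (par g)"
  shows "w \<in> lists G \<Longrightarrow> word_val D \<phi> w \<in> grade D (odd (length (filter par w)))"
proof (induction w)
  case Nil show ?case using grade_one by simp
next
  case (Cons g w)
  then show ?case using grade_mult[OF assms[of g] , of "word_val D \<phi> w" "odd (length (filter par w))"]
    by (cases "par g") auto
qed

lemma evl_even: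
  assumes "\<And>g. g \<in> G \<Longrightarrow> \<phi> g \<in> grade D (par g)"
  shows "evl D \<phi> \<in> even_map Fr D"
  unfolding even_map_def
proof (intro CollectI allI ballI)
  fix s x assume x: "x \<in> grade Fr s"
  let ?X = "{w \<in> lists G. odd (length (filter par w)) = s}"
  let ?P = "free_superalg G par\<lparr>carrier := {f. keys f \<subseteq> ?X}\<rparr>"
  interpret P: fspace ?P ?X by (simp add: fspace_def free_simps)
  have "lin_ext D (word_val D \<phi>) \<in> lin_map ?P D"
    by (rule lin_ext_lin_map[OF P.fspace_axioms]) (auto simp: word_val_closed)
  note l = lin_mapD[OF this] lin_map_more(1)[OF this P.vspace_axioms vspace_axioms]
  have "x \<in> carrier ?P" using x by (simp add: free_simps)
  then show "evl D \<phi> x \<in> grade D s"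
  proof (induction rule: P.fspace_induct)
    case zero show ?case using grade_zero by simp
  next
    case (single w k)
    then show ?case using word_val_grade[OF assms] by (auto simp: word_val_closed intro!: grade_smult)
  next
    case (add f g)
    then show ?case using l(3)[OF add(1,2)] grade_add by (simp add: free_simps)
  qed
qed

end

text \<open>
  Relators that are homogeneous generate a homogeneous ideal, so the quotient inherits the grading.
\<close>

locale presentation =
  fixes G :: "'g set" and par :: "'g \<Rightarrow> bool" and Rel
  assumes rel_homog: "r \<in> Rel \<Longrightarrow> \<exists>s. r \<in> grade (free_superalg G par) s"
begin

abbreviation "F \<equiv> free_superalg G par"
abbreviation "J \<equiv> genideal F Rel"
abbreviation "Pr \<equiv> presented G par Rel"
abbreviation "gcls g \<equiv> cls Pr (gen g)"

interpretation F: superalgebra F by (rule free_superalgebra)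

lemma rel_carr: "Rel \<subseteq> carrier F"
  using rel_homog F.grade_carr by blast

lemma hq: "homogeneous_quotient F J"
  by unfold_locales (use F.homogeneous_genideal rel_homog in blast)

interpretation FJ: homogeneous_quotient F J by (rule hq)

lemma Pr_eq: "Pr = FJ.Q" by (simp add: presented_def)

lemma Pr_superalgebra: "superalgebra Pr" using FJ.quot_superalgebra by (simp add: Pr_eq)

lemma fsub: "fspace_subspace F (lists G) J"
  by (simp add: fspace_subspace_def free_fspace FJ.linear_subspace_axioms)

lemma gen_carr [simp]: "g \<in> G \<Longrightarrow> gen g \<in> carrier F" 
  by (simp add: free_simps)

lemma gen_grade: "g \<in> G \<Longrightarrow> gen g \<in> grade F (par g)" 
  by (simp add: free_simps)

lemma gcls_grade: "g \<in> G \<Longrightarrow> gcls g \<in> grade Pr (par g)"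
  using FJ.cls_even gen_grade by (auto simp: Pr_eq even_map_def)

lemma gcls_closed [simp]: "g \<in> G \<Longrightarrow> gcls g \<in> carrier Pr"
  using alg_homD(4)[OF FJ.cls_alg_hom] by (simp add: Pr_eq)

lemma cls_hom: "cls Pr \<in> alg_hom F Pr" using FJ.cls_alg_hom by (simp add: Pr_eq)

lemma cls_rel: "r \<in> Rel \<Longrightarrow> cls Pr r = \<zero>\<^bsub>Pr\<^esub>"
  using FJ.cls_zero F.genideal_self[OF rel_carr] rel_carr by (auto simp: Pr_eq)

text \<open>
  Words are built up from the left, so a property closed under left multiplication by generators
  and under linear combinations holds everywhere.
\<close>

lemma presented_induct [consumes 1, case_names one gen smult add]:
  assumes x: "x \<in> carrier Pr"
    and one: "Q \<one>\<^bsub>Pr\<^esub>" and gen: "\<And>g x. g \<in> G \<Longrightarrow> x \<in> carrier Pr \<Longrightarrow> Q x \<Longrightarrow> Q (gcls g \<otimes>\<^bsub>Pr\<^esub> x)"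
    and smult: "\<And>k x. x \<in> carrier Pr \<Longrightarrow> Q x \<Longrightarrow> Q (k \<odot>\<^bsub>Pr\<^esub> x)"
    and add: "\<And>x y. x \<in> carrier Pr \<Longrightarrow> y \<in> carrier Pr \<Longrightarrow> Q x \<Longrightarrow> Q y \<Longrightarrow> Q (x \<oplus>\<^bsub>Pr\<^esub> y)"
  shows "Q x"
proof -
  obtain f where f: "f \<in> carrier F" "x = cls Pr f" using FJ.quot_carrierE x by (auto simp: Pr_eq)
  note h = alg_homD[OF cls_hom]
  have "Q (cls Pr f)" using f(1)
  proof (induction rule: free_induct)
    case one show ?case using h(3) assms(2) by (simp add: free_simps)
  next
    case (gen g f) then show ?case using h(2)[of "gen g" f] assms(3)[of g "cls Pr f"] h(4) gen_carr[of g] by (simp add: free_simps(2))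
  next
    case (smult k f) then show ?case using h(5)[of f k] assms(4) h(4) by (simp add: free_simps(6))
  next
    case (add f g) then show ?case using h(6)[of f g] assms(5) h(4) by (simp add: free_simps(5))
  qed
  then show ?thesis using f by simp
qed

lemma hom_eqI:
  assumes "superalgebra D" "h1 \<in> alg_hom Pr D" "h2 \<in> alg_hom Pr D" "\<And>g. g \<in> G \<Longrightarrow> h1 (gcls g) = h2 (gcls g)"
    "x \<in> carrier Pr"
  shows "h1 x = h2 x"
  using assms(5)
  by (induction rule: presented_induct) (simp_all add: alg_homD[OF assms(2)] alg_homD[OF assms(3)] assms(4))

lemma gen_hom:
  assumes "superalgebra D" "\<And>g. g \<in> G \<Longrightarrow> \<phi> g \<in> carrier D" "\<And>r. r \<in> Rel \<Longrightarrow> evl D \<phi> r = \<zero>\<^bsub>D\<^esub>"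
  shows "gen_hom D \<phi> \<in> alg_hom Pr D" "g \<in> G \<Longrightarrow> gen_hom D \<phi> (gcls g) = \<phi> g"
    "(\<And>g. g \<in> G \<Longrightarrow> \<phi> g \<in> grade D (par g)) \<Longrightarrow> gen_hom D \<phi> \<in> even_map Pr D"
proof -
  interpret evaluation D G par \<phi> by (intro evaluation.intro evaluation_axioms.intro assms(1,2))
  note lift_lin_map = fspace_subspace.lift_lin_map[OF fsub]
  note e = alg_homD[OF evl_hom]
  have kill: "evl D \<phi> i = \<zero>\<^bsub>D\<^esub>" if "i \<in> J" for i
    by (rule vanish_genideal[OF free_superalgebra assms(1) evl_hom rel_carr assms(3) that])
  have l: "gen_hom D \<phi> (cls Pr f) = evl D \<phi> f" if "f \<in> carrier F" for f
    unfolding gen_hom_eq Pr_eq using lift_lin_map(1)[OF vspace_axioms word_val_closed kill that] FJ.cls_quot[OF that] by simp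
  have lin: "gen_hom D \<phi> \<in> lin_map Pr D" 
    unfolding gen_hom_eq Pr_eq using lift_lin_map(2)[OF vspace_axioms word_val_closed kill] by simp
  have E: "\<exists>f\<in>carrier F. x = cls Pr f" if "x \<in> carrier Pr" for x
    using FJ.quot_carrierE that by (auto simp: Pr_eq)
  show "gen_hom D \<phi> \<in> alg_hom Pr D"
  proof (rule alg_homI[OF lin])
    fix x y assume x: "x \<in> carrier Pr" and y: "y \<in> carrier Pr"
    from E[OF x] obtain f where f: "f \<in> carrier F" "x = cls Pr f" by (elim bexE)
    from E[OF y] obtain g where g: "g \<in> carrier F" "y = cls Pr g" by (elim bexE)
    from f g show "gen_hom D \<phi> (x \<otimes>\<^bsub>Pr\<^esub> y) = gen_hom D \<phi> x \<otimes>\<^bsub>D\<^esub> gen_hom D \<phi> y"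
      using l[OF F.mult_closed[OF f(1) g(1)]] by (simp add: l e alg_homD(2)[OF cls_hom])
  next
    show "gen_hom D \<phi> \<one>\<^bsub>Pr\<^esub> = \<one>\<^bsub>D\<^esub>"
      using l[OF F.unit_closed] by (simp add: e alg_homD(3)[OF cls_hom])
  qed
  show "g \<in> G \<Longrightarrow> gen_hom D \<phi> (gcls g) = \<phi> g" by (simp add: l)
  assume "\<And>g. g \<in> G \<Longrightarrow> \<phi> g \<in> grade D (par g)"
  note ev = evl_even[OF this] 
  show "gen_hom D \<phi> \<in> even_map Pr D"
    unfolding even_map_def
  proof (intro CollectI allI ballI)
    fix s x assume "x \<in> grade Pr s"
    then obtain f where f: "f \<in> grade F s" "x = FJ.proj f" by (auto simp: Pr_eq FJ.quot_grade)
    then have "x = cls Pr f" using FJ.cls_quot F.grade_carr by (simp add: Pr_eq)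
    then show "gen_hom D \<phi> x \<in> grade D s" using even_mapD[OF ev f(1)] l[OF F.grade_carr[OF f(1)]] by simp
  qed
qed

end

section \<open>Tensor products of superalgebras\<close>

lemma (in abelian_group) add_diff_diff:
  assumes p: "p \<in> carrier G" and r: "r \<in> carrier G"
  shows "(p \<oplus> r) \<ominus> p \<ominus> r = \<zero>"
proof -
  have "(p \<oplus> r) \<ominus> p \<ominus> r = (p \<oplus> r) \<oplus> (\<ominus> p \<oplus> \<ominus> r)" using p r by (simp add: a_minus_def a_assoc)
  also have "\<ominus> p \<oplus> \<ominus> r = \<ominus> (p \<oplus> r)" using p r by (rule minus_add[symmetric])
  also have "(p \<oplus> r) \<oplus> \<ominus> (p \<oplus> r) = \<zero>" using p r by (intro r_neg) simp
  finally show ?thesis .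
qed

context fspace
begin

lemma a_inv_eq: "f \<in> carrier P \<Longrightarrow> \<ominus>\<^bsub>P\<^esub> f = - f"
  by (rule minus_equality) (simp_all add: fspace_simps)

lemma a_minus_eq: "f \<in> carrier P \<Longrightarrow> g \<in> carrier P \<Longrightarrow> f \<ominus>\<^bsub>P\<^esub> g = f - g"
  by (simp add: a_minus_def a_inv_eq add_eq)

lemma diff_closed: "f \<in> carrier P \<Longrightarrow> g \<in> carrier P \<Longrightarrow> f - g \<in> carrier P"
  using a_minus_eq[of f g] minus_closed[of f g] by simp

lemma finsum_eq: "finite S \<Longrightarrow> h \<in> S \<rightarrow> carrier P \<Longrightarrow> (\<Oplus>\<^bsub>P\<^esub>i\<in>S. h i) = (\<Sum>i\<in>S. h i)"
proof (induction S rule: finite_induct)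
  case empty show ?case by (simp add: zero_eq)
next
  case (insert x S) then show ?case by (simp add: add_eq Pi_iff)
qed

lemma lin_ext_eq: 
  "f \<in> carrier P \<Longrightarrow> (\<And>x. x \<in> X \<Longrightarrow> \<beta> x \<in> carrier P) \<Longrightarrow> lin_ext P \<beta> f = (\<Sum>x\<in>keys f. scale (lookup f x) (\<beta> x))"
proof -
  assume f: "f \<in> carrier P" and b: "\<And>x. x \<in> X \<Longrightarrow> \<beta> x \<in> carrier P"
  have "lookup f x \<odot>\<^bsub>P\<^esub> \<beta> x \<in> carrier P" if "x \<in> keys f" for x
    using f that b[of x] by (auto simp only: carrier_eq intro!: smult_closed[unfolded carrier_eq])
  then show ?thesis unfolding lin_ext_def by (subst finsum_eq) (simp_all add: smult_eq)
qed

lemma subspace_of_linear_kernel: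
  assumes "vspace W" "h \<in> lin_map P W"
  shows "module.subspace scale {f \<in> carrier P. h f = \<zero>\<^bsub>W\<^esub>}"
proof -
  interpret W: vspace W by fact
  interpret pmvs: vector_space "scale :: cq \<Rightarrow> ('b \<Rightarrow>\<^sub>0 cq) \<Rightarrow> _" by (rule scale_vector_space)
  note h = lin_mapD[OF assms(2)] lin_map_more[OF assms(2) vspace_axioms assms(1)]
  show ?thesis
    unfolding pmvs.subspace_def
    by (auto simp: h zero_eq[symmetric] smult_eq[symmetric] add_eq[symmetric])
qed

end

text \<open>
  The parity automorphism. With it the sign rule reads \<open>(1 \<otimes> b)(a \<otimes> 1) = flip a \<otimes> b\<close> for odd \<open>b\<close> and all
  \<open>a\<close>, so that homogeneity has to be assumed of one factor only.
\<close>

definition (in superalgebra) flip :: "'a \<Rightarrow> 'a" where "flip x = hcomp A False x \<ominus> hcomp A True x"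

context superalgebra
begin

lemma flip_closed [simp]: "x \<in> carrier A \<Longrightarrow> flip x \<in> carrier A" by (simp add: flip_def)

lemma flip_add: "x \<in> carrier A \<Longrightarrow> y \<in> carrier A \<Longrightarrow> flip (x \<oplus> y) = flip x \<oplus> flip y"
  by (simp add: flip_def hcomp_add a_minus_def minus_add a_ac)

lemma flip_smult: "x \<in> carrier A \<Longrightarrow> flip (k \<odot> x) = k \<odot> flip x"
  by (simp add: flip_def hcomp_smult smult_diff)

lemma flip_grade: "x \<in> grade A s \<Longrightarrow> flip x = (if s then \<ominus> x else x)"
  using grade_carr[of x s] minus_equality[of \<zero> \<zero>] by (auto simp: flip_def hcomp_homog a_minus_def)

lemma flip_one: "flip \<one> = \<one>" using flip_grade[OF grade_one] by simp

lemma homog_induct [consumes 1, case_names homog add]: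
  assumes "x \<in> carrier A" "\<And>x s. x \<in> grade A s \<Longrightarrow> Q x" 
    "\<And>x y. x \<in> carrier A \<Longrightarrow> y \<in> carrier A \<Longrightarrow> Q x \<Longrightarrow> Q y \<Longrightarrow> Q (x \<oplus> y)"
  shows "Q x"
  using grade_span[OF assms(1)] assms(2,3) grade_carr by blast

lemma flip_mult: 
  assumes "x \<in> carrier A" "y \<in> carrier A" 
  shows "flip (x \<otimes> y) = flip x \<otimes> flip y"
  using assms(1)
proof (induction rule: homog_induct)
  case (homog x s)
  note x = homog(1) and xc = grade_carr[OF homog(1)]
  show ?case using assms(2)
  proof (induction rule: homog_induct)
    case (homog y t)
    note yc = grade_carr[OF homog]
    show ?case
      by (subst flip_grade[OF grade_mult[OF x homog]], subst flip_grade[OF x], subst flip_grade[OF homog])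
        (use xc yc in \<open>cases s; cases t; simp add: l_minus r_minus\<close>)
  next
    case (add y z)
    then show ?case using xc by (simp add: mult_add_r flip_add)
  qed
next
  case (add y z)
  then show ?case using assms by (simp add: mult_add_l flip_add)
qed

lemma flip_flip: "x \<in> carrier A \<Longrightarrow> flip (flip x) = x"
proof (induction rule: homog_induct)
  case (homog x s)
  then show ?case using flip_grade[OF homog] flip_grade[OF grade_minus[OF homog]] grade_carr[OF homog] by simp
qed (simp add: flip_add)

end

definition bilin :: "'a superalg \<Rightarrow> 'b superalg \<Rightarrow> 'c superalg \<Rightarrow> ('a \<Rightarrow> 'b \<Rightarrow> 'c) \<Rightarrow> bool" where
  "bilin A B E \<beta> \<longleftrightarrow> (\<forall>a\<in>carrier A. \<beta> a \<in> lin_map B E) \<and> (\<forall>b\<in>carrier B. (\<lambda>a. \<beta> a b) \<in> lin_map A E)"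

lemma bilinI:
  assumes "\<And>a b. a \<in> carrier A \<Longrightarrow> b \<in> carrier B \<Longrightarrow> \<beta> a b \<in> carrier E"
    "\<And>a a' b. a \<in> carrier A \<Longrightarrow> a' \<in> carrier A \<Longrightarrow> b \<in> carrier B \<Longrightarrow> \<beta> (a \<oplus>\<^bsub>A\<^esub> a') b = \<beta> a b \<oplus>\<^bsub>E\<^esub> \<beta> a' b"
    "\<And>a b b'. a \<in> carrier A \<Longrightarrow> b \<in> carrier B \<Longrightarrow> b' \<in> carrier B \<Longrightarrow> \<beta> a (b \<oplus>\<^bsub>B\<^esub> b') = \<beta> a b \<oplus>\<^bsub>E\<^esub> \<beta> a b'"
    "\<And>k a b. a \<in> carrier A \<Longrightarrow> b \<in> carrier B \<Longrightarrow> \<beta> (k \<odot>\<^bsub>A\<^esub> a) b = k \<odot>\<^bsub>E\<^esub> \<beta> a b"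
    "\<And>k a b. a \<in> carrier A \<Longrightarrow> b \<in> carrier B \<Longrightarrow> \<beta> a (k \<odot>\<^bsub>B\<^esub> b) = k \<odot>\<^bsub>E\<^esub> \<beta> a b"
  shows "bilin A B E \<beta>"
  using assms by (auto simp: bilin_def intro!: lin_mapI)

lemma bilinD:
  assumes "bilin A B E \<beta>" "a \<in> carrier A" "b \<in> carrier B"
  shows "\<beta> a b \<in> carrier E" "\<beta> (k \<odot>\<^bsub>A\<^esub> a) b = k \<odot>\<^bsub>E\<^esub> \<beta> a b" "\<beta> a (k \<odot>\<^bsub>B\<^esub> b) = k \<odot>\<^bsub>E\<^esub> \<beta> a b"
    "a' \<in> carrier A \<Longrightarrow> \<beta> (a \<oplus>\<^bsub>A\<^esub> a') b = \<beta> a b \<oplus>\<^bsub>E\<^esub> \<beta> a' b"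
    "b' \<in> carrier B \<Longrightarrow> \<beta> a (b \<oplus>\<^bsub>B\<^esub> b') = \<beta> a b \<oplus>\<^bsub>E\<^esub> \<beta> a b'"
  using assms lin_mapD[of "\<beta> a" B E] lin_mapD[of "\<lambda>a. \<beta> a b" A E] by (auto simp: bilin_def)

lemma pretensor_fspace: "fspace (pretensor A B) (carrier A \<times> carrier B)"
  by (simp add: fspace_def pretensor_def)

locale tensor_product = A: superalgebra A + B: superalgebra B 
  for A :: "'a superalg" and B :: "'b superalg"
begin

abbreviation "P \<equiv> pretensor A B"
abbreviation "X \<equiv> carrier A \<times> carrier B"
abbreviation "N \<equiv> module.span scale (bilinear_rels A B)"
abbreviation "D \<equiv> stensor A B"
abbreviation "tn \<equiv> pure_tensor A B"

sublocale P: fspace P X by (rule pretensor_fspace)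

interpretation pmvs: vector_space "scale :: cq \<Rightarrow> ('a \<times> 'b \<Rightarrow>\<^sub>0 cq) \<Rightarrow> _" by (rule scale_vector_space)

lemma carrier_subspace: "pmvs.subspace (carrier P)"
  unfolding pmvs.subspace_def
  using P.zero_closed P.add.m_closed P.smult_closed by (simp add: P.zero_eq P.add_eq P.smult_eq)

lemma rels_closed: "bilinear_rels A B \<subseteq> carrier P"
  unfolding bilinear_rels_def by (auto intro!: P.diff_closed P.single_closed)

sublocale linear_subspace P N
proof
  show "N \<subseteq> carrier P" by (rule pmvs.span_minimal[OF rels_closed carrier_subspace])
  show "\<zero>\<^bsub>P\<^esub> \<in> N" by (simp add: P.zero_eq pmvs.span_zero)
  show "x \<oplus>\<^bsub>P\<^esub> y \<in> N" if "x \<in> N" "y \<in> N" for x y using that by (simp add: P.add_eq pmvs.span_add)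
  show "k \<odot>\<^bsub>P\<^esub> x \<in> N" if "x \<in> N" for x k using that by (simp add: P.smult_eq pmvs.span_scale)
qed

lemma D_eq: "D = superquot P N" by (simp add: stensor_def)

lemma D_vspace: "vspace D" using quot_vspace by (simp add: D_eq)

sublocale D: vspace D by (rule D_vspace)

lemma pr_lin: "proj \<in> lin_map P D" using proj_lin_map by (simp add: D_eq)

lemmas pr = lin_mapD[OF pr_lin] lin_map_more[OF pr_lin P.vspace_axioms D_vspace]

lemma tn_eq: "a \<in> carrier A \<Longrightarrow> b \<in> carrier B \<Longrightarrow> tn a b = proj (Poly_Mapping.single (a, b) 1)"
  by (simp add: pure_tensor_def D_eq cls_quot)

lemma tn_closed [simp]: "a \<in> carrier A \<Longrightarrow> b \<in> carrier B \<Longrightarrow> tn a b \<in> carrier D"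
  by (simp add: tn_eq pr)

lemma pr_single: "a \<in> carrier A \<Longrightarrow> b \<in> carrier B \<Longrightarrow> proj (Poly_Mapping.single (a, b) k) = k \<odot>\<^bsub>D\<^esub> tn a b"
  using pr(2)[of "Poly_Mapping.single (a, b) 1" k] by (simp add: tn_eq P.smult_eq)

lemma pr_N: "f \<in> N \<Longrightarrow> proj f = \<zero>\<^bsub>D\<^esub>"
  using proj_zero I_carr by (simp add: D_eq)

lemma tn_bilin: "bilin A B D tn"
proof (rule bilinI)
  fix a a' b assume c: "a \<in> carrier A" "a' \<in> carrier A" "b \<in> carrier B"
  let ?s = "\<lambda>a b. Poly_Mapping.single (a, b) (1 :: cq)"
  have "?s (a \<oplus>\<^bsub>A\<^esub> a') b - ?s a b - ?s a' b \<in> N"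
    by (rule pmvs.span_base) (use c in \<open>auto simp: bilinear_rels_def\<close>)
  then have "proj (?s (a \<oplus>\<^bsub>A\<^esub> a') b \<ominus>\<^bsub>P\<^esub> (?s a b \<oplus>\<^bsub>P\<^esub> ?s a' b)) = \<zero>\<^bsub>D\<^esub>"
    by (intro pr_N) (use c in \<open>simp add: P.a_minus_eq P.add_eq diff_diff_eq P.add.m_closed[unfolded P.add_eq]\<close>)
  then show "tn (a \<oplus>\<^bsub>A\<^esub> a') b = tn a b \<oplus>\<^bsub>D\<^esub> tn a' b"
    using c by (simp add: pr tn_eq D.diff_zero_iff)
next
  fix a b b' assume c: "a \<in> carrier A" "b \<in> carrier B" "b' \<in> carrier B"
  let ?s = "\<lambda>a b. Poly_Mapping.single (a, b) (1 :: cq)"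
  have "?s a (b \<oplus>\<^bsub>B\<^esub> b') - ?s a b - ?s a b' \<in> N"
    by (rule pmvs.span_base) (use c in \<open>auto simp: bilinear_rels_def\<close>)
  then have "proj (?s a (b \<oplus>\<^bsub>B\<^esub> b') \<ominus>\<^bsub>P\<^esub> (?s a b \<oplus>\<^bsub>P\<^esub> ?s a b')) = \<zero>\<^bsub>D\<^esub>"
    by (intro pr_N) (use c in \<open>simp add: P.a_minus_eq P.add_eq diff_diff_eq P.add.m_closed[unfolded P.add_eq]\<close>)
  then show "tn a (b \<oplus>\<^bsub>B\<^esub> b') = tn a b \<oplus>\<^bsub>D\<^esub> tn a b'"
    using c by (simp add: pr tn_eq D.diff_zero_iff)
next
  fix a b k assume c: "a \<in> carrier A" "b \<in> carrier B" 
  have "Poly_Mapping.single (k \<odot>\<^bsub>A\<^esub> a, b) 1 - Poly_Mapping.single (a, b) k \<in> N"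
    by (rule pmvs.span_base) (use c in \<open>auto simp: bilinear_rels_def\<close>)
  then have "proj (Poly_Mapping.single (k \<odot>\<^bsub>A\<^esub> a, b) 1 \<ominus>\<^bsub>P\<^esub> Poly_Mapping.single (a, b) k) = \<zero>\<^bsub>D\<^esub>"
    by (intro pr_N) (use c in \<open>simp add: P.a_minus_eq\<close>)
  then show "tn (k \<odot>\<^bsub>A\<^esub> a) b = k \<odot>\<^bsub>D\<^esub> tn a b"
    using c by (simp add: pr pr_single D.diff_zero_iff)
  have "Poly_Mapping.single (a, k \<odot>\<^bsub>B\<^esub> b) 1 - Poly_Mapping.single (a, b) k \<in> N"
    by (rule pmvs.span_base) (use c in \<open>auto simp: bilinear_rels_def\<close>)
  then have "proj (Poly_Mapping.single (a, k \<odot>\<^bsub>B\<^esub> b) 1 \<ominus>\<^bsub>P\<^esub> Poly_Mapping.single (a, b) k) = \<zero>\<^bsub>D\<^esub>"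
    by (intro pr_N) (use c in \<open>simp add: P.a_minus_eq\<close>)
  then show "tn a (k \<odot>\<^bsub>B\<^esub> b) = k \<odot>\<^bsub>D\<^esub> tn a b"
    using c by (simp add: pr pr_single D.diff_zero_iff)
qed simp

lemmas tn = bilinD[OF tn_bilin]

lemma tn_zero: "b \<in> carrier B \<Longrightarrow> tn \<zero>\<^bsub>A\<^esub> b = \<zero>\<^bsub>D\<^esub>" "a \<in> carrier A \<Longrightarrow> tn a \<zero>\<^bsub>B\<^esub> = \<zero>\<^bsub>D\<^esub>"
  using tn(2)[of "\<zero>\<^bsub>A\<^esub>" b 0] tn(3)[of a "\<zero>\<^bsub>B\<^esub>" 0] by simp_all

lemma tn_minus: "a \<in> carrier A \<Longrightarrow> b \<in> carrier B \<Longrightarrow> tn (\<ominus>\<^bsub>A\<^esub> a) b = \<ominus>\<^bsub>D\<^esub> tn a b"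
  "a \<in> carrier A \<Longrightarrow> b \<in> carrier B \<Longrightarrow> tn a (\<ominus>\<^bsub>B\<^esub> b) = \<ominus>\<^bsub>D\<^esub> tn a b"
  using tn(2)[of a b "-1"] tn(3)[of a b "-1"] by (simp_all add: A.smult_neg_one B.smult_neg_one D.smult_neg_one)

lemma D_carrierE: "x \<in> carrier D \<Longrightarrow> \<exists>f\<in>carrier P. x = proj f"
  by (auto simp: D_eq quot_carrier)

lemma D_induct [consumes 1, case_names tensor add]:
  assumes x: "x \<in> carrier D"
    and t: "\<And>a b s t. a \<in> grade A s \<Longrightarrow> b \<in> grade B t \<Longrightarrow> K (tn a b)"
    and add: "\<And>x y. x \<in> carrier D \<Longrightarrow> y \<in> carrier D \<Longrightarrow> K x \<Longrightarrow> K y \<Longrightarrow> K (x \<oplus>\<^bsub>D\<^esub> y)"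
  shows "K x"
proof -
  have t1: "K (tn a b)" if "a \<in> carrier A" "b \<in> grade B t" for a b t
    using that(1)
  proof (induction rule: A.homog_induct)
    case (homog a s) then show ?case using t that by blast
  next
    case (add a a') then show ?case using assms(3)[of "tn a b" "tn a' b"] B.grade_carr[OF that(2)] by (simp add: tn)
  qed
  have t2: "K (tn a b)" if a: "a \<in> carrier A" and "b \<in> carrier B" for a b
    using that(2)
  proof (induction rule: B.homog_induct)
    case (homog b s) then show ?case using t1 a by blast
  next
    case (add b b') then show ?case using assms(3)[of "tn a b" "tn a b'"] a by (simp add: tn)
  qed
  obtain f where f: "f \<in> carrier P" "x = proj f" using D_carrierE[OF x] by (elim bexE)
  have "K (proj f)" using f(1)
  proof (induction rule: P.fspace_induct)
    case zero
    have "proj 0 = tn \<zero>\<^bsub>A\<^esub> \<zero>\<^bsub>B\<^esub>" using pr(4) tn_zero by (simp add: P.zero_eq)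
    then show ?case using t2 by simp
  next
    case (single x k)
    then obtain a b where "x = (a, b)" "a \<in> carrier A" "b \<in> carrier B" by auto
    then show ?case using t2[of "k \<odot>\<^bsub>A\<^esub> a" b] by (simp add: pr_single tn)
  next
    case (add f g)
    then show ?case using assms(3)[of "proj f" "proj g"] pr(1,3)[of f] pr(1)[of g] by (simp add: P.add_eq)
  qed
  then show ?thesis using f by simp
qed

lemma lin_map_D_eqI:
  assumes "h \<in> lin_map D E" "g \<in> lin_map D E" 
    "\<And>a b s t. a \<in> grade A s \<Longrightarrow> b \<in> grade B t \<Longrightarrow> h (tn a b) = g (tn a b)" "x \<in> carrier D"
  shows "h x = g x"
  using assms(4)
  by (induction rule: D_induct) (simp_all add: assms(3) lin_mapD[OF assms(1)] lin_mapD[OF assms(2)])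

text \<open>
  The bilinearity relations are exactly the obstruction to bilinearity of \<open>(a, b) \<mapsto> h (a, b)\<close>, and
  a kernel is a subspace, so it contains their span.
\<close>

lemma bilin_kill:
  assumes E: "vspace E" and h: "h \<in> lin_map P E" and b: "bilin A B E (\<lambda>a b. h (Poly_Mapping.single (a, b) 1))"
    and n: "n \<in> N"
  shows "h n = \<zero>\<^bsub>E\<^esub>"
proof -
  interpret E: vspace E by fact
  note hD = lin_mapD[OF h] lin_map_more[OF h P.vspace_axioms E]
  note bD = bilinD[OF b]
  have hs: "h (Poly_Mapping.single (a, b) k) = k \<odot>\<^bsub>E\<^esub> h (Poly_Mapping.single (a, b) 1)" 
    if "a \<in> carrier A" "b \<in> carrier B" for a b k
    using hD(2)[of "Poly_Mapping.single (a, b) 1" k] that by (simp add: P.smult_eq)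
  have h3: "h (x - y - z) = \<zero>\<^bsub>E\<^esub>" if "x \<in> carrier P" "y \<in> carrier P" "z \<in> carrier P" "h x = h y \<oplus>\<^bsub>E\<^esub> h z" for x y z
  proof -
    have "h (x - y - z) = h x \<ominus>\<^bsub>E\<^esub> h y \<ominus>\<^bsub>E\<^esub> h z"
      using that(1-3) hD(6)[of x y] hD(6)[of "x - y" z] P.a_minus_eq[of x y] P.a_minus_eq[of "x - y" z] P.diff_closed by simp
    also have "\<dots> = \<zero>\<^bsub>E\<^esub>" unfolding that(4) by (rule E.add_diff_diff[OF hD(1)[OF that(2)] hD(1)[OF that(3)]])
    finally show ?thesis .
  qed
  have h2: "h (x - y) = \<zero>\<^bsub>E\<^esub>" if "x \<in> carrier P" "y \<in> carrier P" "h x = h y" for x y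
    using that hD(6)[of x y] P.a_minus_eq[of x y] hD(1)[of y] E.diff_zero_iff[of "h y" "h y"] by simp
  have k1: "h (Poly_Mapping.single (a \<oplus>\<^bsub>A\<^esub> a', b) 1 - Poly_Mapping.single (a, b) 1 - Poly_Mapping.single (a', b) 1) = \<zero>\<^bsub>E\<^esub>"
    if "a \<in> carrier A" "a' \<in> carrier A" "b \<in> carrier B" for a a' b
    by (rule h3) (use that in \<open>simp_all add: bD(4)\<close>)
  have k2: "h (Poly_Mapping.single (a, b \<oplus>\<^bsub>B\<^esub> b') 1 - Poly_Mapping.single (a, b) 1 - Poly_Mapping.single (a, b') 1) = \<zero>\<^bsub>E\<^esub>"
    if "a \<in> carrier A" "b \<in> carrier B" "b' \<in> carrier B" for a b b'
    by (rule h3) (use that in \<open>simp_all add: bD(5)\<close>)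
  have k3: "h (Poly_Mapping.single (k \<odot>\<^bsub>A\<^esub> a, b) 1 - Poly_Mapping.single (a, b) k) = \<zero>\<^bsub>E\<^esub>"
    if "a \<in> carrier A" "b \<in> carrier B" for a b k
    by (rule h2) (use that hs[OF that, of k] bD(2) in simp_all)
  have k4: "h (Poly_Mapping.single (a, k \<odot>\<^bsub>B\<^esub> b) 1 - Poly_Mapping.single (a, b) k) = \<zero>\<^bsub>E\<^esub>"
    if "a \<in> carrier A" "b \<in> carrier B" for a b k
    by (rule h2) (use that hs[OF that, of k] bD(3) in simp_all)
  have "N \<subseteq> {f \<in> carrier P. h f = \<zero>\<^bsub>E\<^esub>}"
  proof (rule pmvs.span_minimal[OF _ P.subspace_of_linear_kernel[OF E h]], rule subsetI, rule CollectI, rule conjI)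
    fix r assume r: "r \<in> bilinear_rels A B"
    show "r \<in> carrier P" by (rule subsetD[OF rels_closed r])
    show "h r = \<zero>\<^bsub>E\<^esub>" using r unfolding bilinear_rels_def
      by (elim UnE CollectE exE conjE) (simp_all only: k1 k2 k3 k4)
  qed
  then show ?thesis using n by auto
qed

lemma univ:
  assumes E: "vspace E" and b: "bilin A B E \<beta>"
  shows "lift E (\<lambda>(a, b). \<beta> a b) \<in> lin_map D E"
    and "a \<in> carrier A \<Longrightarrow> b \<in> carrier B \<Longrightarrow> lift E (\<lambda>(a, b). \<beta> a b) (tn a b) = \<beta> a b"
proof -
  interpret E: vspace E by fact
  interpret fs: fspace_subspace P X N by unfold_locales
  let ?\<beta> = "\<lambda>(a, b). \<beta> a b"
  note bD = bilinD[OF b]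
  have cl: "?\<beta> x \<in> carrier E" if "x \<in> X" for x using that bD(1) by auto
  have l: "lin_ext E ?\<beta> \<in> lin_map P E" by (rule E.lin_ext_lin_map[OF P.fspace_axioms cl])
  have s: "lin_ext E ?\<beta> (Poly_Mapping.single (a, b) 1) = \<beta> a b" if "a \<in> carrier A" "b \<in> carrier B" for a b
    using E.lin_ext_single[of ?\<beta> "(a, b)" 1] that bD(1) by simp
  have kill: "lin_ext E ?\<beta> n = \<zero>\<^bsub>E\<^esub>" if "n \<in> N" for n
    by (rule bilin_kill[OF E l _ that], rule bilinI) (simp_all add: s bD)
  show "lift E ?\<beta> \<in> lin_map D E" using fs.lift_lin_map(2)[OF E cl kill] by (simp add: D_eq)
  show "lift E ?\<beta> (tn a b) = \<beta> a b" if ab: "a \<in> carrier A" "b \<in> carrier B"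
  proof -
    have c: "Poly_Mapping.single (a, b) 1 \<in> carrier P" using ab by simp
    show ?thesis using fs.lift_lin_map(1)[OF E cl kill c] s[OF ab] tn_eq[OF ab] by simp
  qed
qed

end

lemma koszul_simps [simp]: "koszul False t = 1" "koszul s False = 1" "koszul True True = - 1"
  by (simp_all add: koszul_def)

context tensor_product
begin

text \<open>
  The product of two basis vectors of the pretensor.
\<close>

definition ptm :: "'a \<times> 'b \<Rightarrow> 'a \<times> 'b \<Rightarrow> ('a \<times> 'b \<Rightarrow>\<^sub>0 cq)" where
  "ptm x y = (\<Sum>s\<in>UNIV. \<Sum>t\<in>UNIV.
     Poly_Mapping.single (fst x \<otimes>\<^bsub>A\<^esub> hcomp A t (fst y), hcomp B s (snd x) \<otimes>\<^bsub>B\<^esub> snd y) (koszul s t))"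

lemma ptm_closed: "x \<in> X \<Longrightarrow> y \<in> X \<Longrightarrow> ptm x y \<in> carrier P"
  by (cases x; cases y) 
    (simp add: ptm_def UNIV_bool P.add.m_closed[unfolded P.add_eq])

interpretation pmvs: vector_space "scale :: cq \<Rightarrow> ('a \<times> 'b \<Rightarrow>\<^sub>0 cq) \<Rightarrow> _" by (rule scale_vector_space)

lemma P_mult_sum: "f \<otimes>\<^bsub>P\<^esub> g = (\<Sum>x\<in>keys f. \<Sum>y\<in>keys g. scale (lookup f x) (scale (lookup g y) (ptm x y)))"
proof -
  have "scale (lookup f x) (scale (lookup g y) (ptm x y)) = 
    (\<Sum>s\<in>UNIV. \<Sum>t\<in>UNIV.
     Poly_Mapping.single (fst x \<otimes>\<^bsub>A\<^esub> hcomp A t (fst y), hcomp B s (snd x) \<otimes>\<^bsub>B\<^esub> snd y) (koszul s t * lookup f x * lookup g y))" for x y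
    by (simp add: ptm_def UNIV_bool pmvs.scale_right_distrib mult_ac)
  then show ?thesis by (simp add: pretensor_def case_prod_beta)
qed

lemma P_mult_l: "f \<in> carrier P \<Longrightarrow> g \<in> carrier P \<Longrightarrow> f \<otimes>\<^bsub>P\<^esub> g = lin_ext P (\<lambda>x. lin_ext P (ptm x) g) f"
  and P_mult_r: "f \<in> carrier P \<Longrightarrow> g \<in> carrier P \<Longrightarrow> f \<otimes>\<^bsub>P\<^esub> g = lin_ext P (\<lambda>y. lin_ext P (\<lambda>x. ptm x y) f) g"
proof -
  assume f: "f \<in> carrier P" and g: "g \<in> carrier P"
  have c1: "lin_ext P (ptm x) g \<in> carrier P" if "x \<in> X" for x
    by (rule lin_mapD(1)[OF P.lin_ext_lin_map[OF P.fspace_axioms ptm_closed[OF that]] g])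
  have c2: "lin_ext P (\<lambda>x. ptm x y) f \<in> carrier P" if "y \<in> X" for y
    by (rule lin_mapD(1)[OF P.lin_ext_lin_map[OF P.fspace_axioms ptm_closed[OF _ that]] f])
  have "x \<in> X" if "x \<in> keys f \<or> x \<in> keys g" for x using f g that by (auto simp only: P.carrier_eq)
  note k = this[OF disjI1] this[OF disjI2]
  have "lin_ext P (\<lambda>x. lin_ext P (ptm x) g) f = (\<Sum>x\<in>keys f. scale (lookup f x) (lin_ext P (ptm x) g))"
    by (rule P.lin_ext_eq[OF f c1])
  also have "\<dots> = (\<Sum>x\<in>keys f. \<Sum>y\<in>keys g. scale (lookup f x) (scale (lookup g y) (ptm x y)))"
    by (intro sum.cong refl, subst P.lin_ext_eq[OF g ptm_closed]) (simp_all only: k pmvs.scale_sum_right)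
  finally show "f \<otimes>\<^bsub>P\<^esub> g = lin_ext P (\<lambda>x. lin_ext P (ptm x) g) f" by (simp only: P_mult_sum)
  have "lin_ext P (\<lambda>y. lin_ext P (\<lambda>x. ptm x y) f) g = (\<Sum>y\<in>keys g. scale (lookup g y) (lin_ext P (\<lambda>x. ptm x y) f))"
    by (rule P.lin_ext_eq[OF g c2])
  also have "\<dots> = (\<Sum>y\<in>keys g. \<Sum>x\<in>keys f. scale (lookup f x) (scale (lookup g y) (ptm x y)))"
    by (intro sum.cong refl, subst P.lin_ext_eq[OF f ptm_closed]) (simp_all only: k pmvs.scale_sum_right pmvs.scale_left_commute)
  also have "\<dots> = (\<Sum>x\<in>keys f. \<Sum>y\<in>keys g. scale (lookup f x) (scale (lookup g y) (ptm x y)))"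
    by (rule sum.swap)
  finally show "f \<otimes>\<^bsub>P\<^esub> g = lin_ext P (\<lambda>y. lin_ext P (\<lambda>x. ptm x y) f) g" by (simp only: P_mult_sum)
qed

lemma ptm_lin: "x \<in> X \<Longrightarrow> lin_ext P (ptm x) \<in> lin_map P P" "y \<in> X \<Longrightarrow> lin_ext P (\<lambda>x. ptm x y) \<in> lin_map P P"
  by (rule P.lin_ext_lin_map[OF P.fspace_axioms]; simp add: ptm_closed)+

lemma P_mult_lin_l: "g \<in> carrier P \<Longrightarrow> (\<lambda>f. f \<otimes>\<^bsub>P\<^esub> g) \<in> lin_map P P"
proof -
  assume g: "g \<in> carrier P"
  have "lin_ext P (\<lambda>x. lin_ext P (ptm x) g) \<in> lin_map P P"
    by (rule P.lin_ext_lin_map[OF P.fspace_axioms]) (rule lin_mapD(1)[OF ptm_lin(1) g])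
  then show ?thesis using g P_mult_l[OF _ g] unfolding lin_map_def by (auto simp: Pi_iff)
qed

lemma P_mult_lin_r: "f \<in> carrier P \<Longrightarrow> (\<lambda>g. f \<otimes>\<^bsub>P\<^esub> g) \<in> lin_map P P"
proof -
  assume f: "f \<in> carrier P"
  have "lin_ext P (\<lambda>y. lin_ext P (\<lambda>x. ptm x y) f) \<in> lin_map P P"
    by (rule P.lin_ext_lin_map[OF P.fspace_axioms]) (rule lin_mapD(1)[OF ptm_lin(2) f])
  then show ?thesis using f P_mult_r[OF f] unfolding lin_map_def by (auto simp: Pi_iff)
qed

sublocale P: nonassoc_alg P
proof (intro nonassoc_alg.intro nonassoc_alg_axioms.intro P.vspace_axioms, goal_cases)
  case (1 x y) then show ?case by (intro lin_mapD(1)[OF P_mult_lin_l])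
next
  case (2 x y z) then show ?case by (intro lin_mapD(3)[OF P_mult_lin_l])
next
  case (3 x y z) then show ?case by (intro lin_mapD(3)[OF P_mult_lin_r])
next
  case (4 x y k) then show ?case by (intro lin_mapD(2)[OF P_mult_lin_l])
next
  case (5 x y k) then show ?case by (intro lin_mapD(2)[OF P_mult_lin_r])
qed

text \<open>
  The product of two pure tensors, computed in the quotient. The signs of the four terms of \<open>ptm\<close>
  are absorbed in \<open>flip\<close>, which leaves a sum over the parity of \<open>b'\<close>.
\<close>

definition tmul :: "'a \<Rightarrow> 'b \<Rightarrow> 'a \<Rightarrow> 'b \<Rightarrow> ('a \<times> 'b \<Rightarrow>\<^sub>0 cq) set" where
  "tmul a' b' a b = tn (a' \<otimes>\<^bsub>A\<^esub> a) (hcomp B False b' \<otimes>\<^bsub>B\<^esub> b) \<oplus>\<^bsub>D\<^esub> tn (a' \<otimes>\<^bsub>A\<^esub> A.flip a) (hcomp B True b' \<otimes>\<^bsub>B\<^esub> b)"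

lemma proj_ptm:
  assumes "a' \<in> carrier A" "b' \<in> carrier B" "a \<in> carrier A" "b \<in> carrier B"
  shows "proj (ptm (a', b') (a, b)) = tmul a' b' a b"
proof -
  define a0 a1 b0 b1 where "a0 = hcomp A False a" and "a1 = hcomp A True a"
    and "b0 = hcomp B False b'" and "b1 = hcomp B True b'"
  note defs = a0_def a1_def b0_def b1_def
  have a: "a0 \<oplus>\<^bsub>A\<^esub> a1 = a" using A.hcomp_decomp(2)[OF assms(3), of False] by (simp add: defs)
  have fl: "A.flip a = a0 \<ominus>\<^bsub>A\<^esub> a1" by (simp add: A.flip_def defs)
  have c: "a0 \<in> carrier A" "a1 \<in> carrier A" "b0 \<in> carrier B" "b1 \<in> carrier B"
    using assms by (simp_all add: defs)
  let ?s = "\<lambda>b1 a1 k. Poly_Mapping.single (a' \<otimes>\<^bsub>A\<^esub> a1, b1 \<otimes>\<^bsub>B\<^esub> b) (k :: cq)"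
  let ?t = "\<lambda>b1 a1. tn (a' \<otimes>\<^bsub>A\<^esub> a1) (b1 \<otimes>\<^bsub>B\<^esub> b)"
  have cs: "?s u v k \<in> carrier P" if "u \<in> carrier B" "v \<in> carrier A" for u v k
    using assms that by (intro P.single_closed) simp
  have ps: "proj (?s u v k) = k \<odot>\<^bsub>D\<^esub> ?t u v" if "u \<in> carrier B" "v \<in> carrier A" for u v k
    using assms that by (intro pr_single) auto
  have ct: "?t u v \<in> carrier D" if "u \<in> carrier B" "v \<in> carrier A" for u v using assms that by simp
  have "ptm (a', b') (a, b) = (?s b0 a0 1 \<oplus>\<^bsub>P\<^esub> ?s b0 a1 1) \<oplus>\<^bsub>P\<^esub> (?s b1 a0 1 \<oplus>\<^bsub>P\<^esub> ?s b1 a1 (-1))"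
    by (simp add: ptm_def UNIV_bool P.add_eq add_ac defs)
  then have "proj (ptm (a', b') (a, b)) 
      = (proj (?s b0 a0 1) \<oplus>\<^bsub>D\<^esub> proj (?s b0 a1 1)) \<oplus>\<^bsub>D\<^esub> (proj (?s b1 a0 1) \<oplus>\<^bsub>D\<^esub> proj (?s b1 a1 (-1)))"
    by (simp only: pr(3) cs c P.add.m_closed)
  also have "\<dots> = (?t b0 a0 \<oplus>\<^bsub>D\<^esub> ?t b0 a1) \<oplus>\<^bsub>D\<^esub> (?t b1 a0 \<oplus>\<^bsub>D\<^esub> (-1) \<odot>\<^bsub>D\<^esub> ?t b1 a1)"
    by (simp only: ps c D.smult_one ct)
  also have "?t b0 a0 \<oplus>\<^bsub>D\<^esub> ?t b0 a1 = tn (a' \<otimes>\<^bsub>A\<^esub> a) (b0 \<otimes>\<^bsub>B\<^esub> b)"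
    unfolding a[symmetric] using assms c by (simp add: tn(4) A.mult_add_r)
  also have "?t b1 a0 \<oplus>\<^bsub>D\<^esub> (-1) \<odot>\<^bsub>D\<^esub> ?t b1 a1 = tn (a' \<otimes>\<^bsub>A\<^esub> A.flip a) (b1 \<otimes>\<^bsub>B\<^esub> b)"
    unfolding fl using assms c by (simp add: a_minus_def tn(4) A.mult_add_r A.r_minus tn_minus(1) D.smult_neg_one)
  finally show ?thesis by (simp only: tmul_def b0_def b1_def)
qed

lemma tmul_bilin1: "a \<in> carrier A \<Longrightarrow> b \<in> carrier B \<Longrightarrow> bilin A B D (\<lambda>a' b'. tmul a' b' a b)"
  by (rule bilinI) (simp_all add: tmul_def tn A.mult_add_l B.mult_add_l A.smult_mult_l B.smult_mult_l
      B.hcomp_add B.hcomp_smult D.a_ac D.smult_r_distr)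

lemma tmul_bilin2: "a' \<in> carrier A \<Longrightarrow> b' \<in> carrier B \<Longrightarrow> bilin A B D (\<lambda>a b. tmul a' b' a b)"
  by (rule bilinI) (simp_all add: tmul_def tn A.mult_add_r B.mult_add_r A.smult_mult_r B.smult_mult_r
      A.flip_add A.flip_smult D.a_ac D.smult_r_distr)

lemma ptm_single: "x \<in> X \<Longrightarrow> y \<in> X \<Longrightarrow> Poly_Mapping.single x 1 \<otimes>\<^bsub>P\<^esub> Poly_Mapping.single y 1 = ptm x y"
  by (simp add: P_mult_sum)

text \<open>
  Multiplication by a fixed basis vector, followed by the projection, is linear and bilinear in the
  remaining pair by \<open>tmul_bilin1\<close> and \<open>tmul_bilin2\<close>; hence it kills \<open>N\<close>. General factors follow by
  linearity.
\<close>

lemma N_absorb: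
  assumes n: "n \<in> N" and f: "f \<in> carrier P"
  shows "n \<otimes>\<^bsub>P\<^esub> f \<in> N" "f \<otimes>\<^bsub>P\<^esub> n \<in> N"
proof -
  note nc = I_carr[OF n]
  have single: "proj (Poly_Mapping.single (a', b') 1 \<otimes>\<^bsub>P\<^esub> Poly_Mapping.single (a, b) 1) = tmul a' b' a b"
    if "a' \<in> carrier A" "b' \<in> carrier B" "a \<in> carrier A" "b \<in> carrier B" for a' b' a b
    using that proj_ptm by (simp add: ptm_single)
  have s1: "proj (n \<otimes>\<^bsub>P\<^esub> Poly_Mapping.single (a, b) 1) = \<zero>\<^bsub>D\<^esub>" if ab: "a \<in> carrier A" "b \<in> carrier B" for a b
  proof (rule bilin_kill[OF D_vspace _ _ n])
    have "Poly_Mapping.single (a, b) 1 \<in> carrier P" using ab by simp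
    then show "(\<lambda>n. proj (n \<otimes>\<^bsub>P\<^esub> Poly_Mapping.single (a, b) 1)) \<in> lin_map P D"
      by (intro lin_map_comp[OF pr_lin] P_mult_lin_l)
    show "bilin A B D (\<lambda>a' b'. proj (Poly_Mapping.single (a', b') 1 \<otimes>\<^bsub>P\<^esub> Poly_Mapping.single (a, b) 1))"
      by (rule bilinI) (use ab bilinD[OF tmul_bilin1[OF ab]] in \<open>simp_all add: single\<close>)
  qed
  have s2: "proj (Poly_Mapping.single (a, b) 1 \<otimes>\<^bsub>P\<^esub> n) = \<zero>\<^bsub>D\<^esub>" if ab: "a \<in> carrier A" "b \<in> carrier B" for a b
  proof (rule bilin_kill[OF D_vspace _ _ n])
    have "Poly_Mapping.single (a, b) 1 \<in> carrier P" using ab by simp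
    then show "(\<lambda>n. proj (Poly_Mapping.single (a, b) 1 \<otimes>\<^bsub>P\<^esub> n)) \<in> lin_map P D"
      by (intro lin_map_comp[OF pr_lin] P_mult_lin_r)
    show "bilin A B D (\<lambda>a' b'. proj (Poly_Mapping.single (a, b) 1 \<otimes>\<^bsub>P\<^esub> Poly_Mapping.single (a', b') 1))"
      by (rule bilinI) (use ab bilinD[OF tmul_bilin2[OF ab]] in \<open>simp_all add: single\<close>)
  qed
  have zl: "(\<lambda>_. \<zero>\<^bsub>D\<^esub>) \<in> lin_map P D" by (rule lin_mapI) simp_all
  have "proj (n \<otimes>\<^bsub>P\<^esub> f) = \<zero>\<^bsub>D\<^esub>"
    by (rule lin_map_eq_on_singles[OF P.fspace_axioms D_vspace lin_map_comp[OF pr_lin P_mult_lin_r[OF nc]] zl _ f])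
      (use s1 in auto)
  then show "n \<otimes>\<^bsub>P\<^esub> f \<in> N" using proj_zero[of "n \<otimes>\<^bsub>P\<^esub> f"] nc f by (simp add: D_eq)
  have "proj (f \<otimes>\<^bsub>P\<^esub> n) = \<zero>\<^bsub>D\<^esub>"
    by (rule lin_map_eq_on_singles[OF P.fspace_axioms D_vspace lin_map_comp[OF pr_lin P_mult_lin_l[OF nc]] zl _ f])
      (use s2 in auto)
  then show "f \<otimes>\<^bsub>P\<^esub> n \<in> N" using proj_zero[of "f \<otimes>\<^bsub>P\<^esub> n"] nc f by (simp add: D_eq)
qed

sublocale two_sided_ideal P N
  by (intro two_sided_ideal.intro two_sided_ideal_axioms.intro P.nonassoc_alg_axioms linear_subspace_axioms N_absorb)

sublocale D: nonassoc_alg D using quot_nonassoc_alg by (simp add: D_eq)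

lemma tn_mult_tmul: 
  "a' \<in> carrier A \<Longrightarrow> b' \<in> carrier B \<Longrightarrow> a \<in> carrier A \<Longrightarrow> b \<in> carrier B \<Longrightarrow> tn a' b' \<otimes>\<^bsub>D\<^esub> tn a b = tmul a' b' a b"
  using quot_mult[of "Poly_Mapping.single (a', b') 1" "Poly_Mapping.single (a, b) 1"]
  by (simp add: tn_eq D_eq[symmetric] ptm_single proj_ptm)

lemma tn_mult:
  assumes "a' \<in> carrier A" "b' \<in> grade B s" "a \<in> carrier A" "b \<in> carrier B"
  shows "tn a' b' \<otimes>\<^bsub>D\<^esub> tn a b = tn (a' \<otimes>\<^bsub>A\<^esub> (if s then A.flip a else a)) (b' \<otimes>\<^bsub>B\<^esub> b)"
  using assms B.grade_carr[OF assms(2)] by (simp add: tn_mult_tmul tmul_def B.hcomp_homog tn_zero B.l_null)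

lemma tn_mult_homog:
  assumes "a' \<in> carrier A" "b' \<in> grade B s" "a \<in> grade A t" "b \<in> carrier B"
  shows "tn a' b' \<otimes>\<^bsub>D\<^esub> tn a b = koszul s t \<odot>\<^bsub>D\<^esub> tn (a' \<otimes>\<^bsub>A\<^esub> a) (b' \<otimes>\<^bsub>B\<^esub> b)"
  using assms B.grade_carr[OF assms(2)] A.grade_carr[OF assms(3)] tn_mult[OF assms(1,2) A.grade_carr[OF assms(3)] assms(4)]
  by (simp add: A.flip_grade A.r_minus tn_minus koszul_def D.smult_neg_one)

lemma D_one: "\<one>\<^bsub>D\<^esub> = tn \<one>\<^bsub>A\<^esub> \<one>\<^bsub>B\<^esub>"
  by (simp add: tn_eq D_eq quot_one) (simp add: pretensor_def)

text \<open>
  On pure tensors with homogeneous second entries both sides are equal because \<open>flip\<close> is an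
  involutive automorphism.
\<close>

lemma D_assoc:
  assumes "x \<in> carrier D" "y \<in> carrier D" "z \<in> carrier D"
  shows "(x \<otimes>\<^bsub>D\<^esub> y) \<otimes>\<^bsub>D\<^esub> z = x \<otimes>\<^bsub>D\<^esub> (y \<otimes>\<^bsub>D\<^esub> z)"
  using assms(1)
proof (induction rule: D_induct)
  case (tensor a b s s')
  note ab = A.grade_carr[OF tensor(1)] B.grade_carr[OF tensor(2)] and b = tensor(2)
  show ?case using assms(2)
  proof (induction rule: D_induct)
    case (tensor a' b' t t')
    note ab' = A.grade_carr[OF tensor(1)] B.grade_carr[OF tensor(2)] and b' = tensor(2)
    show ?case using assms(3)
    proof (induction rule: D_induct)
      case (tensor a'' b'' u u')
      note ab'' = A.grade_carr[OF tensor(1)] B.grade_carr[OF tensor(2)]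
      show ?case using ab ab' ab''
        by (simp add: tn_mult[OF _ b] tn_mult[OF _ b'] tn_mult[OF _ B.grade_mult[OF b b']]
            A.flip_mult A.flip_flip A.m_assoc B.m_assoc)
    next
      case (add x y)
      then show ?case using ab ab' by (simp add: D.mult_add_r)
    qed
  next
    case (add x y)
    then show ?case using ab assms(3) by (simp add: D.mult_add_r D.mult_add_l)
  qed
next
  case (add x y)
  then show ?case using assms by (simp add: D.mult_add_l)
qed

abbreviation "PX s \<equiv> (\<Union>t. grade A t \<times> grade B (t \<noteq> s))"
abbreviation "Pg s \<equiv> pretensor A B\<lparr>carrier := {f. keys f \<subseteq> PX s}\<rparr>"

lemma Pg_fspace: "fspace (Pg s) (PX s)"
  by (simp add: fspace_def pretensor_def)

lemma PX_sub: "PX s \<subseteq> X" using A.grade_carr B.grade_carr by blast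

lemma D_grade: "grade D s = proj ` carrier (Pg s)"
  by (simp add: D_eq quot_grade) (simp add: pretensor_def)

lemma Pg_carr: "f \<in> carrier (Pg s) \<Longrightarrow> f \<in> carrier P"
  using subset_trans[OF _ PX_sub] by (simp add: P.carrier_eq)

lemma tn_grade: "a \<in> grade A t \<Longrightarrow> b \<in> grade B t' \<Longrightarrow> tn a b \<in> grade D (t \<noteq> t')"
proof -
  assume a: "a \<in> grade A t" "b \<in> grade B t'"
  have "Poly_Mapping.single (a, b) 1 \<in> carrier (Pg (t \<noteq> t'))"
  proof -
    have "(a, b) \<in> grade A t \<times> grade B (t \<noteq> (t \<noteq> t'))" using a by (cases t; cases t') auto
    then show ?thesis by auto
  qed
  then show ?thesis using tn_eq[of a b] a A.grade_carr B.grade_carr by (auto simp: D_grade)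
qed

lemma D_grade_induct [consumes 1, case_names zero tensor add]:
  assumes x: "x \<in> grade D s" and "K \<zero>\<^bsub>D\<^esub>"
    and "\<And>a b t t'. a \<in> grade A t \<Longrightarrow> b \<in> grade B t' \<Longrightarrow> s = (t \<noteq> t') \<Longrightarrow> K (tn a b)"
    and "\<And>x y. x \<in> carrier D \<Longrightarrow> y \<in> carrier D \<Longrightarrow> K x \<Longrightarrow> K y \<Longrightarrow> K (x \<oplus>\<^bsub>D\<^esub> y)"
  shows "K x"
proof -
  interpret Pg: fspace "Pg s" "PX s" by (rule Pg_fspace)
  obtain f where f: "f \<in> carrier (Pg s)" "x = proj f" using x by (auto simp: D_grade)
  have "K (proj f)" using f(1)
  proof (induction rule: Pg.fspace_induct)
    case zero show ?case using pr(4) assms(2) by (simp add: P.zero_eq)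
  next
    case (single x k)
    then obtain a b t where x: "x = (a, b)" "a \<in> grade A t" "b \<in> grade B (t \<noteq> s)" by blast
    have "K (tn (k \<odot>\<^bsub>A\<^esub> a) b)" by (rule assms(3)[OF A.grade_smult[OF x(2)] x(3)]) auto
    then show ?case using x A.grade_carr B.grade_carr by (simp add: pr_single tn)
  next
    case (add f g)
    then show ?case using assms(4)[of "proj f" "proj g"] pr(1,3)[OF Pg_carr[OF add(1)]] pr(1)[OF Pg_carr[OF add(2)]]
        Pg_carr[OF add(2)] by (simp add: P.add_eq)
  qed
  then show ?thesis using f by simp
qed

lemma D_grade_carr: "x \<in> grade D s \<Longrightarrow> x \<in> carrier D"
  using Pg_carr pr(1) by (auto simp: D_grade)

lemma D_grade_zero: "\<zero>\<^bsub>D\<^esub> \<in> grade D s"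
  using tn_grade[OF A.grade_zero[of False] B.grade_zero[of s]] tn_zero by simp

lemma D_grade_add: "x \<in> grade D s \<Longrightarrow> y \<in> grade D s \<Longrightarrow> x \<oplus>\<^bsub>D\<^esub> y \<in> grade D s"
proof -
  interpret Pg: fspace "Pg s" "PX s" by (rule Pg_fspace)
  assume "x \<in> grade D s" "y \<in> grade D s"
  then obtain f g where f: "f \<in> carrier (Pg s)" "x = proj f" "g \<in> carrier (Pg s)" "y = proj g" unfolding D_grade by blast
  have "x \<oplus>\<^bsub>D\<^esub> y = proj (f + g)" using f pr(3)[of f g] Pg_carr by (simp add: P.add_eq)
  moreover have "f + g \<in> carrier (Pg s)" using Pg.add.m_closed[OF f(1,3)] by (simp only: Pg.add_eq)
  ultimately show ?thesis unfolding D_grade by blast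
qed

lemma D_grade_smult: "x \<in> grade D s \<Longrightarrow> k \<odot>\<^bsub>D\<^esub> x \<in> grade D s"
proof -
  interpret Pg: fspace "Pg s" "PX s" by (rule Pg_fspace)
  assume "x \<in> grade D s"
  then obtain f where f: "f \<in> carrier (Pg s)" "x = proj f" unfolding D_grade by blast
  have "k \<odot>\<^bsub>D\<^esub> x = proj (scale k f)" using f pr(2)[of f k] Pg_carr by (simp add: P.smult_eq)
  moreover have "scale k f \<in> carrier (Pg s)" using Pg.smult_closed[OF f(1)] by (simp only: Pg.smult_eq)
  ultimately show ?thesis unfolding D_grade by blast
qed

text \<open>
  The bilinear map that keeps the terms of \<open>a \<otimes> b\<close> with equal parities induces a linear map on the
  tensor product; it is the identity on the even part and vanishes on the odd part.
\<close>

lemma D_grade_disj: "x \<in> grade D False \<Longrightarrow> x \<in> grade D True \<Longrightarrow> x = \<zero>\<^bsub>D\<^esub>"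
proof -
  assume x: "x \<in> grade D False" "x \<in> grade D True"
  let ?\<beta> = "\<lambda>a b. tn (hcomp A False a) (hcomp B False b) \<oplus>\<^bsub>D\<^esub> tn (hcomp A True a) (hcomp B True b)"
  let ?h = "lift D (\<lambda>(a, b). ?\<beta> a b)"
  have b: "bilin A B D ?\<beta>"
    by (rule bilinI) (simp_all add: tn A.hcomp_add B.hcomp_add A.hcomp_smult B.hcomp_smult D.a_ac D.smult_r_distr)
  note h = lin_mapD[OF univ(1)[OF D_vspace b]] univ(2)[OF D_vspace b] lin_map_more[OF univ(1)[OF D_vspace b] D_vspace D_vspace]
  have ht: "?h (tn a b) = (if t = t' then tn a b else \<zero>\<^bsub>D\<^esub>)" if "a \<in> grade A t" "b \<in> grade B t'" for a b t t'
    using that A.grade_carr[OF that(1)] B.grade_carr[OF that(2)] h(4)[of a b]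
    by (cases t; cases t') (simp_all add: A.hcomp_homog B.hcomp_homog tn_zero)
  have "?h x = x" using x(1)
    by (induction rule: D_grade_induct) (simp_all add: h(1,3,5) ht)
  moreover have "?h x = \<zero>\<^bsub>D\<^esub>" using x(2)
    by (induction rule: D_grade_induct) (simp_all add: h(1,3,5) ht)
  ultimately show ?thesis by simp
qed

lemma D_grade_mult: "x \<in> grade D s \<Longrightarrow> y \<in> grade D t \<Longrightarrow> x \<otimes>\<^bsub>D\<^esub> y \<in> grade D (s \<noteq> t)"
proof (induction rule: D_grade_induct)
  case zero
  then show ?case using D.smult_mult_l[of "\<zero>\<^bsub>D\<^esub>" y 0] D_grade_carr[of y t] D_grade_zero by simp
next
  case (tensor a b u u')
  note T = tensor(1-3)
  note ab = A.grade_carr[OF tensor(1)] B.grade_carr[OF tensor(2)]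
  from tensor(4) show ?case
  proof (induction rule: D_grade_induct)
    case zero
    then show ?case using D.smult_mult_r[of "tn a b" "\<zero>\<^bsub>D\<^esub>" 0] ab D_grade_zero by simp
  next
    case (tensor a' b' v v')
    have "tn (a \<otimes>\<^bsub>A\<^esub> a') (b \<otimes>\<^bsub>B\<^esub> b') \<in> grade D ((u \<noteq> v) \<noteq> (u' \<noteq> v'))"
      by (intro tn_grade A.grade_mult B.grade_mult T tensor)
    also have "((u \<noteq> v) \<noteq> (u' \<noteq> v')) = (s \<noteq> t)" using T tensor by auto
    finally show ?case using ab T tensor B.grade_carr by (simp add: tn_mult_homog[OF _ T(2)] D_grade_smult)
  next
    case (add x y)
    then show ?case using ab D_grade_add by (simp add: D.mult_add_r)
  qed
next
  case (add x y)
  then show ?case using D_grade_add D_grade_carr[of _ t] by (simp add: D.mult_add_l)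
qed

lemma D_superalgebra: "superalgebra D"
proof (intro superalgebra.intro superalgebra_axioms.intro, goal_cases)
  case 1 show ?case by (rule D.nonassoc_alg_axioms)
next
  case (2 x y z) then show ?case by (rule D_assoc)
next
  case 3 show ?case by (simp add: D_one)
next
  case (4 x) then show ?case
    by (induction rule: D_induct) 
      (simp_all add: D_one D.mult_add_r tn_mult[OF _ B.grade_one] A.grade_carr B.grade_carr)
next
  case (5 x) then show ?case
    by (induction rule: D_induct) 
      (simp_all add: D_one D.mult_add_l tn_mult A.grade_carr B.grade_carr A.flip_one)
next
  case (6 x s) then show ?case by (rule D_grade_carr)
next
  case 7 show ?case by (rule D_grade_zero)
next
  case 8 then show ?case by (rule D_grade_add)
next
  case 9 then show ?case by (rule D_grade_smult)
next
  case (10 x) then show ?case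
  proof (induction rule: D_induct)
    case (tensor a b s t)
    have c: "tn a b \<in> carrier D" using tensor A.grade_carr B.grade_carr by simp
    show ?case
    proof (cases "s \<noteq> t")
      case True
      then have "tn a b \<in> grade D True" using tn_grade[OF tensor] by simp
      moreover have "tn a b = \<zero>\<^bsub>D\<^esub> \<oplus>\<^bsub>D\<^esub> tn a b" using c by simp
      ultimately show ?thesis by (rule_tac bexI[OF _ D_grade_zero], rule_tac bexI)
    next
      case False
      then have "tn a b \<in> grade D False" using tn_grade[OF tensor] by simp
      moreover have "tn a b = tn a b \<oplus>\<^bsub>D\<^esub> \<zero>\<^bsub>D\<^esub>" using c by simp
      ultimately show ?thesis by (rule_tac bexI, rule_tac bexI[OF _ D_grade_zero])
    qed
  next
    case (add x y)
    from add(3) obtain x0 x1 where x: "x0 \<in> grade D False" "x1 \<in> grade D True" "x = x0 \<oplus>\<^bsub>D\<^esub> x1" by (elim bexE)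
    from add(4) obtain y0 y1 where y: "y0 \<in> grade D False" "y1 \<in> grade D True" "y = y0 \<oplus>\<^bsub>D\<^esub> y1" by (elim bexE)
    have "x \<oplus>\<^bsub>D\<^esub> y = (x0 \<oplus>\<^bsub>D\<^esub> y0) \<oplus>\<^bsub>D\<^esub> (x1 \<oplus>\<^bsub>D\<^esub> y1)"
      using x y D_grade_carr by (simp add: D.a_ac)
    then show ?case by (rule bexI[OF bexI[OF _ D_grade_add[OF x(2) y(2)]] D_grade_add[OF x(1) y(1)]])
  qed
next
  case (11 x) then show ?case by (rule D_grade_disj)
next
  case (12 x s y t) then show ?case by (rule D_grade_mult)
next
  case 13 show ?case using tn_grade[OF A.grade_one B.grade_one] by (simp add: D_one)
qed

end

context tensor_product
begin

sublocale D: superalgebra D by (rule D_superalgebra)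

lemma tn_split: "a \<in> carrier A \<Longrightarrow> b \<in> carrier B \<Longrightarrow> tn a \<one>\<^bsub>B\<^esub> \<otimes>\<^bsub>D\<^esub> tn \<one>\<^bsub>A\<^esub> b = tn a b"
  using tn_mult[OF _ B.grade_one, of a "\<one>\<^bsub>A\<^esub>" b] by simp

lemma tn_supercomm: 
  assumes "a \<in> grade A t" "b \<in> grade B s"
  shows "tn \<one>\<^bsub>A\<^esub> b \<otimes>\<^bsub>D\<^esub> tn a \<one>\<^bsub>B\<^esub> = koszul s t \<odot>\<^bsub>D\<^esub> (tn a \<one>\<^bsub>B\<^esub> \<otimes>\<^bsub>D\<^esub> tn \<one>\<^bsub>A\<^esub> b)"
  using tn_mult_homog[OF A.unit_closed assms(2,1) B.unit_closed] A.grade_carr[OF assms(1)] B.grade_carr[OF assms(2)] 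
  by (simp add: tn_split)

lemma inA_hom: "(\<lambda>a. tn a \<one>\<^bsub>B\<^esub>) \<in> alg_hom A D" "(\<lambda>a. tn a \<one>\<^bsub>B\<^esub>) \<in> even_map A D"
proof -
  show "(\<lambda>a. tn a \<one>\<^bsub>B\<^esub>) \<in> alg_hom A D"
    by (intro alg_homI lin_mapI) (simp_all add: tn D_one tn_mult[OF _ B.grade_one])
  show "(\<lambda>a. tn a \<one>\<^bsub>B\<^esub>) \<in> even_map A D"
    unfolding even_map_def using tn_grade[OF _ B.grade_one] by fastforce
qed

lemma inB_hom: "tn \<one>\<^bsub>A\<^esub> \<in> alg_hom B D" "tn \<one>\<^bsub>A\<^esub> \<in> even_map B D"
proof -
  show "tn \<one>\<^bsub>A\<^esub> \<in> alg_hom B D"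
  proof (intro alg_homI lin_mapI)
    fix x y assume xy: "x \<in> carrier B" "y \<in> carrier B"
    from xy(1) show "tn \<one>\<^bsub>A\<^esub> (x \<otimes>\<^bsub>B\<^esub> y) = tn \<one>\<^bsub>A\<^esub> x \<otimes>\<^bsub>D\<^esub> tn \<one>\<^bsub>A\<^esub> y"
    proof (induction rule: B.homog_induct)
      case (homog x s)
      then show ?case using xy by (simp add: tn_mult A.flip_one)
    next
      case (add x y')
      then show ?case using xy by (simp add: tn B.mult_add_l D.mult_add_l)
    qed
  qed (simp_all add: tn D_one)
  show "tn \<one>\<^bsub>A\<^esub> \<in> even_map B D"
    unfolding even_map_def using tn_grade[OF A.grade_one] by fastforce
qed

lemma D_hom_eqI:
  assumes E: "superalgebra E" and h: "h \<in> alg_hom D E" and g: "g \<in> alg_hom D E"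
    and eA: "\<And>a. a \<in> carrier A \<Longrightarrow> h (tn a \<one>\<^bsub>B\<^esub>) = g (tn a \<one>\<^bsub>B\<^esub>)"
    and eB: "\<And>b. b \<in> carrier B \<Longrightarrow> h (tn \<one>\<^bsub>A\<^esub> b) = g (tn \<one>\<^bsub>A\<^esub> b)"
    and x: "x \<in> carrier D"
  shows "h x = g x"
proof (rule lin_map_D_eqI[OF alg_homD(1)[OF h] alg_homD(1)[OF g] _ x])
  fix a b s t assume "a \<in> grade A s" "b \<in> grade B t"
  then have ab: "a \<in> carrier A" "b \<in> carrier B" using A.grade_carr B.grade_carr by auto
  then show "h (tn a b) = g (tn a b)"
    using alg_homD(2)[OF h, of "tn a \<one>\<^bsub>B\<^esub>" "tn \<one>\<^bsub>A\<^esub> b"] alg_homD(2)[OF g, of "tn a \<one>\<^bsub>B\<^esub>" "tn \<one>\<^bsub>A\<^esub> b"]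
    by (simp add: tn_split eA eB)
qed

text \<open>
  Multiplicativity needs to be checked on pure tensors of homogeneous elements only.
\<close>

lemma univ_hom:
  assumes E: "superalgebra E" and b: "bilin A B E \<beta>" and one: "\<beta> \<one>\<^bsub>A\<^esub> \<one>\<^bsub>B\<^esub> = \<one>\<^bsub>E\<^esub>"
    and mult: "\<And>a' b' a b s t u v. a' \<in> grade A u \<Longrightarrow> b' \<in> grade B s \<Longrightarrow> a \<in> grade A t \<Longrightarrow> b \<in> grade B v \<Longrightarrow>
      \<beta> a' b' \<otimes>\<^bsub>E\<^esub> \<beta> a b = koszul s t \<odot>\<^bsub>E\<^esub> \<beta> (a' \<otimes>\<^bsub>A\<^esub> a) (b' \<otimes>\<^bsub>B\<^esub> b)"
  shows "lift E (\<lambda>(a, b). \<beta> a b) \<in> alg_hom D E"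
    and "(\<And>a b s t. a \<in> grade A s \<Longrightarrow> b \<in> grade B t \<Longrightarrow> \<beta> a b \<in> grade E (s \<noteq> t)) \<Longrightarrow>
      lift E (\<lambda>(a, b). \<beta> a b) \<in> even_map D E"
proof -
  interpret E: superalgebra E by fact
  let ?h = "lift E (\<lambda>(a, b). \<beta> a b)"
  note hl = univ(1)[OF E.vspace_axioms b] and ht = univ(2)[OF E.vspace_axioms b]
  note h = lin_mapD[OF hl] lin_map_more[OF hl D_vspace E.vspace_axioms] ht
  show "?h \<in> alg_hom D E"
  proof (rule alg_homI[OF hl])
    show "?h \<one>\<^bsub>D\<^esub> = \<one>\<^bsub>E\<^esub>" by (simp add: D_one ht one)
    fix x y assume x: "x \<in> carrier D" and y: "y \<in> carrier D"
    from x show "?h (x \<otimes>\<^bsub>D\<^esub> y) = ?h x \<otimes>\<^bsub>E\<^esub> ?h y"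
    proof (induction rule: D_induct)
      case (tensor a' b' u s)
      note t' = tensor
      note c' = A.grade_carr[OF tensor(1)] B.grade_carr[OF tensor(2)]
      from y show ?case
      proof (induction rule: D_induct)
        case (tensor a b t v)
        note c = A.grade_carr[OF tensor(1)] B.grade_carr[OF tensor(2)]
        show ?case using c c' mult[OF t' tensor]
          by (simp add: tn_mult_homog[OF c'(1) t'(2) tensor(1) c(2)] h(2) ht)
      next
        case (add x y)
        then show ?case using c' by (simp add: D.mult_add_r E.mult_add_r h(1,3))
      qed
    next
      case (add x x')
      then show ?case using y by (simp add: D.mult_add_l E.mult_add_l h(1,3))
    qed
  qed
  assume gr: "\<And>a b s t. a \<in> grade A s \<Longrightarrow> b \<in> grade B t \<Longrightarrow> \<beta> a b \<in> grade E (s \<noteq> t)"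
  show "?h \<in> even_map D E"
    unfolding even_map_def
  proof (intro CollectI allI ballI)
    fix s x assume "x \<in> grade D s"
    then show "?h x \<in> grade E s"
    proof (induction rule: D_grade_induct)
      case zero show ?case using E.grade_zero by (simp add: h(4))
    next
      case (tensor a b t t')
      then show ?case using gr[OF tensor(1,2)] ht A.grade_carr[OF tensor(1)] B.grade_carr[OF tensor(2)] by simp
    next
      case (add x y)
      then show ?case using E.grade_add by (simp add: h(3))
    qed
  qed
qed

text \<open>
  Universal property: homomorphisms on the two factors whose images supercommute combine to a
  homomorphism on the tensor product.
\<close>

lemma pair_hom:
  assumes E: "superalgebra E" and f: "f \<in> alg_hom A E" and g: "g \<in> alg_hom B E"
    and comm: "\<And>a b s t. a \<in> grade A t \<Longrightarrow> b \<in> grade B s \<Longrightarrow> g b \<otimes>\<^bsub>E\<^esub> f a = koszul s t \<odot>\<^bsub>E\<^esub> (f a \<otimes>\<^bsub>E\<^esub> g b)"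
  shows "lift E (\<lambda>(a, b). f a \<otimes>\<^bsub>E\<^esub> g b) \<in> alg_hom D E"
    "a \<in> carrier A \<Longrightarrow> b \<in> carrier B \<Longrightarrow> lift E (\<lambda>(a, b). f a \<otimes>\<^bsub>E\<^esub> g b) (tn a b) = f a \<otimes>\<^bsub>E\<^esub> g b"
    "f \<in> even_map A E \<Longrightarrow> g \<in> even_map B E \<Longrightarrow> lift E (\<lambda>(a, b). f a \<otimes>\<^bsub>E\<^esub> g b) \<in> even_map D E"
proof -
  interpret E: superalgebra E by fact
  note f' = alg_homD[OF f] and g' = alg_homD[OF g]
  have b: "bilin A B E (\<lambda>a b. f a \<otimes>\<^bsub>E\<^esub> g b)"
    by (rule bilinI) (simp_all add: f'(4-6) g'(4-6) E.mult_add_l E.mult_add_r E.smult_mult_l E.smult_mult_r)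
  have m: "(f a' \<otimes>\<^bsub>E\<^esub> g b') \<otimes>\<^bsub>E\<^esub> (f a \<otimes>\<^bsub>E\<^esub> g b) = koszul s t \<odot>\<^bsub>E\<^esub> (f (a' \<otimes>\<^bsub>A\<^esub> a) \<otimes>\<^bsub>E\<^esub> g (b' \<otimes>\<^bsub>B\<^esub> b))"
    if h: "a' \<in> grade A u" "b' \<in> grade B s" "a \<in> grade A t" "b \<in> grade B v" for a' b' a b s t u v
  proof -
    have c: "f a' \<in> carrier E" "g b' \<in> carrier E" "f a \<in> carrier E" "g b \<in> carrier E"
      using h A.grade_carr B.grade_carr f' g' by auto
    have "(f a' \<otimes>\<^bsub>E\<^esub> g b') \<otimes>\<^bsub>E\<^esub> (f a \<otimes>\<^bsub>E\<^esub> g b) = f a' \<otimes>\<^bsub>E\<^esub> ((g b' \<otimes>\<^bsub>E\<^esub> f a) \<otimes>\<^bsub>E\<^esub> g b)"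
      using c by (simp add: E.m_assoc)
    also have "g b' \<otimes>\<^bsub>E\<^esub> f a = koszul s t \<odot>\<^bsub>E\<^esub> (f a \<otimes>\<^bsub>E\<^esub> g b')" by (rule comm[OF h(3,2)])
    finally show ?thesis using c h A.grade_carr B.grade_carr
      by (simp add: E.smult_mult_l E.smult_mult_r E.m_assoc f'(2) g'(2))
  qed
  have o: "f \<one>\<^bsub>A\<^esub> \<otimes>\<^bsub>E\<^esub> g \<one>\<^bsub>B\<^esub> = \<one>\<^bsub>E\<^esub>" by (simp add: f'(3) g'(3))
  show "lift E (\<lambda>(a, b). f a \<otimes>\<^bsub>E\<^esub> g b) \<in> alg_hom D E" by (rule univ_hom(1)[OF E b o m])
  show "a \<in> carrier A \<Longrightarrow> b \<in> carrier B \<Longrightarrow> lift E (\<lambda>(a, b). f a \<otimes>\<^bsub>E\<^esub> g b) (tn a b) = f a \<otimes>\<^bsub>E\<^esub> g b"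
    by (rule univ(2)[OF E.vspace_axioms b])
  assume ev: "f \<in> even_map A E" "g \<in> even_map B E"
  show "lift E (\<lambda>(a, b). f a \<otimes>\<^bsub>E\<^esub> g b) \<in> even_map D E"
  proof (rule univ_hom(2)[OF E b o m])
    fix a b s t assume "a \<in> grade A s" "b \<in> grade B t"
    then show "f a \<otimes>\<^bsub>E\<^esub> g b \<in> grade E (s \<noteq> t)" by (intro E.grade_mult even_mapD[OF ev(1)] even_mapD[OF ev(2)])
  qed
qed

text \<open>
  A linear functional \<open>l\<close> with \<open>l 1 = 1\<close> induces \<open>a \<otimes> b \<mapsto> l a \<cdot> b\<close>, a left inverse of
  \<open>b \<mapsto> 1 \<otimes> b\<close>.
\<close>

lemma tn_faithful:
  assumes lam: "\<And>a. a \<in> carrier A \<Longrightarrow> \<forall>a'\<in>carrier A. l (a \<oplus>\<^bsub>A\<^esub> a') = l a + (l a' :: cq)"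
    "\<And>a k. a \<in> carrier A \<Longrightarrow> l (k \<odot>\<^bsub>A\<^esub> a) = k * l a" "l \<one>\<^bsub>A\<^esub> = 1"
    and b: "b \<in> carrier B" "tn \<one>\<^bsub>A\<^esub> b = \<zero>\<^bsub>D\<^esub>"
  shows "b = \<zero>\<^bsub>B\<^esub>"
proof -
  have bl: "bilin A B B (\<lambda>a b. l a \<odot>\<^bsub>B\<^esub> b)"
    by (rule bilinI) (use lam in \<open>simp_all add: B.smult_l_distr B.smult_r_distr B.smult_assoc[symmetric] mult.commute\<close>)
  let ?h = "lift B (\<lambda>(a, b). l a \<odot>\<^bsub>B\<^esub> b)"
  have "?h (tn \<one>\<^bsub>A\<^esub> b) = b" using univ(2)[OF B.vspace_axioms bl A.unit_closed b(1)] lam(3) b(1) by simp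
  moreover have "?h \<zero>\<^bsub>D\<^esub> = \<zero>\<^bsub>B\<^esub>" by (rule lin_map_more(1)[OF univ(1)[OF B.vspace_axioms bl] D_vspace B.vspace_axioms])
  ultimately show ?thesis using b(2) by simp
qed

end

lemma tensor_map_hom:
  assumes "superalgebra A" "superalgebra B" "superalgebra B'" and g: "g \<in> alg_hom B B'" and ge: "g \<in> even_map B B'"
  shows "tensor_map A B' id g \<in> alg_hom (stensor A B) (stensor A B')"
    "tensor_map A B' id g \<in> even_map (stensor A B) (stensor A B')"
    "a \<in> carrier A \<Longrightarrow> b \<in> carrier B \<Longrightarrow> tensor_map A B' id g (pure_tensor A B a b) = pure_tensor A B' a (g b)"
proof -
  interpret S: tensor_product A B using assms by (simp add: tensor_product_def)
  interpret T: tensor_product A B' using assms by (simp add: tensor_product_def)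
  note g' = alg_homD[OF g]
  have e: "tensor_map A B' id g = lift (stensor A B') (\<lambda>(a, b). T.tn a (g b))"
    by (simp add: tensor_map_def id_def)
  have b: "bilin A B (stensor A B') (\<lambda>a b. T.tn a (g b))"
    by (rule bilinI) (simp_all add: g' T.tn)
  have o: "T.tn \<one>\<^bsub>A\<^esub> (g \<one>\<^bsub>B\<^esub>) = \<one>\<^bsub>stensor A B'\<^esub>" by (simp add: g' T.D_one)
  have m: "T.tn a' (g b') \<otimes>\<^bsub>stensor A B'\<^esub> T.tn a (g b) = koszul s t \<odot>\<^bsub>stensor A B'\<^esub> T.tn (a' \<otimes>\<^bsub>A\<^esub> a) (g (b' \<otimes>\<^bsub>B\<^esub> b))"
    if h: "a' \<in> grade A u" "b' \<in> grade B s" "a \<in> grade A t" "b \<in> grade B v" for a' b' a b s t u v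
    using T.tn_mult_homog[OF S.A.grade_carr[OF h(1)] even_mapD[OF ge h(2)] h(3) g'(4)[OF S.B.grade_carr[OF h(4)]]]
      S.B.grade_carr[OF h(2)] S.B.grade_carr[OF h(4)] by (simp add: g'(2))
  show "tensor_map A B' id g \<in> alg_hom (stensor A B) (stensor A B')"
    unfolding e by (rule S.univ_hom(1)[OF T.D_superalgebra b o m])
  show "tensor_map A B' id g \<in> even_map (stensor A B) (stensor A B')"
    unfolding e
  proof (rule S.univ_hom(2)[OF T.D_superalgebra b o m])
    fix a b s t assume "a \<in> grade A s" "b \<in> grade B t"
    then show "T.tn a (g b) \<in> grade (stensor A B') (s \<noteq> t)" by (intro T.tn_grade even_mapD[OF ge])
  qed
  show "a \<in> carrier A \<Longrightarrow> b \<in> carrier B \<Longrightarrow> tensor_map A B' id g (pure_tensor A B a b) = pure_tensor A B' a (g b)"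
    unfolding e by (rule S.univ(2)[OF T.D_vspace b])
qed

lemma tensor_map_surj:
  assumes "superalgebra A" "superalgebra B" "superalgebra B'" and g: "g \<in> alg_hom B B'" and ge: "g \<in> even_map B B'"
    and surj: "\<And>y. y \<in> carrier B' \<Longrightarrow> \<exists>x\<in>carrier B. y = g x" and y: "y \<in> carrier (stensor A B')"
  shows "\<exists>x\<in>carrier (stensor A B). y = tensor_map A B' id g x"
proof -
  interpret S: tensor_product A B using assms by (simp add: tensor_product_def)
  interpret T: tensor_product A B' using assms by (simp add: tensor_product_def)
  note h = tensor_map_hom[OF assms(1-5)]
  show ?thesis using y
  proof (induction rule: T.D_induct)
    case (tensor a b s t)
    obtain b' where b': "b' \<in> carrier B" "b = g b'" using surj[OF T.B.grade_carr[OF tensor(2)]] by (elim bexE)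
    note a = S.A.grade_carr[OF tensor(1)]
    show ?case
      by (rule bexI[of _ "S.tn a b'"], simp only: b'(2) h(3)[OF a b'(1)], rule S.tn_closed[OF a b'(1)])
  next
    case (add x y)
    from add(3) obtain u where u: "u \<in> carrier (stensor A B)" "x = tensor_map A B' id g u" by (elim bexE)
    from add(4) obtain v where v: "v \<in> carrier (stensor A B)" "y = tensor_map A B' id g v" by (elim bexE)
    show ?case
      by (rule bexI[of _ "u \<oplus>\<^bsub>stensor A B\<^esub> v"], simp only: alg_homD(6)[OF h(1) u(1) v(1)] u(2) v(2))
        (rule S.D.add.m_closed[OF u(1) v(1)])
  qed
qed

text \<open>
  Supercommutation passes from generators to all elements, first in \<open>b\<close> for a fixed generator on the
  other side and then in \<open>a\<close>. The induction uses \<open>flip\<close> since the elements reached in between are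
  not homogeneous.
\<close>

lemma supercommute_extend:
  assumes "presentation G par Rel" "presentation G' par' Rel'" and E: "superalgebra E"
    and f: "f \<in> alg_hom (presented G par Rel) E" and g: "g \<in> alg_hom (presented G' par' Rel') E"
    and gens: "\<And>x y. x \<in> G \<Longrightarrow> y \<in> G' \<Longrightarrow> 
       g (cls (presented G' par' Rel') (gen y)) \<otimes>\<^bsub>E\<^esub> f (cls (presented G par Rel) (gen x)) =
       koszul (par' y) (par x) \<odot>\<^bsub>E\<^esub> (f (cls (presented G par Rel) (gen x)) \<otimes>\<^bsub>E\<^esub> g (cls (presented G' par' Rel') (gen y)))"
    and a: "a \<in> grade (presented G par Rel) t" and b: "b \<in> grade (presented G' par' Rel') s"
  shows "g b \<otimes>\<^bsub>E\<^esub> f a = koszul s t \<odot>\<^bsub>E\<^esub> (f a \<otimes>\<^bsub>E\<^esub> g b)"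
proof -
  interpret PA: presentation G par Rel by fact
  interpret PB: presentation G' par' Rel' by fact
  interpret A: superalgebra PA.Pr by (rule PA.Pr_superalgebra)
  interpret B: superalgebra PB.Pr by (rule PB.Pr_superalgebra)
  interpret E: superalgebra E by fact
  note f' = alg_homD[OF f] lin_map_more(2)[OF alg_homD(1)[OF f] A.vspace_axioms E.vspace_axioms] 
    and g' = alg_homD[OF g] lin_map_more(2)[OF alg_homD(1)[OF g] B.vspace_axioms E.vspace_axioms]
  have 1: "g b \<otimes>\<^bsub>E\<^esub> f (PA.gcls x) = f (PA.gcls x) \<otimes>\<^bsub>E\<^esub> g (if par x then B.flip b else b)"
    if x: "x \<in> G" and b: "b \<in> carrier PB.Pr" for x b
  proof -
    let ?x = "f (PA.gcls x)"
    have xc: "?x \<in> carrier E" using x f' by simp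
    show ?thesis using b
    proof (induction rule: PB.presented_induct)
      case one show ?case using xc by (simp add: g' B.flip_one)
    next
      case (gen y b)
      let ?y = "g (PB.gcls y)" and ?b = "g (if par x then B.flip b else b)"
      have yc: "PB.gcls y \<in> carrier PB.Pr" using gen by simp
      have c: "?y \<in> carrier E" "?b \<in> carrier E" "g b \<in> carrier E" using gen yc g' by auto
      have gy: "g (if par x then B.flip (PB.gcls y) else PB.gcls y) = koszul (par' y) (par x) \<odot>\<^bsub>E\<^esub> ?y"
        using B.flip_grade[OF PB.gcls_grade[OF gen(1)]] c yc by (auto simp: g' E.smult_neg_one koszul_def)
      have "g (PB.gcls y \<otimes>\<^bsub>PB.Pr\<^esub> b) \<otimes>\<^bsub>E\<^esub> ?x = ?y \<otimes>\<^bsub>E\<^esub> (g b \<otimes>\<^bsub>E\<^esub> ?x)"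
        using gen c xc yc by (simp add: g'(2) E.m_assoc)
      also have "\<dots> = (?y \<otimes>\<^bsub>E\<^esub> ?x) \<otimes>\<^bsub>E\<^esub> ?b" unfolding gen(3) using c xc by (simp add: E.m_assoc)
      also have "\<dots> = ?x \<otimes>\<^bsub>E\<^esub> (g (if par x then B.flip (PB.gcls y) else PB.gcls y) \<otimes>\<^bsub>E\<^esub> ?b)"
        unfolding gens[OF x gen(1)] gy using c xc by (simp add: E.m_assoc E.smult_mult_l E.smult_mult_r)
      also have "g (if par x then B.flip (PB.gcls y) else PB.gcls y) \<otimes>\<^bsub>E\<^esub> ?b = 
          g (if par x then B.flip (PB.gcls y \<otimes>\<^bsub>PB.Pr\<^esub> b) else PB.gcls y \<otimes>\<^bsub>PB.Pr\<^esub> b)"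
        using gen yc by (simp add: g'(2) B.flip_mult)
      finally show ?case .
    next
      case (smult k b)
      then show ?case using xc by (simp add: g' E.smult_mult_l E.smult_mult_r B.flip_smult)
    next
      case (add b b')
      then show ?case using xc by (simp add: g' E.mult_add_l E.mult_add_r B.flip_add)
    qed
  qed
  have bc: "b \<in> carrier PB.Pr" using b by (rule B.grade_carr)
  have gb: "g b \<in> carrier E" using bc g' by simp
  have 2: "g b \<otimes>\<^bsub>E\<^esub> f a = f (if s then A.flip a else a) \<otimes>\<^bsub>E\<^esub> g b" if "a \<in> carrier PA.Pr" for a
    using that
  proof (induction rule: PA.presented_induct)
    case one show ?case using gb by (simp add: f' A.flip_one)
  next
    case (gen x a)
    let ?x = "f (PA.gcls x)" and ?a = "f (if s then A.flip a else a)"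
    have xc: "PA.gcls x \<in> carrier PA.Pr" using gen by simp
    have c: "?x \<in> carrier E" "?a \<in> carrier E" "f a \<in> carrier E" using gen xc f' by auto
    have gx: "g b \<otimes>\<^bsub>E\<^esub> ?x = f (if s then A.flip (PA.gcls x) else PA.gcls x) \<otimes>\<^bsub>E\<^esub> g b"
      using 1[OF gen(1) bc] A.flip_grade[OF PA.gcls_grade[OF gen(1)]] B.flip_grade[OF b] c xc gb bc
      by (auto simp: f' g' E.l_minus E.r_minus)
    have "g b \<otimes>\<^bsub>E\<^esub> f (PA.gcls x \<otimes>\<^bsub>PA.Pr\<^esub> a) = (g b \<otimes>\<^bsub>E\<^esub> ?x) \<otimes>\<^bsub>E\<^esub> f a"
      using gen c xc gb by (simp add: f'(2) E.m_assoc)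
    also have "\<dots> = f (if s then A.flip (PA.gcls x) else PA.gcls x) \<otimes>\<^bsub>E\<^esub> (g b \<otimes>\<^bsub>E\<^esub> f a)"
      unfolding gx using c xc gb f' by (simp add: E.m_assoc)
    also have "\<dots> = f (if s then A.flip (PA.gcls x \<otimes>\<^bsub>PA.Pr\<^esub> a) else PA.gcls x \<otimes>\<^bsub>PA.Pr\<^esub> a) \<otimes>\<^bsub>E\<^esub> g b"
      unfolding gen(3) using c xc gb gen by (simp add: f' A.flip_mult E.m_assoc)
    finally show ?case .
  next
    case (smult k a)
    then show ?case using gb by (simp add: f' E.smult_mult_l E.smult_mult_r A.flip_smult)
  next
    case (add a a')
    then show ?case using gb by (simp add: f' E.mult_add_l E.mult_add_r A.flip_add)
  qed
  have ac: "a \<in> carrier PA.Pr" using a by (rule A.grade_carr)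
  show ?thesis using 2[OF ac] A.flip_grade[OF a] ac gb f'(4)[OF ac] 
    by (cases s; cases t) (simp_all add: f'(7) E.l_minus E.smult_neg_one)
qed

section \<open>The defining relations as identities between additive operators\<close>

text \<open>
  Identities in a superalgebra are checked for operators: a word becomes a nested application, so
  that brackets and membership conditions disappear and the operators may be pushed past each other
  by rewriting. Here \<open>e\<close> stands for the unit, which need not act as the identity, and \<open>E\<close> for
  the scalar \<open>\<epsilon>\<close>; multiples by small integers are written as sums. The locales below treat
  one strand (one index \<open>i\<close>), two strands, two strands with a generator \<open>T\<^sub>i\<close> or \<open>R\<^sub>i\<close>
  crossing them, and three strands with two crossings. To avoid fractions, \<open>p\<close>, \<open>q\<close> and \<open>T\<close> obtained from the
  other side are scaled by 2.
\<close>

locale additive_operators =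
  fixes e E :: "'v::ab_group_add \<Rightarrow> 'v" and G :: "('v \<Rightarrow> 'v) set"
  assumes add: "f \<in> G \<Longrightarrow> f (v + w) = f v + f w"
    and unit: "f \<in> G \<Longrightarrow> f (e v) = f v" "f \<in> G \<Longrightarrow> e (f v) = f v"
    and eG: "e \<in> G" and EG: "E \<in> G"
    and E_central: "f \<in> G \<Longrightarrow> f (E v) = E (f v)"
    and two: "v + v = 0 \<Longrightarrow> v = (0::'v)"
begin
lemma zero: "f \<in> G \<Longrightarrow> f 0 = 0" using add[of f 0 0] by simp
lemma minus: "f \<in> G \<Longrightarrow> f (- v) = - f v" using add[of f v "-v"] zero[of f]
  by (simp add: eq_neg_iff_add_eq_0 add.commute)
lemma diff: "f \<in> G \<Longrightarrow> f (v - w) = f v - f w" for v w :: 'v using add[of f v "-w"] minus[of f w] by simp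
lemma E_e: "e (E v) = E v" by (rule unit(2)[OF EG])
lemmas lin = add zero minus diff unit
lemma two_eq: "v + v = w + w \<Longrightarrow> v = w" for v w :: 'v using two[of "v - w"] by (simp add: algebra_simps)
end

locale hc_strand = additive_operators +
  fixes c X X'
  assumes G1: "c \<in> G" "X \<in> G" "X' \<in> G"
   and cc: "c (c v) = e v" and XX': "X (X' v) = e v" and X'X: "X' (X v) = e v" and Xc: "X (c v) = c (X' v)"
begin
lemmas L1 = lin[OF G1(1)] lin[OF G1(2)] lin[OF G1(3)] lin(1-4)[OF eG] 
lemma X'c: "X' (c v) = c (X v)"
proof -
  have "X' (c v) = c (c (X' (c v)))" by (simp add: cc L1)
  also have "\<dots> = c (X v)" by (simp add: Xc[symmetric] cc L1)
  finally show ?thesis .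
qed
lemma spin_of_hc_strand:
  assumes "\<And>v. p v = X v + X' v" and "\<And>v. q v = X (c v) - X' (c v)"
  shows "p (p v) + q (q v) = e v + e v + e v + e v" "p (q v) = q (p v)" 
     "p (c v) = c (p v)" "q (c v) = - c (q v)" 
  unfolding assms by (simp_all only: cc XX' X'X Xc X'c L1) (simp_all add: cc XX' X'X Xc X'c L1 algebra_simps)
end

locale spin_strand = additive_operators +
  fixes c p q
  assumes G1: "c \<in> G" "p \<in> G" "q \<in> G"
   and cc: "c (c v) = e v" and qq: "p (p v) + q (q v) = e v" and qp: "p (q v) = q (p v)"
   and pc: "p (c v) = c (p v)" and qc: "q (c v) = - c (q v)"
begin
lemmas L1 = lin[OF G1(1)] lin[OF G1(2)] lin[OF G1(3)] lin(1-4)[OF eG] 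
lemma hc_of_spin_strand:
  assumes "\<And>v. X v = p v - c (q v)" and "\<And>v. X' v = p v + c (q v)"
  shows "X (X' v) = e v" "X' (X v) = e v" "X (c v) = c (X' v)" 
  using qq[of v] unfolding assms by (simp_all add: cc qp pc qc L1 algebra_simps)
end

locale spin_strand_pair = additive_operators +
  fixes c p q d P Q
  assumes G1: "c \<in> G" "p \<in> G" "q \<in> G" "d \<in> G" "P \<in> G" "Q \<in> G"
   and dc: "d (c v) = - c (d v)"
   and pq: "P (p v) = p (P v)" "Q (p v) = p (Q v)" "q (P v) = P (q v)" "q (Q v) = - Q (q v)"
   and pc: "p (d v) = d (p v)" "q (d v) = - d (q v)" "P (c v) = c (P v)" "Q (c v) = - c (Q v)"
begin
lemmas L1 = lin[OF G1(1)] lin[OF G1(2)] lin[OF G1(3)] lin[OF G1(4)] lin[OF G1(5)] lin[OF G1(6)] lin(1-4)[OF eG] 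
lemma hc_of_spin_strand_pair:
  assumes "\<And>v. X v = p v - c (q v)" 
    and "\<And>v. Y v = P v - d (Q v)" 
  shows "X (Y v) = Y (X v)" "X (d v) = d (X v)" 
  unfolding assms by (simp_all add: pq dc pc L1 algebra_simps)
end

locale clifford_pair = additive_operators + 
  fixes c d
  assumes cd: "c \<in> G" "d \<in> G"
   and cc: "c (c v) = e v" and dd: "d (d v) = e v" and dc: "d (c v) = - c (d v)"
begin
lemmas Lc = lin[OF cd(1)] lin[OF cd(2)] E_central[OF cd(1)] E_central[OF cd(2)] lin[OF EG] lin(1-4)[OF eG] E_e
end

locale hc_strand_pair = clifford_pair + 
  fixes X Y X' Y'
  assumes G: "X \<in> G" "Y \<in> G" "X' \<in> G" "Y' \<in> G"
   and XX': "X (X' v) = e v" and X'X: "X' (X v) = e v"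
   and YY': "Y (Y' v) = e v" and Y'Y: "Y' (Y v) = e v"
   and XY: "Y (X v) = X (Y v)"
   and Xc: "X (c v) = c (X' v)" and Yd: "Y (d v) = d (Y' v)"
   and Xd: "X (d v) = d (X v)" and Yc: "Y (c v) = c (Y v)"
begin
lemmas L = Lc lin[OF G(1)] lin[OF G(2)] lin[OF G(3)] lin[OF G(4)]
  E_central[OF G(1)] E_central[OF G(2)] E_central[OF G(3)] E_central[OF G(4)] 
lemma X'_eq: "X' v = c (X (c v))" by (simp add: Xc cc L)
lemma Y'_eq: "Y' v = d (Y (d v))" by (simp add: Yd dd L)
lemma X'c: "X' (c v) = c (X v)" by (simp add: X'_eq cc L)
lemma Y'd: "Y' (d v) = d (Y v)" by (simp add: Y'_eq dd L)
lemma cd': "c (d v) = - d (c v)" by (simp add: dc)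
lemma X'd: "X' (d v) = d (X' v)"
proof -
  have "X' (d v) = c (X (c (d v)))" by (rule X'_eq)
  also have "\<dots> = - c (X (d (c v)))" by (simp add: dc L)
  also have "\<dots> = d (c (X (c v)))" by (simp only: Xd cd' L) (simp)
  finally show ?thesis by (simp only: X'_eq)
qed
lemma Y'c: "Y' (c v) = c (Y' v)" 
proof -
  have "Y' (c v) = d (Y (d (c v)))" by (rule Y'_eq)
  also have "\<dots> = - d (c (Y (d v)))" by (simp only: dc Yc L)
  also have "\<dots> = c (d (Y (d v)))" by (simp only: cd') 
  finally show ?thesis by (simp only: Y'_eq)
qed
lemma YX': "Y (X' v) = X' (Y v)" by (simp only: X'_eq Yc XY)
lemma Y'X: "Y' (X v) = X (Y' v)" by (simp only: Y'_eq Xd XY[symmetric])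
lemma Y'X': "Y' (X' v) = X' (Y' v)" by (simp only: X'_eq Y'c Y'X)
lemmas xc = cc dd dc XX' X'X YY' Y'Y XY Xc Yd Xd Yc X'c Y'd X'd Y'c YX' Y'X Y'X'

lemma spin_of_hc_strand_pair:
  assumes "\<And>v. p v = X v + X' v" and "\<And>v. q v = X (c v) - X' (c v)"
    and "\<And>v. P v = Y v + Y' v" and "\<And>v. Q v = Y (d v) - Y' (d v)"
  shows "p (P v) = P (p v)" "p (Q v) = Q (p v)" "q (Q v) = - Q (q v)"
    "p (d v) = d (p v)" "q (d v) = - d (q v)"
  unfolding assms by (simp_all only: xc L) (simp_all add: xc L algebra_simps)
end

text \<open>
  The defining relations move \<open>T\<close> past \<open>c\<close> and express \<open>Y\<close> by \<open>X\<close>. The lemmas \<open>Td\<close>, \<open>TX\<close>, \<open>TY\<close>, \<open>TX'\<close>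
  and \<open>TY'\<close> complete them to rules that move \<open>T\<close> to the right past every letter, after which all
  words have a normal form.
\<close>

locale hc_crossing = hc_strand_pair +
  fixes T 
  assumes TG: "T \<in> G" and TT: "T (T v) = E (T v) + e v" and Tc: "T (c v) = d (T v)"
   and Y_def: "T (X (T v)) + E (c (d (X (T v)))) = Y v"
begin
lemmas LT = L lin[OF TG] E_central[OF TG]
lemma TdT: "T (d (T v)) = E (d (T v)) + c v" 
proof -
  have "T (d (T v)) = T (T (c v))" by (simp only: Tc)
  also have "\<dots> = E (d (T v)) + c v" by (simp only: TT LT) (simp only: Tc)
  finally show ?thesis .
qed
text \<open>
  \<open>TdT\<close> is applied to \<open>T v\<close>, and \<open>T\<close> is cancelled by means of the quadratic relation.
\<close>

lemma Td: "T (d v) = c (T v) - E (c v) + E (d v)"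
  using TdT[of "T v"] by (simp add: TT TdT LT algebra_simps)
lemma TX: "T (X v) = Y (T v) - E (Y v) - E (c (d (X v)))"
proof -
  have "E (Y v) = E (T (X (T v))) + E (E (c (d (X (T v)))))" by (simp flip: Y_def add: LT)
  then show ?thesis using Y_def[of "T v"] by (simp add: TT LT algebra_simps)
qed
lemma TY: "T (Y v) = X (T v) + E (Y v) - E (c (d (Y v)))"
proof -
  have "T (Y v) = T (T (X (T v))) + T (E (c (d (X (T v)))))" by (simp flip: Y_def add: LT)
  also have "\<dots> = E (T (X (T v))) + X (T v) + E (d (c (T (X (T v)))) - E (d (c (X (T v)))) + E (d (d (X (T v)))))" 
    by (simp add: TT Tc Td LT algebra_simps)
  also have "\<dots> = X (T v) + E (Y v) - E (c (d (Y v)))"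
   by (simp flip: Y_def add: xc LT algebra_simps)
  finally show ?thesis .
qed

text \<open>
  The inverses are expressed as \<open>X' = c X c\<close> and \<open>Y' = d Y d\<close>.
\<close>

lemma TX': "T (X' v) = Y' (T v) + E (X' v) + E (c (d (Y v)))"
proof -
  have "T (X' v) = d (T (X (c v)))" by (simp only: X'_eq Tc)
  also have "\<dots> = d (Y (T (c v)) - E (Y (c v)) - E (c (d (X (c v)))))" by (simp only: TX)
  also have "\<dots> = Y' (T v) + E (X' v) + E (c (d (Y v)))" by (simp add: Tc xc LT algebra_simps)
  finally show ?thesis .
qed
lemma TY': "T (Y' v) = X' (T v) - E (X' v) + E (c (d (X v)))"
proof -
  have "T (Y' v) = c (T (Y (d v))) - E (c (Y (d v))) + E (d (Y (d v)))" by (simp only: Y'_eq Td)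
  also have "\<dots> = c (X (T (d v)) + E (Y (d v)) - E (c (d (Y (d v))))) - E (c (Y (d v))) + E (d (Y (d v)))" by (simp only: TY)
  also have "\<dots> = X' (T v) - E (X' v) + E (c (d (X v)))" by (simp add: Td xc LT algebra_simps)
  finally show ?thesis .
qed
lemmas hc = xc TT Tc Td TX TY TX' TY'

lemma spin_of_hc_crossing:
  assumes "\<And>v. p v = X v + X' v" and "\<And>v. q v = X (c v) - X' (c v)"
    and "\<And>v. P v = Y v + Y' v" and "\<And>v. Q v = Y (d v) - Y' (d v)"
    and "\<And>v. R v = c (T v) - d (T v) + E (d v)"
  shows "R (R v) = - E (E (e v)) - e v - e v"
    "R (c v) = - c (R v)" "R (d v) = - d (R v)"
    "R (p v) = P (R v) + E (q v) - E (Q v)"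
    "R (q v) = - Q (R v) - E (p v) - E (P v)"
  unfolding assms by (simp_all only: hc LT) (simp_all add: hc LT algebra_simps)
end

locale spin_crossing = clifford_pair +
  fixes R p q P Q
  assumes RG: "R \<in> G" "p \<in> G" "q \<in> G" "P \<in> G" "Q \<in> G"
   and RR: "R (R v) = - E (E (e v)) - e v - e v"
   and rc: "R (c v) = - c (R v)" "R (d v) = - d (R v)"
     "p (c v) = c (p v)" "p (d v) = d (p v)"
     "P (c v) = c (P v)" "P (d v) = d (P v)"
     "q (c v) = - c (q v)" "q (d v) = - d (q v)"
     "Q (c v) = - c (Q v)" "Q (d v) = - d (Q v)"
   and pq: "q (p v) = p (q v)" "Q (P v) = P (Q v)" "P (p v) = p (P v)" "Q (p v) = p (Q v)"
      "q (P v) = P (q v)" "Q (q v) = - q (Q v)"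
   and qq: "q (q v) = e v - p (p v)" "Q (Q v) = e v - P (P v)"
   and Rp: "R (p v) = P (R v) + E (q v) - E (Q v)"
   and Rq: "R (q v) = - Q (R v) - E (p v) - E (P v)"
begin
lemmas LR = Lc lin[OF RG(1)] lin[OF RG(2)] lin[OF RG(3)] lin[OF RG(4)] lin[OF RG(5)]
  E_central[OF RG(1)] E_central[OF RG(2)] E_central[OF RG(3)] E_central[OF RG(4)]  E_central[OF RG(5)] 
text \<open>
  The relations move \<open>R\<close> past \<open>p\<close> and \<open>q\<close> of the left strand. Multiplying them by \<open>R\<close> from both sides,
  and using that \<open>R\<^sup>2\<close> is a scalar, gives linear equations for the right strand; solving them divides
  by 2.
\<close>

lemma R_reverse: 
  "R (P v) = p (R v) + E (Q v) - E (q v)"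
  "R (Q v) = - q (R v) - E (p v) - E (P v)"
proof -
  have a: "R (P (R w)) = - E (E (p w)) - p w - p w - E (R (q w)) + E (R (Q w))" for w
    using arg_cong[OF Rp[of w], of R] by (simp add: RR LR algebra_simps)
  have b: "R (Q (R w)) = E (E (q w)) + q w + q w - E (R (p w)) - E (R (P w))" for w
    using arg_cong[OF Rq[of w], of R] by (simp add: RR LR algebra_simps)
  show "R (P v) = p (R v) + E (Q v) - E (q v)"
    apply (rule two_eq)
    using a[of "R v"] by (simp add: b Rp Rq RR LR algebra_simps)
  show "R (Q v) = - q (R v) - E (p v) - E (P v)"
    apply (rule two_eq)
    using b[of "R v"] by (simp add: a Rp Rq RR LR algebra_simps eq_neg_iff_add_eq_0 neg_eq_iff_add_eq_0)
qed
lemmas sp = cc dd dc RR rc pq qq Rp Rq R_reverse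
lemma hc_of_spin_crossing:
  assumes "\<And>v. T v = R (d v) - R (c v) + E v - E (c (d v))"
    and "\<And>v. X v = p v - c (q v)" and "\<And>v. Y v = P v - d (Q v)"
  shows "T (T v) = E (T v) + E (T v) + e v + e v + e v + e v"
    "T (c v) = d (T v)"
    "T (X (T v)) + E (c (d (X (T v)))) + E (c (d (X (T v)))) = Y v + Y v + Y v + Y v"
  unfolding assms by (simp_all only: sp LR) (simp_all add: sp LR algebra_simps)
end

locale clifford_triple = clifford_pair +
  fixes f
  assumes fG: "f \<in> G" and ff: "f (f v) = e v" and fc: "f (c v) = - c (f v)" and fd: "f (d v) = - d (f v)"
begin
lemmas Lf = Lc lin[OF fG] E_central[OF fG] 
end

locale hc_braid = clifford_triple +
  fixes T S
  assumes TG: "T \<in> G" "S \<in> G" 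
   and TT: "T (T v) = E (T v) + e v" "S (S v) = E (S v) + e v" 
   and Tc: "T (c v) = d (T v)" "S (d v) = f (S v)" "T (f v) = f (T v)" "S (c v) = c (S v)"
   and Td: "T (d v) = c (T v) - E (c v) + E (d v)" "S (f v) = d (S v) - E (d v) + E (f v)"
   and br: "S (T (S v)) = T (S (T v))"
begin
lemmas LT = Lf lin[OF TG(1)] lin[OF TG(2)] E_central[OF TG(1)] E_central[OF TG(2)] 
lemmas hc = cc dd dc ff fc fd TT Tc Td br
lemma spin_of_hc_braid:
  assumes "\<And>v. R v = c (T v) - d (T v) + E (d v)"
  assumes "\<And>v. U v = d (S v) - f (S v) + E (f v)"
  shows "R (U (R v)) - U (R (U v)) = E (E (U v)) - E (E (R v))" "R (f v) = - f (R v)" "U (c v) = - c (U v)"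
  unfolding assms by (simp_all only: hc LT) (simp_all add: hc LT algebra_simps)
end

locale spin_braid = clifford_triple +
  fixes R S
  assumes RG: "R \<in> G" "S \<in> G" 
   and RR: "R (R v) = - E (E (e v)) - e v - e v" "S (S v) = - E (E (e v)) - e v - e v" 
   and Rc: "R (c v) = - c (R v)" "R (d v) = - d (R v)" "R (f v) = - f (R v)"
    "S (c v) = - c (S v)" "S (d v) = - d (S v)" "S (f v) = - f (S v)"
   and br: "R (S (R v)) - S (R (S v)) = E (E (S v)) - E (E (R v))"
begin
lemma br': "S (R (S v)) = R (S (R v)) - E (E (S v)) + E (E (R v))"
  using br[of v] by (simp add: algebra_simps)
lemmas LR = Lf lin[OF RG(1)] lin[OF RG(2)] E_central[OF RG(1)] E_central[OF RG(2)] 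
lemmas sp = cc dd dc ff fc fd RR Rc br'
lemma hc_of_spin_braid:
  assumes "\<And>v. T v = R (d v) - R (c v) + E v - E (c (d v))"
  assumes "\<And>v. U v = S (f v) - S (d v) + E v - E (d (f v))"
  shows "T (U (T v)) = U (T (U v))"
  unfolding assms by (simp_all only: sp LR) (simp_all add: sp LR algebra_simps)
end

section \<open>A faithful representation by additive operators\<close>

text \<open>
  This makes the numerals of \<open>\<complex>(q)\<close> different from zero.
\<close>

instance fract :: ("{idom,ring_char_0}") ring_char_0
  by standard (rule injI, simp add: of_nat_fract eq_fract)

context superalgebra
begin

text \<open>
  Left multiplication is faithful because of the unit, but it acts on a carrier only, whereas the
  calculations with operators need an additive group on a whole type. The carrier is therefore
  embedded in the space of finitely supported functions on it: \<open>r\<close> is the canonical map of that free space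
  onto \<open>A\<close>, a complement of its kernel \<open>N\<close> provides a linear section \<open>s\<close> of \<open>r\<close>, and \<open>a\<close> acts by
  \<open>v \<mapsto> s (a \<otimes> r v)\<close>. The projection \<open>g\<close> along \<open>N\<close> also maps functions with other supports into the
  free space on the carrier. The unit acts as a projection, which is why it is not the identity
  operator.
\<close>

lemma faithful_rep:
  "\<exists>op :: 'a \<Rightarrow> ('a \<Rightarrow>\<^sub>0 cq) \<Rightarrow> ('a \<Rightarrow>\<^sub>0 cq).
    (\<forall>a\<in>carrier A. \<forall>v w. op a (v + w) = op a v + op a w) \<and>
    (\<forall>a\<in>carrier A. \<forall>k v. op a (scale k v) = scale k (op a v)) \<and>
    (\<forall>a\<in>carrier A. \<forall>b\<in>carrier A. \<forall>v. op (a \<otimes> b) v = op a (op b v)) \<and>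
    (\<forall>a\<in>carrier A. \<forall>b\<in>carrier A. \<forall>v. op (a \<oplus> b) v = op a v + op b v) \<and>
    (\<forall>a\<in>carrier A. \<forall>k v. op (k \<odot> a) v = scale k (op a v)) \<and>
    (\<forall>a\<in>carrier A. \<forall>b\<in>carrier A. (\<forall>v. op a v = op b v) \<longrightarrow> a = b)"
proof -
  let ?S = "\<lambda>x. Poly_Mapping.single x (1 :: cq)"
  interpret pmvs: vector_space "scale :: cq \<Rightarrow> ('a \<Rightarrow>\<^sub>0 cq) \<Rightarrow> _" by (rule scale_vector_space)
  interpret pmp: vector_space_pair "scale :: cq \<Rightarrow> ('a \<Rightarrow>\<^sub>0 cq) \<Rightarrow> _" "scale :: cq \<Rightarrow> ('a \<Rightarrow>\<^sub>0 cq) \<Rightarrow> _" 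
    by unfold_locales
  define U :: "('a \<Rightarrow>\<^sub>0 cq) superalg" where "U = \<lparr>carrier = {f. keys f \<subseteq> carrier A}, mult = (\<lambda>x y. x), one = 0, zero = 0, add = (+),
     smult = scale, grade = (\<lambda>_. {})\<rparr>"
  interpret U: fspace U "carrier A" by (simp add: fspace_def U_def)
  define r where "r = lin_ext A (\<lambda>x. x)"
  have rl: "r \<in> lin_map U A" unfolding r_def by (rule lin_ext_lin_map[OF U.fspace_axioms])
  note r' = lin_mapD[OF rl] lin_map_more[OF rl U.vspace_axioms vspace_axioms]
  have rS: "r (?S x) = x" if "x \<in> carrier A" for x using that by (simp add: r_def)
  define N where "N = {v \<in> carrier U. r v = \<zero>}"
  have Nsub: "pmvs.subspace N" unfolding N_def by (rule U.subspace_of_linear_kernel[OF vspace_axioms rl])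
  have Usub: "pmvs.subspace (carrier U)"
    unfolding pmvs.subspace_def using U.zero_closed U.add.m_closed U.smult_closed by (simp add: U.zero_eq U.add_eq U.smult_eq)
  obtain B where B: "B \<subseteq> N" "pmvs.independent B" "N \<subseteq> pmvs.span B"
    using pmvs.maximal_independent_subset[of N] by blast
  have "B \<subseteq> carrier U" using B(1) by (auto simp: N_def)
  then obtain C where C: "B \<subseteq> C" "C \<subseteq> carrier U" "pmvs.independent C" "carrier U \<subseteq> pmvs.span C"
    using pmvs.maximal_independent_subset_extend[of B "carrier U"] B(2) by blast
  \<comment> \<open>\<open>B\<close> is a basis of the kernel and \<open>C\<close> extends it to a basis of the free space, so \<open>g\<close> projects along the kernel.\<close>
  let ?f = "\<lambda>x. if x \<in> B then 0 else x"
  obtain g where g: "Vector_Spaces.linear scale scale g" "\<forall>x\<in>C. g x = ?f x" "range g = pmvs.span (?f ` C)"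
    using pmp.linear_independent_extend_subspace[OF C(3), of ?f] by blast
  have gadd: "g (v + w) = g v + g w" and gsc: "g (scale k v) = scale k (g v)" for v w k
    using pmp.linear_add[OF g(1)] pmp.linear_scale[OF g(1)] by auto
  have gsub: "g (v - w) = g v - g w" for v w using pmp.linear_diff[OF g(1)] by auto
  have "?f ` C \<subseteq> carrier U" using C(2) U.zero_closed by (auto simp: U.zero_eq)
  then have gU: "g v \<in> carrier U" for v
    using pmvs.span_minimal[OF _ Usub] g(3) by blast
  have gN: "g v = 0" if "v \<in> N" for v
  proof -
    have "v \<in> pmvs.span B" using B(3) that by blast
    then show ?thesis
    proof (induction rule: pmvs.span_induct_alt)
      case base show ?case using gsc[of 0 0] by simp
    next
      case (step c x y) then show ?case using g(2) C(1) by (auto simp: gadd gsc)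
    qed
  qed
  have gUN: "g v - v \<in> N" if "v \<in> carrier U" for v
  proof -
    have "v \<in> pmvs.span C" using C(4) that by blast
    then show ?thesis
    proof (induction rule: pmvs.span_induct_alt)
      case base show ?case using gsc[of 0 0] pmvs.subspace_0[OF Nsub] by simp
    next
      case (step c x y) 
      have "g x - x \<in> N" using g(2) step(1) B(1) pmvs.subspace_0[OF Nsub] pmvs.subspace_neg[OF Nsub] by auto
      then have "scale c (g x - x) + (g y - y) \<in> N" 
        using step(2) pmvs.subspace_add[OF Nsub] pmvs.subspace_scale[OF Nsub] by blast
      then show ?case by (simp add: gadd gsc pmvs.scale_right_diff_distrib algebra_simps)
    qed
  qed
  have rg: "r (g v) = r v" if "v \<in> carrier U" for v
  proof -
    have "r (g v - v) = \<zero>" using gUN[OF that] by (simp add: N_def)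
    then have "r (g v) \<ominus> r v = \<zero>" using r'(6)[OF gU that] U.a_minus_eq[OF gU that] by simp
    then show ?thesis using diff_zero_iff[OF r'(1)[OF gU] r'(1)[OF that]] by simp
  qed
  define s where "s x = g (?S x)" for x
  have sadd: "s (x \<oplus> y) = s x + s y" if xy: "x \<in> carrier A" "y \<in> carrier A" for x y
  proof -
    have c: "?S (x \<oplus> y) \<in> carrier U" "?S x \<in> carrier U" "?S y \<in> carrier U" using xy by simp_all
    have c2: "?S x + ?S y \<in> carrier U" using U.add.m_closed[OF c(2,3)] by (simp add: U.add_eq)
    have "r (?S x + ?S y) = x \<oplus> y" using r'(3)[OF c(2,3)] xy by (simp add: U.add_eq rS)
    then have "?S (x \<oplus> y) - (?S x + ?S y) \<in> N"
      using r'(6)[OF c(1) c2] U.a_minus_eq[OF c(1) c2] U.diff_closed[OF c(1) c2] xy diff_zero_iff[of "x \<oplus> y" "x \<oplus> y"] 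
      by (simp add: N_def rS)
    from gN[OF this] show ?thesis by (simp add: gsub gadd s_def)
  qed
  have ssc: "s (k \<odot> x) = scale k (s x)" if x: "x \<in> carrier A" for x k
  proof -
    have c: "?S (k \<odot> x) \<in> carrier U" "?S x \<in> carrier U" using x by simp_all
    have c2: "scale k (?S x) \<in> carrier U" using U.smult_closed[OF c(2), of k] by (simp only: U.smult_eq)
    have "r (scale k (?S x)) = k \<odot> x" using r'(2)[OF c(2), of k] x by (simp only: U.smult_eq rS)
    then have "?S (k \<odot> x) - scale k (?S x) \<in> N"
      using r'(6)[OF c(1) c2] U.a_minus_eq[OF c(1) c2] U.diff_closed[OF c(1) c2] x diff_zero_iff[of "k \<odot> x" "k \<odot> x"] 
      by (simp only: N_def rS smult_closed mem_Collect_eq simp_thms)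
    from gN[OF this] show ?thesis by (simp add: gsub gsc s_def del: scale_single)
  qed
  have sU: "s x \<in> carrier U" for x by (simp add: s_def gU)
  have rs: "r (s x) = x" if "x \<in> carrier A" for x
    using rg[of "?S x"] rS[OF that] that by (simp add: s_def)
  define op where "op a v = s (a \<otimes> r (g v))" for a v
  have rgc: "r (g v) \<in> carrier A" for v by (rule r'(1)[OF gU])
  have rga: "r (g (v + w)) = r (g v) \<oplus> r (g w)" for v w using r'(3)[OF gU gU, of v w] by (simp add: gadd U.add_eq)
  have rgs: "r (g (scale k v)) = k \<odot> r (g v)" for k v using r'(2)[OF gU[of v], of k] by (simp add: gsc U.smult_eq)
  have rgs': "r (g (s x)) = x" if "x \<in> carrier A" for x using rg[OF sU] rs[OF that] by simp
  have inj: "a = b" if ab: "a \<in> carrier A" "b \<in> carrier A" and eq: "\<forall>v. op a v = op b v" for a b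
  proof -
    have "s a = s b" using eq[rule_format, of "s \<one>"] ab by (simp add: op_def rgs')
    then show ?thesis using rs ab by metis
  qed
  show ?thesis
    by (rule exI[of _ op], intro conjI ballI allI impI)
      (simp_all add: op_def rga rgs rgc rgs' sadd ssc mult_add_l mult_add_r smult_mult_l smult_mult_r m_assoc inj[unfolded op_def])
qed

end

locale op_rep = superalgebra A for A :: "'a superalg" (structure) +
  fixes op :: "'a \<Rightarrow> ('a \<Rightarrow>\<^sub>0 cq) \<Rightarrow> ('a \<Rightarrow>\<^sub>0 cq)"
  assumes op_add: "a \<in> carrier A \<Longrightarrow> op a (v + w) = op a v + op a w"
    and op_scale: "a \<in> carrier A \<Longrightarrow> op a (scale k v) = scale k (op a v)"
    and op_mult: "a \<in> carrier A \<Longrightarrow> b \<in> carrier A \<Longrightarrow> op (a \<otimes> b) v = op a (op b v)"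
    and op_plus: "a \<in> carrier A \<Longrightarrow> b \<in> carrier A \<Longrightarrow> op (a \<oplus> b) v = op a v + op b v"
    and op_smult: "a \<in> carrier A \<Longrightarrow> op (k \<odot> a) v = scale k (op a v)"
    and op_inj: "a \<in> carrier A \<Longrightarrow> b \<in> carrier A \<Longrightarrow> (\<And>v. op a v = op b v) \<Longrightarrow> a = b"
begin

interpretation pmvs: vector_space "scale :: cq \<Rightarrow> ('a \<Rightarrow>\<^sub>0 cq) \<Rightarrow> _" by (rule scale_vector_space)

lemma op_uminus: "a \<in> carrier A \<Longrightarrow> op (\<ominus> a) v = - op a v"
  using op_smult[of a "-1" v] by (simp add: smult_neg_one)

lemma op_minus: "a \<in> carrier A \<Longrightarrow> b \<in> carrier A \<Longrightarrow> op (a \<ominus> b) v = op a v - op b v"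
  by (simp add: a_minus_def op_plus op_uminus)

lemma op_e: "a \<in> carrier A \<Longrightarrow> op a (op \<one> v) = op a v" "a \<in> carrier A \<Longrightarrow> op \<one> (op a v) = op a v"
  using op_mult[of a \<one> v] op_mult[of \<one> a v] by simp_all

lemmas op_simps = op_mult op_plus op_smult op_uminus op_minus op_scale op_e

sublocale additive_operators "op \<one>" "op (eps \<odot> \<one>)" "op ` carrier A"
proof (unfold_locales, goal_cases)
  case (6 f v)
  then show ?case by (auto simp: op_simps)
next
  case (7 v)
  show ?case
  proof (rule poly_mapping_eqI)
    fix x show "lookup v x = lookup 0 x" using arg_cong[OF 7, of "\<lambda>v. lookup v x"] by (simp add: lookup_add)
  qed
qed (auto simp: op_add op_e)

end

lemma (in superalgebra) op_rep_exists: "\<exists>op. op_rep A op"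
proof -
  obtain op :: "'a \<Rightarrow> ('a \<Rightarrow>\<^sub>0 cq) \<Rightarrow> ('a \<Rightarrow>\<^sub>0 cq)" where op:
    "(\<forall>a\<in>carrier A. \<forall>v w. op a (v + w) = op a v + op a w) \<and>
    (\<forall>a\<in>carrier A. \<forall>k v. op a (scale k v) = scale k (op a v)) \<and>
    (\<forall>a\<in>carrier A. \<forall>b\<in>carrier A. \<forall>v. op (a \<otimes> b) v = op a (op b v)) \<and>
    (\<forall>a\<in>carrier A. \<forall>b\<in>carrier A. \<forall>v. op (a \<oplus> b) v = op a v + op b v) \<and>
    (\<forall>a\<in>carrier A. \<forall>k v. op (k \<odot> a) v = scale k (op a v)) \<and>
    (\<forall>a\<in>carrier A. \<forall>b\<in>carrier A. (\<forall>v. op a v = op b v) \<longrightarrow> a = b)"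
    using faithful_rep by (elim exE)
  have "op_rep A op"
    by unfold_locales (use op in simp_all)
  then show ?thesis by (intro exI)
qed

section \<open>The relations in a superalgebra\<close>

context superalgebra
begin

text \<open>
  The operator identities of the previous section are transported back to the algebra along the
  faithful representation. In this lemma and the following ones \<open>p\<close> and \<open>q\<close> on the Hecke-Clifford side
  and \<open>T\<close> on the spin side are twice the images under \<open>\<Psi>\<close> and \<open>\<Phi>\<close>.
\<close>

lemma spin_of_hc_strand_ring:
  assumes c: "c \<in> carrier A" "x \<in> carrier A" "x' \<in> carrier A"
    and r: "c \<otimes> c = \<one>" "x \<otimes> x' = \<one>" "x' \<otimes> x = \<one>" "x \<otimes> c = c \<otimes> x'"
    and p: "p = x \<oplus> x'" and q: "q = (x \<ominus> x') \<otimes> c"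
  shows "p \<otimes> p \<oplus> q \<otimes> q = 4 \<odot> \<one>" "p \<otimes> q = q \<otimes> p" "p \<otimes> c = c \<otimes> p" "q \<otimes> c = \<ominus> (c \<otimes> q)"
proof -
  obtain op where "op_rep A op" using op_rep_exists by (elim exE)
  then interpret op_rep A op .
  interpret hc_strand "op \<one>" "op (eps \<odot> \<one>)" "op ` carrier A" "op c" "op x" "op x'"
    by unfold_locales (use c in \<open>simp_all add: op_mult[symmetric] r\<close>)
  have pq: "p \<in> carrier A" "q \<in> carrier A" using c by (simp_all add: p q)
  have o: "op p v = op x v + op x' v" "op q v = op x (op c v) - op x' (op c v)" for v
    using c by (simp_all add: p q op_simps)
  have 4: "scale 4 w = w + w + w + w" for w :: "'a \<Rightarrow>\<^sub>0 cq" by (rule poly_mapping_eqI) (simp add: lookup_add)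
  note s = spin_of_hc_strand[OF o]
  show "p \<otimes> p \<oplus> q \<otimes> q = 4 \<odot> \<one>"
    by (rule op_inj) (use pq c s(1) in \<open>simp_all add: op_simps 4\<close>)
  show "p \<otimes> q = q \<otimes> p" "p \<otimes> c = c \<otimes> p" "q \<otimes> c = \<ominus> (c \<otimes> q)"
    by (rule op_inj; use pq c s(2-4) in \<open>simp add: op_simps\<close>)+
qed

lemma spin_of_hc_strand_pair_ring:
  assumes c: "c \<in> carrier A" "x \<in> carrier A" "x' \<in> carrier A" "d \<in> carrier A" "y \<in> carrier A" "y' \<in> carrier A"
    and r: "c \<otimes> c = \<one>" "x \<otimes> x' = \<one>" "x' \<otimes> x = \<one>" "x \<otimes> c = c \<otimes> x'"
      "d \<otimes> d = \<one>" "y \<otimes> y' = \<one>" "y' \<otimes> y = \<one>" "y \<otimes> d = d \<otimes> y'"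
      "d \<otimes> c = \<ominus> (c \<otimes> d)" "y \<otimes> x = x \<otimes> y" "x \<otimes> d = d \<otimes> x" "y \<otimes> c = c \<otimes> y"
    and p: "p = x \<oplus> x'" and q: "q = (x \<ominus> x') \<otimes> c"
    and P: "P = y \<oplus> y'" and Q: "Q = (y \<ominus> y') \<otimes> d"
  shows "p \<otimes> P = P \<otimes> p" "p \<otimes> Q = Q \<otimes> p" "q \<otimes> Q = \<ominus> (Q \<otimes> q)" "p \<otimes> d = d \<otimes> p" "q \<otimes> d = \<ominus> (d \<otimes> q)"
    "x' \<otimes> d = d \<otimes> x'" "y' \<otimes> x = x \<otimes> y'" 
proof -
  obtain op where "op_rep A op" using op_rep_exists by (elim exE)
  then interpret op_rep A op .
  interpret hc_strand_pair "op \<one>" "op (eps \<odot> \<one>)" "op ` carrier A" "op c" "op d" "op x" "op y" "op x'" "op y'"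
    by unfold_locales (use c in \<open>simp_all add: op_mult[symmetric] op_uminus[symmetric] r\<close>)
  have pq: "p \<in> carrier A" "q \<in> carrier A" "P \<in> carrier A" "Q \<in> carrier A" using c by (simp_all add: p q P Q)
  have o: "op p v = op x v + op x' v" "op q v = op x (op c v) - op x' (op c v)"
     "op P v = op y v + op y' v" "op Q v = op y (op d v) - op y' (op d v)" for v
    using c by (simp_all add: p q P Q op_simps)
  note s = spin_of_hc_strand_pair[OF o]
  show "p \<otimes> P = P \<otimes> p" "p \<otimes> Q = Q \<otimes> p" "q \<otimes> Q = \<ominus> (Q \<otimes> q)" "p \<otimes> d = d \<otimes> p" "q \<otimes> d = \<ominus> (d \<otimes> q)"
    "x' \<otimes> d = d \<otimes> x'" "y' \<otimes> x = x \<otimes> y'" 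
    by (rule op_inj; use pq c s X'd Y'X in \<open>simp add: op_simps\<close>)+
qed

lemma spin_of_hc_crossing_ring:
  assumes c: "c \<in> carrier A" "x \<in> carrier A" "x' \<in> carrier A" "d \<in> carrier A" "y \<in> carrier A" "y' \<in> carrier A"
      "T \<in> carrier A"
    and r: "c \<otimes> c = \<one>" "x \<otimes> x' = \<one>" "x' \<otimes> x = \<one>" "x \<otimes> c = c \<otimes> x'"
      "d \<otimes> d = \<one>" "y \<otimes> y' = \<one>" "y' \<otimes> y = \<one>" "y \<otimes> d = d \<otimes> y'"
      "d \<otimes> c = \<ominus> (c \<otimes> d)" "y \<otimes> x = x \<otimes> y" "x \<otimes> d = d \<otimes> x" "y \<otimes> c = c \<otimes> y"
    and r2: "T \<otimes> T = eps \<odot> T \<oplus> \<one>" "T \<otimes> c = d \<otimes> T" 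
      "T \<otimes> (x \<otimes> T) \<oplus> eps \<odot> (c \<otimes> (d \<otimes> (x \<otimes> T))) = y"
    and p: "p = x \<oplus> x'" and q: "q = (x \<ominus> x') \<otimes> c"
    and P: "P = y \<oplus> y'" and Q: "Q = (y \<ominus> y') \<otimes> d"
    and R: "R = (c \<ominus> d) \<otimes> T \<oplus> eps \<odot> d"
  shows "R \<otimes> R = (- (eps ^ 2) - 2) \<odot> \<one>" "R \<otimes> c = \<ominus> (c \<otimes> R)" "R \<otimes> d = \<ominus> (d \<otimes> R)"
    "R \<otimes> p = P \<otimes> R \<oplus> eps \<odot> (q \<ominus> Q)" "R \<otimes> q = \<ominus> (Q \<otimes> R) \<ominus> eps \<odot> (p \<oplus> P)"
    "T \<otimes> d = c \<otimes> T \<ominus> eps \<odot> c \<oplus> eps \<odot> d"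
proof -
  obtain op where "op_rep A op" using op_rep_exists by (elim exE)
  then interpret op_rep A op .
  have t: "op T (op T v) = op (eps \<odot> \<one>) (op T v) + op \<one> v" 
     "op T (op x (op T v)) + op (eps \<odot> \<one>) (op c (op d (op x (op T v)))) = op y v" for v
    using arg_cong[OF r2(1), of "\<lambda>a. op a v"] arg_cong[OF r2(3), of "\<lambda>a. op a v"] c by (simp_all add: op_simps)
  interpret hc_crossing "op \<one>" "op (eps \<odot> \<one>)" "op ` carrier A" "op c" "op d" "op x" "op y" "op x'" "op y'" "op T"
    by unfold_locales (use c in \<open>simp_all add: t, simp_all add: op_mult[symmetric] op_uminus[symmetric] r r2(2)\<close>)
  have pq: "p \<in> carrier A" "q \<in> carrier A" "P \<in> carrier A" "Q \<in> carrier A" "R \<in> carrier A" using c by (simp_all add: p q P Q R)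
  have o: "op p v = op x v + op x' v" "op q v = op x (op c v) - op x' (op c v)"
     "op P v = op y v + op y' v" "op Q v = op y (op d v) - op y' (op d v)" 
     "op R v = op c (op T v) - op d (op T v) + op (eps \<odot> \<one>) (op d v)" for v
    using c by (simp_all add: p q P Q R op_simps)
  have 2: "scale (- (eps ^ 2) - 2) w = - scale eps (scale eps w) - w - w" for w :: "'a \<Rightarrow>\<^sub>0 cq"
    by (rule poly_mapping_eqI) (simp add: lookup_minus lookup_add power2_eq_square algebra_simps)
  have l: "scale k (v + w) = scale k v + scale k w" "scale k (v - w) = scale k v - scale k w" for k and v w :: "'a \<Rightarrow>\<^sub>0 cq"
    by (rule poly_mapping_eqI; simp add: lookup_minus lookup_add algebra_simps)+
  note s = spin_of_hc_crossing[OF o]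
  show "R \<otimes> R = (- (eps ^ 2) - 2) \<odot> \<one>" by (rule op_inj) (use pq c s(1) in \<open>simp_all add: op_simps 2\<close>)
  show "R \<otimes> c = \<ominus> (c \<otimes> R)" "R \<otimes> d = \<ominus> (d \<otimes> R)" by (rule op_inj; use pq c s(2,3) in \<open>simp add: op_simps\<close>)+
  show "R \<otimes> p = P \<otimes> R \<oplus> eps \<odot> (q \<ominus> Q)" by (rule op_inj) (use pq c s(4) in \<open>simp_all add: op_simps l\<close>)
  show "R \<otimes> q = \<ominus> (Q \<otimes> R) \<ominus> eps \<odot> (p \<oplus> P)"  by (rule op_inj) (use pq c s(5) in \<open>simp_all add: op_simps l\<close>)
  show "T \<otimes> d = c \<otimes> T \<ominus> eps \<odot> c \<oplus> eps \<odot> d" by (rule op_inj) (use pq c Td in \<open>simp_all add: op_simps l\<close>)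
qed

lemma spin_of_hc_braid_ring:
  assumes c: "c \<in> carrier A" "d \<in> carrier A" "f \<in> carrier A" "T \<in> carrier A" "S \<in> carrier A"
    and r: "c \<otimes> c = \<one>" "d \<otimes> d = \<one>" "f \<otimes> f = \<one>" 
      "d \<otimes> c = \<ominus> (c \<otimes> d)" "f \<otimes> c = \<ominus> (c \<otimes> f)" "f \<otimes> d = \<ominus> (d \<otimes> f)" 
    and r2: "T \<otimes> T = eps \<odot> T \<oplus> \<one>" "T \<otimes> c = d \<otimes> T" "S \<otimes> S = eps \<odot> S \<oplus> \<one>" "S \<otimes> d = f \<otimes> S" 
       "T \<otimes> f = f \<otimes> T" "S \<otimes> c = c \<otimes> S" 
       "T \<otimes> d = c \<otimes> T \<ominus> eps \<odot> c \<oplus> eps \<odot> d" "S \<otimes> f = d \<otimes> S \<ominus> eps \<odot> d \<oplus> eps \<odot> f"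
       "S \<otimes> (T \<otimes> S) = T \<otimes> (S \<otimes> T)"
    and R: "R = (c \<ominus> d) \<otimes> T \<oplus> eps \<odot> d" and U: "U = (d \<ominus> f) \<otimes> S \<oplus> eps \<odot> f"
  shows "R \<otimes> (U \<otimes> R) \<ominus> U \<otimes> (R \<otimes> U) = eps ^ 2 \<odot> (U \<ominus> R)"
proof -
  obtain op where "op_rep A op" using op_rep_exists by (elim exE)
  then interpret op_rep A op .
  have t: "op T (op T v) = op (eps \<odot> \<one>) (op T v) + op \<one> v"  "op S (op S v) = op (eps \<odot> \<one>) (op S v) + op \<one> v" 
     "op T (op d v) = op c (op T v) - op (eps \<odot> \<one>) (op c v) + op (eps \<odot> \<one>) (op d v)"
     "op S (op f v) = op d (op S v) - op (eps \<odot> \<one>) (op d v) + op (eps \<odot> \<one>) (op f v)"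
     "op S (op T (op S v)) = op T (op S (op T v))" for v
    using arg_cong[OF r2(1), of "\<lambda>a. op a v"] arg_cong[OF r2(3), of "\<lambda>a. op a v"]
      arg_cong[OF r2(7), of "\<lambda>a. op a v"] arg_cong[OF r2(8), of "\<lambda>a. op a v"] 
      arg_cong[OF r2(9), of "\<lambda>a. op a v"] c by (simp_all add: op_simps)
  interpret hc_braid "op \<one>" "op (eps \<odot> \<one>)" "op ` carrier A" "op c" "op d" "op f" "op T" "op S"
    by unfold_locales (use c in \<open>simp_all add: t, simp_all add: op_mult[symmetric] op_uminus[symmetric] r r2(2,4-6)\<close>)
  have pq: "R \<in> carrier A" "U \<in> carrier A" using c by (simp_all add: U R)
  have o: "op R v = op c (op T v) - op d (op T v) + op (eps \<odot> \<one>) (op d v)"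
     "op U v = op d (op S v) - op f (op S v) + op (eps \<odot> \<one>) (op f v)" for v
    using c by (simp_all add: U R op_simps)
  have 2: "scale (eps ^ 2) (v - w) = scale eps (scale eps v) - scale eps (scale eps w)" for v w :: "'a \<Rightarrow>\<^sub>0 cq"
    by (rule poly_mapping_eqI) (simp add: lookup_minus lookup_add power2_eq_square algebra_simps)
  note s = spin_of_hc_braid[OF o]
  show ?thesis by (rule op_inj) (use pq c s(1) in \<open>simp_all add: op_simps 2\<close>)
qed

lemma hc_of_spin_strand_ring:
  assumes c: "c \<in> carrier A" "p \<in> carrier A" "q \<in> carrier A"
    and r: "c \<otimes> c = \<one>" "p \<otimes> p \<oplus> q \<otimes> q = \<one>" "p \<otimes> q = q \<otimes> p" "p \<otimes> c = c \<otimes> p" "q \<otimes> c = \<ominus> (c \<otimes> q)"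
    and x: "x = p \<ominus> c \<otimes> q" and x': "x' = p \<oplus> c \<otimes> q"
  shows "x \<otimes> x' = \<one>" "x' \<otimes> x = \<one>" "x \<otimes> c = c \<otimes> x'"
proof -
  obtain op where "op_rep A op" using op_rep_exists by (elim exE)
  then interpret op_rep A op .
  have t: "op p (op p v) + op q (op q v) = op \<one> v" for v
    using arg_cong[OF r(2), of "\<lambda>a. op a v"] c by (simp add: op_simps)
  interpret spin_strand "op \<one>" "op (eps \<odot> \<one>)" "op ` carrier A" "op c" "op p" "op q"
    by unfold_locales (use c in \<open>simp_all add: t, simp_all add: op_mult[symmetric] op_uminus[symmetric] r(1,3-)\<close>)
  have pq: "x \<in> carrier A" "x' \<in> carrier A" using c by (simp_all add: x x')
  have o: "op x v = op p v - op c (op q v)" "op x' v = op p v + op c (op q v)" for v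
    using c by (simp_all add: x x' op_simps)
  note s = hc_of_spin_strand[OF o]
  show "x \<otimes> x' = \<one>" "x' \<otimes> x = \<one>" "x \<otimes> c = c \<otimes> x'" 
    by (rule op_inj; use pq c s in \<open>simp add: op_simps\<close>)+
qed

lemma hc_of_spin_strand_pair_ring:
  assumes c: "c \<in> carrier A" "p \<in> carrier A" "q \<in> carrier A" "d \<in> carrier A" "P \<in> carrier A" "Q \<in> carrier A"
    and r: "d \<otimes> c = \<ominus> (c \<otimes> d)" "P \<otimes> p = p \<otimes> P" "Q \<otimes> p = p \<otimes> Q" "q \<otimes> P = P \<otimes> q" "q \<otimes> Q = \<ominus> (Q \<otimes> q)"
     "p \<otimes> d = d \<otimes> p" "q \<otimes> d = \<ominus> (d \<otimes> q)" "P \<otimes> c = c \<otimes> P" "Q \<otimes> c = \<ominus> (c \<otimes> Q)"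
    and x: "x = p \<ominus> c \<otimes> q" and y: "y = P \<ominus> d \<otimes> Q"
  shows "x \<otimes> y = y \<otimes> x" "x \<otimes> d = d \<otimes> x"
proof -
  obtain op where "op_rep A op" using op_rep_exists by (elim exE)
  then interpret op_rep A op .
  interpret spin_strand_pair "op \<one>" "op (eps \<odot> \<one>)" "op ` carrier A" "op c" "op p" "op q" "op d" "op P" "op Q"
    by unfold_locales (use c in \<open>simp_all add: op_mult[symmetric] op_uminus[symmetric] r\<close>)
  have pq: "x \<in> carrier A" "y \<in> carrier A" using c by (simp_all add: x y)
  have o: "op x v = op p v - op c (op q v)" "op y v = op P v - op d (op Q v)" for v
    using c by (simp_all add: x y op_simps)
  note s = hc_of_spin_strand_pair[OF o]
  show "x \<otimes> y = y \<otimes> x" "x \<otimes> d = d \<otimes> x"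
    by (rule op_inj; use pq c s in \<open>simp add: op_simps\<close>)+
qed

lemma hc_of_spin_crossing_ring:
  assumes c: "c \<in> carrier A" "p \<in> carrier A" "q \<in> carrier A" "d \<in> carrier A" "P \<in> carrier A" "Q \<in> carrier A"
      "R \<in> carrier A"
    and r: "c \<otimes> c = \<one>" "d \<otimes> d = \<one>" "d \<otimes> c = \<ominus> (c \<otimes> d)" 
     "R \<otimes> c = \<ominus> (c \<otimes> R)" "R \<otimes> d = \<ominus> (d \<otimes> R)" "p \<otimes> c = c \<otimes> p" "p \<otimes> d = d \<otimes> p" "P \<otimes> c = c \<otimes> P" "P \<otimes> d = d \<otimes> P"
     "q \<otimes> c = \<ominus> (c \<otimes> q)" "q \<otimes> d = \<ominus> (d \<otimes> q)" "Q \<otimes> c = \<ominus> (c \<otimes> Q)" "Q \<otimes> d = \<ominus> (d \<otimes> Q)"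
     "q \<otimes> p = p \<otimes> q" "Q \<otimes> P = P \<otimes> Q" "P \<otimes> p = p \<otimes> P" "Q \<otimes> p = p \<otimes> Q" "q \<otimes> P = P \<otimes> q" "Q \<otimes> q = \<ominus> (q \<otimes> Q)"
    and r2: "p \<otimes> p \<oplus> q \<otimes> q = \<one>" "P \<otimes> P \<oplus> Q \<otimes> Q = \<one>" "R \<otimes> R = (- (eps ^ 2) - 2) \<odot> \<one>"
       "R \<otimes> p = P \<otimes> R \<oplus> eps \<odot> (q \<ominus> Q)" "R \<otimes> q = \<ominus> (Q \<otimes> R) \<ominus> eps \<odot> (p \<oplus> P)"
    and x: "x = p \<ominus> c \<otimes> q" and y: "y = P \<ominus> d \<otimes> Q"
    and T: "T = R \<otimes> d \<ominus> R \<otimes> c \<oplus> eps \<odot> \<one> \<ominus> eps \<odot> (c \<otimes> d)"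
  shows "T \<otimes> T = (2 * eps) \<odot> T \<oplus> 4 \<odot> \<one>" "T \<otimes> c = d \<otimes> T" 
    "T \<otimes> (x \<otimes> T) \<oplus> (2 * eps) \<odot> (c \<otimes> (d \<otimes> (x \<otimes> T))) = 4 \<odot> y"
proof -
  obtain op where "op_rep A op" using op_rep_exists by (elim exE)
  then interpret op_rep A op .
  have 2: "scale (- (eps ^ 2) - 2) w = - scale eps (scale eps w) - w - w" for w :: "'a \<Rightarrow>\<^sub>0 cq"
    by (rule poly_mapping_eqI) (simp add: lookup_minus lookup_add power2_eq_square algebra_simps)
  have l: "scale k (v + w) = scale k v + scale k w" "scale k (v - w) = scale k v - scale k w" for k and v w :: "'a \<Rightarrow>\<^sub>0 cq"
    by (rule poly_mapping_eqI; simp add: lookup_minus lookup_add algebra_simps)+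
  have t: "op p (op p v) + op q (op q v) = op \<one> v" "op P (op P v) + op Q (op Q v) = op \<one> v"
    "op R (op R v) = - op (eps \<odot> \<one>) (op (eps \<odot> \<one>) (op \<one> v)) - op \<one> v - op \<one> v"
    "op R (op p v) = op P (op R v) + op (eps \<odot> \<one>) (op q v) - op (eps \<odot> \<one>) (op Q v)" 
    "op R (op q v) = - op Q (op R v) - op (eps \<odot> \<one>) (op p v) - op (eps \<odot> \<one>) (op P v)" for v
    using r2[THEN arg_cong, of "\<lambda>a. op a v"] c by (simp_all add: op_simps 2 l)
  have t': "op q (op q v) = op \<one> v - op p (op p v)" "op Q (op Q v) = op \<one> v - op P (op P v)" for v
    using t(1,2)[of v] by (simp_all add: algebra_simps)
  interpret spin_crossing "op \<one>" "op (eps \<odot> \<one>)" "op ` carrier A" "op c" "op d" "op R" "op p" "op q" "op P" "op Q"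
    by unfold_locales (use c in \<open>simp_all add: t(3-) t', simp_all add: op_mult[symmetric] op_uminus[symmetric] r\<close>)
  have pq: "x \<in> carrier A" "y \<in> carrier A" "T \<in> carrier A" using c by (simp_all add: x y T)
  have o: "op T v = op R (op d v) - op R (op c v) + op (eps \<odot> \<one>) v - op (eps \<odot> \<one>) (op c (op d v))" 
    "op x v = op p v - op c (op q v)" "op y v = op P v - op d (op Q v)" for v
    using c by (simp_all add: x y T op_simps l)
  have 4: "scale 4 w = w + w + w + w" "scale (2 * eps) w = scale eps w + scale eps w" for w :: "'a \<Rightarrow>\<^sub>0 cq" 
    by (rule poly_mapping_eqI; simp add: lookup_add algebra_simps)+
  note s = hc_of_spin_crossing[OF o]
  show "T \<otimes> T = (2 * eps) \<odot> T \<oplus> 4 \<odot> \<one>" by (rule op_inj) (use pq c s(1) in \<open>simp_all add: op_simps 4\<close>)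
  show "T \<otimes> c = d \<otimes> T" by (rule op_inj) (use pq c s(2) in \<open>simp_all add: op_simps\<close>)
  show "T \<otimes> (x \<otimes> T) \<oplus> (2 * eps) \<odot> (c \<otimes> (d \<otimes> (x \<otimes> T))) = 4 \<odot> y"
    by (rule op_inj) (use pq c s(3) in \<open>simp_all add: op_simps 4 add.assoc\<close>)
qed

lemma hc_of_spin_braid_ring:
  assumes c: "c \<in> carrier A" "d \<in> carrier A" "f \<in> carrier A" "R \<in> carrier A" "S \<in> carrier A"
    and r: "c \<otimes> c = \<one>" "d \<otimes> d = \<one>" "f \<otimes> f = \<one>" 
      "d \<otimes> c = \<ominus> (c \<otimes> d)" "f \<otimes> c = \<ominus> (c \<otimes> f)" "f \<otimes> d = \<ominus> (d \<otimes> f)" 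
      "R \<otimes> c = \<ominus> (c \<otimes> R)" "R \<otimes> d = \<ominus> (d \<otimes> R)" "R \<otimes> f = \<ominus> (f \<otimes> R)" 
      "S \<otimes> c = \<ominus> (c \<otimes> S)" "S \<otimes> d = \<ominus> (d \<otimes> S)" "S \<otimes> f = \<ominus> (f \<otimes> S)" 
    and r2: "R \<otimes> R = (- (eps ^ 2) - 2) \<odot> \<one>" "S \<otimes> S = (- (eps ^ 2) - 2) \<odot> \<one>"
       "R \<otimes> (S \<otimes> R) \<ominus> S \<otimes> (R \<otimes> S) = eps ^ 2 \<odot> (S \<ominus> R)"
    and T: "T = R \<otimes> d \<ominus> R \<otimes> c \<oplus> eps \<odot> \<one> \<ominus> eps \<odot> (c \<otimes> d)"
    and U: "U = S \<otimes> f \<ominus> S \<otimes> d \<oplus> eps \<odot> \<one> \<ominus> eps \<odot> (d \<otimes> f)"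
  shows "T \<otimes> (U \<otimes> T) = U \<otimes> (T \<otimes> U)"
proof -
  obtain op where "op_rep A op" using op_rep_exists by (elim exE)
  then interpret op_rep A op .
  have 2: "scale (- (eps ^ 2) - 2) w = - scale eps (scale eps w) - w - w" for w :: "'a \<Rightarrow>\<^sub>0 cq"
    by (rule poly_mapping_eqI) (simp add: lookup_minus lookup_add power2_eq_square algebra_simps)
  have 3: "scale (eps ^ 2) (v - w) = scale eps (scale eps v) - scale eps (scale eps w)" for v w :: "'a \<Rightarrow>\<^sub>0 cq"
    by (rule poly_mapping_eqI) (simp add: lookup_minus lookup_add power2_eq_square algebra_simps)
  have t: "op R (op R v) = - op (eps \<odot> \<one>) (op (eps \<odot> \<one>) (op \<one> v)) - op \<one> v - op \<one> v"
    "op S (op S v) = - op (eps \<odot> \<one>) (op (eps \<odot> \<one>) (op \<one> v)) - op \<one> v - op \<one> v"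
    "op R (op S (op R v)) - op S (op R (op S v)) = 
       op (eps \<odot> \<one>) (op (eps \<odot> \<one>) (op S v)) - op (eps \<odot> \<one>) (op (eps \<odot> \<one>) (op R v))" for v
    using r2[THEN arg_cong, of "\<lambda>a. op a v"] c by (simp_all add: op_simps 2 3)
  interpret spin_braid "op \<one>" "op (eps \<odot> \<one>)" "op ` carrier A" "op c" "op d" "op f" "op R" "op S"
    by unfold_locales (use c in \<open>simp_all add: t, simp_all add: op_mult[symmetric] op_uminus[symmetric] r\<close>)
  have pq: "T \<in> carrier A" "U \<in> carrier A" using c by (simp_all add: U T)
  have o: "op T v = op R (op d v) - op R (op c v) + op (eps \<odot> \<one>) v - op (eps \<odot> \<one>) (op c (op d v))" 
    "op U v = op S (op f v) - op S (op d v) + op (eps \<odot> \<one>) v - op (eps \<odot> \<one>) (op d (op f v))" for v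
    using c by (simp_all add: U T op_simps)
  show ?thesis by (rule op_inj) (use pq c hc_of_spin_braid[OF o] in \<open>simp_all add: op_simps\<close>)
qed

end

lemma qpar_nz: "qpar \<noteq> 0"
  by (simp add: qpar_def eq_fract Zero_fract_def)

context superalgebra
begin

text \<open>
  Every term of \<open>R\<close> contains exactly one of the letters \<open>c\<close>, \<open>d\<close>, so \<open>R\<close> inherits the sign with which these
  pass \<open>z\<close>. In \<open>T_comm\<close> every term of \<open>T\<close> contains an even number of the letters \<open>c\<close>, \<open>d\<close>, \<open>R\<close>, so signs cancel.
\<close>

lemma R_comm:
  assumes c: "c \<in> carrier A" "d \<in> carrier A" "T \<in> carrier A" "z \<in> carrier A"
    and R: "R = (c \<ominus> d) \<otimes> T \<oplus> eps \<odot> d" and T: "T \<otimes> z = z \<otimes> T"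
  shows "c \<otimes> z = z \<otimes> c \<Longrightarrow> d \<otimes> z = z \<otimes> d \<Longrightarrow> R \<otimes> z = z \<otimes> R"
    "c \<otimes> z = \<ominus> (z \<otimes> c) \<Longrightarrow> d \<otimes> z = \<ominus> (z \<otimes> d) \<Longrightarrow> R \<otimes> z = \<ominus> (z \<otimes> R)"
proof -
  have e: "R \<otimes> z = c \<otimes> (T \<otimes> z) \<ominus> d \<otimes> (T \<otimes> z) \<oplus> eps \<odot> (d \<otimes> z)"
    using c by (simp add: R l_distr r_distr minus_eq l_minus m_assoc smult_mult_l)
  have f: "z \<otimes> R = z \<otimes> (c \<otimes> T) \<ominus> z \<otimes> (d \<otimes> T) \<oplus> eps \<odot> (z \<otimes> d)"
    using c by (simp add: R l_distr r_distr minus_eq l_minus r_minus m_assoc smult_mult_r)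
  show "R \<otimes> z = z \<otimes> R" if h: "c \<otimes> z = z \<otimes> c" "d \<otimes> z = z \<otimes> d"
    unfolding e f T using c h by (simp add: m_assoc[symmetric])
  show "R \<otimes> z = \<ominus> (z \<otimes> R)" if h: "c \<otimes> z = \<ominus> (z \<otimes> c)" "d \<otimes> z = \<ominus> (z \<otimes> d)"
    unfolding e f T using c h
    by (simp add: m_assoc[symmetric]) (simp add: m_assoc l_minus minus_eq minus_add smult_minus_right)
qed

lemma T_comm:
  assumes c: "c \<in> carrier A" "d \<in> carrier A" "R \<in> carrier A" "z \<in> carrier A"
    and T: "T = R \<otimes> d \<ominus> R \<otimes> c \<oplus> eps \<odot> \<one> \<ominus> eps \<odot> (c \<otimes> d)"
  shows "c \<otimes> z = z \<otimes> c \<Longrightarrow> d \<otimes> z = z \<otimes> d \<Longrightarrow> R \<otimes> z = z \<otimes> R \<Longrightarrow> T \<otimes> z = z \<otimes> T"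
    "c \<otimes> z = \<ominus> (z \<otimes> c) \<Longrightarrow> d \<otimes> z = \<ominus> (z \<otimes> d) \<Longrightarrow> R \<otimes> z = \<ominus> (z \<otimes> R) \<Longrightarrow> T \<otimes> z = z \<otimes> T"
proof -
  have e: "T \<otimes> z = R \<otimes> (d \<otimes> z) \<ominus> R \<otimes> (c \<otimes> z) \<oplus> eps \<odot> z \<ominus> eps \<odot> (c \<otimes> (d \<otimes> z))"
    using c by (simp add: T l_distr r_distr minus_eq l_minus m_assoc smult_mult_l)
  have f: "z \<otimes> T = z \<otimes> (R \<otimes> d) \<ominus> z \<otimes> (R \<otimes> c) \<oplus> eps \<odot> z \<ominus> eps \<odot> (z \<otimes> (c \<otimes> d))"
    using c by (simp add: T l_distr r_distr minus_eq r_minus m_assoc smult_mult_r)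
  show "T \<otimes> z = z \<otimes> T" if h: "c \<otimes> z = z \<otimes> c" "d \<otimes> z = z \<otimes> d" "R \<otimes> z = z \<otimes> R"
  proof -
    have "R \<otimes> (z \<otimes> w) = z \<otimes> (R \<otimes> w)" "c \<otimes> (z \<otimes> w) = z \<otimes> (c \<otimes> w)" if "w \<in> carrier A" for w
      using h c that by (simp_all add: m_assoc[symmetric])
    then show ?thesis unfolding e f using c h by simp
  qed
  show "T \<otimes> z = z \<otimes> T" if h: "c \<otimes> z = \<ominus> (z \<otimes> c)" "d \<otimes> z = \<ominus> (z \<otimes> d)" "R \<otimes> z = \<ominus> (z \<otimes> R)"
  proof -
    have "R \<otimes> (z \<otimes> w) = \<ominus> (z \<otimes> (R \<otimes> w))" "c \<otimes> (z \<otimes> w) = \<ominus> (z \<otimes> (c \<otimes> w))" if "w \<in> carrier A" for w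
      using h c that by (simp_all add: m_assoc[symmetric]) (simp_all add: l_minus)
    then show ?thesis unfolding e f using c h by (simp add: r_minus)
  qed
qed

text \<open>
  The defining relations as equations, in the form in which the calculations below use them.
\<close>

definition clifford_relations :: "nat \<Rightarrow> (nat \<Rightarrow> 'a) \<Rightarrow> bool" where
  "clifford_relations n c \<longleftrightarrow> (\<forall>i. i \<in> {1..n} \<longrightarrow> c i \<otimes> c i = \<one>) \<and>
     (\<forall>i j. i \<in> {1..n} \<and> j \<in> {1..n} \<and> i \<noteq> j \<longrightarrow> c i \<otimes> c j = \<ominus> (c j \<otimes> c i))"

definition hc_relations :: "nat \<Rightarrow> (nat \<Rightarrow> 'a) \<Rightarrow> (nat \<Rightarrow> 'a) \<Rightarrow> (nat \<Rightarrow> 'a) \<Rightarrow> (nat \<Rightarrow> 'a) \<Rightarrow> bool" where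
  "hc_relations n T c x x' \<longleftrightarrow>
     (\<forall>i. i \<in> {1..<n} \<longrightarrow> T i \<otimes> T i = eps \<odot> T i \<oplus> \<one>) \<and>
     (\<forall>i. i \<in> {1..<n} \<and> i + 1 \<in> {1..<n} \<longrightarrow> T i \<otimes> (T (i + 1) \<otimes> T i) = T (i + 1) \<otimes> (T i \<otimes> T (i + 1))) \<and>
     (\<forall>i j. i \<in> {1..<n} \<and> j \<in> {1..<n} \<and> (i + 1 < j \<or> j + 1 < i) \<longrightarrow> T i \<otimes> T j = T j \<otimes> T i) \<and>
     (\<forall>i. i \<in> {1..<n} \<longrightarrow> T i \<otimes> c i = c (i + 1) \<otimes> T i) \<and>
     (\<forall>i j. i \<in> {1..<n} \<and> j \<in> {1..n} \<and> j \<noteq> i \<and> j \<noteq> i + 1 \<longrightarrow> T i \<otimes> c j = c j \<otimes> T i) \<and>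
     (\<forall>i. i \<in> {1..n} \<longrightarrow> c i \<otimes> c i = \<one>) \<and>
     (\<forall>i j. i \<in> {1..n} \<and> j \<in> {1..n} \<and> i \<noteq> j \<longrightarrow> c i \<otimes> c j = \<ominus> (c j \<otimes> c i)) \<and>
     (\<forall>i. i \<in> {1..n} \<longrightarrow> x i \<otimes> x' i = \<one>) \<and>
     (\<forall>i. i \<in> {1..n} \<longrightarrow> x' i \<otimes> x i = \<one>) \<and>
     (\<forall>i. i \<in> {1..<n} \<longrightarrow> T i \<otimes> (x i \<otimes> T i) \<oplus> eps \<odot> (c i \<otimes> (c (i + 1) \<otimes> (x i \<otimes> T i))) = x (i + 1)) \<and>
     (\<forall>i j. i \<in> {1..<n} \<and> j \<in> {1..n} \<and> j \<noteq> i \<and> j \<noteq> i + 1 \<longrightarrow> T i \<otimes> x j = x j \<otimes> T i) \<and>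
     (\<forall>i j. i \<in> {1..n} \<and> j \<in> {1..n} \<longrightarrow> x i \<otimes> x j = x j \<otimes> x i) \<and>
     (\<forall>i. i \<in> {1..n} \<longrightarrow> x i \<otimes> c i = c i \<otimes> x' i) \<and>
     (\<forall>i j. i \<in> {1..n} \<and> j \<in> {1..n} \<and> i \<noteq> j \<longrightarrow> x i \<otimes> c j = c j \<otimes> x i)"

definition spin_relations :: "nat \<Rightarrow> (nat \<Rightarrow> 'a) \<Rightarrow> (nat \<Rightarrow> 'a) \<Rightarrow> (nat \<Rightarrow> 'a) \<Rightarrow> bool" where
  "spin_relations n R p q \<longleftrightarrow>
     (\<forall>i. i \<in> {1..<n} \<longrightarrow> R i \<otimes> R i = (- (eps ^ 2) - 2) \<odot> \<one>) \<and>
     (\<forall>i j. i \<in> {1..<n} \<and> j \<in> {1..<n} \<and> (i + 1 < j \<or> j + 1 < i) \<longrightarrow> R i \<otimes> R j = \<ominus> (R j \<otimes> R i)) \<and>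
     (\<forall>i. i \<in> {1..<n} \<and> i + 1 \<in> {1..<n} \<longrightarrow>
        R i \<otimes> (R (i + 1) \<otimes> R i) \<ominus> R (i + 1) \<otimes> (R i \<otimes> R (i + 1)) = eps ^ 2 \<odot> (R (i + 1) \<ominus> R i)) \<and>
     (\<forall>i j. i \<in> {1..n} \<and> j \<in> {1..n} \<and> i \<noteq> j \<longrightarrow> p i \<otimes> p j = p j \<otimes> p i) \<and>
     (\<forall>i j. i \<in> {1..n} \<and> j \<in> {1..n} \<and> i \<noteq> j \<longrightarrow> q i \<otimes> q j = \<ominus> (q j \<otimes> q i)) \<and>
     (\<forall>i. i \<in> {1..n} \<longrightarrow> p i \<otimes> p i \<oplus> q i \<otimes> q i = \<one>) \<and>
     (\<forall>i j. i \<in> {1..n} \<and> j \<in> {1..n} \<longrightarrow> p i \<otimes> q j = q j \<otimes> p i) \<and>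
     (\<forall>i j. i \<in> {1..<n} \<and> j \<in> {1..n} \<and> j \<noteq> i \<and> j \<noteq> i + 1 \<longrightarrow> R i \<otimes> p j = p j \<otimes> R i) \<and>
     (\<forall>i j. i \<in> {1..<n} \<and> j \<in> {1..n} \<and> j \<noteq> i \<and> j \<noteq> i + 1 \<longrightarrow> R i \<otimes> q j = \<ominus> (q j \<otimes> R i)) \<and>
     (\<forall>i. i \<in> {1..<n} \<longrightarrow> R i \<otimes> p i = p (i + 1) \<otimes> R i \<oplus> eps \<odot> (q i \<ominus> q (i + 1))) \<and>
     (\<forall>i. i \<in> {1..<n} \<longrightarrow> R i \<otimes> q i = \<ominus> (q (i + 1) \<otimes> R i) \<ominus> eps \<odot> (p i \<oplus> p (i + 1)))"

lemma add_zero_iff: "u \<in> carrier A \<Longrightarrow> v \<in> carrier A \<Longrightarrow> u \<oplus> v = \<zero> \<longleftrightarrow> u = \<ominus> v"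
  using diff_zero_iff[of u "\<ominus> v"] by (simp add: a_minus_def)

lemma relator_quadratic:
  assumes "T \<in> carrier A"
  shows "(T \<ominus> qpar \<odot> \<one>) \<otimes> (T \<oplus> inverse qpar \<odot> \<one>) = \<zero> \<longleftrightarrow> T \<otimes> T = eps \<odot> T \<oplus> \<one>"
proof -
  have "(T \<ominus> qpar \<odot> \<one>) \<otimes> (T \<oplus> inverse qpar \<odot> \<one>) = T \<otimes> T \<ominus> (eps \<odot> T \<oplus> \<one>)"
    using assms qpar_nz 
    by (simp add: minus_eq l_distr r_distr smult_mult_l smult_mult_r l_minus smult_assoc[symmetric] smult_l_distr smult_r_distr
        smult_minus_left smult_minus_right minus_add eps_def diff_conv_add_uminus del: add_uminus_conv_diff) (simp add: a_ac)
  then show ?thesis using assms by (simp add: diff_zero_iff)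
qed

lemma relator_affine:
  assumes "T \<in> carrier A" "c \<in> carrier A" "d \<in> carrier A" "x \<in> carrier A" "y \<in> carrier A"
  shows "(T \<oplus> (eps \<odot> \<one>) \<otimes> c \<otimes> d) \<otimes> x \<otimes> T \<ominus> y = \<zero> \<longleftrightarrow> T \<otimes> (x \<otimes> T) \<oplus> eps \<odot> (c \<otimes> (d \<otimes> (x \<otimes> T))) = y"
proof -
  have "(T \<oplus> (eps \<odot> \<one>) \<otimes> c \<otimes> d) \<otimes> x \<otimes> T = T \<otimes> (x \<otimes> T) \<oplus> eps \<odot> (c \<otimes> (d \<otimes> (x \<otimes> T)))"
    using assms by (simp add: l_distr smult_mult_l m_assoc)
  then show ?thesis using assms by (simp add: diff_zero_iff)
qed

lemma relator_spin:
  assumes "u \<in> carrier A" "v \<in> carrier A" "a \<in> carrier A" "b \<in> carrier A"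
  shows "u \<ominus> v \<ominus> (k \<odot> \<one>) \<otimes> (a \<ominus> b) = \<zero> \<longleftrightarrow> u = v \<oplus> k \<odot> (a \<ominus> b)"
    "u \<ominus> v \<ominus> (k \<odot> \<one>) \<otimes> (a \<ominus> b) = \<zero> \<longleftrightarrow> u \<ominus> v = k \<odot> (a \<ominus> b)"
    "u \<oplus> v \<oplus> (k \<odot> \<one>) \<otimes> (a \<oplus> b) = \<zero> \<longleftrightarrow> u = \<ominus> v \<ominus> k \<odot> (a \<oplus> b)"
proof -
  have "u \<ominus> v \<ominus> (k \<odot> \<one>) \<otimes> (a \<ominus> b) = u \<ominus> (v \<oplus> k \<odot> (a \<ominus> b))"
    using assms by (simp add: minus_eq smult_mult_l minus_add a_assoc)
  then show "u \<ominus> v \<ominus> (k \<odot> \<one>) \<otimes> (a \<ominus> b) = \<zero> \<longleftrightarrow> u = v \<oplus> k \<odot> (a \<ominus> b)"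
    using assms by (simp add: diff_zero_iff)
  show "u \<ominus> v \<ominus> (k \<odot> \<one>) \<otimes> (a \<ominus> b) = \<zero> \<longleftrightarrow> u \<ominus> v = k \<odot> (a \<ominus> b)"
    using assms by (simp add: diff_zero_iff smult_mult_l)
  have "u \<oplus> v \<oplus> (k \<odot> \<one>) \<otimes> (a \<oplus> b) = u \<ominus> (\<ominus> v \<ominus> k \<odot> (a \<oplus> b))"
    using assms by (simp add: minus_eq smult_mult_l minus_add a_assoc)
  then show "u \<oplus> v \<oplus> (k \<odot> \<one>) \<otimes> (a \<oplus> b) = \<zero> \<longleftrightarrow> u = \<ominus> v \<ominus> k \<odot> (a \<oplus> b)"
    using assms by (simp add: diff_zero_iff)
qed

end

lemma free_closed [simp]:
  fixes x y :: "'g list \<Rightarrow>\<^sub>0 cq"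
  shows "x \<in> carrier (free_superalg G par) \<Longrightarrow> y \<in> carrier (free_superalg G par) \<Longrightarrow> x * y \<in> carrier (free_superalg G par)"
   "x \<in> carrier (free_superalg G par) \<Longrightarrow> y \<in> carrier (free_superalg G par) \<Longrightarrow> x + y \<in> carrier (free_superalg G par)"
   "x \<in> carrier (free_superalg G par) \<Longrightarrow> y \<in> carrier (free_superalg G par) \<Longrightarrow> x - y \<in> carrier (free_superalg G par)"
   "scal k \<in> carrier (free_superalg G par)" "1 \<in> carrier (free_superalg G par)"
proof -
  interpret F: superalgebra "free_superalg G par" by (rule free_superalgebra)
  interpret P: fspace "free_superalg G par" "lists G" by (rule free_fspace)
  show "x \<in> carrier (free_superalg G par) \<Longrightarrow> y \<in> carrier (free_superalg G par) \<Longrightarrow> x * y \<in> carrier (free_superalg G par)"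
    using F.mult_closed[of x y] by (simp only: free_simps(2))
  show "x \<in> carrier (free_superalg G par) \<Longrightarrow> y \<in> carrier (free_superalg G par) \<Longrightarrow> x + y \<in> carrier (free_superalg G par)"
    using F.add.m_closed[of x y] by (simp only: free_simps(5))
  show "x \<in> carrier (free_superalg G par) \<Longrightarrow> y \<in> carrier (free_superalg G par) \<Longrightarrow> x - y \<in> carrier (free_superalg G par)"
    by (rule P.diff_closed)
  show "scal k \<in> carrier (free_superalg G par)" by (rule P.single_closed) simp
  show "1 \<in> carrier (free_superalg G par)"
    using F.unit_closed by (simp only: free_simps(3))
qed

lemma free_hom_simps:
  fixes x y :: "'g list \<Rightarrow>\<^sub>0 cq"
  assumes h: "h \<in> alg_hom (free_superalg G par) A" and A: "superalgebra A"
  shows "x \<in> carrier (free_superalg G par) \<Longrightarrow> y \<in> carrier (free_superalg G par) \<Longrightarrow> h (x * y) = h x \<otimes>\<^bsub>A\<^esub> h y"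
   "x \<in> carrier (free_superalg G par) \<Longrightarrow> y \<in> carrier (free_superalg G par) \<Longrightarrow> h (x + y) = h x \<oplus>\<^bsub>A\<^esub> h y"
   "x \<in> carrier (free_superalg G par) \<Longrightarrow> y \<in> carrier (free_superalg G par) \<Longrightarrow> h (x - y) = h x \<ominus>\<^bsub>A\<^esub> h y"
   "h (scal k) = k \<odot>\<^bsub>A\<^esub> \<one>\<^bsub>A\<^esub>" "h 1 = \<one>\<^bsub>A\<^esub>"
proof -
  interpret A: superalgebra A by fact
  interpret P: fspace "free_superalg G par" "lists G" by (rule free_fspace)
  note hD = alg_homD[OF h] lin_map_more[OF alg_homD(1)[OF h] P.vspace_axioms A.vspace_axioms]
  show "x \<in> carrier (free_superalg G par) \<Longrightarrow> y \<in> carrier (free_superalg G par) \<Longrightarrow> h (x * y) = h x \<otimes>\<^bsub>A\<^esub> h y"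
    using hD(2)[of x y] by (simp only: free_simps(2))
  show "x \<in> carrier (free_superalg G par) \<Longrightarrow> y \<in> carrier (free_superalg G par) \<Longrightarrow> h (x + y) = h x \<oplus>\<^bsub>A\<^esub> h y"
    using hD(6)[of x y] by (simp only: free_simps(5))
  show "x \<in> carrier (free_superalg G par) \<Longrightarrow> y \<in> carrier (free_superalg G par) \<Longrightarrow> h (x - y) = h x \<ominus>\<^bsub>A\<^esub> h y"
    using hD(9)[of x y] by (simp only: P.a_minus_eq)
  show 1: "h 1 = \<one>\<^bsub>A\<^esub>" using hD(3) by (simp only: free_simps(3))
  have "scal k = scale k (1 :: 'g list \<Rightarrow>\<^sub>0 cq)" by (simp add: one_eq_single)
  then show "h (scal k) = k \<odot>\<^bsub>A\<^esub> \<one>\<^bsub>A\<^esub>" using hD(5)[OF free_closed(5), of k] 1 by (simp only: free_simps(6))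
qed

lemma gen_in_free [simp]: "g \<in> G \<Longrightarrow> gen g \<in> carrier (free_superalg G par)"
  by (simp add: free_simps)

lemma ball_setcompr1: "(\<forall>r\<in>{f i | i. P i}. Q r) \<longleftrightarrow> (\<forall>i. P i \<longrightarrow> Q (f i))" by blast
lemma ball_setcompr2: "(\<forall>r\<in>{f i j | i j. P i j}. Q r) \<longleftrightarrow> (\<forall>i j. P i j \<longrightarrow> Q (f i j))" by blast

context superalgebra
begin

text \<open>
  A relator is sent to zero iff the corresponding equation holds, one equivalence for each shape of
  relator that occurs in the three presentations.
\<close>

lemma relator_iffs:
  fixes a b c d f :: "'g list \<Rightarrow>\<^sub>0 cq"
  assumes h: "h \<in> alg_hom (free_superalg G par) A"
    and F: "a \<in> carrier (free_superalg G par)" "b \<in> carrier (free_superalg G par)" 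
  shows relator_swap: "c \<in> carrier (free_superalg G par) \<Longrightarrow> d \<in> carrier (free_superalg G par) \<Longrightarrow>
      h (a * b - c * d) = \<zero> \<longleftrightarrow> h a \<otimes> h b = h c \<otimes> h d"
    and relator_anti: "h (a * b + b * a) = \<zero> \<longleftrightarrow> h a \<otimes> h b = \<ominus> (h b \<otimes> h a)"
    and relator_inv: "h (a * b - 1) = \<zero> \<longleftrightarrow> h a \<otimes> h b = \<one>"
    and relator_circle: "h (a * a + b * b - 1) = \<zero> \<longleftrightarrow> h a \<otimes> h a \<oplus> h b \<otimes> h b = \<one>"
    and relator_scal: "h (a * b - scal k) = \<zero> \<longleftrightarrow> h a \<otimes> h b = k \<odot> \<one>"
    and relator_quad: "h ((a - scal qpar) * (a + scal (inverse qpar))) = \<zero> \<longleftrightarrow> h a \<otimes> h a = eps \<odot> h a \<oplus> \<one>"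
    and relator_braid: "h (a * b * a - b * a * b) = \<zero> \<longleftrightarrow> h a \<otimes> (h b \<otimes> h a) = h b \<otimes> (h a \<otimes> h b)"
    and relator_spin_braid: "h (a * b * a - b * a * b - scal k * (b - a)) = \<zero> \<longleftrightarrow>
        h a \<otimes> (h b \<otimes> h a) \<ominus> h b \<otimes> (h a \<otimes> h b) = k \<odot> (h b \<ominus> h a)"
    and relator_affine': "c \<in> carrier (free_superalg G par) \<Longrightarrow> d \<in> carrier (free_superalg G par) \<Longrightarrow> f \<in> carrier (free_superalg G par) \<Longrightarrow>
      h ((a + scal eps * c * d) * f * a - b) = \<zero> \<longleftrightarrow> 
      h a \<otimes> (h f \<otimes> h a) \<oplus> eps \<odot> (h c \<otimes> (h d \<otimes> (h f \<otimes> h a))) = h b"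
    and relator_p: "c \<in> carrier (free_superalg G par) \<Longrightarrow> d \<in> carrier (free_superalg G par) \<Longrightarrow> f \<in> carrier (free_superalg G par) \<Longrightarrow>
      h (a * b - c * a - scal k * (d - f)) = \<zero> \<longleftrightarrow> h a \<otimes> h b = h c \<otimes> h a \<oplus> k \<odot> (h d \<ominus> h f)"
    and relator_q: "c \<in> carrier (free_superalg G par) \<Longrightarrow> d \<in> carrier (free_superalg G par) \<Longrightarrow> f \<in> carrier (free_superalg G par) \<Longrightarrow>
      h (a * b + c * a + scal k * (d + f)) = \<zero> \<longleftrightarrow> h a \<otimes> h b = \<ominus> (h c \<otimes> h a) \<ominus> k \<odot> (h d \<oplus> h f)"
proof -
  note S = free_hom_simps[OF h superalgebra_axioms] alg_homD(4)[OF h]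
  show "c \<in> carrier (free_superalg G par) \<Longrightarrow> d \<in> carrier (free_superalg G par) \<Longrightarrow>
      h (a * b - c * d) = \<zero> \<longleftrightarrow> h a \<otimes> h b = h c \<otimes> h d" by (simp add: S F diff_zero_iff)
  show "h (a * b + b * a) = \<zero> \<longleftrightarrow> h a \<otimes> h b = \<ominus> (h b \<otimes> h a)" by (simp add: S F add_zero_iff)
  show "h (a * b - 1) = \<zero> \<longleftrightarrow> h a \<otimes> h b = \<one>" by (simp add: S F diff_zero_iff)
  show "h (a * a + b * b - 1) = \<zero> \<longleftrightarrow> h a \<otimes> h a \<oplus> h b \<otimes> h b = \<one>" by (simp add: S F diff_zero_iff)
  show "h (a * b - scal k) = \<zero> \<longleftrightarrow> h a \<otimes> h b = k \<odot> \<one>" by (simp add: S F diff_zero_iff)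
  show "h ((a - scal qpar) * (a + scal (inverse qpar))) = \<zero> \<longleftrightarrow> h a \<otimes> h a = eps \<odot> h a \<oplus> \<one>" 
    by (simp add: S F relator_quadratic)
  show "h (a * b * a - b * a * b) = \<zero> \<longleftrightarrow> h a \<otimes> (h b \<otimes> h a) = h b \<otimes> (h a \<otimes> h b)"
    by (simp add: S F diff_zero_iff m_assoc)
  show "h (a * b * a - b * a * b - scal k * (b - a)) = \<zero> \<longleftrightarrow>
        h a \<otimes> (h b \<otimes> h a) \<ominus> h b \<otimes> (h a \<otimes> h b) = k \<odot> (h b \<ominus> h a)"
    by (simp add: S F relator_spin(2) m_assoc)
  show "h ((a + scal eps * c * d) * f * a - b) = \<zero> \<longleftrightarrow> 
      h a \<otimes> (h f \<otimes> h a) \<oplus> eps \<odot> (h c \<otimes> (h d \<otimes> (h f \<otimes> h a))) = h b"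
    if "c \<in> carrier (free_superalg G par)" "d \<in> carrier (free_superalg G par)" "f \<in> carrier (free_superalg G par)"
    using relator_affine[of "h a" "h c" "h d" "h f" "h b"] by (simp add: S F that)
  show "h (a * b - c * a - scal k * (d - f)) = \<zero> \<longleftrightarrow> h a \<otimes> h b = h c \<otimes> h a \<oplus> k \<odot> (h d \<ominus> h f)"
    if "c \<in> carrier (free_superalg G par)" "d \<in> carrier (free_superalg G par)" "f \<in> carrier (free_superalg G par)"
    using relator_spin(1)[of "h a \<otimes> h b" "h c \<otimes> h a" "h d" "h f" k] by (simp add: S F that)
  show "h (a * b + c * a + scal k * (d + f)) = \<zero> \<longleftrightarrow> h a \<otimes> h b = \<ominus> (h c \<otimes> h a) \<ominus> k \<odot> (h d \<oplus> h f)"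
    if "c \<in> carrier (free_superalg G par)" "d \<in> carrier (free_superalg G par)" "f \<in> carrier (free_superalg G par)"
    using relator_spin(3)[of "h a \<otimes> h b" "h c \<otimes> h a" "h d" "h f" k] by (simp add: S F that)
qed

lemma clifford_rels_iff:
  assumes h: "h \<in> alg_hom (free_superalg (ClC ` {1..n}) par) A"
  shows "(\<forall>r\<in>clifford_rels n. h r = \<zero>) \<longleftrightarrow> clifford_relations n (\<lambda>i. h (gen (ClC i)))"
proof -
  have g: "gen (ClC i) \<in> carrier (free_superalg (ClC ` {1..n}) par)" if "i \<in> {1..n}" for i using that by simp
  show ?thesis
    unfolding clifford_rels_def Let_def ball_Un ball_setcompr1 ball_setcompr2 clifford_relations_def
    by (intro arg_cong2[where f="(\<and>)"] all_cong1 imp_cong refl; (elim conjE)?;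
      rule relator_inv[OF h] relator_anti[OF h]; blast intro: g)
qed

lemma hc_rels_iff:
  assumes h: "h \<in> alg_hom (free_superalg (hc_gens n) par) A"
  shows "(\<forall>r\<in>hc_rels n. h r = \<zero>) \<longleftrightarrow> 
    hc_relations n (\<lambda>i. h (gen (HcT i))) (\<lambda>i. h (gen (HcC i))) (\<lambda>i. h (gen (HcX i))) (\<lambda>i. h (gen (HcXi i)))"
proof -
  have g: "i \<in> {1..n} \<Longrightarrow> gen (HcC i) \<in> carrier (free_superalg (hc_gens n) par)" 
    "i \<in> {1..n} \<Longrightarrow> gen (HcX i) \<in> carrier (free_superalg (hc_gens n) par)" 
    "i \<in> {1..n} \<Longrightarrow> gen (HcXi i) \<in> carrier (free_superalg (hc_gens n) par)" 
    "i \<in> {1..<n} \<Longrightarrow> gen (HcT i) \<in> carrier (free_superalg (hc_gens n) par)" for i 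
    by (simp_all add: hc_gens_def)
  have g': "i \<in> {1..<n} \<Longrightarrow> i \<in> {1..n}" "i \<in> {1..<n} \<Longrightarrow> i + 1 \<in> {1..n}" for i by auto
  show ?thesis
    unfolding hc_rels_def Let_def ball_Un ball_setcompr1 ball_setcompr2 hc_relations_def conj_assoc
    by (intro arg_cong2[where f="(\<and>)"] all_cong1 imp_cong refl; (elim conjE)?;
      rule relator_quad[OF h] relator_braid[OF h] relator_inv[OF h] relator_anti[OF h] relator_affine'[OF h] relator_swap[OF h]; 
      blast intro: g g')
qed

lemma spin_rels_iff:
  assumes h: "h \<in> alg_hom (free_superalg (spin_gens n) par) A"
  shows "(\<forall>r\<in>spin_rels n. h r = \<zero>) \<longleftrightarrow> 
    spin_relations n (\<lambda>i. h (gen (SpR i))) (\<lambda>i. h (gen (SpP i))) (\<lambda>i. h (gen (SpQ i)))"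
proof -
  have g: "i \<in> {1..n} \<Longrightarrow> gen (SpP i) \<in> carrier (free_superalg (spin_gens n) par)" 
    "i \<in> {1..n} \<Longrightarrow> gen (SpQ i) \<in> carrier (free_superalg (spin_gens n) par)" 
    "i \<in> {1..<n} \<Longrightarrow> gen (SpR i) \<in> carrier (free_superalg (spin_gens n) par)" for i 
    by (simp_all add: spin_gens_def)
  have g': "i \<in> {1..<n} \<Longrightarrow> i \<in> {1..n}" "i \<in> {1..<n} \<Longrightarrow> i + 1 \<in> {1..n}" for i by auto
  show ?thesis
    unfolding spin_rels_def Let_def ball_Un ball_setcompr1 ball_setcompr2 spin_relations_def conj_assoc
    by (intro arg_cong2[where f="(\<and>)"] all_cong1 imp_cong refl; (elim conjE)?;
      rule relator_scal[OF h] relator_spin_braid[OF h] relator_circle[OF h] relator_p[OF h] relator_q[OF h]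
        relator_anti[OF h] relator_swap[OF h]; 
      blast intro: g g')
qed

end

context superalgebra
begin

text \<open>
  Elements that satisfy the relations of the affine Hecke-Clifford algebra yield, through the formulas
  for \<open>\<Psi>\<close>, elements that satisfy the relations of the spin affine Hecke algebra and supercommute
  with the \<open>c\<^sub>i\<close>. This holds in any superalgebra. Relations of neighbouring strands
  are the instances of the identities above; those of distant strands are instances of \<open>R_comm\<close>.
\<close>

lemma spin_of_hc:
  assumes cT: "\<And>i. i \<in> {1..<n} \<Longrightarrow> T i \<in> carrier A" and cc: "\<And>i. i \<in> {1..n} \<Longrightarrow> c i \<in> carrier A"
    and cx: "\<And>i. i \<in> {1..n} \<Longrightarrow> x i \<in> carrier A" "\<And>i. i \<in> {1..n} \<Longrightarrow> x' i \<in> carrier A"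
    and rel: "hc_relations n T c x x'"
    and R: "\<And>i. R i = (c i \<ominus> c (i + 1)) \<otimes> T i \<oplus> eps \<odot> c (i + 1)"
    and p: "\<And>i. p i = (1 / 2) \<odot> (x i \<oplus> x' i)" and q: "\<And>i. q i = (1 / 2) \<odot> ((x i \<ominus> x' i) \<otimes> c i)"
  shows "spin_relations n R p q"
    "i \<in> {1..<n} \<Longrightarrow> j \<in> {1..n} \<Longrightarrow> R i \<otimes> c j = \<ominus> (c j \<otimes> R i)"
    "i \<in> {1..n} \<Longrightarrow> j \<in> {1..n} \<Longrightarrow> p i \<otimes> c j = c j \<otimes> p i"
    "i \<in> {1..n} \<Longrightarrow> j \<in> {1..n} \<Longrightarrow> q i \<otimes> c j = \<ominus> (c j \<otimes> q i)"
proof -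
  define u where "u i = x i \<oplus> x' i" for i
  define w where "w i = (x i \<ominus> x' i) \<otimes> c i" for i
  have p': "p i = (1 / 2) \<odot> u i" and q': "q i = (1 / 2) \<odot> w i" for i by (simp_all add: p q u_def w_def)
  have up: "i \<in> {1..n}" "i + 1 \<in> {1..n}" if "i \<in> {1..<n}" for i using that by auto
  have cu: "u i \<in> carrier A" "w i \<in> carrier A" if "i \<in> {1..n}" for i using that cx cc by (simp_all add: u_def w_def)
  have cR: "R i \<in> carrier A" if "i \<in> {1..<n}" for i using that up[OF that] cT cc by (simp add: R)
  note ar0 = rel[unfolded hc_relations_def]
  note a1 = ar0[THEN conjunct1, rule_format] and ar1 = ar0[THEN conjunct2]
  note a2 = ar1[THEN conjunct1, rule_format] and ar2 = ar1[THEN conjunct2]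
  note a3 = ar2[THEN conjunct1, rule_format] and ar3 = ar2[THEN conjunct2]
  note a4 = ar3[THEN conjunct1, rule_format] and ar4 = ar3[THEN conjunct2]
  note a5 = ar4[THEN conjunct1, rule_format] and ar5 = ar4[THEN conjunct2]
  note a6 = ar5[THEN conjunct1, rule_format] and ar6 = ar5[THEN conjunct2]
  note a7 = ar6[THEN conjunct1, rule_format] and ar7 = ar6[THEN conjunct2]
  note a8 = ar7[THEN conjunct1, rule_format] and ar8 = ar7[THEN conjunct2]
  note a9 = ar8[THEN conjunct1, rule_format] and ar9 = ar8[THEN conjunct2]
  note a10 = ar9[THEN conjunct1, rule_format] and ar10 = ar9[THEN conjunct2]
  note a11 = ar10[THEN conjunct1, rule_format] and ar11 = ar10[THEN conjunct2]
  note a12 = ar11[THEN conjunct1, rule_format] and ar12 = ar11[THEN conjunct2]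
  note a13 = ar12[THEN conjunct1, rule_format] and ar13 = ar12[THEN conjunct2]
  note a14 = ar13[rule_format]
  have TT: "T i \<otimes> T i = eps \<odot> T i \<oplus> \<one>" if "i \<in> {1..<n}" for i by (intro a1 conjI that)
  have TbT: "T i \<otimes> (T (i + 1) \<otimes> T i) = T (i + 1) \<otimes> (T i \<otimes> T (i + 1))" if "i \<in> {1..<n}" "i + 1 \<in> {1..<n}" for i by (intro a2 conjI that)
  have Tf: "T i \<otimes> T j = T j \<otimes> T i" if "i \<in> {1..<n}" "j \<in> {1..<n}" "i + 1 < j \<or> j + 1 < i" for i j by (intro a3 conjI that)
  have Tc: "T i \<otimes> c i = c (i + 1) \<otimes> T i" if "i \<in> {1..<n}" for i by (intro a4 conjI that)
  have Tcf: "T i \<otimes> c j = c j \<otimes> T i" if "i \<in> {1..<n}" "j \<in> {1..n}" "j \<noteq> i" "j \<noteq> i + 1" for i j by (intro a5 conjI that)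
  have c2: "c i \<otimes> c i = \<one>" if "i \<in> {1..n}" for i by (intro a6 conjI that)
  have cf: "c i \<otimes> c j = \<ominus> (c j \<otimes> c i)" if "i \<in> {1..n}" "j \<in> {1..n}" "i \<noteq> j" for i j by (intro a7 conjI that)
  have xx': "x i \<otimes> x' i = \<one>" "x' i \<otimes> x i = \<one>" if "i \<in> {1..n}" for i by (intro a8 a9 conjI that)+
  have TxT: "T i \<otimes> (x i \<otimes> T i) \<oplus> eps \<odot> (c i \<otimes> (c (i + 1) \<otimes> (x i \<otimes> T i))) = x (i + 1)" if "i \<in> {1..<n}" for i by (intro a10 conjI that)
  have Txf: "T i \<otimes> x j = x j \<otimes> T i" if "i \<in> {1..<n}" "j \<in> {1..n}" "j \<noteq> i" "j \<noteq> i + 1" for i j by (intro a11 conjI that)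
  have xf: "x i \<otimes> x j = x j \<otimes> x i" if "i \<in> {1..n}" "j \<in> {1..n}" for i j by (intro a12 conjI that)
  have xc: "x i \<otimes> c i = c i \<otimes> x' i" if "i \<in> {1..n}" for i by (intro a13 conjI that)
  have xcf: "x i \<otimes> c j = c j \<otimes> x i" if "i \<in> {1..n}" "j \<in> {1..n}" "i \<noteq> j" for i j by (intro a14 conjI that)
  note one = spin_of_hc_strand_ring[OF cc cx c2 xx' xc u_def w_def]
  note two = spin_of_hc_strand_pair_ring[OF cc cx cc cx c2 xx' xc c2 xx' xc cf xf xcf xcf u_def w_def u_def w_def]
  have x'_eq: "x' i = c i \<otimes> (x i \<otimes> c i)" if "i \<in> {1..n}" for i
    using that by (simp add: xc cc cx m_assoc[symmetric] c2)
  have ne: "i \<noteq> i + 1" for i :: nat by simp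
  note hc2 = spin_of_hc_crossing_ring[OF cc cx cc cx cT c2 xx' xc c2 xx' xc cf xf xcf xcf TT Tc TxT u_def w_def u_def w_def R]
  have hc2': "R i \<otimes> R i = (- (eps ^ 2) - 2) \<odot> \<one>" "R i \<otimes> c i = \<ominus> (c i \<otimes> R i)" "R i \<otimes> c (i + 1) = \<ominus> (c (i + 1) \<otimes> R i)"
    "R i \<otimes> u i = u (i + 1) \<otimes> R i \<oplus> eps \<odot> (w i \<ominus> w (i + 1))" "R i \<otimes> w i = \<ominus> (w (i + 1) \<otimes> R i) \<ominus> eps \<odot> (u i \<oplus> u (i + 1))"
    "T i \<otimes> c (i + 1) = c i \<otimes> T i \<ominus> eps \<odot> c i \<oplus> eps \<odot> c (i + 1)"
    if i: "i \<in> {1..<n}" for i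
    by ((rule hc2, (use i up[OF i] ne in simp)+)[])+
  have Rc: "R i \<otimes> c j = \<ominus> (c j \<otimes> R i)" if "i \<in> {1..<n}" "j \<in> {1..n}" for i j
  proof (cases "j = i \<or> j = i + 1")
    case True then show ?thesis using hc2'(2,3)[OF that(1)] by auto
  next
    case False
    then show ?thesis
      using R_comm(2)[OF cc cc cT cc R Tcf cf cf] that up[OF that(1)] by auto
  qed
  show "R i \<otimes> c j = \<ominus> (c j \<otimes> R i)" if "i \<in> {1..<n}" "j \<in> {1..n}" by (rule Rc[OF that])
  have uc: "u i \<otimes> c j = c j \<otimes> u i" "w i \<otimes> c j = \<ominus> (c j \<otimes> w i)" if "i \<in> {1..n}" "j \<in> {1..n}" for i j
    by (cases "i = j"; use one[of i] two(4,5)[of i j] that in auto)+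
  have half: "((1 / 2) \<odot> a) \<otimes> ((1 / 2) \<odot> b) = (1 / 4) \<odot> (a \<otimes> b)" if "a \<in> carrier A" "b \<in> carrier A" for a b
    using that by (simp add: smult_mult_l smult_mult_r smult_assoc[symmetric])
  show "p i \<otimes> c j = c j \<otimes> p i" "q i \<otimes> c j = \<ominus> (c j \<otimes> q i)" if "i \<in> {1..n}" "j \<in> {1..n}"
    using uc[OF that] that cu cc by (simp_all add: p' q' smult_mult_l smult_mult_r smult_minus_right)
  show "spin_relations n R p q"
    unfolding spin_relations_def
  proof (intro conjI allI impI; (elim conjE)?)
    fix i assume i: "i \<in> {1..<n}"
    note ii = up[OF i]
    show "R i \<otimes> R i = (- (eps ^ 2) - 2) \<odot> \<one>" by (rule hc2'(1)[OF i])
    show "R i \<otimes> p i = p (i + 1) \<otimes> R i \<oplus> eps \<odot> (q i \<ominus> q (i + 1))"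
      using hc2'(4)[OF i] cR[OF i] cu ii
      by (simp add: p' q' smult_mult_l smult_mult_r smult_r_distr smult_diff smult_assoc[symmetric] mult.commute)
    show "R i \<otimes> q i = \<ominus> (q (i + 1) \<otimes> R i) \<ominus> eps \<odot> (p i \<oplus> p (i + 1))"
      using hc2'(5)[OF i] cR[OF i] cu ii
      by (simp add: p' q' smult_mult_l smult_mult_r smult_r_distr smult_diff smult_minus_right smult_assoc[symmetric] mult.commute)
  next
    fix i j assume i: "i \<in> {1..<n}" and j: "j \<in> {1..<n}" and f: "i + 1 < j \<or> j + 1 < i"
    note ii = up[OF i] up[OF j]
    have "T j \<otimes> c i = c i \<otimes> T j" "T j \<otimes> c (i + 1) = c (i + 1) \<otimes> T j" by (rule Tcf; use i j ii f in auto)+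
    moreover have "T i \<otimes> T j = T j \<otimes> T i" by (rule Tf[OF i j f])
    ultimately have RT: "R i \<otimes> T j = T j \<otimes> R i"
      by (intro R_comm(1)[OF cc cc cT cT R]) (use i j ii in simp_all)
    have "R j \<otimes> R i = \<ominus> (R i \<otimes> R j)"
      by (rule R_comm(2)[OF cc cc cT cR R]) (use i j ii RT Rc[OF i ii(3)] Rc[OF i ii(4)] cR[OF i] cc in simp_all)
    then show "R i \<otimes> R j = \<ominus> (R j \<otimes> R i)" using cR[OF i] cR[OF j] by simp
  next
    fix i assume i: "i \<in> {1..<n}" and j: "i + 1 \<in> {1..<n}"
    note ii = up[OF i] up[OF j]
    show "R i \<otimes> (R (i + 1) \<otimes> R i) \<ominus> R (i + 1) \<otimes> (R i \<otimes> R (i + 1)) = eps ^ 2 \<odot> (R (i + 1) \<ominus> R i)"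
      by (rule spin_of_hc_braid_ring[OF cc cc cc cT cT c2 c2 c2 cf cf cf TT Tc TT Tc Tcf Tcf hc2'(6) hc2'(6) TbT[symmetric] R R])
        (use i j ii in simp_all)
  next
    fix i j assume i: "i \<in> {1..n}" and j: "j \<in> {1..n}" and f: "i \<noteq> j" 
    show "p i \<otimes> p j = p j \<otimes> p i" using two(1)[of i j] i j f cu by (simp add: p' half)
    show "q i \<otimes> q j = \<ominus> (q j \<otimes> q i)" using two(3)[of i j] i j f cu by (simp add: q' half smult_minus_right)
  next
    fix i assume i: "i \<in> {1..n}"
    have "p i \<otimes> p i \<oplus> q i \<otimes> q i = (1 / 4) \<odot> (u i \<otimes> u i \<oplus> w i \<otimes> w i)"
      using i cu by (simp add: p' q' half smult_r_distr)
    then show "p i \<otimes> p i \<oplus> q i \<otimes> q i = \<one>" using one(1)[of i] i by (simp add: smult_assoc[symmetric])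
  next
    fix i j assume i: "i \<in> {1..n}" and j: "j \<in> {1..n}" 
    show "p i \<otimes> q j = q j \<otimes> p i" using two(2)[of i j] one(2)[of i] i j cu by (cases "i = j") (simp_all add: p' q' half)
  next
    fix i j assume i: "i \<in> {1..<n}" and j: "j \<in> {1..n}" and f: "j \<noteq> i" "j \<noteq> i + 1"
    note ii = up[OF i]
    have Rx: "R i \<otimes> x j = x j \<otimes> R i"
      by (rule R_comm(1)[OF cc cc cT cx(1) R Txf xcf[symmetric] xcf[symmetric]]) (use i ii j f in auto)
    have Rx': "R i \<otimes> x' j = x' j \<otimes> R i"
    proof -
      have "R i \<otimes> (c j \<otimes> z) = \<ominus> (c j \<otimes> (R i \<otimes> z))" "R i \<otimes> (x j \<otimes> z) = x j \<otimes> (R i \<otimes> z)" if "z \<in> carrier A" for z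
        using that i j Rx Rc[OF i j] cR[OF i] cc cx by (simp_all add: m_assoc[symmetric]) (simp add: l_minus)
      then show ?thesis using x'_eq[OF j] i j Rc[OF i j] cR[OF i] cc cx by (simp add: r_minus m_assoc)
    qed
    have Ru: "R i \<otimes> u j = u j \<otimes> R i" using Rx Rx' i j cR cx by (simp add: u_def l_distr r_distr)
    show "R i \<otimes> p j = p j \<otimes> R i" using Ru i j cR cu by (simp add: p' smult_mult_l smult_mult_r)
    have "R i \<otimes> w j = (R i \<otimes> (x j \<ominus> x' j)) \<otimes> c j" using i j cR cx cc by (simp add: w_def m_assoc)
    also have "R i \<otimes> (x j \<ominus> x' j) = (x j \<ominus> x' j) \<otimes> R i" using Rx Rx' i j cR cx by (simp add: minus_eq l_distr r_distr l_minus r_minus)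
    also have "\<dots> \<otimes> c j = \<ominus> (w j \<otimes> R i)" using Rc[OF i j] i j cR cx cc by (simp add: w_def m_assoc r_minus)
    finally show "R i \<otimes> q j = \<ominus> (q j \<otimes> R i)" using i j cR cu by (simp add: q' smult_mult_l smult_mult_r smult_minus_right)
  qed
qed

text \<open>
  The converse, through the formulas for \<open>\<Phi>\<close>.
\<close>

lemma hc_of_spin:
  assumes cR: "\<And>i. i \<in> {1..<n} \<Longrightarrow> R i \<in> carrier A" and cc: "\<And>i. i \<in> {1..n} \<Longrightarrow> c i \<in> carrier A"
    and cp: "\<And>i. i \<in> {1..n} \<Longrightarrow> p i \<in> carrier A" "\<And>i. i \<in> {1..n} \<Longrightarrow> q i \<in> carrier A"
    and crel: "clifford_relations n c" and rel: "spin_relations n R p q"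
    and Rc: "\<And>i j. i \<in> {1..<n} \<Longrightarrow> j \<in> {1..n} \<Longrightarrow> R i \<otimes> c j = \<ominus> (c j \<otimes> R i)"
    and pc: "\<And>i j. i \<in> {1..n} \<Longrightarrow> j \<in> {1..n} \<Longrightarrow> p i \<otimes> c j = c j \<otimes> p i"
    and qc: "\<And>i j. i \<in> {1..n} \<Longrightarrow> j \<in> {1..n} \<Longrightarrow> q i \<otimes> c j = \<ominus> (c j \<otimes> q i)"
    and T: "\<And>i. T i = (- (1 / 2)) \<odot> (R i \<otimes> (c i \<ominus> c (i + 1))) \<oplus> (eps / 2) \<odot> (\<one> \<ominus> c i \<otimes> c (i + 1))"
    and x: "\<And>i. x i = p i \<ominus> c i \<otimes> q i" and x': "\<And>i. x' i = p i \<oplus> c i \<otimes> q i"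
  shows "hc_relations n T c x x'"
proof -
  have up: "i \<in> {1..n}" "i + 1 \<in> {1..n}" if "i \<in> {1..<n}" for i using that by auto
  define t where "t i = R i \<otimes> c (i + 1) \<ominus> R i \<otimes> c i \<oplus> eps \<odot> \<one> \<ominus> eps \<odot> (c i \<otimes> c (i + 1))" for i
  have ct: "t i \<in> carrier A" if "i \<in> {1..<n}" for i using that up[OF that] cR cc by (simp add: t_def)
  have Tt: "T i = (1 / 2) \<odot> t i" if "i \<in> {1..<n}" for i
    using that up[OF that] cR cc
    by (simp add: T t_def minus_eq r_distr smult_r_distr smult_minus_right r_minus smult_assoc[symmetric] smult_minus_left a_ac)
  have cx: "x i \<in> carrier A" "x' i \<in> carrier A" if "i \<in> {1..n}" for i using that cp cc by (simp_all add: x x')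
  note C1 = crel[unfolded clifford_relations_def, THEN conjunct1, rule_format]
    and C2 = crel[unfolded clifford_relations_def, THEN conjunct2, rule_format]
  note br0 = rel[unfolded spin_relations_def]
  note b1 = br0[THEN conjunct1, rule_format] and br1 = br0[THEN conjunct2]
  note b2 = br1[THEN conjunct1, rule_format] and br2 = br1[THEN conjunct2]
  note b3 = br2[THEN conjunct1, rule_format] and br3 = br2[THEN conjunct2]
  note b4 = br3[THEN conjunct1, rule_format] and br4 = br3[THEN conjunct2]
  note b5 = br4[THEN conjunct1, rule_format] and br5 = br4[THEN conjunct2]
  note b6 = br5[THEN conjunct1, rule_format] and br6 = br5[THEN conjunct2]
  note b7 = br6[THEN conjunct1, rule_format] and br7 = br6[THEN conjunct2]
  note b8 = br7[THEN conjunct1, rule_format] and br8 = br7[THEN conjunct2]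
  note b9 = br8[THEN conjunct1, rule_format] and br9 = br8[THEN conjunct2]
  note b10 = br9[THEN conjunct1, rule_format] and br10 = br9[THEN conjunct2]
  note b11 = br10[rule_format]
  have c2: "c i \<otimes> c i = \<one>" if "i \<in> {1..n}" for i by (intro C1 conjI that)
  have cf: "c i \<otimes> c j = \<ominus> (c j \<otimes> c i)" if "i \<in> {1..n}" "j \<in> {1..n}" "i \<noteq> j" for i j by (intro C2 conjI that)
  have RR: "R i \<otimes> R i = (- (eps ^ 2) - 2) \<odot> \<one>" if "i \<in> {1..<n}" for i by (intro b1 conjI that)
  have Rf: "R i \<otimes> R j = \<ominus> (R j \<otimes> R i)" if "i \<in> {1..<n}" "j \<in> {1..<n}" "i + 1 < j \<or> j + 1 < i" for i j by (intro b2 conjI that)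
  have Rb: "R i \<otimes> (R (i + 1) \<otimes> R i) \<ominus> R (i + 1) \<otimes> (R i \<otimes> R (i + 1)) = eps ^ 2 \<odot> (R (i + 1) \<ominus> R i)"
    if "i \<in> {1..<n}" "i + 1 \<in> {1..<n}" for i by (intro b3 conjI that)
  have pf: "p i \<otimes> p j = p j \<otimes> p i" "q i \<otimes> q j = \<ominus> (q j \<otimes> q i)" if "i \<in> {1..n}" "j \<in> {1..n}" "i \<noteq> j" for i j by (intro b4 b5 conjI that)+
  have pq2: "p i \<otimes> p i \<oplus> q i \<otimes> q i = \<one>" if "i \<in> {1..n}" for i by (intro b6 conjI that)
  have pqf: "p i \<otimes> q j = q j \<otimes> p i" if "i \<in> {1..n}" "j \<in> {1..n}" for i j by (intro b7 conjI that)
  have Rpf: "R i \<otimes> p j = p j \<otimes> R i" "R i \<otimes> q j = \<ominus> (q j \<otimes> R i)" if "i \<in> {1..<n}" "j \<in> {1..n}" "j \<noteq> i" "j \<noteq> i + 1" for i j by (intro b8 b9 conjI that)+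
  have Rp: "R i \<otimes> p i = p (i + 1) \<otimes> R i \<oplus> eps \<odot> (q i \<ominus> q (i + 1))" if "i \<in> {1..<n}" for i by (intro b10 conjI that)
  have Rq: "R i \<otimes> q i = \<ominus> (q (i + 1) \<otimes> R i) \<ominus> eps \<odot> (p i \<oplus> p (i + 1))" if "i \<in> {1..<n}" for i by (intro b11 conjI that)
  have ne: "i \<noteq> i + 1" for i :: nat by simp
  note one = hc_of_spin_strand_ring[OF cc cp c2 pq2 pqf pc qc x x']
  note two = hc_of_spin_strand_pair_ring[OF cc cp cc cp cf pf(1) pqf[symmetric] pqf[symmetric] pf(2) pc qc pc qc x x]
  note sp2 = hc_of_spin_crossing_ring[OF cc cp cc cp cR c2 c2 cf Rc Rc pc pc pc pc qc qc qc qc pqf[symmetric] pqf[symmetric] pf(1) pqf[symmetric] pqf[symmetric] pf(2)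
    pq2 pq2 RR Rp Rq x x t_def]
  have sp2': "t i \<otimes> t i = (2 * eps) \<odot> t i \<oplus> 4 \<odot> \<one>" "t i \<otimes> c i = c (i + 1) \<otimes> t i" 
    "t i \<otimes> (x i \<otimes> t i) \<oplus> (2 * eps) \<odot> (c i \<otimes> (c (i + 1) \<otimes> (x i \<otimes> t i))) = 4 \<odot> x (i + 1)"
    if i: "i \<in> {1..<n}" for i
    by ((rule sp2, (use i up[OF i] ne in simp)+)[])+
  have q4: "((1 / 2) \<odot> a) \<otimes> ((1 / 2) \<odot> b) = (1 / 4) \<odot> (a \<otimes> b)" if "a \<in> carrier A" "b \<in> carrier A" for a b
    using that by (simp add: smult_mult_l smult_mult_r smult_assoc[symmetric])
  \<comment> \<open>\<open>t i\<close> is twice \<open>T i\<close>.\<close>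
  have tz: "t i \<otimes> z = z \<otimes> t i" if i: "i \<in> {1..<n}" and z: "z \<in> carrier A" and h: "c i \<otimes> z = \<ominus> (z \<otimes> c i)" "c (i + 1) \<otimes> z = \<ominus> (z \<otimes> c (i + 1))" 
       "R i \<otimes> z = \<ominus> (z \<otimes> R i)" for i z
    by (rule T_comm(2)[OF cc cc cR z t_def]) (use i up[OF i] h in simp_all)
  have tz': "t i \<otimes> z = z \<otimes> t i" if i: "i \<in> {1..<n}" and z: "z \<in> carrier A" and h: "c i \<otimes> z = z \<otimes> c i" "c (i + 1) \<otimes> z = z \<otimes> c (i + 1)" 
       "R i \<otimes> z = z \<otimes> R i" for i z
    by (rule T_comm(1)[OF cc cc cR z t_def]) (use i up[OF i] h in simp_all)
  have tc: "t i \<otimes> c j = c j \<otimes> t i" if i: "i \<in> {1..<n}" and j: "j \<in> {1..n}" "j \<noteq> i" "j \<noteq> i + 1" for i j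
    by (rule tz[OF i cc[OF j(1)] cf cf Rc[OF i j(1)]]) (use i j up[OF i] in auto)
  have cq: "c j \<otimes> q i = \<ominus> (q i \<otimes> c j)" if "i \<in> {1..n}" "j \<in> {1..n}" for i j
    using qc[OF that] that cc cp by simp
  have tx: "t i \<otimes> x j = x j \<otimes> t i" if i: "i \<in> {1..<n}" and j: "j \<in> {1..n}" "j \<noteq> i" "j \<noteq> i + 1" for i j
  proof -
    note ii = up[OF i]
    have 1: "t i \<otimes> p j = p j \<otimes> t i" 
      by (rule tz'[OF i cp(1)[OF j(1)] pc[symmetric] pc[symmetric] Rpf(1)]) (use i j ii in auto)
    have 2: "t i \<otimes> q j = q j \<otimes> t i" 
      by (rule tz[OF i cp(2)[OF j(1)] cq cq Rpf(2)]) (use i j ii in auto)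
    have "t i \<otimes> (c j \<otimes> q j) = (t i \<otimes> c j) \<otimes> q j" using i j ct cc cp by (simp add: m_assoc)
    also have "\<dots> = c j \<otimes> q j \<otimes> t i" using tc[OF i j] 2 i j ct cc cp by (simp add: m_assoc)
    finally show ?thesis using 1 i j ct cc cp by (simp add: x minus_eq l_distr r_distr l_minus r_minus)
  qed
  have tt: "t i \<otimes> t j = t j \<otimes> t i" if i: "i \<in> {1..<n}" and j: "j \<in> {1..<n}" and f: "i + 1 < j \<or> j + 1 < i" for i j
  proof -
    note ii = up[OF i] up[OF j]
    have cRj: "c k \<otimes> R j = \<ominus> (R j \<otimes> c k)" if "k \<in> {1..n}" for k using Rc[OF j that] that j cc cR by simp
    have a: "t i \<otimes> R j = R j \<otimes> t i"
      by (rule tz[OF i cR[OF j] cRj cRj Rf]) (use i j ii f in auto)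
    have b: "t i \<otimes> c j = c j \<otimes> t i" "t i \<otimes> c (j + 1) = c (j + 1) \<otimes> t i"
      by (rule tc; use i j ii f in auto)+
    have "t j \<otimes> t i = t i \<otimes> t j"
      by (rule T_comm(1)[OF cc cc cR ct t_def]) (use i j ii a b in simp_all)
    then show ?thesis by simp
  qed
  show ?thesis
    unfolding hc_relations_def
  proof (intro conjI allI impI; (elim conjE)?)
    fix i assume i: "i \<in> {1..<n}"
    note ii = up[OF i]
    show "T i \<otimes> T i = eps \<odot> T i \<oplus> \<one>"
      using i ct sp2'(1)[OF i] by (simp add: Tt q4 smult_r_distr smult_assoc[symmetric])
    show "T i \<otimes> c i = c (i + 1) \<otimes> T i"
      using i ii ct cc sp2'(2)[OF i] by (simp add: Tt smult_mult_l smult_mult_r)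
    have "T i \<otimes> (x i \<otimes> T i) \<oplus> eps \<odot> (c i \<otimes> (c (i + 1) \<otimes> (x i \<otimes> T i)))
       = (1 / 4) \<odot> (t i \<otimes> (x i \<otimes> t i) \<oplus> (2 * eps) \<odot> (c i \<otimes> (c (i + 1) \<otimes> (x i \<otimes> t i))))"
      using i ii ct cc cx by (simp add: Tt smult_mult_l smult_mult_r smult_r_distr smult_assoc[symmetric])
    then show "T i \<otimes> (x i \<otimes> T i) \<oplus> eps \<odot> (c i \<otimes> (c (i + 1) \<otimes> (x i \<otimes> T i))) = x (i + 1)"
      using sp2'(3)[OF i] cx ii by (simp add: smult_assoc[symmetric])
  next
    fix i assume i: "i \<in> {1..<n}" and j: "i + 1 \<in> {1..<n}"
    note ii = up[OF i] up[OF j]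
    have "t i \<otimes> (t (i + 1) \<otimes> t i) = t (i + 1) \<otimes> (t i \<otimes> t (i + 1))"
      by (rule hc_of_spin_braid_ring[OF cc cc cc cR cR c2 c2 c2 cf cf cf Rc Rc Rc Rc Rc Rc RR RR Rb t_def t_def])
        (use i j ii in simp_all)
    then show "T i \<otimes> (T (i + 1) \<otimes> T i) = T (i + 1) \<otimes> (T i \<otimes> T (i + 1))"
      unfolding Tt[OF i] Tt[OF j] using ct[OF i] ct[OF j]
      by (simp add: smult_mult_l smult_mult_r smult_assoc[symmetric])
  next
    fix i j assume i: "i \<in> {1..<n}" and j: "j \<in> {1..<n}" and f: "i + 1 < j \<or> j + 1 < i"
    show "T i \<otimes> T j = T j \<otimes> T i" using tt[OF i j f] i j ct by (simp add: Tt q4)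
  next
    fix i j assume i: "i \<in> {1..<n}" and j: "j \<in> {1..n}" and f: "j \<noteq> i" "j \<noteq> i + 1"
    show "T i \<otimes> c j = c j \<otimes> T i" using tc[OF i j f] i j ct cc by (simp add: Tt smult_mult_l smult_mult_r)
    show "T i \<otimes> x j = x j \<otimes> T i" using tx[OF i j f] i j ct cx by (simp add: Tt smult_mult_l smult_mult_r)
  next
    fix i assume i: "i \<in> {1..n}"
    show "c i \<otimes> c i = \<one>" by (rule c2[OF i])
    show "x i \<otimes> x' i = \<one>" "x' i \<otimes> x i = \<one>" "x i \<otimes> c i = c i \<otimes> x' i" by (rule one; use i in simp)+
  next
    fix i j assume i: "i \<in> {1..n}" and j: "j \<in> {1..n}" and f: "i \<noteq> j"
    show "c i \<otimes> c j = \<ominus> (c j \<otimes> c i)" by (rule cf[OF i j f])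
    show "x i \<otimes> c j = c j \<otimes> x i" by (rule two(2)[of i j]) (use i j f in simp_all)
  next
    fix i j assume i: "i \<in> {1..n}" and j: "j \<in> {1..n}"
    show "x i \<otimes> x j = x j \<otimes> x i"
    proof (cases "i = j")
      case False show ?thesis by (rule two(1)[of i j]) (use i j False in simp_all)
    qed simp
  qed
qed

text \<open>
  Both identities rest on \<open>(c - d)\<^sup>2 = 2\<close> for anticommuting \<open>c\<close>, \<open>d\<close> of square 1.
\<close>

lemma roundtrip:
  assumes c: "c \<in> carrier A" "d \<in> carrier A" "T \<in> carrier A" "R \<in> carrier A"
    and r: "c \<otimes> c = \<one>" "d \<otimes> d = \<one>" "d \<otimes> c = \<ominus> (c \<otimes> d)"
      "R \<otimes> c = \<ominus> (c \<otimes> R)" "R \<otimes> d = \<ominus> (d \<otimes> R)"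
  shows "R = (c \<ominus> d) \<otimes> T \<oplus> eps \<odot> d \<Longrightarrow> 
      (- (1 / 2)) \<odot> (R \<otimes> (c \<ominus> d)) \<oplus> (eps / 2) \<odot> (\<one> \<ominus> c \<otimes> d) = T"
    "T = (- (1 / 2)) \<odot> (R \<otimes> (c \<ominus> d)) \<oplus> (eps / 2) \<odot> (\<one> \<ominus> c \<otimes> d) \<Longrightarrow> (c \<ominus> d) \<otimes> T \<oplus> eps \<odot> d = R"
proof -
  obtain op where "op_rep A op" using op_rep_exists by (elim exE)
  then interpret op_rep A op .
  have o: "op c (op c v) = op \<one> v" "op d (op d v) = op \<one> v" "op d (op c v) = - op c (op d v)" 
    "op R (op c v) = - op c (op R v)"  "op R (op d v) = - op d (op R v)" for v
    using c by (simp_all add: op_mult[symmetric] op_uminus[symmetric] r)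
  have lin: "op a (v - w) = op a v - op a w" "op a (- v) = - op a v" if "a \<in> carrier A" for a v w
    using that diff[of "op a" v w] minus[of "op a" v] by simp_all
  have l: "scale k (v + w) = scale k v + scale k w" "scale k (v - w) = scale k v - scale k w" "scale k (- v) = - scale k v" 
      "scale k (scale l v) = scale (k * l) v" for k l and v w :: "'a \<Rightarrow>\<^sub>0 cq"
    by (rule poly_mapping_eqI; simp add: lookup_minus lookup_add algebra_simps)+
  have h: "scale (1 / 2) v + (scale (1 / 2) v + w) = v + w" "scale (1 / 2) v + scale (1 / 2) v = v" 
     "scale (- (1 / 2)) v = - scale (1 / 2) v" "scale (eps / 2) v + scale (eps / 2) v = scale eps v" for v w :: "'a \<Rightarrow>\<^sub>0 cq"
    by (rule poly_mapping_eqI; simp add: lookup_minus lookup_add algebra_simps)+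
  { assume R: "R = (c \<ominus> d) \<otimes> T \<oplus> eps \<odot> d"
    have oR: "op R v = op c (op T v) - op d (op T v) + scale eps (op d v)" for v
      using c by (simp add: R op_simps)
    show "(- (1 / 2)) \<odot> (R \<otimes> (c \<ominus> d)) \<oplus> (eps / 2) \<odot> (\<one> \<ominus> c \<otimes> d) = T"
    proof (rule op_inj)
      fix v
      have e: "op R (op c v) - op R (op d v) = - op T v - op T v + scale eps (op \<one> v) - scale eps (op c (op d v))"
        unfolding o(4,5) unfolding oR using c by (simp add: op_simps op_add lin o algebra_simps)
      have "op ((- (1 / 2)) \<odot> (R \<otimes> (c \<ominus> d)) \<oplus> (eps / 2) \<odot> (\<one> \<ominus> c \<otimes> d)) v =
         scale (- (1 / 2)) (op R (op c v) - op R (op d v)) + scale (eps / 2) (op \<one> v - op c (op d v))"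
        using c by (simp add: op_simps lin)
      also have "\<dots> = op T v"
        unfolding e by (rule poly_mapping_eqI) (simp add: lookup_add lookup_minus field_simps)
      finally show "op ((- (1 / 2)) \<odot> (R \<otimes> (c \<ominus> d)) \<oplus> (eps / 2) \<odot> (\<one> \<ominus> c \<otimes> d)) v = op T v" .
    qed (use c in simp_all)
  }
  { assume T: "T = (- (1 / 2)) \<odot> (R \<otimes> (c \<ominus> d)) \<oplus> (eps / 2) \<odot> (\<one> \<ominus> c \<otimes> d)"
    have oT: "op T v = scale (- (1 / 2)) (op R (op c v) - op R (op d v)) + scale (eps / 2) (op \<one> v - op c (op d v))" for v
      using c by (simp add: T op_simps lin)
    show "(c \<ominus> d) \<otimes> T \<oplus> eps \<odot> d = R"
    proof (rule op_inj)
      fix v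
      show "op ((c \<ominus> d) \<otimes> T \<oplus> eps \<odot> d) v = op R v"
        using c by (simp add: op_simps oT op_add lin o l) (simp add: h algebra_simps l o lin op_simps)
    qed (use c in simp_all)
  }
qed

lemma roundtrip_x:
  assumes c: "c \<in> carrier A" "p \<in> carrier A" "q \<in> carrier A" "x \<in> carrier A" "x' \<in> carrier A"
    and r: "c \<otimes> c = \<one>" 
  shows "x \<otimes> c = c \<otimes> x' \<Longrightarrow> p = (1 / 2) \<odot> (x \<oplus> x') \<Longrightarrow> q = (1 / 2) \<odot> ((x \<ominus> x') \<otimes> c) \<Longrightarrow> p \<ominus> c \<otimes> q = x"
    "x \<otimes> c = c \<otimes> x' \<Longrightarrow> p = (1 / 2) \<odot> (x \<oplus> x') \<Longrightarrow> q = (1 / 2) \<odot> ((x \<ominus> x') \<otimes> c) \<Longrightarrow> p \<oplus> c \<otimes> q = x'"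
    "x = p \<ominus> c \<otimes> q \<Longrightarrow> x' = p \<oplus> c \<otimes> q \<Longrightarrow> (1 / 2) \<odot> (x \<oplus> x') = p"
    "x = p \<ominus> c \<otimes> q \<Longrightarrow> x' = p \<oplus> c \<otimes> q \<Longrightarrow> q \<otimes> c = \<ominus> (c \<otimes> q) \<Longrightarrow> (1 / 2) \<odot> ((x \<ominus> x') \<otimes> c) = q"
proof -
  { assume h: "x \<otimes> c = c \<otimes> x'" "p = (1 / 2) \<odot> (x \<oplus> x')" "q = (1 / 2) \<odot> ((x \<ominus> x') \<otimes> c)"
    have cxc: "c \<otimes> (x \<otimes> c) = x'" unfolding h(1) using c by (simp add: m_assoc[symmetric] r)
    have "c \<otimes> (x' \<otimes> c) = c \<otimes> (c \<otimes> (x \<otimes> (c \<otimes> c)))" unfolding cxc[symmetric] using c by (simp add: m_assoc)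
    then have cx'c: "c \<otimes> (x' \<otimes> c) = x" using c by (simp add: r) (simp add: m_assoc[symmetric] r)
    have cq: "c \<otimes> q = (1 / 2) \<odot> (x' \<ominus> x)"
      using c by (simp add: h(3) smult_mult_r m_assoc minus_eq l_distr r_distr l_minus r_minus cxc cx'c)
    have d: "(1 / 2) \<odot> y \<oplus> (1 / 2) \<odot> y = y" if "y \<in> carrier A" for y
      using that by (simp add: smult_l_distr[symmetric])
    have "p \<ominus> c \<otimes> q = (1 / 2) \<odot> ((x \<oplus> x') \<ominus> (x' \<ominus> x))" using c by (simp add: h(2) cq smult_diff)
    also have "(x \<oplus> x') \<ominus> (x' \<ominus> x) = x \<oplus> x" using c by algebra
    finally show "p \<ominus> c \<otimes> q = x" using c by (simp add: smult_r_distr d)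
    have "p \<oplus> c \<otimes> q = (1 / 2) \<odot> ((x \<oplus> x') \<oplus> (x' \<ominus> x))" using c by (simp add: h(2) cq smult_r_distr)
    also have "(x \<oplus> x') \<oplus> (x' \<ominus> x) = x' \<oplus> x'" using c by algebra
    finally show "p \<oplus> c \<otimes> q = x'" using c by (simp add: smult_r_distr d)
  }
  assume h: "x = p \<ominus> c \<otimes> q" "x' = p \<oplus> c \<otimes> q"
  have d: "(1 / 2) \<odot> (y \<oplus> y) = y" if "y \<in> carrier A" for y
    using that by (simp add: smult_r_distr smult_l_distr[symmetric])
  have "x \<oplus> x' = p \<oplus> p" unfolding h using c by algebra
  then show "(1 / 2) \<odot> (x \<oplus> x') = p" using c d by simp
  assume a: "q \<otimes> c = \<ominus> (c \<otimes> q)"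
  have cqc: "c \<otimes> q \<otimes> c = \<ominus> q" using c by (simp add: m_assoc a r_minus) (simp add: m_assoc[symmetric] r)
  have "x \<ominus> x' = \<ominus> (c \<otimes> q \<oplus> c \<otimes> q)" unfolding h using c by algebra
  then have "(x \<ominus> x') \<otimes> c = q \<oplus> q" using c by (simp add: l_minus l_distr cqc minus_add)
  then show "(1 / 2) \<odot> ((x \<ominus> x') \<otimes> c) = q" using c d by simp
qed

lemma hc_relations_cong:
  assumes "\<And>i. i \<in> {1..<n} \<Longrightarrow> T i = T1 i" "\<And>i. i \<in> {1..n} \<Longrightarrow> c i = c1 i"
    "\<And>i. i \<in> {1..n} \<Longrightarrow> x i = x1 i" "\<And>i. i \<in> {1..n} \<Longrightarrow> x' i = x1' i"
  shows "hc_relations n T c x x' \<longleftrightarrow> hc_relations n T1 c1 x1 x1'"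
proof -
  have up: "i \<in> {1..<n} \<Longrightarrow> i \<in> {1..n}" "i \<in> {1..<n} \<Longrightarrow> i + 1 \<in> {1..n}" for i by auto
  show ?thesis
    unfolding hc_relations_def
    by (intro arg_cong2[where f="(\<and>)"] all_cong1 imp_cong refl; (elim conjE)?; simp only: assms up)
qed

lemma spin_relations_cong:
  assumes "\<And>i. i \<in> {1..<n} \<Longrightarrow> R i = R1 i" "\<And>i. i \<in> {1..n} \<Longrightarrow> p i = p1 i" "\<And>i. i \<in> {1..n} \<Longrightarrow> q i = q1 i"
  shows "spin_relations n R p q \<longleftrightarrow> spin_relations n R1 p1 q1"
proof -
  have up: "i \<in> {1..<n} \<Longrightarrow> i \<in> {1..n}" "i \<in> {1..<n} \<Longrightarrow> i + 1 \<in> {1..n}" for i by auto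
  show ?thesis
    unfolding spin_relations_def
    by (intro arg_cong2[where f="(\<and>)"] all_cong1 imp_cong refl; (elim conjE)?; simp only: assms up)
qed

lemma clifford_relations_cong:
  assumes "\<And>i. i \<in> {1..n} \<Longrightarrow> c i = c1 i"
  shows "clifford_relations n c \<longleftrightarrow> clifford_relations n c1"
  unfolding clifford_relations_def
  by (intro arg_cong2[where f="(\<and>)"] all_cong1 imp_cong refl; (elim conjE)?; simp only: assms)

lemma clifford_of_hc: "hc_relations n T c x x' \<Longrightarrow> clifford_relations n c"
  unfolding hc_relations_def clifford_relations_def by (elim conjE) (intro conjI; assumption)

end

section \<open>The three algebras and the isomorphisms between them\<close>

lemma free_grade_intros:
  fixes x y :: "'g list \<Rightarrow>\<^sub>0 cq"
  shows fg_mult: "x \<in> grade (free_superalg G par) s \<Longrightarrow> y \<in> grade (free_superalg G par) t \<Longrightarrow> u = (s \<noteq> t) \<Longrightarrow> x * y \<in> grade (free_superalg G par) u"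
   and fg_add: "x \<in> grade (free_superalg G par) s \<Longrightarrow> y \<in> grade (free_superalg G par) t \<Longrightarrow> t = s \<Longrightarrow> x + y \<in> grade (free_superalg G par) s"
   and fg_diff: "x \<in> grade (free_superalg G par) s \<Longrightarrow> y \<in> grade (free_superalg G par) t \<Longrightarrow> t = s \<Longrightarrow> x - y \<in> grade (free_superalg G par) s"
   and fg_scal: "scal k \<in> grade (free_superalg G par) False" 
   and fg_one: "1 \<in> grade (free_superalg G par) False"
   and fg_gen: "g \<in> G \<Longrightarrow> gen g \<in> grade (free_superalg G par) (par g)"
proof -
  interpret F: superalgebra "free_superalg G par" by (rule free_superalgebra)
  interpret P: fspace "free_superalg G par" "lists G" by (rule free_fspace)
  show "x \<in> grade (free_superalg G par) s \<Longrightarrow> y \<in> grade (free_superalg G par) t \<Longrightarrow> u = (s \<noteq> t) \<Longrightarrow> x * y \<in> grade (free_superalg G par) u"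
    using F.grade_mult[of x s y t] by (simp only: free_simps(2))
  show "x \<in> grade (free_superalg G par) s \<Longrightarrow> y \<in> grade (free_superalg G par) t \<Longrightarrow> t = s \<Longrightarrow> x + y \<in> grade (free_superalg G par) s"
    using F.grade_add[of x s y] by (simp only: free_simps(5))
  show "x \<in> grade (free_superalg G par) s \<Longrightarrow> y \<in> grade (free_superalg G par) t \<Longrightarrow> t = s \<Longrightarrow> x - y \<in> grade (free_superalg G par) s"
    using F.grade_diff[of x s y] P.a_minus_eq[OF F.grade_carr F.grade_carr, of x s y s] by simp
  show "scal k \<in> grade (free_superalg G par) False" "1 \<in> grade (free_superalg G par) False"
     "g \<in> G \<Longrightarrow> gen g \<in> grade (free_superalg G par) (par g)"
    by (simp_all add: free_simps(7) zero_list_def)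
qed

lemma clifford_presentation: "presentation (ClC ` {1..n}) (\<lambda>_. True) (clifford_rels n)"
proof -
  have "\<forall>r\<in>clifford_rels n. \<exists>s. r \<in> grade (free_superalg (ClC ` {1..n}) (\<lambda>_. True)) s"
    unfolding clifford_rels_def Let_def ball_Un ball_setcompr1 ball_setcompr2
    by (intro conjI allI impI; (elim conjE)?; rule exI,
        (rule fg_add fg_diff fg_mult[OF _ _ refl] fg_one fg_scal | (rule fg_gen, simp) | simp)+)
  then show ?thesis by (simp add: presentation_def)
qed

lemma hc_presentation: "presentation (hc_gens n) hc_par (hc_rels n)"
proof -
  have "\<forall>r\<in>hc_rels n. \<exists>s. r \<in> grade (free_superalg (hc_gens n) hc_par) s"
    unfolding hc_rels_def Let_def ball_Un ball_setcompr1 ball_setcompr2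
    by (intro conjI allI impI; (elim conjE)?; rule exI,
        (rule fg_add fg_diff fg_mult[OF _ _ refl] fg_one fg_scal | (rule fg_gen, simp add: hc_gens_def) | simp)+)
  then show ?thesis by (simp add: presentation_def)
qed

lemma spin_presentation: "presentation (spin_gens n) spin_par (spin_rels n)"
proof -
  have "\<forall>r\<in>spin_rels n. \<exists>s. r \<in> grade (free_superalg (spin_gens n) spin_par) s"
    unfolding spin_rels_def Let_def ball_Un ball_setcompr1 ball_setcompr2
    by (intro conjI allI impI; (elim conjE)?; rule exI,
        (rule fg_add fg_diff fg_mult[OF _ _ refl] fg_one fg_scal | (rule fg_gen, simp add: spin_gens_def) | simp)+)
  then show ?thesis by (simp add: presentation_def)
qed

text \<open>
  A locale without assumptions; it fixes \<open>n\<close> and names the algebras. The letters \<open>cC\<close>, \<open>sH\<close>, \<open>gH\<close> stand for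
  the classes of the generators, \<open>cD\<close> and \<open>bD\<close> for their images in the tensor product, and \<open>phi\<close>, \<open>psi\<close> for the values
  of \<open>\<Phi>\<close> and \<open>\<Psi>\<close> on generators.
\<close>

locale hecke =
  fixes n :: nat
begin

abbreviation "C \<equiv> clifford n"
abbreviation "H \<equiv> affine_spin n"
abbreviation "HC \<equiv> affine_hc n"
abbreviation "CH \<equiv> stensor C H"

sublocale PC: presentation "ClC ` {1..n}" "\<lambda>_. True" "clifford_rels n" 
  rewrites "presented (ClC ` {1..n}) (\<lambda>_. True) (clifford_rels n) = C"
  by (rule clifford_presentation) (simp add: clifford_def)
sublocale PS: presentation "spin_gens n" spin_par "spin_rels n"
  rewrites "presented (spin_gens n) spin_par (spin_rels n) = H"
  by (rule spin_presentation) (simp add: affine_spin_def)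
sublocale PH: presentation "hc_gens n" hc_par "hc_rels n"
  rewrites "presented (hc_gens n) hc_par (hc_rels n) = HC"
  by (rule hc_presentation) (simp add: affine_hc_def)

sublocale T: tensor_product C H
  by (simp add: tensor_product_def PC.Pr_superalgebra PS.Pr_superalgebra)
sublocale HC: superalgebra HC by (rule PH.Pr_superalgebra)

definition "cC i = cls C (gen (ClC i))"
definition "sH g = cls H (gen g)"
definition "gH g = cls HC (gen g)"

lemma cC_grade: "i \<in> {1..n} \<Longrightarrow> cC i \<in> grade C True" using PC.gcls_grade[of "ClC i"] by (simp add: cC_def)
lemma sH_grade: "g \<in> spin_gens n \<Longrightarrow> sH g \<in> grade H (spin_par g)" using PS.gcls_grade[of g] by (simp add: sH_def)
lemma gH_grade: "g \<in> hc_gens n \<Longrightarrow> gH g \<in> grade HC (hc_par g)" using PH.gcls_grade[of g] by (simp add: gH_def)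
lemma cC_carr: "i \<in> {1..n} \<Longrightarrow> cC i \<in> carrier C" using PC.gcls_closed[of "ClC i"] by (simp add: cC_def)
lemma sH_carr: "g \<in> spin_gens n \<Longrightarrow> sH g \<in> carrier H" using PS.gcls_closed[of g] by (simp add: sH_def)
lemma gH_carr: "g \<in> hc_gens n \<Longrightarrow> gH g \<in> carrier HC" using PH.gcls_closed[of g] by (simp add: gH_def)

lemma gens: 
  "i \<in> {1..<n} \<Longrightarrow> SpR i \<in> spin_gens n" "i \<in> {1..n} \<Longrightarrow> SpP i \<in> spin_gens n" "i \<in> {1..n} \<Longrightarrow> SpQ i \<in> spin_gens n"
  "i \<in> {1..<n} \<Longrightarrow> HcT i \<in> hc_gens n" "i \<in> {1..n} \<Longrightarrow> HcC i \<in> hc_gens n" "i \<in> {1..n} \<Longrightarrow> HcX i \<in> hc_gens n" 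
  "i \<in> {1..n} \<Longrightarrow> HcXi i \<in> hc_gens n"
  by (auto simp: spin_gens_def hc_gens_def)

lemma HC_relations: "HC.hc_relations n (\<lambda>i. gH (HcT i)) (\<lambda>i. gH (HcC i)) (\<lambda>i. gH (HcX i)) (\<lambda>i. gH (HcXi i))"
  unfolding gH_def by (rule iffD1[OF HC.hc_rels_iff[OF PH.cls_hom]]) (intro ballI PH.cls_rel)

definition "cD i = T.tn (cC i) \<one>\<^bsub>H\<^esub>"
definition "bD g = T.tn \<one>\<^bsub>C\<^esub> (sH g)"

lemma cD_grade: "i \<in> {1..n} \<Longrightarrow> cD i \<in> grade CH True"
  using T.tn_grade[OF cC_grade T.B.grade_one] by (simp add: cD_def)
lemma bD_grade: "g \<in> spin_gens n \<Longrightarrow> bD g \<in> grade CH (spin_par g)"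
  using T.tn_grade[OF T.A.grade_one sH_grade] by (simp add: bD_def)
lemma cD_carr [simp]: "i \<in> {1..n} \<Longrightarrow> cD i \<in> carrier CH" by (simp add: cD_def cC_carr)
lemma bD_carr [simp]: "g \<in> spin_gens n \<Longrightarrow> bD g \<in> carrier CH" by (simp add: bD_def sH_carr)

lemma D_clifford: "T.D.clifford_relations n cD"
proof -
  have h: "(\<lambda>f. T.tn (cls C f) \<one>\<^bsub>H\<^esub>) \<in> alg_hom (free_superalg (ClC ` {1..n}) (\<lambda>_. True)) CH"
    by (rule alg_hom_comp[OF T.inA_hom(1) PC.cls_hom])
  have "\<forall>r\<in>clifford_rels n. T.tn (cls C r) \<one>\<^bsub>H\<^esub> = \<zero>\<^bsub>CH\<^esub>"
    by (simp add: PC.cls_rel T.tn_zero)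
  then show ?thesis using T.D.clifford_rels_iff[OF h] by (simp only: cD_def[abs_def] cC_def)
qed

lemma D_spin: "T.D.spin_relations n (\<lambda>i. bD (SpR i)) (\<lambda>i. bD (SpP i)) (\<lambda>i. bD (SpQ i))"
proof -
  have h: "(\<lambda>f. T.tn \<one>\<^bsub>C\<^esub> (cls H f)) \<in> alg_hom (free_superalg (spin_gens n) spin_par) CH"
    by (rule alg_hom_comp[OF T.inB_hom(1) PS.cls_hom])
  have "\<forall>r\<in>spin_rels n. T.tn \<one>\<^bsub>C\<^esub> (cls H r) = \<zero>\<^bsub>CH\<^esub>"
    by (simp add: PS.cls_rel T.tn_zero)
  then show ?thesis using T.D.spin_rels_iff[OF h] by (simp only: bD_def[abs_def] sH_def)
qed

lemma D_comm: 
  assumes "g \<in> spin_gens n" "j \<in> {1..n}"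
  shows "bD g \<otimes>\<^bsub>CH\<^esub> cD j = koszul (spin_par g) True \<odot>\<^bsub>CH\<^esub> (cD j \<otimes>\<^bsub>CH\<^esub> bD g)"
  using T.tn_supercomm[OF cC_grade[OF assms(2)] sH_grade[OF assms(1)]] by (simp add: bD_def cD_def)

lemma D_comm':
  "i \<in> {1..<n} \<Longrightarrow> j \<in> {1..n} \<Longrightarrow> bD (SpR i) \<otimes>\<^bsub>CH\<^esub> cD j = \<ominus>\<^bsub>CH\<^esub> (cD j \<otimes>\<^bsub>CH\<^esub> bD (SpR i))"
  "i \<in> {1..n} \<Longrightarrow> j \<in> {1..n} \<Longrightarrow> bD (SpP i) \<otimes>\<^bsub>CH\<^esub> cD j = cD j \<otimes>\<^bsub>CH\<^esub> bD (SpP i)"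
  "i \<in> {1..n} \<Longrightarrow> j \<in> {1..n} \<Longrightarrow> bD (SpQ i) \<otimes>\<^bsub>CH\<^esub> cD j = \<ominus>\<^bsub>CH\<^esub> (cD j \<otimes>\<^bsub>CH\<^esub> bD (SpQ i))"
  using D_comm[OF gens(1), of i j] D_comm[OF gens(2), of i j] D_comm[OF gens(3), of i j] gens(1-3)[of i]
  by (simp_all add: T.D.smult_neg_one del: atLeastAtMost_iff atLeastLessThan_iff)

definition phi :: "hc_gen \<Rightarrow> ((clifford_gen list \<Rightarrow>\<^sub>0 cq) set \<times> (spin_gen list \<Rightarrow>\<^sub>0 cq) set \<Rightarrow>\<^sub>0 cq) set" where
  "phi g = (case g of
        HcT i \<Rightarrow> (- (1 / 2)) \<odot>\<^bsub>CH\<^esub> (bD (SpR i) \<otimes>\<^bsub>CH\<^esub> (cD i \<ominus>\<^bsub>CH\<^esub> cD (i + 1)))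
                  \<oplus>\<^bsub>CH\<^esub> (eps / 2) \<odot>\<^bsub>CH\<^esub> (\<one>\<^bsub>CH\<^esub> \<ominus>\<^bsub>CH\<^esub> cD i \<otimes>\<^bsub>CH\<^esub> cD (i + 1))
      | HcC i \<Rightarrow> cD i
      | HcX i \<Rightarrow> bD (SpP i) \<ominus>\<^bsub>CH\<^esub> cD i \<otimes>\<^bsub>CH\<^esub> bD (SpQ i)
      | HcXi i \<Rightarrow> bD (SpP i) \<oplus>\<^bsub>CH\<^esub> cD i \<otimes>\<^bsub>CH\<^esub> bD (SpQ i))"

lemma Phi_eq: "Phi n = gen_hom CH phi"
  unfolding Phi_def Let_def phi_def[abs_def] cD_def[abs_def] bD_def[abs_def] cC_def sH_def ..

lemma up: "i \<in> {1..<n} \<Longrightarrow> i \<in> {1..n}" "i \<in> {1..<n} \<Longrightarrow> i + 1 \<in> {1..n}" by auto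

lemma phi_grade: "g \<in> hc_gens n \<Longrightarrow> phi g \<in> grade CH (hc_par g)"
proof (cases g)
  case (HcT i)
  assume "g \<in> hc_gens n"
  then have i: "i \<in> {1..<n}" using HcT by (auto simp: hc_gens_def)
  note c = cD_grade[OF up(1)[OF i]] cD_grade[OF up(2)[OF i]] and r = bD_grade[OF gens(1)[OF i]]
  have "bD (SpR i) \<otimes>\<^bsub>CH\<^esub> (cD i \<ominus>\<^bsub>CH\<^esub> cD (i + 1)) \<in> grade CH (spin_par (SpR i) \<noteq> True)"
    by (intro T.D.grade_mult T.D.grade_diff c r)
  moreover have "cD i \<otimes>\<^bsub>CH\<^esub> cD (i + 1) \<in> grade CH (True \<noteq> True)"
    by (intro T.D.grade_mult c)
  ultimately show ?thesis using HcT
    by (simp add: phi_def T.D.grade_add T.D.grade_smult T.D.grade_diff T.D.grade_one)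
next
  case (HcC i) assume "g \<in> hc_gens n" then show ?thesis using HcC cD_grade[of i] by (auto simp: phi_def hc_gens_def)
next
  case (HcX i) assume "g \<in> hc_gens n" 
  then have i: "i \<in> {1..n}" using HcX by (auto simp: hc_gens_def)
  have "cD i \<otimes>\<^bsub>CH\<^esub> bD (SpQ i) \<in> grade CH (True \<noteq> spin_par (SpQ i))"
    by (intro T.D.grade_mult cD_grade bD_grade gens i)
  then show ?thesis using HcX bD_grade[OF gens(2)[OF i]] by (simp add: phi_def T.D.grade_diff)
next
  case (HcXi i) assume "g \<in> hc_gens n" 
  then have i: "i \<in> {1..n}" using HcXi by (auto simp: hc_gens_def)
  have "cD i \<otimes>\<^bsub>CH\<^esub> bD (SpQ i) \<in> grade CH (True \<noteq> spin_par (SpQ i))"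
    by (intro T.D.grade_mult cD_grade bD_grade gens i)
  then show ?thesis using HcXi bD_grade[OF gens(2)[OF i]] by (simp add: phi_def T.D.grade_add)
qed

lemma phi_carr: "g \<in> hc_gens n \<Longrightarrow> phi g \<in> carrier CH"
  by (rule T.D.grade_carr[OF phi_grade])

lemma phi_relations: "T.D.hc_relations n (\<lambda>i. phi (HcT i)) (\<lambda>i. phi (HcC i)) (\<lambda>i. phi (HcX i)) (\<lambda>i. phi (HcXi i))"
proof -
  have "T.D.hc_relations n (\<lambda>i. phi (HcT i)) cD (\<lambda>i. phi (HcX i)) (\<lambda>i. phi (HcXi i))"
    by (rule T.D.hc_of_spin[OF bD_carr[OF gens(1)] cD_carr bD_carr[OF gens(2)] bD_carr[OF gens(3)] D_clifford D_spin D_comm'])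
      (simp_all add: phi_def)
  moreover have "(\<lambda>i. phi (HcC i)) = cD" by (rule ext) (simp add: phi_def)
  ultimately show ?thesis by (simp only:)
qed

lemma Phi_hom: "Phi n \<in> alg_hom HC CH" "g \<in> hc_gens n \<Longrightarrow> Phi n (gH g) = phi g" "Phi n \<in> even_map HC CH"
proof -
  interpret ev: evaluation CH "hc_gens n" hc_par phi
    by (intro evaluation.intro evaluation_axioms.intro T.D_superalgebra phi_carr)
  have "T.D.hc_relations n (\<lambda>i. evl CH phi (gen (HcT i))) (\<lambda>i. evl CH phi (gen (HcC i))) 
    (\<lambda>i. evl CH phi (gen (HcX i))) (\<lambda>i. evl CH phi (gen (HcXi i)))"
    by (rule iffD2[OF T.D.hc_relations_cong phi_relations]) (rule ev.evl_gen, erule gens)+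
  then have r: "evl CH phi r = \<zero>\<^bsub>CH\<^esub>" if "r \<in> hc_rels n" for r
    by (rule bspec[OF iffD2[OF T.D.hc_rels_iff[OF ev.evl_hom]] that])
  note g = PH.gen_hom[OF T.D_superalgebra]
  show "Phi n \<in> alg_hom HC CH" unfolding Phi_eq by (rule g(1)) (erule phi_carr r)+
  show "g \<in> hc_gens n \<Longrightarrow> Phi n (gH g) = phi g" unfolding Phi_eq gH_def by (rule g(2)) (erule phi_carr r | assumption)+
  show "Phi n \<in> even_map HC CH" unfolding Phi_eq by (rule g(3)) (erule phi_carr r phi_grade)+
qed

lemma hc_elems:
  "i \<in> {1..<n} \<Longrightarrow> gH (HcT i) \<in> carrier HC" "i \<in> {1..n} \<Longrightarrow> gH (HcC i) \<in> carrier HC"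
  "i \<in> {1..n} \<Longrightarrow> gH (HcX i) \<in> carrier HC" "i \<in> {1..n} \<Longrightarrow> gH (HcXi i) \<in> carrier HC"
  by (erule gH_carr[OF gens(4)] gH_carr[OF gens(5)] gH_carr[OF gens(6)] gH_carr[OF gens(7)])+

definition psi :: "spin_gen \<Rightarrow> (hc_gen list \<Rightarrow>\<^sub>0 cq) set" where
  "psi g = (case g of
          SpR i \<Rightarrow> (gH (HcC i) \<ominus>\<^bsub>HC\<^esub> gH (HcC (i + 1))) \<otimes>\<^bsub>HC\<^esub> gH (HcT i) \<oplus>\<^bsub>HC\<^esub> eps \<odot>\<^bsub>HC\<^esub> gH (HcC (i + 1))
        | SpP i \<Rightarrow> (1 / 2) \<odot>\<^bsub>HC\<^esub> (gH (HcX i) \<oplus>\<^bsub>HC\<^esub> gH (HcXi i))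
        | SpQ i \<Rightarrow> (1 / 2) \<odot>\<^bsub>HC\<^esub> ((gH (HcX i) \<ominus>\<^bsub>HC\<^esub> gH (HcXi i)) \<otimes>\<^bsub>HC\<^esub> gH (HcC i)))"

definition "psiC = gen_hom HC (\<lambda>g. case g of ClC i \<Rightarrow> gH (HcC i))"
definition "psiH = gen_hom HC psi"

lemma Psi_eq: "Psi n = lift HC (\<lambda>(a, b). psiC a \<otimes>\<^bsub>HC\<^esub> psiH b)"
  unfolding Psi_def Let_def psiC_def psiH_def psi_def[abs_def] gH_def ..

lemma psi_relations: "HC.spin_relations n (\<lambda>i. psi (SpR i)) (\<lambda>i. psi (SpP i)) (\<lambda>i. psi (SpQ i))"
  by (rule HC.spin_of_hc(1)[OF hc_elems HC_relations]) (simp_all add: psi_def)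

lemma psi_comm: 
  "i \<in> {1..<n} \<Longrightarrow> j \<in> {1..n} \<Longrightarrow> psi (SpR i) \<otimes>\<^bsub>HC\<^esub> gH (HcC j) = \<ominus>\<^bsub>HC\<^esub> (gH (HcC j) \<otimes>\<^bsub>HC\<^esub> psi (SpR i))"
  "i \<in> {1..n} \<Longrightarrow> j \<in> {1..n} \<Longrightarrow> psi (SpP i) \<otimes>\<^bsub>HC\<^esub> gH (HcC j) = gH (HcC j) \<otimes>\<^bsub>HC\<^esub> psi (SpP i)"
  "i \<in> {1..n} \<Longrightarrow> j \<in> {1..n} \<Longrightarrow> psi (SpQ i) \<otimes>\<^bsub>HC\<^esub> gH (HcC j) = \<ominus>\<^bsub>HC\<^esub> (gH (HcC j) \<otimes>\<^bsub>HC\<^esub> psi (SpQ i))"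
  by (rule HC.spin_of_hc(2-4)[OF hc_elems HC_relations, where R="\<lambda>i. psi (SpR i)" and p="\<lambda>i. psi (SpP i)" and q="\<lambda>i. psi (SpQ i)"];
     simp add: psi_def)+

lemma psi_grade: "g \<in> spin_gens n \<Longrightarrow> psi g \<in> grade HC (spin_par g)"
proof (cases g)
  case (SpR i) assume "g \<in> spin_gens n"
  then have i: "i \<in> {1..<n}" using SpR by (auto simp: spin_gens_def)
  note c = gH_grade[OF gens(5)[OF up(1)[OF i]]] gH_grade[OF gens(5)[OF up(2)[OF i]]]
  have "(gH (HcC i) \<ominus>\<^bsub>HC\<^esub> gH (HcC (i + 1))) \<otimes>\<^bsub>HC\<^esub> gH (HcT i) \<in> grade HC (True \<noteq> hc_par (HcT i))"
    by (intro HC.grade_mult HC.grade_diff c[unfolded hc_par.simps] gH_grade gens(4) i)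
  then show ?thesis using SpR c by (simp add: psi_def HC.grade_add HC.grade_smult)
next
  case (SpP i) assume "g \<in> spin_gens n"
  then have i: "i \<in> {1..n}" using SpP by (auto simp: spin_gens_def)
  show ?thesis using SpP gH_grade[OF gens(6)[OF i]] gH_grade[OF gens(7)[OF i]] by (simp add: psi_def HC.grade_add HC.grade_smult)
next
  case (SpQ i) assume "g \<in> spin_gens n"
  then have i: "i \<in> {1..n}" using SpQ by (auto simp: spin_gens_def)
  have "(gH (HcX i) \<ominus>\<^bsub>HC\<^esub> gH (HcXi i)) \<otimes>\<^bsub>HC\<^esub> gH (HcC i) \<in> grade HC (False \<noteq> hc_par (HcC i))"
    by (intro HC.grade_mult HC.grade_diff gH_grade[OF gens(6)[OF i], unfolded hc_par.simps]
       gH_grade[OF gens(7)[OF i], unfolded hc_par.simps] gH_grade[OF gens(5)[OF i]])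
  then show ?thesis using SpQ by (simp add: psi_def HC.grade_smult)
qed

lemma psi_carr: "g \<in> spin_gens n \<Longrightarrow> psi g \<in> carrier HC"
  by (rule HC.grade_carr[OF psi_grade])

lemma psiC_hom: "psiC \<in> alg_hom C HC" "i \<in> {1..n} \<Longrightarrow> psiC (cC i) = gH (HcC i)" "psiC \<in> even_map C HC"
proof -
  let ?f = "\<lambda>g. case g of ClC i \<Rightarrow> gH (HcC i)"
  have c: "?f g \<in> carrier HC" and gr: "?f g \<in> grade HC True" if "g \<in> ClC ` {1..n}" for g
    using that gH_grade[OF gens(5)] hc_elems(2) by (auto simp del: atLeastAtMost_iff)
  interpret ev: evaluation HC "ClC ` {1..n}" "\<lambda>_. True" ?f
    by (intro evaluation.intro evaluation_axioms.intro HC.superalgebra_axioms c)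
  have e: "evl HC ?f (gen (ClC i)) = gH (HcC i)" if "i \<in> {1..n}" for i
    using ev.evl_gen[of "ClC i"] that by simp
  have "HC.clifford_relations n (\<lambda>i. evl HC ?f (gen (ClC i)))"
    by (rule iffD2[OF HC.clifford_relations_cong HC.clifford_of_hc[OF HC_relations]]) (rule e)
  then have r: "evl HC ?f r = \<zero>\<^bsub>HC\<^esub>" if "r \<in> clifford_rels n" for r
    by (rule bspec[OF iffD2[OF HC.clifford_rels_iff[OF ev.evl_hom]] that])
  note g = PC.gen_hom[OF HC.superalgebra_axioms]
  show "psiC \<in> alg_hom C HC" unfolding psiC_def by (rule g(1)) (erule c r)+
  show "psiC \<in> even_map C HC" unfolding psiC_def by (rule g(3)) (erule c r gr)+
  show "i \<in> {1..n} \<Longrightarrow> psiC (cC i) = gH (HcC i)"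
    using g(2)[of ?f "ClC i", OF c r] unfolding psiC_def cC_def by simp
qed

lemma psiH_hom: "psiH \<in> alg_hom H HC" "g \<in> spin_gens n \<Longrightarrow> psiH (sH g) = psi g" "psiH \<in> even_map H HC"
proof -
  interpret ev: evaluation HC "spin_gens n" spin_par psi
    by (intro evaluation.intro evaluation_axioms.intro HC.superalgebra_axioms psi_carr)
  have "HC.spin_relations n (\<lambda>i. evl HC psi (gen (SpR i))) (\<lambda>i. evl HC psi (gen (SpP i))) (\<lambda>i. evl HC psi (gen (SpQ i)))"
    by (rule iffD2[OF HC.spin_relations_cong psi_relations]) (rule ev.evl_gen, erule gens)+
  then have r: "evl HC psi r = \<zero>\<^bsub>HC\<^esub>" if "r \<in> spin_rels n" for r
    by (rule bspec[OF iffD2[OF HC.spin_rels_iff[OF ev.evl_hom]] that])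
  note g = PS.gen_hom[OF HC.superalgebra_axioms]
  show "psiH \<in> alg_hom H HC" unfolding psiH_def by (rule g(1)) (erule psi_carr r)+
  show "g \<in> spin_gens n \<Longrightarrow> psiH (sH g) = psi g" unfolding psiH_def sH_def by (rule g(2)) (erule psi_carr r | assumption)+
  show "psiH \<in> even_map H HC" unfolding psiH_def by (rule g(3)) (erule psi_carr r psi_grade)+
qed

lemma psi_supercomm:
  assumes "a \<in> grade C t" "b \<in> grade H s"
  shows "psiH b \<otimes>\<^bsub>HC\<^esub> psiC a = koszul s t \<odot>\<^bsub>HC\<^esub> (psiC a \<otimes>\<^bsub>HC\<^esub> psiH b)"
proof (rule supercommute_extend[OF clifford_presentation spin_presentation HC.superalgebra_axioms, 
    folded clifford_def affine_spin_def, OF psiC_hom(1) psiH_hom(1) _ assms])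
  fix x y assume x: "x \<in> ClC ` {1..n}" and y: "y \<in> spin_gens n"
  then obtain j where j: "j \<in> {1..n}" "x = ClC j" by (elim imageE)
  have "psi y \<otimes>\<^bsub>HC\<^esub> gH (HcC j) = koszul (spin_par y) True \<odot>\<^bsub>HC\<^esub> (gH (HcC j) \<otimes>\<^bsub>HC\<^esub> psi y)"
  proof (cases y)
    case (SpR i) then have "i \<in> {1..<n}" using y by (auto simp: spin_gens_def)
    then show ?thesis using SpR psi_comm(1)[of i j] j(1) psi_carr[OF y] hc_elems(2)[OF j(1)] by (simp add: HC.smult_neg_one)
  next
    case (SpP i) then have "i \<in> {1..n}" using y by (auto simp: spin_gens_def)
    then show ?thesis using SpP psi_comm(2)[of i j] j(1) psi_carr[OF y] hc_elems(2)[OF j(1)] by simp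
  next
    case (SpQ i) then have "i \<in> {1..n}" using y by (auto simp: spin_gens_def)
    then show ?thesis using SpQ psi_comm(3)[of i j] j(1) psi_carr[OF y] hc_elems(2)[OF j(1)] by (simp add: HC.smult_neg_one)
  qed
  then show "psiH (cls H (gen y)) \<otimes>\<^bsub>HC\<^esub> psiC (cls C (gen x)) =
       koszul (spin_par y) True \<odot>\<^bsub>HC\<^esub> (psiC (cls C (gen x)) \<otimes>\<^bsub>HC\<^esub> psiH (cls H (gen y)))"
    using psiC_hom(2)[OF j(1)] psiH_hom(2)[OF y] by (simp add: j(2) cC_def sH_def)
qed

lemma Psi_hom: "Psi n \<in> alg_hom CH HC" "Psi n \<in> even_map CH HC"
  "a \<in> carrier C \<Longrightarrow> b \<in> carrier H \<Longrightarrow> Psi n (T.tn a b) = psiC a \<otimes>\<^bsub>HC\<^esub> psiH b"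
  unfolding Psi_eq
  using T.pair_hom[OF HC.superalgebra_axioms psiC_hom(1) psiH_hom(1) psi_supercomm] psiC_hom(3) psiH_hom(3) by simp_all

lemma Psi_c: "i \<in> {1..n} \<Longrightarrow> Psi n (cD i) = gH (HcC i)"
  using Psi_hom(3)[of "cC i" "\<one>\<^bsub>H\<^esub>"] alg_homD(3)[OF psiH_hom(1)] psiC_hom(2)[of i] hc_elems(2)[of i] by (simp add: cD_def cC_carr del: atLeastAtMost_iff)

lemma Psi_b: "g \<in> spin_gens n \<Longrightarrow> Psi n (bD g) = psi g"
  using Psi_hom(3)[of "\<one>\<^bsub>C\<^esub>" "sH g"] alg_homD(3)[OF psiC_hom(1)] psiH_hom(2)[of g] psi_carr[of g] by (simp add: bD_def sH_carr)

end

section \<open>Quotients by matching ideals\<close>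

lemma superalg_isoI:
  assumes A: "superalgebra A" and B: "superalgebra B"
    and h: "h \<in> alg_hom A B" "h \<in> even_map A B" and g: "g \<in> alg_hom B A" "g \<in> even_map B A"
    and gh: "\<And>x. x \<in> carrier A \<Longrightarrow> g (h x) = x" and hg: "\<And>y. y \<in> carrier B \<Longrightarrow> h (g y) = y"
  shows "h \<in> superalg_iso A B"
proof -
  interpret A: superalgebra A by fact
  interpret B: superalgebra B by fact
  note hD = alg_homD[OF h(1)] and gD = alg_homD[OF g(1)]
  have "h \<in> ring_hom A B" by (rule ring_hom_memI) (simp_all add: hD)
  moreover have "bij_betw h (carrier A) (carrier B)"
    by (rule bij_betw_byWitness[where f'=g]) (use gh hg hD(4) gD(4) in auto)
  moreover have "h ` grade A s = grade B s" for s
  proof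
    show "h ` grade A s \<subseteq> grade B s" using even_mapD[OF h(2)] by auto
    show "grade B s \<subseteq> h ` grade A s"
    proof
      fix y assume y: "y \<in> grade B s"
      from hg[OF B.grade_carr[OF y]] have "y = h (g y)" by (rule sym)
      then show "y \<in> h ` grade A s" using even_mapD[OF g(2) y] by (rule image_eqI)
    qed
  qed
  ultimately show ?thesis by (simp add: superalg_iso_def ring_iso_def hD(5))
qed

lemma trivial_superalgebra:
  fixes A :: "'a superalg" (structure)
  assumes "nonassoc_alg A" "\<And>x y z. x \<in> carrier A \<Longrightarrow> y \<in> carrier A \<Longrightarrow> z \<in> carrier A \<Longrightarrow> (x \<otimes> y) \<otimes> z = x \<otimes> (y \<otimes> z)"
    "\<one> \<in> carrier A" "\<And>x. x \<in> carrier A \<Longrightarrow> \<one> \<otimes> x = x" "\<And>x. x \<in> carrier A \<Longrightarrow> x \<otimes> \<one> = x"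
    and gr: "grade A = (\<lambda>s. if s then {\<zero>} else carrier A)"
  shows "superalgebra A"
proof -
  interpret nonassoc_alg A by fact
  have z: "\<zero> \<otimes> x = \<zero>" "x \<otimes> \<zero> = \<zero>" if "x \<in> carrier A" for x
    using smult_mult_l[of \<zero> x 0] smult_mult_r[of x \<zero> 0] that by simp_all
  show ?thesis
    by unfold_locales (use assms(2-5) z in \<open>auto simp: gr split: if_splits\<close>)
qed

text \<open>
  Clifford generators act on the exterior algebra, here the functions on finite or infinite subsets \<open>S\<close>
  of \<open>\<nat>\<close>: the \<open>i\<close>-th one adds or removes \<open>i\<close>, with a sign that counts the smaller elements.
\<close>

definition cliff_op :: "nat \<Rightarrow> (nat set \<Rightarrow> cq) \<Rightarrow> nat set \<Rightarrow> cq" where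
  "cliff_op i v S = (if even (card (S \<inter> {..<i})) then 1 else - 1) * v (if i \<in> S then S - {i} else insert i S)"

text \<open>
  The operators on these functions. The whole algebra is declared even because only its
  ring structure is used.
\<close>

definition End_alg :: "((nat set \<Rightarrow> cq) \<Rightarrow> nat set \<Rightarrow> cq) superalg" where
  "End_alg = (let E = {f. (\<forall>v w. f (\<lambda>S. v S + w S) = (\<lambda>S. f v S + f w S)) \<and> (\<forall>k v. f (\<lambda>S. k * v S) = (\<lambda>S. k * f v S))} in
     \<lparr>carrier = E, mult = (\<lambda>f g v. f (g v)), one = (\<lambda>v. v), zero = (\<lambda>v S. 0), add = (\<lambda>f g v S. f v S + g v S),
      smult = (\<lambda>k f v S. k * f v S), grade = (\<lambda>s. if s then {\<lambda>v S. 0} else E)\<rparr>)"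

lemma End_simps: 
  "f \<in> carrier End_alg \<longleftrightarrow> (\<forall>v w. f (\<lambda>S. v S + w S) = (\<lambda>S. f v S + f w S)) \<and> (\<forall>k v. f (\<lambda>S. k * v S) = (\<lambda>S. k * f v S))"
  "mult End_alg = (\<lambda>f g v. f (g v))" "one End_alg = (\<lambda>v. v)" "zero End_alg = (\<lambda>v S. 0)" 
  "add End_alg = (\<lambda>f g v S. f v S + g v S)" "smult End_alg = (\<lambda>k f v S. k * f v S)"
  "grade End_alg = (\<lambda>s. if s then {\<lambda>v S. 0} else carrier End_alg)"
  by (auto simp: End_alg_def Let_def fun_eq_iff)

lemma End_superalgebra: "superalgebra End_alg"
proof -
  have "vspace End_alg"
    by (rule vspaceI) (auto simp: End_simps algebra_simps fun_eq_iff)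
  then have "nonassoc_alg End_alg"
    by (intro nonassoc_alg.intro nonassoc_alg_axioms.intro) (simp_all add: End_simps)
  then show ?thesis
    by (rule trivial_superalgebra) (simp_all only: End_simps(7,4), simp_all add: End_simps)
qed

lemma cliff_op_square: "cliff_op i (cliff_op i v) = v"
proof (rule ext)
  fix S
  have e: "(S - {i}) \<inter> {..<i} = S \<inter> {..<i}" "insert i S \<inter> {..<i} = S \<inter> {..<i}" by auto
  show "cliff_op i (cliff_op i v) S = v S" by (auto simp: cliff_op_def e insert_absorb)
qed

lemma cliff_op_anti: 
  assumes "i < j" 
  shows "cliff_op i (cliff_op j v) S = - cliff_op j (cliff_op i v) S"
proof -
  have e: "(S - {j}) \<inter> {..<i} = S \<inter> {..<i}" "insert j S \<inter> {..<i} = S \<inter> {..<i}" using assms by auto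
  have c: "card ((S - {i}) \<inter> {..<j}) = card (S \<inter> {..<j}) - 1" "card (S \<inter> {..<j}) > 0" if "i \<in> S"
  proof -
    have "(S - {i}) \<inter> {..<j} = (S \<inter> {..<j}) - {i}" "i \<in> S \<inter> {..<j}" using that assms by auto
    then show "card ((S - {i}) \<inter> {..<j}) = card (S \<inter> {..<j}) - 1" "card (S \<inter> {..<j}) > 0" 
      by (auto simp: card_gt_0_iff)
  qed
  have ne: "S \<inter> {..<j} \<noteq> {}" if "i \<in> S" using that assms by auto
  have d: "card (insert i S \<inter> {..<j}) = Suc (card (S \<inter> {..<j}))" if "i \<notin> S"
  proof -
    have "insert i S \<inter> {..<j} = insert i (S \<inter> {..<j})" using assms by auto
    then show ?thesis using that by simp
  qed
  have s: "insert j (S - {i}) = insert j S - {i}" "insert i (S - {j}) = insert i S - {j}" using assms by auto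
  have p: "S - {i} - {j} = S - {j} - {i}" "insert i (insert j S) = insert j (insert i S)" by auto
  show ?thesis
    using assms c d ne by (cases "i \<in> S"; cases "j \<in> S") (simp_all add: cliff_op_def e s p)
qed

text \<open>
  The Clifford algebra acts on the exterior algebra, and the coefficient of the vacuum vector in
  \<open>a \<cdot> vacuum\<close> is a linear functional that is 1 at the unit. In particular the Clifford algebra is
  not zero.
\<close>

lemma clifford_functional:
  "\<exists>l. (\<forall>a\<in>carrier (clifford n). \<forall>b\<in>carrier (clifford n). l (a \<oplus>\<^bsub>clifford n\<^esub> b) = l a + (l b :: cq)) \<and>
       (\<forall>a\<in>carrier (clifford n). \<forall>k. l (k \<odot>\<^bsub>clifford n\<^esub> a) = k * l a) \<and> l \<one>\<^bsub>clifford n\<^esub> = 1"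
proof -
  interpret P: presentation "ClC ` {1..n}" "\<lambda>_. True" "clifford_rels n" 
    rewrites "presented (ClC ` {1..n}) (\<lambda>_. True) (clifford_rels n) = clifford n"
    by (rule clifford_presentation) (simp add: clifford_def)
  interpret E: superalgebra End_alg by (rule End_superalgebra)
  let ?f = "\<lambda>g. case g of ClC i \<Rightarrow> cliff_op i"
  have c: "?f g \<in> carrier End_alg" for g
    by (cases g) (auto simp: End_simps cliff_op_def[abs_def] fun_eq_iff algebra_simps)
  interpret ev: evaluation End_alg "ClC ` {1..n}" "\<lambda>_. True" ?f
    by (intro evaluation.intro evaluation_axioms.intro E.superalgebra_axioms c)
  have e: "evl End_alg ?f (gen (ClC i)) = cliff_op i" if "i \<in> {1..n}" for i
    using ev.evl_gen[of "ClC i"] that by simp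
  have inv: "\<ominus>\<^bsub>End_alg\<^esub> g = (\<lambda>v S. - g v S)" if "g \<in> carrier End_alg" for g
    using E.smult_neg_one[OF that] by (simp add: End_simps)
  have cl: "cliff_op i \<in> carrier End_alg" for i using c[of "ClC i"] by simp
  have anti: "cliff_op i (cliff_op j v) S = - cliff_op j (cliff_op i v) S" if "i \<noteq> j" for i j v S
  proof (cases "i < j")
    case True then show ?thesis by (rule cliff_op_anti)
  next
    case False
    then have "j < i" using that by simp
    then have "cliff_op j (cliff_op i v) S = - cliff_op i (cliff_op j v) S" by (rule cliff_op_anti)
    then show ?thesis by (rule equation_minus_iff[THEN iffD1])
  qed
  have "E.clifford_relations n cliff_op"
    unfolding E.clifford_relations_def
  proof (intro conjI allI impI ballI)
    fix i show "cliff_op i \<otimes>\<^bsub>End_alg\<^esub> cliff_op i = \<one>\<^bsub>End_alg\<^esub>"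
      unfolding End_simps(2,3) by (rule ext) (rule cliff_op_square)
  next
    fix i j assume a: "i \<in> {1..n} \<and> j \<in> {1..n} \<and> i \<noteq> j"
    have "cliff_op j \<otimes>\<^bsub>End_alg\<^esub> cliff_op i \<in> carrier End_alg" by (rule E.mult_closed[OF cl cl])
    from inv[OF this] show "cliff_op i \<otimes>\<^bsub>End_alg\<^esub> cliff_op j = \<ominus>\<^bsub>End_alg\<^esub> (cliff_op j \<otimes>\<^bsub>End_alg\<^esub> cliff_op i)"
      by (rule ssubst) (unfold End_simps(2), intro ext, rule anti, use a in simp)
  qed
  then have "E.clifford_relations n (\<lambda>i. evl End_alg ?f (gen (ClC i)))"
    by (rule iffD2[OF E.clifford_relations_cong, rotated]) (rule e)
  then have r: "evl End_alg ?f r = \<zero>\<^bsub>End_alg\<^esub>" if "r \<in> clifford_rels n" for r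
    by (rule bspec[OF iffD2[OF E.clifford_rels_iff[OF ev.evl_hom]] that])
  have "gen_hom End_alg ?f \<in> alg_hom (clifford n) End_alg" 
    by (rule P.gen_hom(1)[OF E.superalgebra_axioms c]) (erule r)
  note g = alg_homD[OF this]
  \<comment> \<open>The vacuum is the indicator function of the empty set.\<close>
  let ?l = "\<lambda>a. gen_hom End_alg ?f a (\<lambda>S. if S = {} then 1 else 0) {}"
  show ?thesis
    by (rule exI[of _ ?l]) (simp add: g(3,5,6), simp add: End_simps)
qed

context hecke
begin

text \<open>
  Both composites are homomorphisms, so it suffices to compare them with the identity on generators,
  which is \<open>roundtrip\<close> and \<open>roundtrip_x\<close>.
\<close>

lemma Psi_Phi: "x \<in> carrier HC \<Longrightarrow> Psi n (Phi n x) = x"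
proof (rule PH.hom_eqI[OF HC.superalgebra_axioms alg_hom_comp[OF Psi_hom(1) Phi_hom(1)] alg_hom_id])
  fix g assume g: "g \<in> hc_gens n"
  note P = alg_homD[OF Psi_hom(1)] lin_map_more[OF alg_homD(1)[OF Psi_hom(1)] T.D_vspace HC.vspace_axioms]
  note xc = HC_relations[unfolded HC.hc_relations_def, THEN conjunct2, THEN conjunct2, THEN conjunct2, THEN conjunct2, THEN conjunct2, THEN conjunct2, THEN conjunct2, THEN conjunct2, THEN conjunct2, THEN conjunct2, THEN conjunct2, THEN conjunct2, THEN conjunct1, rule_format]
  note cl = HC.clifford_of_hc[OF HC_relations, unfolded HC.clifford_relations_def]
  have "Psi n (phi g) = gH g"
  proof (cases g)
    case (HcT i)
    then have i: "i \<in> {1..<n}" using g by (auto simp: hc_gens_def)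
    note ii = up[OF i]
    have "Psi n (phi g) = (- (1 / 2)) \<odot>\<^bsub>HC\<^esub> (psi (SpR i) \<otimes>\<^bsub>HC\<^esub> (gH (HcC i) \<ominus>\<^bsub>HC\<^esub> gH (HcC (i + 1))))
                  \<oplus>\<^bsub>HC\<^esub> (eps / 2) \<odot>\<^bsub>HC\<^esub> (\<one>\<^bsub>HC\<^esub> \<ominus>\<^bsub>HC\<^esub> gH (HcC i) \<otimes>\<^bsub>HC\<^esub> gH (HcC (i + 1)))"
      unfolding HcT phi_def hc_gen.case
      by (simp only: P T.D.smult_closed T.D.mult_closed T.D.minus_closed T.D.add.m_closed T.D.unit_closed cD_carr bD_carr gens(1)[OF i] ii 
          Psi_c Psi_b)
    also have "\<dots> = gH (HcT i)"
    proof (rule HC.roundtrip(1))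
      show "gH (HcC i) \<in> carrier HC" "gH (HcC (i + 1)) \<in> carrier HC" "gH (HcT i) \<in> carrier HC" "psi (SpR i) \<in> carrier HC"
        by (rule hc_elems(2)[OF ii(1)], rule hc_elems(2)[OF ii(2)], rule hc_elems(1)[OF i], rule psi_carr[OF gens(1)[OF i]])
      show "gH (HcC i) \<otimes>\<^bsub>HC\<^esub> gH (HcC i) = \<one>\<^bsub>HC\<^esub>" "gH (HcC (i + 1)) \<otimes>\<^bsub>HC\<^esub> gH (HcC (i + 1)) = \<one>\<^bsub>HC\<^esub>"
        by (rule cl[THEN conjunct1, rule_format]; rule ii)+
      show "gH (HcC (i + 1)) \<otimes>\<^bsub>HC\<^esub> gH (HcC i) = \<ominus>\<^bsub>HC\<^esub> (gH (HcC i) \<otimes>\<^bsub>HC\<^esub> gH (HcC (i + 1)))"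
        by (rule cl[THEN conjunct2, rule_format]) (use ii in simp)
      show "psi (SpR i) \<otimes>\<^bsub>HC\<^esub> gH (HcC i) = \<ominus>\<^bsub>HC\<^esub> (gH (HcC i) \<otimes>\<^bsub>HC\<^esub> psi (SpR i))"
        "psi (SpR i) \<otimes>\<^bsub>HC\<^esub> gH (HcC (i + 1)) = \<ominus>\<^bsub>HC\<^esub> (gH (HcC (i + 1)) \<otimes>\<^bsub>HC\<^esub> psi (SpR i))"
        by (rule psi_comm(1)[OF i ii(1)], rule psi_comm(1)[OF i ii(2)])
      show "psi (SpR i) = (gH (HcC i) \<ominus>\<^bsub>HC\<^esub> gH (HcC (i + 1))) \<otimes>\<^bsub>HC\<^esub> gH (HcT i) \<oplus>\<^bsub>HC\<^esub> eps \<odot>\<^bsub>HC\<^esub> gH (HcC (i + 1))"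
        by (simp add: psi_def)
    qed
    finally show ?thesis by (simp only: HcT)
  next
    case (HcC i)
    then have i: "i \<in> {1..n}" using g by (auto simp: hc_gens_def)
    show ?thesis using Psi_c[OF i] by (simp add: phi_def HcC)
  next
    case (HcX i)
    then have i: "i \<in> {1..n}" using g by (auto simp: hc_gens_def)
    have x: "gH (HcX i) \<otimes>\<^bsub>HC\<^esub> gH (HcC i) = gH (HcC i) \<otimes>\<^bsub>HC\<^esub> gH (HcXi i)" by (rule xc[OF i])
    have c: "gH (HcC i) \<otimes>\<^bsub>HC\<^esub> gH (HcC i) = \<one>\<^bsub>HC\<^esub>" by (rule cl[THEN conjunct1, rule_format, OF i])
    have "Psi n (phi g) = psi (SpP i) \<ominus>\<^bsub>HC\<^esub> gH (HcC i) \<otimes>\<^bsub>HC\<^esub> psi (SpQ i)"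
      unfolding HcX phi_def hc_gen.case
      by (simp only: P T.D.mult_closed cD_carr bD_carr gens(2,3)[OF i] i Psi_c Psi_b)
    also have "\<dots> = gH (HcX i)"
      by (rule HC.roundtrip_x(1)[OF hc_elems(2)[OF i] psi_carr[OF gens(2)[OF i]] psi_carr[OF gens(3)[OF i]] hc_elems(3,4)[OF i] c x])
        (simp_all add: psi_def)
    finally show ?thesis by (simp only: HcX)
  next
    case (HcXi i)
    then have i: "i \<in> {1..n}" using g by (auto simp: hc_gens_def)
    have x: "gH (HcX i) \<otimes>\<^bsub>HC\<^esub> gH (HcC i) = gH (HcC i) \<otimes>\<^bsub>HC\<^esub> gH (HcXi i)" by (rule xc[OF i])
    have c: "gH (HcC i) \<otimes>\<^bsub>HC\<^esub> gH (HcC i) = \<one>\<^bsub>HC\<^esub>" by (rule cl[THEN conjunct1, rule_format, OF i])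
    have "Psi n (phi g) = psi (SpP i) \<oplus>\<^bsub>HC\<^esub> gH (HcC i) \<otimes>\<^bsub>HC\<^esub> psi (SpQ i)"
      unfolding HcXi phi_def hc_gen.case
      by (simp only: P T.D.mult_closed cD_carr bD_carr gens(2,3)[OF i] i Psi_c Psi_b)
    also have "\<dots> = gH (HcXi i)"
      by (rule HC.roundtrip_x(2)[OF hc_elems(2)[OF i] psi_carr[OF gens(2)[OF i]] psi_carr[OF gens(3)[OF i]] hc_elems(3,4)[OF i] c x])
        (simp_all add: psi_def)
    finally show ?thesis by (simp only: HcXi)
  qed
  then show "Psi n (Phi n (cls HC (gen g))) = cls HC (gen g)"
    using Phi_hom(2)[OF g] by (simp add: gH_def)
qed

lemma Phi_Psi_gen:
  "i \<in> {1..n} \<Longrightarrow> Phi n (gH (HcC i)) = cD i"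
  "g \<in> spin_gens n \<Longrightarrow> Phi n (psi g) = bD g"
proof -
  note P = alg_homD[OF Phi_hom(1)] lin_map_more[OF alg_homD(1)[OF Phi_hom(1)] HC.vspace_axioms T.D_vspace]
  note cl = D_clifford[unfolded T.D.clifford_relations_def]
  show c: "Phi n (gH (HcC i)) = cD i" if "i \<in> {1..n}" for i using Phi_hom(2)[OF gens(5)[OF that]] by (simp add: phi_def)
  assume g: "g \<in> spin_gens n"
  show "Phi n (psi g) = bD g"
  proof (cases g)
    case (SpR i)
    then have i: "i \<in> {1..<n}" using g by (auto simp: spin_gens_def)
    note ii = up[OF i]
    have "Phi n (psi g) = (cD i \<ominus>\<^bsub>CH\<^esub> cD (i + 1)) \<otimes>\<^bsub>CH\<^esub> phi (HcT i) \<oplus>\<^bsub>CH\<^esub> eps \<odot>\<^bsub>CH\<^esub> cD (i + 1)"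
      unfolding SpR psi_def spin_gen.case
      by (simp only: P HC.smult_closed HC.mult_closed HC.minus_closed HC.add.m_closed hc_elems i ii c Phi_hom(2)[OF gens(4)[OF i]])
    also have "\<dots> = bD (SpR i)"
    proof (rule T.D.roundtrip(2))
      show "cD i \<in> carrier CH" "cD (i + 1) \<in> carrier CH" "phi (HcT i) \<in> carrier CH" "bD (SpR i) \<in> carrier CH"
        by (rule cD_carr[OF ii(1)], rule cD_carr[OF ii(2)], rule phi_carr[OF gens(4)[OF i]], rule bD_carr[OF gens(1)[OF i]])
      show "cD i \<otimes>\<^bsub>CH\<^esub> cD i = \<one>\<^bsub>CH\<^esub>" "cD (i + 1) \<otimes>\<^bsub>CH\<^esub> cD (i + 1) = \<one>\<^bsub>CH\<^esub>"
        by (rule cl[THEN conjunct1, rule_format]; rule ii)+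
      show "cD (i + 1) \<otimes>\<^bsub>CH\<^esub> cD i = \<ominus>\<^bsub>CH\<^esub> (cD i \<otimes>\<^bsub>CH\<^esub> cD (i + 1))"
        by (rule cl[THEN conjunct2, rule_format]) (use ii in simp)
      show "bD (SpR i) \<otimes>\<^bsub>CH\<^esub> cD i = \<ominus>\<^bsub>CH\<^esub> (cD i \<otimes>\<^bsub>CH\<^esub> bD (SpR i))" "bD (SpR i) \<otimes>\<^bsub>CH\<^esub> cD (i + 1) = \<ominus>\<^bsub>CH\<^esub> (cD (i + 1) \<otimes>\<^bsub>CH\<^esub> bD (SpR i))"
        by (rule D_comm'(1)[OF i ii(1)], rule D_comm'(1)[OF i ii(2)])
      show "phi (HcT i) = (- (1 / 2)) \<odot>\<^bsub>CH\<^esub> (bD (SpR i) \<otimes>\<^bsub>CH\<^esub> (cD i \<ominus>\<^bsub>CH\<^esub> cD (i + 1)))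
                  \<oplus>\<^bsub>CH\<^esub> (eps / 2) \<odot>\<^bsub>CH\<^esub> (\<one>\<^bsub>CH\<^esub> \<ominus>\<^bsub>CH\<^esub> cD i \<otimes>\<^bsub>CH\<^esub> cD (i + 1))"
        by (simp add: phi_def)
    qed
    finally show ?thesis by (simp only: SpR)
  next
    case (SpP i)
    then have i: "i \<in> {1..n}" using g by (auto simp: spin_gens_def)
    note e = cD_carr[OF i] bD_carr[OF gens(2)[OF i]] bD_carr[OF gens(3)[OF i]] phi_carr[OF gens(6)[OF i]] phi_carr[OF gens(7)[OF i]]
      cl[THEN conjunct1, rule_format, OF i]
    have "Phi n (psi g) = (1 / 2) \<odot>\<^bsub>CH\<^esub> (phi (HcX i) \<oplus>\<^bsub>CH\<^esub> phi (HcXi i))"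
      unfolding SpP psi_def spin_gen.case
      by (simp only: P HC.add.m_closed hc_elems i Phi_hom(2)[OF gens(6)[OF i]] Phi_hom(2)[OF gens(7)[OF i]])
    also have "\<dots> = bD (SpP i)"
      by (rule T.D.roundtrip_x(3)[OF e]) (simp_all add: phi_def)
    finally show ?thesis by (simp only: SpP)
  next
    case (SpQ i)
    then have i: "i \<in> {1..n}" using g by (auto simp: spin_gens_def)
    note e = cD_carr[OF i] bD_carr[OF gens(2)[OF i]] bD_carr[OF gens(3)[OF i]] phi_carr[OF gens(6)[OF i]] phi_carr[OF gens(7)[OF i]]
      cl[THEN conjunct1, rule_format, OF i]
    have "Phi n (psi g) = (1 / 2) \<odot>\<^bsub>CH\<^esub> ((phi (HcX i) \<ominus>\<^bsub>CH\<^esub> phi (HcXi i)) \<otimes>\<^bsub>CH\<^esub> cD i)"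
      unfolding SpQ psi_def spin_gen.case
      by (simp only: P HC.mult_closed HC.minus_closed hc_elems i c Phi_hom(2)[OF gens(6)[OF i]] Phi_hom(2)[OF gens(7)[OF i]])
    also have "\<dots> = bD (SpQ i)"
      by (rule T.D.roundtrip_x(4)[OF e]) (use D_comm'(3)[OF i i] in \<open>simp_all add: phi_def\<close>)
    finally show ?thesis by (simp only: SpQ)
  qed
qed

lemma Phi_Psi: "y \<in> carrier CH \<Longrightarrow> Phi n (Psi n y) = y"
proof (rule T.D_hom_eqI[OF T.D_superalgebra alg_hom_comp[OF Phi_hom(1) Psi_hom(1)] alg_hom_id])
  fix a assume a: "a \<in> carrier C"
  show "Phi n (Psi n (T.tn a \<one>\<^bsub>H\<^esub>)) = T.tn a \<one>\<^bsub>H\<^esub>"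
  proof (rule PC.hom_eqI[OF T.D_superalgebra alg_hom_comp[OF alg_hom_comp[OF Phi_hom(1) Psi_hom(1)] T.inA_hom(1)] T.inA_hom(1) _ a])
    fix g assume "g \<in> ClC ` {1..n}"
    then obtain i where i: "i \<in> {1..n}" "g = ClC i" by (elim imageE)
    show "Phi n (Psi n (T.tn (cls C (gen g)) \<one>\<^bsub>H\<^esub>)) = T.tn (cls C (gen g)) \<one>\<^bsub>H\<^esub>"
      using Psi_c[OF i(1)] Phi_Psi_gen(1)[OF i(1)] by (simp only: i(2) cD_def cC_def)
  qed
next
  fix b assume b: "b \<in> carrier H"
  show "Phi n (Psi n (T.tn \<one>\<^bsub>C\<^esub> b)) = T.tn \<one>\<^bsub>C\<^esub> b"
  proof (rule PS.hom_eqI[OF T.D_superalgebra alg_hom_comp[OF alg_hom_comp[OF Phi_hom(1) Psi_hom(1)] T.inB_hom(1)] T.inB_hom(1) _ b])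
    fix g assume g: "g \<in> spin_gens n"
    show "Phi n (Psi n (T.tn \<one>\<^bsub>C\<^esub> (cls H (gen g)))) = T.tn \<one>\<^bsub>C\<^esub> (cls H (gen g))"
      using Psi_b[OF g] Phi_Psi_gen(2)[OF g] by (simp only: bD_def sH_def)
  qed
qed

text \<open>
  The two inclusions in the assumptions make \<open>\<Phi>\<close> and \<open>\<Psi>\<close> descend to the quotients. The descended
  maps stay mutually inverse because the projections are surjective. Injectivity of these isomorphisms, together with
  \<open>tn_faithful\<close>, shows that the ideals determine each other.
\<close>

lemma matching_ideals:
  fixes J I
  defines "A \<equiv> superquot HC J" and "B \<equiv> superquot H I"
  defines "\<tau> \<equiv> tensor_map C B id (cls B)"
  assumes J: "homogeneous_ideal J HC" and I: "homogeneous_ideal I H"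
    and JI: "\<And>x. x \<in> J \<Longrightarrow> \<tau> (Phi n x) = \<zero>\<^bsub>stensor C B\<^esub>"
    and IJ: "\<And>b. b \<in> I \<Longrightarrow> psiH b \<in> J"
  shows "iso_via_Phi n A B" "iso_via_Psi n B A"
    "J = {x \<in> carrier HC. \<tau> (Phi n x) = \<zero>\<^bsub>stensor C B\<^esub>}" "I = {b \<in> carrier H. psiH b \<in> J}"
proof -
  interpret QA: homogeneous_quotient HC J by (intro homogeneous_quotient.intro homogeneous_quotient_axioms.intro HC.superalgebra_axioms J)
  interpret QB: homogeneous_quotient H I by (intro homogeneous_quotient.intro homogeneous_quotient_axioms.intro T.B.superalgebra_axioms I)
  have As: "superalgebra A" unfolding A_def by (rule QA.quot_superalgebra)
  have Bs: "superalgebra B" unfolding B_def by (rule QB.quot_superalgebra)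
  interpret A: superalgebra A by (rule As)
  interpret TB: tensor_product C B by (simp add: tensor_product_def T.A.superalgebra_axioms Bs)
  have cA: "cls A \<in> alg_hom HC A" "cls A \<in> even_map HC A" unfolding A_def by (rule QA.cls_alg_hom, rule QA.cls_even)
  have cB: "cls B \<in> alg_hom H B" "cls B \<in> even_map H B" unfolding B_def by (rule QB.cls_alg_hom, rule QB.cls_even)
  have A0: "cls A x = \<zero>\<^bsub>A\<^esub> \<longleftrightarrow> x \<in> J" if "x \<in> carrier HC" for x unfolding A_def by (rule QA.cls_zero[OF that])
  have B0: "cls B x = \<zero>\<^bsub>B\<^esub> \<longleftrightarrow> x \<in> I" if "x \<in> carrier H" for x unfolding B_def by (rule QB.cls_zero[OF that])
  note tau = tensor_map_hom[OF T.A.superalgebra_axioms T.B.superalgebra_axioms Bs cB, folded \<tau>_def]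
  have tau_surj: "\<exists>y\<in>carrier CH. w = \<tau> y" if "w \<in> carrier (stensor C B)" for w
    unfolding \<tau>_def
    by (rule tensor_map_surj[OF T.A.superalgebra_axioms T.B.superalgebra_axioms Bs cB _ that])
      (unfold B_def, rule QB.quot_carrierE)
  have one_B: "cls B \<one>\<^bsub>H\<^esub> = \<one>\<^bsub>B\<^esub>" by (rule alg_homD(3)[OF cB(1)])
  obtain \<theta> where \<theta>: "\<theta> \<in> alg_hom A (stensor C B)" "\<And>x. x \<in> carrier HC \<Longrightarrow> \<theta> (cls A x) = \<tau> (Phi n x)" "\<theta> \<in> even_map A (stensor C B)"
  proof -
    have "\<exists>g\<in>alg_hom A (stensor C B). (\<forall>x\<in>carrier HC. g (cls A x) = \<tau> (Phi n x)) \<and>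
       ((\<lambda>x. \<tau> (Phi n x)) \<in> even_map HC (stensor C B) \<longrightarrow> g \<in> even_map A (stensor C B))"
      unfolding A_def by (rule QA.induced_hom[OF TB.D_superalgebra alg_hom_comp[OF tau(1) Phi_hom(1)] JI])
    then show ?thesis using even_map_comp[OF tau(2) Phi_hom(3)] by (elim bexE conjE) (rule that, simp_all)
  qed
  obtain g where g: "g \<in> alg_hom B A" "\<And>b. b \<in> carrier H \<Longrightarrow> g (cls B b) = cls A (psiH b)" "g \<in> even_map B A"
  proof -
    have k: "cls A (psiH b) = \<zero>\<^bsub>A\<^esub>" if "b \<in> I" for b
      using A0[OF alg_homD(4)[OF psiH_hom(1) QB.I_carr[OF that]]] IJ[OF that] by simp
    have "\<exists>g\<in>alg_hom B A. (\<forall>b\<in>carrier H. g (cls B b) = cls A (psiH b)) \<and>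
       ((\<lambda>b. cls A (psiH b)) \<in> even_map H A \<longrightarrow> g \<in> even_map B A)"
      unfolding B_def by (rule QB.induced_hom[OF As alg_hom_comp[OF cA(1) psiH_hom(1)] k])
    then show ?thesis using even_map_comp[OF cA(2) psiH_hom(3)] by (elim bexE conjE) (rule that, simp_all)
  qed
  define f where "f a = cls A (psiC a)" for a
  have f: "f \<in> alg_hom C A" "f \<in> even_map C A" 
    unfolding f_def[abs_def] by (rule alg_hom_comp[OF cA(1) psiC_hom(1)], rule even_map_comp[OF cA(2) psiC_hom(3)])
  have comm: "g b \<otimes>\<^bsub>A\<^esub> f a = koszul s t \<odot>\<^bsub>A\<^esub> (f a \<otimes>\<^bsub>A\<^esub> g b)" if a: "a \<in> grade C t" and b: "b \<in> grade B s" for a b s t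
  proof -
    from b obtain b' where b': "b' \<in> grade H s" "b = cls B b'"
    proof -
      have "b \<in> (\<lambda>x. I +>\<^bsub>H\<^esub> x) ` grade H s" using b unfolding B_def QB.quot_grade .
      then obtain b' where b': "b' \<in> grade H s" "b = I +>\<^bsub>H\<^esub> b'" by (elim imageE)
      show ?thesis by (rule that[OF b'(1)]) (simp only: b'(2) B_def QB.cls_quot[OF T.B.grade_carr[OF b'(1)]])
    qed
    note c = T.B.grade_carr[OF b'(1)] T.A.grade_carr[OF a]
    have p: "psiH b' \<in> carrier HC" "psiC a \<in> carrier HC" using alg_homD(4)[OF psiH_hom(1)] alg_homD(4)[OF psiC_hom(1)] c by auto
    have "cls A (psiH b' \<otimes>\<^bsub>HC\<^esub> psiC a) = cls A (koszul s t \<odot>\<^bsub>HC\<^esub> (psiC a \<otimes>\<^bsub>HC\<^esub> psiH b'))"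
      by (simp only: psi_supercomm[OF a b'(1)])
    then show ?thesis using p c by (simp add: b'(2) g(2) f_def alg_homD[OF cA(1)])
  qed
  define \<psi> where "\<psi> = lift A (\<lambda>(a, b). f a \<otimes>\<^bsub>A\<^esub> g b)"
  have \<psi>: "\<psi> \<in> alg_hom (stensor C B) A" "\<psi> \<in> even_map (stensor C B) A"
     "\<And>a b. a \<in> carrier C \<Longrightarrow> b \<in> carrier B \<Longrightarrow> \<psi> (TB.tn a b) = f a \<otimes>\<^bsub>A\<^esub> g b"
    unfolding \<psi>_def
    by (rule TB.pair_hom(1)[OF As f(1) g(1) comm], assumption+, rule TB.pair_hom(3)[OF As f(1) g(1) comm f(2) g(3)], assumption+,
      rule TB.pair_hom(2)[OF As f(1) g(1) comm], assumption+)
  have cBc: "cls B b \<in> carrier B" if "b \<in> carrier H" for b by (rule alg_homD(4)[OF cB(1) that])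
  have \<psi>\<tau>: "\<psi> (\<tau> y) = cls A (Psi n y)" if y: "y \<in> carrier CH" for y
  proof (rule T.D_hom_eqI[OF As alg_hom_comp[OF \<psi>(1) tau(1)] alg_hom_comp[OF cA(1) Psi_hom(1)] _ _ y])
    fix a assume a: "a \<in> carrier C"
    have fa: "f a \<in> carrier A" "psiC a \<in> carrier HC" by (rule alg_homD(4)[OF f(1) a], rule alg_homD(4)[OF psiC_hom(1) a])
    show "\<psi> (\<tau> (T.tn a \<one>\<^bsub>H\<^esub>)) = cls A (Psi n (T.tn a \<one>\<^bsub>H\<^esub>))"
      using a fa \<psi>(3)[OF a TB.B.unit_closed] tau(3)[OF a T.B.unit_closed] Psi_hom(3)[OF a T.B.unit_closed]
      by (simp add: one_B alg_homD(3)[OF g(1)] alg_homD(3)[OF psiH_hom(1)] f_def)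
  next
    fix b assume b: "b \<in> carrier H"
    have pb: "psiH b \<in> carrier HC" "cls A (psiH b) \<in> carrier A" by (rule alg_homD(4)[OF psiH_hom(1) b], rule alg_homD(4)[OF cA(1) alg_homD(4)[OF psiH_hom(1) b]])
    show "\<psi> (\<tau> (T.tn \<one>\<^bsub>C\<^esub> b)) = cls A (Psi n (T.tn \<one>\<^bsub>C\<^esub> b))"
      using b pb \<psi>(3)[OF T.A.unit_closed cBc[OF b]] tau(3)[OF T.A.unit_closed b] Psi_hom(3)[OF T.A.unit_closed b]
      by (simp add: alg_homD(3)[OF f(1)] alg_homD(3)[OF psiC_hom(1)] g(2))
  qed
  have clsE: "\<exists>x\<in>carrier HC. w = cls A x" if "w \<in> carrier A" for w 
    using that unfolding A_def by (rule QA.quot_carrierE)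
  have Phic: "Phi n x \<in> carrier CH" if "x \<in> carrier HC" for x by (rule alg_homD(4)[OF Phi_hom(1) that])
  have Psic: "Psi n y \<in> carrier HC" if "y \<in> carrier CH" for y by (rule alg_homD(4)[OF Psi_hom(1) that])
  have 1: "\<psi> (\<theta> w) = w" if w: "w \<in> carrier A" for w
  proof -
    from clsE[OF w] obtain x where x: "x \<in> carrier HC" "w = cls A x" by (elim bexE)
    show ?thesis using \<psi>\<tau>[OF Phic[OF x(1)]] Psi_Phi[OF x(1)] by (simp add: x \<theta>(2))
  qed
  have 2: "\<theta> (\<psi> w) = w" if w: "w \<in> carrier (stensor C B)" for w
  proof -
    from tau_surj[OF w] obtain y where y: "y \<in> carrier CH" "w = \<tau> y" by (elim bexE)
    show ?thesis using \<psi>\<tau>[OF y(1)] Phi_Psi[OF y(1)] \<theta>(2)[OF Psic[OF y(1)]] by (simp add: y)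
  qed
  have \<theta>i: "\<theta> \<in> superalg_iso A (stensor C B)" by (rule superalg_isoI[OF As TB.D_superalgebra \<theta>(1,3) \<psi>(1,2) 1 2])
  have \<psi>i: "\<psi> \<in> superalg_iso (stensor C B) A" by (rule superalg_isoI[OF TB.D_superalgebra As \<psi>(1,2) \<theta>(1,3) 2 1])
  show "iso_via_Phi n A B" unfolding iso_via_Phi_def
    by (rule bexI[OF _ \<theta>i]) (use \<theta>(2) in \<open>simp add: \<tau>_def\<close>)
  show "iso_via_Psi n B A" unfolding iso_via_Psi_def
    by (rule bexI[OF _ \<psi>i]) (use \<psi>\<tau> in \<open>simp add: \<tau>_def\<close>)
  have \<theta>0: "\<theta> \<zero>\<^bsub>A\<^esub> = \<zero>\<^bsub>stensor C B\<^esub>" and \<psi>0: "\<psi> \<zero>\<^bsub>stensor C B\<^esub> = \<zero>\<^bsub>A\<^esub>"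
    by (rule lin_map_more(1)[OF alg_homD(1)[OF \<theta>(1)] A.vspace_axioms TB.D_vspace],
        rule lin_map_more(1)[OF alg_homD(1)[OF \<psi>(1)] TB.D_vspace A.vspace_axioms])
  show "J = {x \<in> carrier HC. \<tau> (Phi n x) = \<zero>\<^bsub>stensor C B\<^esub>}"
  proof (rule equalityI; rule subsetI)
    fix x assume x: "x \<in> J" 
    show "x \<in> {x \<in> carrier HC. \<tau> (Phi n x) = \<zero>\<^bsub>stensor C B\<^esub>}"
      by (rule CollectI, rule conjI, rule QA.I_carr[OF x], rule JI[OF x])
  next
    fix x assume "x \<in> {x \<in> carrier HC. \<tau> (Phi n x) = \<zero>\<^bsub>stensor C B\<^esub>}"
    then have x: "x \<in> carrier HC" "\<theta> (cls A x) = \<zero>\<^bsub>stensor C B\<^esub>" using \<theta>(2) by auto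
    have "cls A x = \<zero>\<^bsub>A\<^esub>" using 1[OF alg_homD(4)[OF cA(1) x(1)]] x(2) \<psi>0 by simp
    then show "x \<in> J" using A0[OF x(1)] by simp
  qed
  show "I = {b \<in> carrier H. psiH b \<in> J}"
  proof (intro equalityI subsetI CollectI conjI)
    fix b assume b: "b \<in> I" 
    show "b \<in> carrier H" "psiH b \<in> J" by (rule QB.I_carr[OF b], rule IJ[OF b])
  next
    fix b assume "b \<in> {b \<in> carrier H. psiH b \<in> J}"
    then have b: "b \<in> carrier H" "psiH b \<in> J" by auto
    have pb: "psiH b \<in> carrier HC" by (rule alg_homD(4)[OF psiH_hom(1) b(1)])
    have "Psi n (T.tn \<one>\<^bsub>C\<^esub> b) = psiH b"
      using Psi_hom(3)[OF T.A.unit_closed b(1)] pb by (simp add: alg_homD(3)[OF psiC_hom(1)])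
    then have "\<psi> (TB.tn \<one>\<^bsub>C\<^esub> (cls B b)) = \<zero>\<^bsub>A\<^esub>"
      using \<psi>\<tau>[OF T.tn_closed[OF T.A.unit_closed b(1)]] tau(3)[OF T.A.unit_closed b(1)] A0[OF pb] b(2) by simp
    then have z: "TB.tn \<one>\<^bsub>C\<^esub> (cls B b) = \<zero>\<^bsub>stensor C B\<^esub>"
      using 2[OF TB.tn_closed[OF T.A.unit_closed cBc[OF b(1)]]] \<theta>0 by simp
    from clifford_functional[of n] obtain l where l: "(\<forall>a\<in>carrier C. \<forall>b\<in>carrier C. l (a \<oplus>\<^bsub>C\<^esub> b) = l a + (l b :: cq)) \<and>
       (\<forall>a\<in>carrier C. \<forall>k. l (k \<odot>\<^bsub>C\<^esub> a) = k * l a) \<and> l \<one>\<^bsub>C\<^esub> = 1"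
      by (elim exE)
    have "cls B b = \<zero>\<^bsub>B\<^esub>" by (rule TB.tn_faithful[OF _ _ _ cBc[OF b(1)] z, of l]) (use l in simp_all)
    then show "b \<in> I" using B0[OF b(1)] by simp
  qed
qed

end

section \<open>Polynomials in an element of an algebra\<close>

context superalgebra
begin

lemma eval_superset:
  assumes "x \<in> carrier A" "degree F \<le> m"
  shows "eval_poly A F x = (\<Oplus>i\<in>{..m}. coeff F i \<odot> (x [^] i))"
  unfolding eval_poly_def
  by (rule add.finprod_mono_neutral_cong_left) (use assms in \<open>auto simp: coeff_eq_0\<close>)

lemma eval_closed [simp]: "x \<in> carrier A \<Longrightarrow> eval_poly A F x \<in> carrier A"
  unfolding eval_poly_def by (rule finsum_closed) auto

lemma eval_0 [simp]: "x \<in> carrier A \<Longrightarrow> eval_poly A 0 x = \<zero>"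
  by (simp add: eval_poly_def)

lemma eval_pCons:
  assumes x: "x \<in> carrier A"
  shows "eval_poly A (pCons a F) x = eval_poly A F x \<otimes> x \<oplus> a \<odot> \<one>"
proof -
  have "eval_poly A (pCons a F) x = (\<Oplus>i\<in>{..Suc (degree F)}. coeff (pCons a F) i \<odot> (x [^] i))"
    by (rule eval_superset[OF x degree_pCons_le])
  also have "\<dots> = (\<Oplus>i\<in>{..degree F}. coeff (pCons a F) (Suc i) \<odot> (x [^] Suc i)) \<oplus> coeff (pCons a F) 0 \<odot> (x [^] (0::nat))"
    by (rule finsum_Suc2) (use x in auto)
  also have "(\<Oplus>i\<in>{..degree F}. coeff (pCons a F) (Suc i) \<odot> (x [^] Suc i)) = (\<Oplus>i\<in>{..degree F}. (coeff F i \<odot> (x [^] i)) \<otimes> x)"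
    by (rule finsum_cong') (use x in \<open>auto simp: smult_mult_l\<close>)
  also have "\<dots> = (\<Oplus>i\<in>{..degree F}. coeff F i \<odot> (x [^] i)) \<otimes> x"
    by (rule finsum_ldistr[symmetric]) (use x in auto)
  finally show ?thesis by (simp add: eval_poly_def)
qed

lemma eval_1 [simp]: "x \<in> carrier A \<Longrightarrow> eval_poly A 1 x = \<one>"
  using eval_pCons[of x 1 0] by (simp add: one_pCons[symmetric] l_null)

lemma eval_add: "x \<in> carrier A \<Longrightarrow> eval_poly A (F + G) x = eval_poly A F x \<oplus> eval_poly A G x"
proof (induction F arbitrary: G)
  case (pCons a F)
  obtain b G' where "G = pCons b G'" by (rule pCons_cases)
  then show ?case using pCons by (simp add: eval_pCons smult_l_distr l_distr a_ac)
qed simp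

lemma eval_smult: "x \<in> carrier A \<Longrightarrow> eval_poly A (Polynomial.smult k F) x = k \<odot> eval_poly A F x"
  by (induction F) (simp_all add: eval_pCons smult_assoc smult_r_distr smult_mult_l)

lemma eval_comm: "x \<in> carrier A \<Longrightarrow> eval_poly A F x \<otimes> x = x \<otimes> eval_poly A F x"
  by (induction F) (simp_all add: eval_pCons l_distr r_distr smult_mult_l smult_mult_r l_null r_null m_assoc)

lemma eval_mult: "x \<in> carrier A \<Longrightarrow> eval_poly A (F * G) x = eval_poly A F x \<otimes> eval_poly A G x"
proof (induction F)
  case (pCons a F)
  have "eval_poly A (pCons a F * G) x = a \<odot> eval_poly A G x \<oplus> (eval_poly A F x \<otimes> eval_poly A G x) \<otimes> x"
    using pCons by (simp add: eval_add eval_smult eval_pCons r_zero)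
  also have "\<dots> = eval_poly A (pCons a F) x \<otimes> eval_poly A G x"
    using pCons(3) by (simp add: eval_pCons l_distr smult_mult_l m_assoc eval_comm[of x G] a_comm)
  finally show ?case .
qed (simp add: l_null)

end

lemma eval_hom:
  assumes "superalgebra A" "superalgebra B" "h \<in> alg_hom A B" "x \<in> carrier A"
  shows "h (eval_poly A F x) = eval_poly B F (h x)"
proof -
  interpret A: superalgebra A by fact
  interpret B: superalgebra B by fact
  note h = alg_homD[OF assms(3)] lin_map_more(1)[OF alg_homD(1)[OF assms(3)] A.vspace_axioms B.vspace_axioms]
  show ?thesis by (induction F) (use assms(4) in \<open>simp_all add: h A.eval_pCons B.eval_pCons\<close>)
qed

text \<open>
  The field itself as a superalgebra, the target of the points of the circle.
\<close>

definition scalar_alg :: "cq superalg" where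
  "scalar_alg = \<lparr>carrier = UNIV, mult = (*), one = 1, zero = 0, add = (+), smult = (*), grade = (\<lambda>s. if s then {0} else UNIV)\<rparr>"

lemma scalar_simps: "carrier scalar_alg = UNIV" "mult scalar_alg = (*)" "one scalar_alg = 1" "zero scalar_alg = 0"
  "add scalar_alg = (+)" "smult scalar_alg = (*)" "grade scalar_alg = (\<lambda>s. if s then {0} else UNIV)"
  by (simp_all add: scalar_alg_def)

lemma scalar_superalgebra: "superalgebra scalar_alg"
proof -
  have "vspace scalar_alg" by (rule vspaceI) (simp_all add: scalar_simps algebra_simps)
  then have "nonassoc_alg scalar_alg" by (intro nonassoc_alg.intro nonassoc_alg_axioms.intro) (simp_all add: scalar_simps algebra_simps)
  then show ?thesis by (rule trivial_superalgebra) (simp_all only: scalar_simps(7,4,1), simp_all add: scalar_simps)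
qed

lemma scalar_eval: "eval_poly scalar_alg F t = poly F t"
proof -
  interpret superalgebra scalar_alg by (rule scalar_superalgebra)
  show ?thesis by (induction F) (simp_all add: eval_pCons scalar_simps eval_0[unfolded scalar_simps] algebra_simps)
qed

section \<open>Homogeneous ideals of the circle algebra\<close>

text \<open>
  The imaginary unit.
\<close>

definition iu :: cq where "iu = Fract [:\<i>:] 1"

lemma iu_square: "iu * iu = - 1"
  by (simp add: iu_def one_pCons[symmetric] One_fract_def minus_fract) (simp add: One_fract_def[symmetric] one_pCons)

context hecke
begin

lemma circle_presentation: 
  "presentation {SpP 1, SpQ 1} spin_par {gen (SpP 1) * gen (SpQ 1) - gen (SpQ 1) * gen (SpP 1),
     gen (SpP 1) * gen (SpP 1) + gen (SpQ 1) * gen (SpQ 1) - 1}"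
proof -
  let ?R = "{gen (SpP 1) * gen (SpQ 1) - gen (SpQ 1) * gen (SpP 1), gen (SpP 1) * gen (SpP 1) + gen (SpQ 1) * gen (SpQ 1) - 1}"
  have "\<forall>r\<in>?R. \<exists>s. r \<in> grade (free_superalg {SpP 1, SpQ 1} spin_par) s"
    by (intro ballI, elim insertE emptyE; hypsubst, rule exI,
        (rule fg_add fg_diff fg_mult[OF _ _ refl] fg_one fg_scal | (rule fg_gen, simp) | simp)+)
  then show ?thesis by (simp add: presentation_def)
qed

abbreviation "Z \<equiv> circle_alg"

sublocale PZ: presentation "{SpP 1, SpQ 1}" spin_par "{gen (SpP 1) * gen (SpQ 1) - gen (SpQ 1) * gen (SpP 1),
     gen (SpP 1) * gen (SpP 1) + gen (SpQ 1) * gen (SpQ 1) - 1}"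
  rewrites "presented {SpP 1, SpQ 1} spin_par {gen (SpP 1) * gen (SpQ 1) - gen (SpQ 1) * gen (SpP 1),
     gen (SpP 1) * gen (SpP 1) + gen (SpQ 1) * gen (SpQ 1) - 1} = Z"
  by (rule circle_presentation) (simp add: circle_alg_def Let_def)
sublocale Z: superalgebra Z by (rule PZ.Pr_superalgebra)

definition "zP = cls Z (gen (SpP 1))"
definition "zQ = cls Z (gen (SpQ 1))"

lemma zPQ [simp]: "zP \<in> carrier Z" "zQ \<in> carrier Z" 
  and zPQ_grade: "zP \<in> grade Z False" "zQ \<in> grade Z True"
  using PZ.gcls_closed[of "SpP 1"] PZ.gcls_closed[of "SpQ 1"] PZ.gcls_grade[of "SpP 1"] PZ.gcls_grade[of "SpQ 1"]
  by (simp_all add: zP_def zQ_def)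

lemma zPQ_rel: "zP \<otimes>\<^bsub>Z\<^esub> zQ = zQ \<otimes>\<^bsub>Z\<^esub> zP" "zP \<otimes>\<^bsub>Z\<^esub> zP \<oplus>\<^bsub>Z\<^esub> zQ \<otimes>\<^bsub>Z\<^esub> zQ = \<one>\<^bsub>Z\<^esub>"
proof -
  let ?F = "free_superalg {SpP 1, SpQ 1} spin_par"
  have g: "gen (SpP 1) \<in> carrier ?F" "gen (SpQ 1) \<in> carrier ?F" by simp_all
  show "zP \<otimes>\<^bsub>Z\<^esub> zQ = zQ \<otimes>\<^bsub>Z\<^esub> zP" unfolding zP_def zQ_def
    by (rule iffD1[OF Z.relator_swap[OF PZ.cls_hom g g(2,1)]]) (rule PZ.cls_rel, simp)
  show "zP \<otimes>\<^bsub>Z\<^esub> zP \<oplus>\<^bsub>Z\<^esub> zQ \<otimes>\<^bsub>Z\<^esub> zQ = \<one>\<^bsub>Z\<^esub>" unfolding zP_def zQ_def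
    by (rule iffD1[OF Z.relator_circle[OF PZ.cls_hom g]]) (rule PZ.cls_rel, simp)
qed

lemma Z_induct [consumes 1, case_names one P Q smult add]:
  assumes "x \<in> carrier Z" "K \<one>\<^bsub>Z\<^esub>" "\<And>x. x \<in> carrier Z \<Longrightarrow> K x \<Longrightarrow> K (zP \<otimes>\<^bsub>Z\<^esub> x)" "\<And>x. x \<in> carrier Z \<Longrightarrow> K x \<Longrightarrow> K (zQ \<otimes>\<^bsub>Z\<^esub> x)"
    "\<And>k x. x \<in> carrier Z \<Longrightarrow> K x \<Longrightarrow> K (k \<odot>\<^bsub>Z\<^esub> x)" 
    "\<And>x y. x \<in> carrier Z \<Longrightarrow> y \<in> carrier Z \<Longrightarrow> K x \<Longrightarrow> K y \<Longrightarrow> K (x \<oplus>\<^bsub>Z\<^esub> y)"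
  shows "K x"
  using assms(1)
proof (induction rule: PZ.presented_induct)
  case (gen g x)
  then show ?case using assms(3,4)[of x] by (auto simp: zP_def zQ_def)
qed (use assms in auto)

lemma Z_comm: 
  assumes "x \<in> carrier Z" "y \<in> carrier Z"
  shows "x \<otimes>\<^bsub>Z\<^esub> y = y \<otimes>\<^bsub>Z\<^esub> x"
proof -
  have hP: "zP \<otimes>\<^bsub>Z\<^esub> y = y \<otimes>\<^bsub>Z\<^esub> zP" if "y \<in> carrier Z" for y
    using that
  proof (induction rule: Z_induct)
    case (P y)
    show ?case unfolding Z.m_assoc[OF zPQ(1) P(1) zPQ(1)] by (simp only: P(2))
  next
    case (Q y)
    have "zP \<otimes>\<^bsub>Z\<^esub> (zQ \<otimes>\<^bsub>Z\<^esub> y) = (zP \<otimes>\<^bsub>Z\<^esub> zQ) \<otimes>\<^bsub>Z\<^esub> y" by (rule Z.m_assoc[OF zPQ Q(1), symmetric])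
    also have "\<dots> = zQ \<otimes>\<^bsub>Z\<^esub> (zP \<otimes>\<^bsub>Z\<^esub> y)" unfolding zPQ_rel(1) by (rule Z.m_assoc[OF zPQ(2,1) Q(1)])
    finally have "zP \<otimes>\<^bsub>Z\<^esub> (zQ \<otimes>\<^bsub>Z\<^esub> y) = zQ \<otimes>\<^bsub>Z\<^esub> (zP \<otimes>\<^bsub>Z\<^esub> y)" .
    then show ?case using Q by (simp add: Z.m_assoc)
  qed (simp_all add: Z.m_assoc Z.smult_mult_l Z.smult_mult_r Z.l_distr Z.r_distr)
  have hQ: "zQ \<otimes>\<^bsub>Z\<^esub> y = y \<otimes>\<^bsub>Z\<^esub> zQ" if "y \<in> carrier Z" for y
    using that
  proof (induction rule: Z_induct)
    case (Q y)
    show ?case unfolding Z.m_assoc[OF zPQ(2) Q(1) zPQ(2)] by (simp only: Q(2))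
  next
    case (P y)
    have "zQ \<otimes>\<^bsub>Z\<^esub> (zP \<otimes>\<^bsub>Z\<^esub> y) = (zQ \<otimes>\<^bsub>Z\<^esub> zP) \<otimes>\<^bsub>Z\<^esub> y" by (rule Z.m_assoc[OF zPQ(2,1) P(1), symmetric])
    also have "\<dots> = zP \<otimes>\<^bsub>Z\<^esub> (zQ \<otimes>\<^bsub>Z\<^esub> y)" unfolding zPQ_rel(1)[symmetric] by (rule Z.m_assoc[OF zPQ P(1)])
    finally have "zQ \<otimes>\<^bsub>Z\<^esub> (zP \<otimes>\<^bsub>Z\<^esub> y) = zP \<otimes>\<^bsub>Z\<^esub> (zQ \<otimes>\<^bsub>Z\<^esub> y)" .
    then show ?case using P by (simp add: Z.m_assoc)
  qed (simp_all add: Z.m_assoc Z.smult_mult_l Z.smult_mult_r Z.l_distr Z.r_distr)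
  show ?thesis using assms(1)
  proof (induction rule: Z_induct)
    case (P x)
    have "zP \<otimes>\<^bsub>Z\<^esub> x \<otimes>\<^bsub>Z\<^esub> y = (zP \<otimes>\<^bsub>Z\<^esub> y) \<otimes>\<^bsub>Z\<^esub> x" using P assms(2) by (simp add: Z.m_assoc)
    also have "\<dots> = y \<otimes>\<^bsub>Z\<^esub> (zP \<otimes>\<^bsub>Z\<^esub> x)" using hP[OF assms(2)] P assms(2) by (simp add: Z.m_assoc)
    finally show ?case .
  next
    case (Q x)
    have "zQ \<otimes>\<^bsub>Z\<^esub> x \<otimes>\<^bsub>Z\<^esub> y = (zQ \<otimes>\<^bsub>Z\<^esub> y) \<otimes>\<^bsub>Z\<^esub> x" using Q assms(2) by (simp add: Z.m_assoc)
    also have "\<dots> = y \<otimes>\<^bsub>Z\<^esub> (zQ \<otimes>\<^bsub>Z\<^esub> x)" using hQ[OF assms(2)] Q assms(2) by (simp add: Z.m_assoc)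
    finally show ?case .
  qed (use assms(2) in \<open>simp_all add: Z.smult_mult_l Z.smult_mult_r Z.l_distr Z.r_distr\<close>)
qed

sublocale Z: cring Z
  by (rule cring.intro[OF Z.ring_axioms monoid.monoid_comm_monoidI[OF Z.monoid_axioms Z_comm]])

text \<open>
  Generators of the Laurent polynomial ring: \<open>zi\<close> is the inverse of \<open>z\<close>.
\<close>

definition "z = zP \<oplus>\<^bsub>Z\<^esub> iu \<odot>\<^bsub>Z\<^esub> zQ"
definition "zi = zP \<ominus>\<^bsub>Z\<^esub> iu \<odot>\<^bsub>Z\<^esub> zQ"

lemma z_closed [simp]: "z \<in> carrier Z" "zi \<in> carrier Z" by (simp_all add: z_def zi_def)

lemma z_zi: "z \<otimes>\<^bsub>Z\<^esub> zi = \<one>\<^bsub>Z\<^esub>"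
proof -
  have "z \<otimes>\<^bsub>Z\<^esub> zi = (zP \<oplus>\<^bsub>Z\<^esub> iu \<odot>\<^bsub>Z\<^esub> zQ) \<otimes>\<^bsub>Z\<^esub> (zP \<ominus>\<^bsub>Z\<^esub> iu \<odot>\<^bsub>Z\<^esub> zQ)" by (simp only: z_def zi_def)
  also have "\<dots> = zP \<otimes>\<^bsub>Z\<^esub> zP \<ominus>\<^bsub>Z\<^esub> (iu \<odot>\<^bsub>Z\<^esub> zQ) \<otimes>\<^bsub>Z\<^esub> (iu \<odot>\<^bsub>Z\<^esub> zQ)"
  proof -
    have "iu \<odot>\<^bsub>Z\<^esub> zQ \<in> carrier Z" by simp
    then show ?thesis using zPQ(1) by algebra
  qed
  also have "(iu \<odot>\<^bsub>Z\<^esub> zQ) \<otimes>\<^bsub>Z\<^esub> (iu \<odot>\<^bsub>Z\<^esub> zQ) = \<ominus>\<^bsub>Z\<^esub> (zQ \<otimes>\<^bsub>Z\<^esub> zQ)"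
    by (simp add: Z.smult_mult_l Z.smult_mult_r Z.smult_assoc[symmetric] iu_square Z.smult_neg_one)
  finally show ?thesis by (simp add: zPQ_rel a_minus_def)
qed

lemma flip_z: "Z.flip z = zi" "Z.flip zi = z"
  using Z.flip_grade[OF zPQ_grade(1)] Z.flip_grade[OF zPQ_grade(2)]
  by (simp_all add: z_def zi_def a_minus_def Z.flip_add Z.flip_smult Z.smult_minus_right Z.smult_minus_left[symmetric]
      del: Z.smult_minus_left)

lemma zP_z: "zP = (1 / 2) \<odot>\<^bsub>Z\<^esub> (z \<oplus>\<^bsub>Z\<^esub> zi)" and zQ_z: "zQ = (- iu / 2) \<odot>\<^bsub>Z\<^esub> (z \<ominus>\<^bsub>Z\<^esub> zi)"
proof -
  have c: "iu \<odot>\<^bsub>Z\<^esub> zQ \<in> carrier Z" by simp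
  have "z \<oplus>\<^bsub>Z\<^esub> zi = zP \<oplus>\<^bsub>Z\<^esub> zP" unfolding z_def zi_def using c zPQ(1) by algebra
  then show "zP = (1 / 2) \<odot>\<^bsub>Z\<^esub> (z \<oplus>\<^bsub>Z\<^esub> zi)" by (simp add: Z.smult_r_distr Z.smult_l_distr[symmetric])
  have "z \<ominus>\<^bsub>Z\<^esub> zi = iu \<odot>\<^bsub>Z\<^esub> zQ \<oplus>\<^bsub>Z\<^esub> iu \<odot>\<^bsub>Z\<^esub> zQ" unfolding z_def zi_def using c zPQ(1) by algebra
  also have "\<dots> = (2 * iu) \<odot>\<^bsub>Z\<^esub> zQ" by (simp add: Z.smult_l_distr[symmetric])
  finally show "zQ = (- iu / 2) \<odot>\<^bsub>Z\<^esub> (z \<ominus>\<^bsub>Z\<^esub> zi)" using iu_square by (simp add: Z.smult_assoc[symmetric])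
qed

abbreviation "ez F \<equiv> eval_poly Z F z"

lemma ez_X: "ez [:0, 1:] = z" "ez [:k:] = k \<odot>\<^bsub>Z\<^esub> \<one>\<^bsub>Z\<^esub>"
  by (simp_all add: Z.eval_pCons Z.l_null)

lemma zi_pow_z: "(zi [^]\<^bsub>Z\<^esub> (m::nat)) \<otimes>\<^bsub>Z\<^esub> (z [^]\<^bsub>Z\<^esub> m) = \<one>\<^bsub>Z\<^esub>"
  using Z.nat_pow_distrib[of zi z m] z_zi Z_comm[of z zi] by (simp add: Z.nat_pow_one)

lemma ez_pow: "ez (monom 1 m) = z [^]\<^bsub>Z\<^esub> m"
  by (induction m) (simp_all add: monom_0 monom_Suc Z.eval_pCons Z.l_null one_pCons[symmetric])

text \<open>
  Every Laurent polynomial in \<open>z\<close> is a polynomial divided by a power of \<open>z\<close>; the polynomials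
  \<open>?p\<close> in the proof come from \<open>p\<^sub>1 = (z + z\<inverse>) / 2\<close> and \<open>q\<^sub>1 = - i (z - z\<inverse>) / 2\<close>.
\<close>

lemma Z_rep: "y \<in> carrier Z \<Longrightarrow> \<exists>m G. y = (zi [^]\<^bsub>Z\<^esub> (m::nat)) \<otimes>\<^bsub>Z\<^esub> ez G"
proof (induction rule: Z_induct)
  case one
  show ?case by (rule exI[of _ 0], rule exI[of _ 1]) simp
next
  case (P y)
  from P(2) obtain m G where y: "y = (zi [^]\<^bsub>Z\<^esub> (m::nat)) \<otimes>\<^bsub>Z\<^esub> ez G" by blast
  let ?w = "zi [^]\<^bsub>Z\<^esub> m" and ?p = "[:1 / 2, 0, 1 / 2:]"
  have c: "?w \<in> carrier Z" "ez G \<in> carrier Z" by simp_all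
  have "zi \<otimes>\<^bsub>Z\<^esub> ez ?p = (1 / 2) \<odot>\<^bsub>Z\<^esub> (zi \<oplus>\<^bsub>Z\<^esub> (z \<otimes>\<^bsub>Z\<^esub> zi) \<otimes>\<^bsub>Z\<^esub> z)"
    by (simp add: Z.eval_pCons Z.l_null Z.smult_mult_l Z.smult_mult_r Z.r_distr Z.smult_r_distr Z.m_ac Z.a_ac)
  also have "\<dots> = zP" by (subst zP_z) (simp add: z_zi Z.a_ac)
  finally have e: "zi \<otimes>\<^bsub>Z\<^esub> ez ?p = zP" .
  have "ez ?p \<in> carrier Z" by (rule Z.eval_closed[OF z_closed(1)])
  then have "(?w \<otimes>\<^bsub>Z\<^esub> zi) \<otimes>\<^bsub>Z\<^esub> (ez ?p \<otimes>\<^bsub>Z\<^esub> ez G) = (zi \<otimes>\<^bsub>Z\<^esub> ez ?p) \<otimes>\<^bsub>Z\<^esub> (?w \<otimes>\<^bsub>Z\<^esub> ez G)"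
    using c by (simp add: Z.m_ac)
  then have "zP \<otimes>\<^bsub>Z\<^esub> y = (?w \<otimes>\<^bsub>Z\<^esub> zi) \<otimes>\<^bsub>Z\<^esub> (ez ?p \<otimes>\<^bsub>Z\<^esub> ez G)" unfolding e y by (rule sym)
  then have "zP \<otimes>\<^bsub>Z\<^esub> y = (zi [^]\<^bsub>Z\<^esub> (Suc m)) \<otimes>\<^bsub>Z\<^esub> ez (?p * G)" using Z.eval_mult[of z ?p G] by simp
  then show ?case by (intro exI)
next
  case (Q y)
  from Q(2) obtain m G where y: "y = (zi [^]\<^bsub>Z\<^esub> (m::nat)) \<otimes>\<^bsub>Z\<^esub> ez G" by blast
  let ?w = "zi [^]\<^bsub>Z\<^esub> m" and ?p = "[:iu / 2, 0, - iu / 2:]"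
  have c: "?w \<in> carrier Z" "ez G \<in> carrier Z" by simp_all
  have "ez ?p = (- iu / 2) \<odot>\<^bsub>Z\<^esub> (z \<otimes>\<^bsub>Z\<^esub> z \<ominus>\<^bsub>Z\<^esub> \<one>\<^bsub>Z\<^esub>)"
    by (simp add: Z.eval_pCons Z.l_null Z.smult_mult_l Z.smult_minus_left Z.smult_minus_right Z.smult_r_distr Z.l_minus Z.minus_add a_minus_def)
  then have "zi \<otimes>\<^bsub>Z\<^esub> ez ?p = (- iu / 2) \<odot>\<^bsub>Z\<^esub> ((z \<otimes>\<^bsub>Z\<^esub> zi) \<otimes>\<^bsub>Z\<^esub> z \<ominus>\<^bsub>Z\<^esub> zi)"
    by (simp add: Z.smult_mult_r a_minus_def Z.r_distr Z.r_minus Z.m_ac)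
  also have "\<dots> = zQ" by (subst zQ_z) (simp add: z_zi)
  finally have e: "zi \<otimes>\<^bsub>Z\<^esub> ez ?p = zQ" .
  have "ez ?p \<in> carrier Z" by (rule Z.eval_closed[OF z_closed(1)])
  then have "(?w \<otimes>\<^bsub>Z\<^esub> zi) \<otimes>\<^bsub>Z\<^esub> (ez ?p \<otimes>\<^bsub>Z\<^esub> ez G) = (zi \<otimes>\<^bsub>Z\<^esub> ez ?p) \<otimes>\<^bsub>Z\<^esub> (?w \<otimes>\<^bsub>Z\<^esub> ez G)"
    using c by (simp add: Z.m_ac)
  then have "zQ \<otimes>\<^bsub>Z\<^esub> y = (?w \<otimes>\<^bsub>Z\<^esub> zi) \<otimes>\<^bsub>Z\<^esub> (ez ?p \<otimes>\<^bsub>Z\<^esub> ez G)" unfolding e y by (rule sym)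
  then have "zQ \<otimes>\<^bsub>Z\<^esub> y = (zi [^]\<^bsub>Z\<^esub> (Suc m)) \<otimes>\<^bsub>Z\<^esub> ez (?p * G)" using Z.eval_mult[of z ?p G] by simp
  then show ?case by (intro exI)
next
  case (smult k y)
  from smult(2) obtain m G where y: "y = (zi [^]\<^bsub>Z\<^esub> (m::nat)) \<otimes>\<^bsub>Z\<^esub> ez G" by blast
  then have "k \<odot>\<^bsub>Z\<^esub> y = (zi [^]\<^bsub>Z\<^esub> m) \<otimes>\<^bsub>Z\<^esub> ez (Polynomial.smult k G)" by (simp add: Z.eval_smult Z.smult_mult_r)
  then show ?case by (intro exI)
next
  case (add x y)
  from add(3) obtain k E where x: "x = (zi [^]\<^bsub>Z\<^esub> (k::nat)) \<otimes>\<^bsub>Z\<^esub> ez E" by blast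
  from add(4) obtain m G where y: "y = (zi [^]\<^bsub>Z\<^esub> (m::nat)) \<otimes>\<^bsub>Z\<^esub> ez G" by blast
  let ?k = "zi [^]\<^bsub>Z\<^esub> k" and ?m = "zi [^]\<^bsub>Z\<^esub> m" and ?k' = "z [^]\<^bsub>Z\<^esub> k" and ?m' = "z [^]\<^bsub>Z\<^esub> m"
  have c: "?k \<in> carrier Z" "?m \<in> carrier Z" "?k' \<in> carrier Z" "?m' \<in> carrier Z" "ez E \<in> carrier Z" "ez G \<in> carrier Z" by simp_all
  have "(zi [^]\<^bsub>Z\<^esub> (k + m)) \<otimes>\<^bsub>Z\<^esub> ez (monom 1 m * E + monom 1 k * G) = (?k \<otimes>\<^bsub>Z\<^esub> ?m) \<otimes>\<^bsub>Z\<^esub> (?m' \<otimes>\<^bsub>Z\<^esub> ez E \<oplus>\<^bsub>Z\<^esub> ?k' \<otimes>\<^bsub>Z\<^esub> ez G)"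
    by (simp add: Z.eval_add Z.eval_mult ez_pow Z.nat_pow_mult[symmetric])
  also have "\<dots> = (?m \<otimes>\<^bsub>Z\<^esub> ?m') \<otimes>\<^bsub>Z\<^esub> (?k \<otimes>\<^bsub>Z\<^esub> ez E) \<oplus>\<^bsub>Z\<^esub> (?k \<otimes>\<^bsub>Z\<^esub> ?k') \<otimes>\<^bsub>Z\<^esub> (?m \<otimes>\<^bsub>Z\<^esub> ez G)"
    using c by (simp add: Z.r_distr Z.m_ac)
  also have "\<dots> = x \<oplus>\<^bsub>Z\<^esub> y" using c by (simp add: zi_pow_z x y)
  finally show ?case by (intro exI) (rule sym)
qed

lemma ez_reflect: "ez (reflect_poly F) = (z [^]\<^bsub>Z\<^esub> (degree F)) \<otimes>\<^bsub>Z\<^esub> eval_poly Z F zi"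
proof (induction F)
  case (pCons a F)
  show ?case
  proof (cases "F = 0")
    case True then show ?thesis by (simp add: ez_X Z.eval_pCons Z.l_null)
  next
    case False
    let ?d = "z [^]\<^bsub>Z\<^esub> (degree F)" and ?e = "eval_poly Z F zi"
    have c: "?d \<in> carrier Z" "?e \<in> carrier Z" by simp_all
    have m: "monom a (Suc (degree F)) = Polynomial.smult a (monom 1 (Suc (degree F)))" by (simp add: smult_monom)
    have "ez (reflect_poly (pCons a F)) = ?d \<otimes>\<^bsub>Z\<^esub> ?e \<oplus>\<^bsub>Z\<^esub> a \<odot>\<^bsub>Z\<^esub> (?d \<otimes>\<^bsub>Z\<^esub> z)"
      using False pCons(2) by (simp add: reflect_poly_pCons' Z.eval_add m Z.eval_smult ez_pow del: monom_Suc)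
    also have "?d \<otimes>\<^bsub>Z\<^esub> ?e = (?d \<otimes>\<^bsub>Z\<^esub> z) \<otimes>\<^bsub>Z\<^esub> (?e \<otimes>\<^bsub>Z\<^esub> zi)"
    proof -
      have "(?d \<otimes>\<^bsub>Z\<^esub> z) \<otimes>\<^bsub>Z\<^esub> (?e \<otimes>\<^bsub>Z\<^esub> zi) = (?d \<otimes>\<^bsub>Z\<^esub> ?e) \<otimes>\<^bsub>Z\<^esub> (z \<otimes>\<^bsub>Z\<^esub> zi)" using c by (simp add: Z.m_ac)
      then show ?thesis using c by (simp add: z_zi)
    qed
    finally show ?thesis using c False by (simp add: Z.eval_pCons Z.r_distr Z.smult_mult_r)
  qed
qed simp

lemma flip_hom: "Z.flip \<in> alg_hom Z Z"
  by (intro alg_homI lin_mapI) (simp_all add: Z.flip_add Z.flip_smult Z.flip_mult Z.flip_one)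

lemma flip_ez: "Z.flip (ez F) = eval_poly Z F zi"
  using eval_hom[OF Z.superalgebra_axioms Z.superalgebra_axioms flip_hom z_closed(1), of F] by (simp add: flip_z)

text \<open>
  The parity components are half the sum and half the difference of an element and its image
  under \<open>flip\<close>.
\<close>

lemma homogeneous_iff_flip:
  assumes I: "ideal I Z"
  shows "homogeneous_ideal I Z \<longleftrightarrow> (\<forall>x\<in>I. Z.flip x \<in> I)"
proof -
  interpret I: linear_subspace Z I by (rule Z.ideal_linear_subspace[OF I])
  show ?thesis
  proof
    assume h: "homogeneous_ideal I Z"
    show "\<forall>x\<in>I. Z.flip x \<in> I" 
      unfolding Z.flip_def using h by (auto simp: homogeneous_ideal_def intro!: I.I_diff)
  next
    assume f: "\<forall>x\<in>I. Z.flip x \<in> I"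
    have "hcomp Z s x \<in> I" if x: "x \<in> I" for x s
    proof -
      note xc = I.I_carr[OF x]
      let ?a = "hcomp Z False x" and ?b = "hcomp Z True x"
      have c: "?a \<in> carrier Z" "?b \<in> carrier Z" using xc by simp_all
      have e: "x = ?a \<oplus>\<^bsub>Z\<^esub> ?b" using Z.hcomp_decomp(2)[OF xc, of False] by simp
      have fx: "Z.flip x \<in> I" using f x by simp
      have "x \<oplus>\<^bsub>Z\<^esub> Z.flip x = (?a \<oplus>\<^bsub>Z\<^esub> ?b) \<oplus>\<^bsub>Z\<^esub> (?a \<ominus>\<^bsub>Z\<^esub> ?b)" using e by (simp add: Z.flip_def)
      also have "\<dots> = ?a \<oplus>\<^bsub>Z\<^esub> ?a" using c by algebra
      finally have "?a \<oplus>\<^bsub>Z\<^esub> ?a \<in> I" using I.I_add[OF x fx] by simp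
      then have "(1 / 2) \<odot>\<^bsub>Z\<^esub> (?a \<oplus>\<^bsub>Z\<^esub> ?a) \<in> I" by (rule I.I_smult)
      then have a: "?a \<in> I" using c by (simp add: Z.smult_r_distr Z.smult_l_distr[symmetric])
      have "?b = x \<ominus>\<^bsub>Z\<^esub> ?a"
      proof -
        have "(?a \<oplus>\<^bsub>Z\<^esub> ?b) \<ominus>\<^bsub>Z\<^esub> ?a = ?b" using c by algebra
        then show ?thesis using e by simp
      qed
      then have "?b \<in> I" using I.I_diff[OF x a] by simp
      with a show ?thesis by (cases s) simp_all
    qed
    then show "homogeneous_ideal I Z" using I by (simp add: homogeneous_ideal_def)
  qed
qed

lemma reflect_admissible: 
  assumes "admissible F"
  shows "reflect_poly F = Polynomial.smult (coeff F 0) F" "F \<noteq> 0"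
proof -
  note adm = assms[unfolded admissible_def]
  have a1: "coeff F (degree F) = 1" by (rule conjunct1[OF adm])
  have a2: "coeff F i = coeff F 0 * coeff F (degree F - i)" if "i \<le> degree F" for i
    by (rule conjunct2[OF adm, rule_format, OF that])
  show "F \<noteq> 0" using a1 by auto
  show "reflect_poly F = Polynomial.smult (coeff F 0) F"
  proof (rule poly_eqI)
    fix i
    show "coeff (reflect_poly F) i = coeff (Polynomial.smult (coeff F 0) F) i"
    proof (cases "i \<le> degree F")
      case True
      then have "degree F - (degree F - i) = i" by simp
      then have "coeff F (degree F - i) = coeff F 0 * coeff F i" using a2[OF diff_le_self[of "degree F" i]] by (simp only:)
      then show ?thesis using True by (simp only: coeff_reflect_poly coeff_smult not_less[symmetric] if_False)
    next
      case False
      then show ?thesis by (simp add: coeff_reflect_poly coeff_eq_0)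
    qed
  qed
qed

text \<open>
  Among the polynomials \<open>G\<close> with \<open>G(z)\<close> in the ideal let \<open>F\<close> be monic of least degree. It divides all of
  them, and \<open>F(0) \<noteq> 0\<close> since otherwise \<open>F / z\<close> would have smaller degree. As the
  ideal is stable under \<open>flip\<close>, the reflection of \<open>F\<close> is among them as well; it has the same
  degree, so it is a constant multiple of \<open>F\<close>, and comparing leading coefficients the constant is \<open>F(0)\<close>.
\<close>

lemma admissible_of_homogeneous:
  assumes I: "homogeneous_ideal I Z" and nz: "I \<noteq> {\<zero>\<^bsub>Z\<^esub>}"
  shows "\<exists>F. admissible F \<and> ez F \<in> I \<and> (\<forall>y\<in>I. \<exists>w\<in>carrier Z. y = w \<otimes>\<^bsub>Z\<^esub> ez F)"
proof -
  have idI: "ideal I Z" using I by (simp add: homogeneous_ideal_def)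
  interpret I: two_sided_ideal Z I by (rule Z.ideal_two_sided[OF idI])
  have fl: "Z.flip x \<in> I" if "x \<in> I" for x using I that homogeneous_iff_flip[OF idI] by simp
  \<comment> \<open>Clearing denominators reduces the ideal to its polynomials in \<open>z\<close>.\<close>
  define M where "M = {G. ez G \<in> I}"
  have rep: "\<exists>m G. y = (zi [^]\<^bsub>Z\<^esub> (m::nat)) \<otimes>\<^bsub>Z\<^esub> ez G \<and> G \<in> M" if y: "y \<in> I" for y
  proof -
    obtain m G where e: "y = (zi [^]\<^bsub>Z\<^esub> (m::nat)) \<otimes>\<^bsub>Z\<^esub> ez G" using Z_rep[OF I.I_carr[OF y]] by blast
    have "(z [^]\<^bsub>Z\<^esub> m) \<otimes>\<^bsub>Z\<^esub> y = ((zi [^]\<^bsub>Z\<^esub> m) \<otimes>\<^bsub>Z\<^esub> (z [^]\<^bsub>Z\<^esub> m)) \<otimes>\<^bsub>Z\<^esub> ez G" unfolding e by (simp add: Z.m_ac)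
    also have "\<dots> = ez G" by (simp add: zi_pow_z)
    finally have "ez G \<in> I" using I.absorb_l[OF y, of "z [^]\<^bsub>Z\<^esub> m"] by simp
    then show ?thesis using e by (auto simp: M_def)
  qed
  obtain y where y: "y \<in> I" "y \<noteq> \<zero>\<^bsub>Z\<^esub>" using nz I.I_zero by blast
  obtain m G0 where G0: "y = (zi [^]\<^bsub>Z\<^esub> (m::nat)) \<otimes>\<^bsub>Z\<^esub> ez G0" "G0 \<in> M" using rep[OF y(1)] by blast
  have "G0 \<noteq> 0" using G0(1) y(2) by auto
  define d where "d = (LEAST d. \<exists>G\<in>M. G \<noteq> 0 \<and> degree G = d)"
  have "\<exists>G\<in>M. G \<noteq> 0 \<and> degree G = d" unfolding d_def
    by (rule LeastI[of _ "degree G0"]) (use G0(2) \<open>G0 \<noteq> 0\<close> in blast)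
  then obtain G1 where G1: "G1 \<in> M" "G1 \<noteq> 0" "degree G1 = d" by blast
  have min: "d \<le> degree G" if "G \<in> M" "G \<noteq> 0" for G unfolding d_def by (rule Least_le) (use that in blast)
  define F where "F = Polynomial.smult (inverse (lead_coeff G1)) G1"
  have "coeff G1 d \<noteq> 0" using G1(2,3) leading_coeff_neq_0[of G1] by simp
  then have F: "F \<in> M" "F \<noteq> 0" "degree F = d" "coeff F d = 1"
    using G1 I.I_smult by (simp_all add: F_def M_def Z.eval_smult)
  have dvd: "F dvd G" if G: "G \<in> M" for G
  proof -
    have "ez (G mod F) = ez G \<ominus>\<^bsub>Z\<^esub> ez (G div F) \<otimes>\<^bsub>Z\<^esub> ez F"
    proof -
      have "ez G = ez (G div F) \<otimes>\<^bsub>Z\<^esub> ez F \<oplus>\<^bsub>Z\<^esub> ez (G mod F)"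
        using Z.eval_add[of z "G div F * F" "G mod F"] by (simp add: Z.eval_mult)
      moreover have c: "ez (G div F) \<otimes>\<^bsub>Z\<^esub> ez F \<in> carrier Z" "ez (G mod F) \<in> carrier Z" by simp_all
      moreover have "(ez (G div F) \<otimes>\<^bsub>Z\<^esub> ez F \<oplus>\<^bsub>Z\<^esub> ez (G mod F)) \<ominus>\<^bsub>Z\<^esub> ez (G div F) \<otimes>\<^bsub>Z\<^esub> ez F = ez (G mod F)"
        using c by algebra
      ultimately show ?thesis by simp
    qed
    then have gm: "G mod F \<in> M" using G F(1) I.I_diff I.absorb_l by (simp add: M_def)
    have "G mod F = 0"
    proof (rule ccontr)
      assume nz: "G mod F \<noteq> 0"
      then have "degree (G mod F) < d" using degree_mod_less[OF F(2), of G] F(3) by simp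
      then show False using min[OF gm nz] by simp
    qed
    then show ?thesis by (simp add: mod_eq_0_iff_dvd)
  qed
  have refl: "reflect_poly F \<in> M"
  proof -
    have "eval_poly Z F zi \<in> I" using fl[of "ez F"] F(1) by (simp add: M_def flip_ez)
    then show ?thesis by (simp add: M_def ez_reflect I.absorb_l)
  qed
  have F0: "coeff F 0 \<noteq> 0"
  proof
    assume "coeff F 0 = 0"
    then obtain F' where F': "F = pCons 0 F'" by (cases F) auto
    then have "F' \<noteq> 0" using F(2) by auto
    have "ez F \<otimes>\<^bsub>Z\<^esub> zi = ez F' \<otimes>\<^bsub>Z\<^esub> (z \<otimes>\<^bsub>Z\<^esub> zi)" by (simp add: F' Z.eval_pCons Z.m_assoc)
    also have "\<dots> = ez F'" by (simp add: z_zi)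
    finally have "F' \<in> M" using I.absorb_r[of "ez F" zi] F(1) by (simp add: M_def)
    from min[OF this \<open>F' \<noteq> 0\<close>] show False using F(3) F' \<open>F' \<noteq> 0\<close> by simp
  qed
  obtain q where q: "reflect_poly F = F * q" using dvd[OF refl] by (elim dvdE)
  have rd: "degree (reflect_poly F) = d" using F0 F(3) by simp
  have "q \<noteq> 0" using q F0 by auto
  then have "degree q = 0" using rd q F(2,3) by (simp add: degree_mult_eq)
  then obtain k where k: "q = [:k:]" by (rule degree_eq_zeroE)
  have r: "reflect_poly F = Polynomial.smult k F" using q k by simp
  have cr: "coeff F (d - i) = k * coeff F i" if "i \<le> d" for i
    using arg_cong[OF r, of "\<lambda>p. coeff p i"] that F(3) by (simp add: coeff_reflect_poly)
  have k0: "k = coeff F 0" using cr[of d] F(4) by simp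
  have "admissible F" unfolding admissible_def
  proof (intro conjI allI impI)
    show "lead_coeff F = 1" using F(3,4) by simp
    fix i assume "i \<le> degree F"
    then show "coeff F i = coeff F 0 * coeff F (degree F - i)" using cr[of "d - i"] F(3) k0 by simp
  qed
  moreover have "\<exists>w\<in>carrier Z. y = w \<otimes>\<^bsub>Z\<^esub> ez F" if y: "y \<in> I" for y
  proof -
    obtain m G where G: "y = (zi [^]\<^bsub>Z\<^esub> (m::nat)) \<otimes>\<^bsub>Z\<^esub> ez G" "G \<in> M" using rep[OF y] by blast
    obtain h where h: "G = F * h" using dvd[OF G(2)] by (elim dvdE)
    show ?thesis
      by (rule bexI[of _ "(zi [^]\<^bsub>Z\<^esub> m) \<otimes>\<^bsub>Z\<^esub> ez h"]) (simp_all add: G(1) h Z.eval_mult Z.m_ac)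
  qed
  ultimately show ?thesis using F(1) by (auto simp: M_def)
qed

text \<open>
  The points of the circle over \<open>\<complex>(q)\<close>, parametrised by the value of \<open>z\<close>. They show that \<open>F(z)\<close> vanishes for no
  \<open>F \<noteq> 0\<close>.
\<close>

lemma circle_point:
  assumes "t \<noteq> 0"
  shows "\<exists>h\<in>alg_hom Z scalar_alg. h z = t"
proof -
  interpret K: superalgebra scalar_alg by (rule scalar_superalgebra)
  let ?f = "\<lambda>g. if g = SpP 1 then (t + inverse t) / 2 else - iu * (t - inverse t) / 2"
  interpret ev: evaluation scalar_alg "{SpP 1, SpQ 1}" spin_par ?f
    by (intro evaluation.intro evaluation_axioms.intro scalar_superalgebra) (simp add: scalar_simps)
  have e: "evl scalar_alg ?f (gen (SpP 1)) = (t + inverse t) / 2" "evl scalar_alg ?f (gen (SpQ 1)) = - iu * (t - inverse t) / 2"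
    using ev.evl_gen[of "SpP 1"] ev.evl_gen[of "SpQ 1"] by simp_all
  have sq: "(- iu * a / 2) * (- iu * a / 2) = - (a * a / 4)" for a
  proof -
    have "(- iu * a / 2) * (- iu * a / 2) = (iu * iu) * (a * a / 4)" by (simp add: field_simps)
    then show ?thesis by (simp add: iu_square)
  qed
  let ?F = "free_superalg {SpP 1, SpQ 1} spin_par"
  have g: "gen (SpP 1) \<in> carrier ?F" "gen (SpQ 1) \<in> carrier ?F" by simp_all
  have swap: "evl scalar_alg ?f (gen (SpP 1) * gen (SpQ 1) - gen (SpQ 1) * gen (SpP 1)) = \<zero>\<^bsub>scalar_alg\<^esub>"
    by (rule iffD2[OF K.relator_swap[OF ev.evl_hom g g(2,1)]]) (simp only: e scalar_simps mult.commute)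
  have circ: "evl scalar_alg ?f (gen (SpP 1) * gen (SpP 1) + gen (SpQ 1) * gen (SpQ 1) - 1) = \<zero>\<^bsub>scalar_alg\<^esub>"
  proof (rule iffD2[OF K.relator_circle[OF ev.evl_hom g]])
    have "(t + inverse t) / 2 * ((t + inverse t) / 2) + (- iu * (t - inverse t) / 2) * (- iu * (t - inverse t) / 2) = 1"
      unfolding sq using assms by (simp add: field_simps)
    then show "evl scalar_alg ?f (gen (SpP 1)) \<otimes>\<^bsub>scalar_alg\<^esub> evl scalar_alg ?f (gen (SpP 1)) \<oplus>\<^bsub>scalar_alg\<^esub>
        evl scalar_alg ?f (gen (SpQ 1)) \<otimes>\<^bsub>scalar_alg\<^esub> evl scalar_alg ?f (gen (SpQ 1)) = \<one>\<^bsub>scalar_alg\<^esub>"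
      by (simp only: e scalar_simps)
  qed
  have r: "evl scalar_alg ?f r = \<zero>\<^bsub>scalar_alg\<^esub>" if "r \<in> {gen (SpP 1) * gen (SpQ 1) - gen (SpQ 1) * gen (SpP 1),
     gen (SpP 1) * gen (SpP 1) + gen (SpQ 1) * gen (SpQ 1) - 1}" for r
    using that by (elim insertE emptyE) (simp_all only: swap circ)
  have h: "gen_hom scalar_alg ?f \<in> alg_hom Z scalar_alg"
    by (rule PZ.gen_hom(1)[OF scalar_superalgebra]) (simp add: scalar_simps, erule r)
  have v: "gen_hom scalar_alg ?f (cls Z (gen g)) = ?f g" if "g \<in> {SpP 1, SpQ 1}" for g
    by (rule PZ.gen_hom(2)[OF scalar_superalgebra _ _ that]) (simp add: scalar_simps, erule r)
  have vP: "gen_hom scalar_alg ?f zP = (t + inverse t) / 2"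
    using v[of "SpP 1", OF insertI1] unfolding zP_def by (simp only: if_True simp_thms)
  have vQ: "gen_hom scalar_alg ?f zQ = - iu * (t - inverse t) / 2"
    using v[of "SpQ 1", OF insertI2[OF insertI1]] unfolding zQ_def by (simp only: spin_gen.distinct if_False simp_thms)
  have "gen_hom scalar_alg ?f z = (t + inverse t) / 2 + iu * (- iu * (t - inverse t) / 2)"
    by (simp only: z_def alg_homD[OF h] zPQ Z.smult_closed vP vQ scalar_simps)
  also have "\<dots> = (t + inverse t) / 2 - iu * iu * (t - inverse t) / 2" by simp
  also have "\<dots> = t" unfolding iu_square by (simp add: field_simps)
  finally show ?thesis using h by blast
qed

text \<open>
  Admissibility says that \<open>F(z\<inverse>)\<close>, the image of \<open>F(z)\<close> under \<open>flip\<close>, is \<open>F(z)\<close> times a scalar and a power of \<open>z\<close>.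
\<close>

lemma homogeneous_of_admissible:
  assumes F: "admissible F"
  shows "homogeneous_ideal (genideal Z {ez F}) Z" "genideal Z {ez F} \<noteq> {\<zero>\<^bsub>Z\<^esub>}"
    "\<And>y. y \<in> genideal Z {ez F} \<Longrightarrow> \<exists>w\<in>carrier Z. y = w \<otimes>\<^bsub>Z\<^esub> ez F"
proof -
  have c: "ez F \<in> carrier Z" by simp
  have idI: "ideal (genideal Z {ez F}) Z" by (rule Z.genideal_ideal) simp
  have E: "\<exists>w\<in>carrier Z. y = w \<otimes>\<^bsub>Z\<^esub> ez F" if "y \<in> genideal Z {ez F}" for y
    using that unfolding Z.cgenideal_eq_genideal[OF c, symmetric] cgenideal_def by blast
  then show "\<And>y. y \<in> genideal Z {ez F} \<Longrightarrow> \<exists>w\<in>carrier Z. y = w \<otimes>\<^bsub>Z\<^esub> ez F" .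
  interpret I: two_sided_ideal Z "genideal Z {ez F}" by (rule Z.ideal_two_sided[OF idI])
  have g: "ez F \<in> genideal Z {ez F}" by (rule Z.genideal_self'[OF c])
  have "eval_poly Z F zi = ((zi [^]\<^bsub>Z\<^esub> degree F) \<otimes>\<^bsub>Z\<^esub> (z [^]\<^bsub>Z\<^esub> degree F)) \<otimes>\<^bsub>Z\<^esub> eval_poly Z F zi" by (simp add: zi_pow_z)
  also have "\<dots> = (zi [^]\<^bsub>Z\<^esub> degree F) \<otimes>\<^bsub>Z\<^esub> ez (reflect_poly F)" by (simp add: ez_reflect Z.m_assoc)
  also have "\<dots> = (zi [^]\<^bsub>Z\<^esub> degree F) \<otimes>\<^bsub>Z\<^esub> (coeff F 0 \<odot>\<^bsub>Z\<^esub> ez F)" by (simp add: reflect_admissible[OF F] Z.eval_smult)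
  finally have fi: "eval_poly Z F zi \<in> genideal Z {ez F}" using I.absorb_l[OF I.I_smult[OF g]] by simp
  have "Z.flip y \<in> genideal Z {ez F}" if y: "y \<in> genideal Z {ez F}" for y
  proof -
    obtain w where w: "w \<in> carrier Z" "y = w \<otimes>\<^bsub>Z\<^esub> ez F" using E[OF y] by (elim bexE)
    show ?thesis using w I.absorb_l[OF fi, of "Z.flip w"] by (simp add: Z.flip_mult flip_ez)
  qed
  then show "homogeneous_ideal (genideal Z {ez F}) Z" using homogeneous_iff_flip[OF idI] by simp
  show "genideal Z {ez F} \<noteq> {\<zero>\<^bsub>Z\<^esub>}"
  proof
    assume "genideal Z {ez F} = {\<zero>\<^bsub>Z\<^esub>}"
    then have e0: "ez F = \<zero>\<^bsub>Z\<^esub>" using g by blast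
    \<comment> \<open>A point with \<open>z = t\<close> where \<open>t\<close> is neither zero nor a root of \<open>F\<close> separates \<open>F(z)\<close> from zero.\<close>
    have "finite (insert 0 {t. poly F t = 0})" using poly_roots_finite[OF reflect_admissible(2)[OF F]] by simp
    then obtain t where t: "t \<noteq> 0" "poly F t \<noteq> 0" using ex_new_if_finite[OF infinite_UNIV_char_0, of "insert 0 {t. poly F t = 0}"] by blast
    obtain h where h: "h \<in> alg_hom Z scalar_alg" "h z = t" using circle_point[OF t(1)] by (elim bexE)
    interpret K: superalgebra scalar_alg by (rule scalar_superalgebra)
    have "h (ez F) = poly F t"
      using eval_hom[OF Z.superalgebra_axioms scalar_superalgebra h(1) z_closed(1), of F] by (simp add: h(2) scalar_eval)
    moreover have "h \<zero>\<^bsub>Z\<^esub> = 0"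
      using lin_map_more(1)[OF alg_homD(1)[OF h(1)] Z.vspace_axioms K.vspace_axioms] by (simp add: scalar_simps)
    ultimately show False using e0 t(2) by simp
  qed
qed

end

section \<open>Corresponding cyclotomic quotients\<close>

context superalgebra
begin

lemma eval_even:
  assumes x: "x \<in> grade A False"
  shows "eval_poly A F x \<in> grade A False"
proof (induction F)
  case 0
  then show ?case using grade_carr[OF x] grade_zero[of False] by simp
next
  case (pCons a F)
  have "eval_poly A F x \<otimes> x \<in> grade A (False \<noteq> False)" by (rule grade_mult[OF pCons(2) x])
  then show ?case using grade_add[OF _ grade_smult[OF grade_one]] by (simp add: eval_pCons[OF grade_carr[OF x]])
qed

end

lemma hcomp_hom:
  assumes "superalgebra A" "superalgebra B" and h: "h \<in> alg_hom A B" "h \<in> even_map A B" and x: "x \<in> carrier A"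
  shows "hcomp B s (h x) = h (hcomp A s x)"
proof -
  interpret A: superalgebra A by fact
  interpret B: superalgebra B by fact
  have c: "hcomp A s x \<in> carrier A" "hcomp A (\<not> s) x \<in> carrier A" using x by simp_all
  have "h x = h (hcomp A s x \<oplus>\<^bsub>A\<^esub> hcomp A (\<not> s) x)" by (rule arg_cong[OF A.hcomp_decomp(2)[OF x]])
  also have "\<dots> = h (hcomp A s x) \<oplus>\<^bsub>B\<^esub> h (hcomp A (\<not> s) x)" by (rule alg_homD(6)[OF h(1) c])
  finally show ?thesis
    using B.hcomp_unique[OF even_mapD[OF h(2) A.hcomp_decomp(1)[OF x]] even_mapD[OF h(2) A.hcomp_decomp(1)[OF x]], of s] by simp
qed

context hecke
begin

text \<open>
  The map \<open>y\<^sub>0 + y\<^sub>1 \<mapsto> \<eta> y\<^sub>0 + i c \<cdot> \<eta> y\<^sub>1\<close>.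
\<close>

definition twist :: "'d superalg \<Rightarrow> ((spin_gen list \<Rightarrow>\<^sub>0 cq) set \<Rightarrow> 'd) \<Rightarrow> 'd \<Rightarrow> (spin_gen list \<Rightarrow>\<^sub>0 cq) set \<Rightarrow> 'd" where
  "twist D \<eta> c y = \<eta> (hcomp Z False y) \<oplus>\<^bsub>D\<^esub> iu \<odot>\<^bsub>D\<^esub> (c \<otimes>\<^bsub>D\<^esub> \<eta> (hcomp Z True y))"

text \<open>
  For odd \<open>y\<close>, \<open>y'\<close> one has \<open>(i c y)(i c y') = - c y c y' = c c y y' = y y'\<close>, so the twist is
  multiplicative. The factor \<open>i\<close> makes \<open>i q\<^sub>1\<close> in \<open>z\<close> become \<open>- c q\<^sub>1\<close>.
\<close>

lemma twist:
  fixes D :: "'d superalg" (structure)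
  assumes D: "superalgebra D" and \<eta>: "\<eta> \<in> alg_hom Z D" and c: "c \<in> carrier D" "c \<otimes> c = \<one>"
    and cm: "\<And>y s. y \<in> grade Z s \<Longrightarrow> \<eta> y \<otimes> c = koszul s True \<odot> (c \<otimes> \<eta> y)"
  shows twist_hom: "twist D \<eta> c \<in> alg_hom Z D"
    and twist_z: "twist D \<eta> c z = \<eta> zP \<ominus> c \<otimes> \<eta> zQ"
    and twist_flip: "y \<in> carrier Z \<Longrightarrow> twist D \<eta> c (Z.flip y) = \<eta> (hcomp Z False y) \<ominus> iu \<odot> (c \<otimes> \<eta> (hcomp Z True y))"
proof -
  interpret D: superalgebra D by (rule D)
  note h = alg_homD[OF \<eta>] lin_map_more[OF alg_homD(1)[OF \<eta>] Z.vspace_axioms D.vspace_axioms]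
  have ev: "\<eta> (hcomp Z False y) \<otimes> c = c \<otimes> \<eta> (hcomp Z False y)" if y: "y \<in> carrier Z" for y
    using cm[OF Z.hcomp_decomp(1)[OF y, of False]] y c(1) by (simp add: koszul_def h(4))
  have od: "\<eta> (hcomp Z True y) \<otimes> c = \<ominus> (c \<otimes> \<eta> (hcomp Z True y))" if y: "y \<in> carrier Z" for y
    using cm[OF Z.hcomp_decomp(1)[OF y, of True]] y c(1) by (simp add: koszul_def h(4) D.smult_neg_one)
  have cc: "c \<otimes> (c \<otimes> x) = x" if "x \<in> carrier D" for x
    using that c by (simp add: D.m_assoc[symmetric])
  show "twist D \<eta> c \<in> alg_hom Z D"
  proof (intro alg_homI lin_mapI)
    fix x y assume x: "x \<in> carrier Z" and y: "y \<in> carrier Z"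
    show "twist D \<eta> c (x \<oplus>\<^bsub>Z\<^esub> y) = twist D \<eta> c x \<oplus> twist D \<eta> c y"
      using x y c(1) by (simp add: twist_def Z.hcomp_add h D.r_distr D.smult_r_distr D.a_ac)
    define a b a' b' where "a = \<eta> (hcomp Z False x)" "b = \<eta> (hcomp Z True x)" "a' = \<eta> (hcomp Z False y)" "b' = \<eta> (hcomp Z True y)"
    note ab = this
    have k: "a \<in> carrier D" "b \<in> carrier D" "a' \<in> carrier D" "b' \<in> carrier D" using x y by (simp_all add: ab h(4))
    have 1: "a \<otimes> (c \<otimes> b') = c \<otimes> (a \<otimes> b')"
      using ev[OF x, folded ab] k c(1) D.m_assoc[of a c b'] D.m_assoc[of c a b'] by simp
    have "(c \<otimes> b) \<otimes> (c \<otimes> b') = c \<otimes> ((b \<otimes> c) \<otimes> b')" using k c(1) by (simp add: D.m_assoc)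
    also have "\<dots> = c \<otimes> ((\<ominus> (c \<otimes> b)) \<otimes> b')" using od[OF x, folded ab] by simp
    also have "\<dots> = \<ominus> (b \<otimes> b')" using k c(1) by (simp add: D.l_minus D.r_minus D.m_assoc cc)
    finally have 2: "(c \<otimes> b) \<otimes> (c \<otimes> b') = \<ominus> (b \<otimes> b')" .
    have 3: "(iu \<odot> (c \<otimes> b)) \<otimes> (iu \<odot> (c \<otimes> b')) = b \<otimes> b'"
    proof -
      have "(iu \<odot> (c \<otimes> b)) \<otimes> (iu \<odot> (c \<otimes> b')) = (iu * iu) \<odot> ((c \<otimes> b) \<otimes> (c \<otimes> b'))"
        using k c(1) by (simp only: D.smult_mult_l D.smult_mult_r D.smult_assoc D.smult_closed D.mult_closed)
      then show ?thesis unfolding 2 iu_square using k by (simp add: D.smult_neg_one)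
    qed
    have "twist D \<eta> c x \<otimes> twist D \<eta> c y = (a \<oplus> iu \<odot> (c \<otimes> b)) \<otimes> (a' \<oplus> iu \<odot> (c \<otimes> b'))" by (simp add: twist_def ab)
    also have "\<dots> = (a \<otimes> a' \<oplus> (iu \<odot> (c \<otimes> b)) \<otimes> (iu \<odot> (c \<otimes> b'))) \<oplus> (a \<otimes> (iu \<odot> (c \<otimes> b')) \<oplus> (iu \<odot> (c \<otimes> b)) \<otimes> a')"
    proof -
      define u v where "u = iu \<odot> (c \<otimes> b)" "v = iu \<odot> (c \<otimes> b')"
      then have "u \<in> carrier D" "v \<in> carrier D" using k c(1) by simp_all
      then show ?thesis unfolding u_v_def[symmetric] using k by (simp add: D.l_distr D.r_distr D.a_ac)
    qed
    also have "\<dots> = (a \<otimes> a' \<oplus> b \<otimes> b') \<oplus> (iu \<odot> (c \<otimes> (a \<otimes> b')) \<oplus> iu \<odot> (c \<otimes> (b \<otimes> a')))"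
    proof -
      have "a \<otimes> (iu \<odot> (c \<otimes> b')) = iu \<odot> (c \<otimes> (a \<otimes> b'))" using k c(1) 1 by (simp add: D.smult_mult_r)
      moreover have "(iu \<odot> (c \<otimes> b)) \<otimes> a' = iu \<odot> (c \<otimes> (b \<otimes> a'))" using k c(1) by (simp add: D.smult_mult_l D.m_assoc)
      ultimately show ?thesis by (simp only: 3)
    qed
    also have "\<dots> = (a \<otimes> a' \<oplus> b \<otimes> b') \<oplus> iu \<odot> (c \<otimes> (a \<otimes> b' \<oplus> b \<otimes> a'))"
      using k c(1) by (simp add: D.r_distr D.smult_r_distr)
    also have "\<dots> = twist D \<eta> c (x \<otimes>\<^bsub>Z\<^esub> y)"
      using x y by (simp add: twist_def ab Z.hcomp_mult h)
    finally show "twist D \<eta> c (x \<otimes>\<^bsub>Z\<^esub> y) = twist D \<eta> c x \<otimes> twist D \<eta> c y" by (rule sym)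
  next
    fix k x assume x: "x \<in> carrier Z"
    show "twist D \<eta> c (k \<odot>\<^bsub>Z\<^esub> x) = k \<odot> twist D \<eta> c x"
      using x c(1) by (simp add: twist_def Z.hcomp_smult h D.smult_mult_r D.smult_r_distr D.smult_assoc[symmetric] mult.commute)
  next
    fix x assume x: "x \<in> carrier Z" then show "twist D \<eta> c x \<in> carrier D" using c(1) by (simp add: twist_def h(4))
  next
    show "twist D \<eta> c \<one>\<^bsub>Z\<^esub> = \<one>" using c(1) Z.hcomp_homog[OF Z.grade_one] by (simp add: twist_def h)
  qed
  have zz: "hcomp Z False z = zP" "hcomp Z True z = iu \<odot>\<^bsub>Z\<^esub> zQ"
  proof -
    show "hcomp Z False z = zP" unfolding z_def
      by (rule Z.hcomp_unique) (use zPQ_grade in \<open>simp_all add: Z.grade_smult\<close>)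
    have "hcomp Z True (iu \<odot>\<^bsub>Z\<^esub> zQ \<oplus>\<^bsub>Z\<^esub> zP) = iu \<odot>\<^bsub>Z\<^esub> zQ"
      by (rule Z.hcomp_unique) (use zPQ_grade in \<open>simp_all add: Z.grade_smult\<close>)
    then show "hcomp Z True z = iu \<odot>\<^bsub>Z\<^esub> zQ" unfolding z_def by (simp add: Z.a_comm)
  qed
  have "iu \<odot> (c \<otimes> \<eta> (iu \<odot>\<^bsub>Z\<^esub> zQ)) = (iu * iu) \<odot> (c \<otimes> \<eta> zQ)"
    using c(1) by (simp only: h D.smult_mult_r D.smult_assoc D.mult_closed zPQ)
  then show "twist D \<eta> c z = \<eta> zP \<ominus> c \<otimes> \<eta> zQ"
    using c(1) by (simp add: twist_def zz iu_square D.smult_neg_one h(4) a_minus_def)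
  assume y: "y \<in> carrier Z"
  let ?a = "hcomp Z False y" and ?b = "hcomp Z True y"
  have g: "?a \<in> grade Z False" "?b \<in> grade Z True" by (rule Z.hcomp_decomp(1)[OF y])+
  have k: "?a \<in> carrier Z" "?b \<in> carrier Z" using y by simp_all
  have "Z.flip y = ?a \<oplus>\<^bsub>Z\<^esub> (-1) \<odot>\<^bsub>Z\<^esub> ?b" using k by (simp add: Z.flip_def a_minus_def Z.smult_neg_one)
  moreover have "hcomp Z False (?a \<oplus>\<^bsub>Z\<^esub> (-1) \<odot>\<^bsub>Z\<^esub> ?b) = ?a"
    by (rule Z.hcomp_unique[OF g(1)]) (simp add: Z.grade_smult[OF g(2)])
  moreover have "hcomp Z True ((-1) \<odot>\<^bsub>Z\<^esub> ?b \<oplus>\<^bsub>Z\<^esub> ?a) = (-1) \<odot>\<^bsub>Z\<^esub> ?b"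
    by (rule Z.hcomp_unique[OF Z.grade_smult[OF g(2)]]) (simp add: g(1))
  ultimately have "hcomp Z False (Z.flip y) = ?a" "hcomp Z True (Z.flip y) = (-1) \<odot>\<^bsub>Z\<^esub> ?b"
    using k Z.a_comm[of ?a "(-1) \<odot>\<^bsub>Z\<^esub> ?b"] by simp_all
  moreover have "iu \<odot> (c \<otimes> \<eta> ((-1) \<odot>\<^bsub>Z\<^esub> ?b)) = \<ominus> (iu \<odot> (c \<otimes> \<eta> ?b))"
  proof -
    have e: "\<eta> ((-1) \<odot>\<^bsub>Z\<^esub> ?b) = \<ominus> \<eta> ?b" using h(5)[OF k(2), of "-1"] h(4)[OF k(2)] by (simp add: D.smult_neg_one)
    show ?thesis unfolding e using c(1) h(4)[OF k(2)] by (simp add: D.r_minus D.smult_minus_right)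
  qed
  ultimately show "twist D \<eta> c (Z.flip y) = \<eta> ?a \<ominus> iu \<odot> (c \<otimes> \<eta> ?b)"
    by (simp only: twist_def a_minus_def)
qed

lemma emb_hom:
  assumes n: "n \<ge> 1"
  shows "circle_emb n \<in> alg_hom Z H" "circle_emb n \<in> even_map Z H"
    "circle_emb n zP = sH (SpP 1)" "circle_emb n zQ = sH (SpQ 1)"
proof -
  have n1: "1 \<in> {1..n}" using n by simp
  let ?f = "\<lambda>g. cls H (gen g)"
  have f: "?f g \<in> carrier H" "?f g \<in> grade H (spin_par g)" if "g \<in> {SpP 1, SpQ 1}" for g
    using that sH_carr[OF gens(2)[OF n1]] sH_carr[OF gens(3)[OF n1]] sH_grade[OF gens(2)[OF n1]] sH_grade[OF gens(3)[OF n1]]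
    by (auto simp: sH_def)
  interpret ev: evaluation H "{SpP 1, SpQ 1}" spin_par ?f
    by (intro evaluation.intro evaluation_axioms.intro T.B.superalgebra_axioms f(1))
  have e: "evl H ?f (gen (SpP 1)) = ?f (SpP 1)" "evl H ?f (gen (SpQ 1)) = ?f (SpQ 1)"
    by (rule ev.evl_gen, simp)+
  have "\<forall>r\<in>spin_rels n. cls H r = \<zero>\<^bsub>H\<^esub>" by (intro ballI PS.cls_rel)
  then have rel: "T.B.spin_relations n (\<lambda>i. ?f (SpR i)) (\<lambda>i. ?f (SpP i)) (\<lambda>i. ?f (SpQ i))"
    by (rule iffD1[OF T.B.spin_rels_iff[OF PS.cls_hom]])
  have circ: "?f (SpP 1) \<otimes>\<^bsub>H\<^esub> ?f (SpP 1) \<oplus>\<^bsub>H\<^esub> ?f (SpQ 1) \<otimes>\<^bsub>H\<^esub> ?f (SpQ 1) = \<one>\<^bsub>H\<^esub>"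
    by (rule rel[unfolded T.B.spin_relations_def, THEN conjunct2, THEN conjunct2, THEN conjunct2, THEN conjunct2, THEN conjunct2,
          THEN conjunct1, rule_format, OF n1])
  have swap: "?f (SpP 1) \<otimes>\<^bsub>H\<^esub> ?f (SpQ 1) = ?f (SpQ 1) \<otimes>\<^bsub>H\<^esub> ?f (SpP 1)"
    by (rule rel[unfolded T.B.spin_relations_def, THEN conjunct2, THEN conjunct2, THEN conjunct2, THEN conjunct2, THEN conjunct2,
          THEN conjunct2, THEN conjunct1, rule_format]) (use n1 in simp)
  let ?F = "free_superalg {SpP 1, SpQ 1} spin_par"
  have g: "gen (SpP 1) \<in> carrier ?F" "gen (SpQ 1) \<in> carrier ?F" by simp_all
  have r: "evl H ?f r = \<zero>\<^bsub>H\<^esub>" if "r \<in> {gen (SpP 1) * gen (SpQ 1) - gen (SpQ 1) * gen (SpP 1),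
     gen (SpP 1) * gen (SpP 1) + gen (SpQ 1) * gen (SpQ 1) - 1}" for r
    using that
  proof (elim insertE emptyE)
    assume "r = gen (SpP 1) * gen (SpQ 1) - gen (SpQ 1) * gen (SpP 1)"
    then show ?thesis using iffD2[OF T.B.relator_swap[OF ev.evl_hom g g(2,1)]] swap by (simp only: e)
  next
    assume "r = gen (SpP 1) * gen (SpP 1) + gen (SpQ 1) * gen (SpQ 1) - 1"
    then show ?thesis using iffD2[OF T.B.relator_circle[OF ev.evl_hom g]] circ by (simp only: e)
  qed
  note h = PZ.gen_hom[OF T.B.superalgebra_axioms]
  show "circle_emb n \<in> alg_hom Z H" unfolding circle_emb_def by (rule h(1)) (erule f(1) r)+
  show "circle_emb n \<in> even_map Z H" unfolding circle_emb_def by (rule h(3)) (erule f r)+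
  show "circle_emb n zP = sH (SpP 1)" unfolding circle_emb_def zP_def sH_def
    by (rule h(2)) (erule f(1) r | simp)+
  show "circle_emb n zQ = sH (SpQ 1)" unfolding circle_emb_def zQ_def sH_def
    by (rule h(2)) (erule f(1) r | simp)+
qed

text \<open>
  The twist is used twice. Towards \<open>C \<otimes> H / I\<close>, where the image of \<open>I\<^sub>1\<close> vanishes, it shows that
  \<open>F(X\<^sub>1)\<close> vanishes. Towards the affine Hecke-Clifford algebra it maps \<open>I\<^sub>1\<close> into the ideal generated by
  \<open>F(X\<^sub>1)\<close>; as \<open>I\<^sub>1\<close> is stable under \<open>flip\<close>, both \<open>y\<^sub>0 + i c\<^sub>1 y\<^sub>1\<close> and \<open>y\<^sub>0 - i c\<^sub>1 y\<^sub>1\<close> lie in that ideal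
  for \<open>y \<in> I\<^sub>1\<close>, and hence so does \<open>y\<close>.
\<close>

lemma matching_generators:
  fixes I1 F
  defines "J \<equiv> genideal HC {eval_poly HC F (gH (HcX 1))}" and "I \<equiv> genideal H (circle_emb n ` I1)"
  defines "B \<equiv> superquot H I"
  assumes n: "n \<ge> 1" and I1: "homogeneous_ideal I1 Z" and FI: "ez F \<in> I1"
    and E: "\<forall>y\<in>I1. \<exists>w\<in>carrier Z. y = w \<otimes>\<^bsub>Z\<^esub> ez F"
  shows "homogeneous_ideal J HC" "homogeneous_ideal I H"
    "x \<in> J \<Longrightarrow> tensor_map C B id (cls B) (Phi n x) = \<zero>\<^bsub>stensor C B\<^esub>"
    "b \<in> I \<Longrightarrow> psiH b \<in> J"
proof -
  have n1: "1 \<in> {1..n}" using n by simp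
  note emb = emb_hom[OF n]
  have idI1: "ideal I1 Z" using I1 by (simp add: homogeneous_ideal_def)
  interpret I1: two_sided_ideal Z I1 by (rule Z.ideal_two_sided[OF idI1])
  have I1h: "hcomp Z s y \<in> I1" if "y \<in> I1" for y s using I1 that by (simp add: homogeneous_ideal_def)
  have X: "gH (HcX 1) \<in> grade HC False" "gH (HcX 1) \<in> carrier HC"
    using gH_grade[OF gens(6)[OF n1]] gH_carr[OF gens(6)[OF n1]] by simp_all
  let ?FX = "eval_poly HC F (gH (HcX 1))"
  have FX: "?FX \<in> carrier HC" by (rule HC.eval_closed[OF X(2)])
  show J: "homogeneous_ideal J HC" unfolding J_def
    by (rule HC.homogeneous_genideal, elim singletonE, hypsubst, rule exI, rule HC.eval_even[OF X(1)])
  have sub: "circle_emb n ` I1 \<subseteq> carrier H" using alg_homD(4)[OF emb(1) I1.I_carr] by (rule image_subsetI)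
  show I: "homogeneous_ideal I H" unfolding I_def
  proof (rule T.B.homogeneous_genideal_components[OF sub])
    fix x s assume "x \<in> circle_emb n ` I1"
    then obtain y where y: "y \<in> I1" "x = circle_emb n y" by (elim imageE)
    have "hcomp H s x = circle_emb n (hcomp Z s y)"
      unfolding y(2) by (rule hcomp_hom[OF Z.superalgebra_axioms T.B.superalgebra_axioms emb(1,2) I1.I_carr[OF y(1)]])
    then show "hcomp H s x \<in> genideal H (circle_emb n ` I1)"
      using subsetD[OF T.B.genideal_self[OF sub] imageI[OF I1h[OF y(1)]]] by simp
  qed
  have emb_I: "circle_emb n y \<in> I" if "y \<in> I1" for y
    unfolding I_def by (rule subsetD[OF T.B.genideal_self[OF sub] imageI[OF that]])
  interpret QA: homogeneous_quotient HC J by (intro homogeneous_quotient.intro homogeneous_quotient_axioms.intro HC.superalgebra_axioms J)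
  interpret QB: homogeneous_quotient H I by (intro homogeneous_quotient.intro homogeneous_quotient_axioms.intro T.B.superalgebra_axioms I)
  have Bs: "superalgebra B" unfolding B_def by (rule QB.quot_superalgebra)
  interpret TB: tensor_product C B by (simp add: tensor_product_def T.A.superalgebra_axioms Bs)
  have cB: "cls B \<in> alg_hom H B" "cls B \<in> even_map H B" unfolding B_def by (rule QB.cls_alg_hom, rule QB.cls_even)
  have B0: "cls B b = \<zero>\<^bsub>B\<^esub>" if "b \<in> I" for b unfolding B_def using QB.cls_zero[OF QB.I_carr[OF that]] that by simp
  define \<tau> where "\<tau> = tensor_map C B id (cls B)"
  note tau = tensor_map_hom[OF T.A.superalgebra_axioms T.B.superalgebra_axioms Bs cB, folded \<tau>_def]
  note tD = alg_homD[OF tau(1)]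
  define \<eta> where "\<eta> y = \<tau> (T.tn \<one>\<^bsub>C\<^esub> (circle_emb n y))" for y
  have \<eta>: "\<eta> \<in> alg_hom Z (stensor C B)" unfolding \<eta>_def[abs_def]
    by (rule alg_hom_comp[OF tau(1) alg_hom_comp[OF T.inB_hom(1) emb(1)]])
  define c where "c = \<tau> (cD 1)"
  have c: "c \<in> carrier (stensor C B)" unfolding c_def by (rule tD(4)[OF cD_carr[OF n1]])
  have "cD 1 \<otimes>\<^bsub>CH\<^esub> cD 1 = \<one>\<^bsub>CH\<^esub>"
    by (rule D_clifford[unfolded T.D.clifford_relations_def, THEN conjunct1, rule_format, OF n1])
  then have cc: "c \<otimes>\<^bsub>stensor C B\<^esub> c = \<one>\<^bsub>stensor C B\<^esub>"
    unfolding c_def using tD(2)[OF cD_carr[OF n1] cD_carr[OF n1]] tD(3) by simp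
  have cm: "\<eta> y \<otimes>\<^bsub>stensor C B\<^esub> c = koszul s True \<odot>\<^bsub>stensor C B\<^esub> (c \<otimes>\<^bsub>stensor C B\<^esub> \<eta> y)" if y: "y \<in> grade Z s" for y s
  proof -
    have t: "T.tn \<one>\<^bsub>C\<^esub> (circle_emb n y) \<in> carrier CH"
      by (rule T.tn_closed[OF T.A.unit_closed alg_homD(4)[OF emb(1) Z.grade_carr[OF y]]])
    have "\<tau> (T.tn \<one>\<^bsub>C\<^esub> (circle_emb n y) \<otimes>\<^bsub>CH\<^esub> cD 1) = \<tau> (koszul s True \<odot>\<^bsub>CH\<^esub> (cD 1 \<otimes>\<^bsub>CH\<^esub> T.tn \<one>\<^bsub>C\<^esub> (circle_emb n y)))"
      unfolding cD_def by (rule arg_cong[OF T.tn_supercomm[OF cC_grade[OF n1] even_mapD[OF emb(2) y]]])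
    then show ?thesis unfolding \<eta>_def c_def using t cD_carr[OF n1] by (simp only: tD T.D.mult_closed)
  qed
  have \<eta>0: "\<eta> y = \<zero>\<^bsub>stensor C B\<^esub>" if "y \<in> I1" for y
    unfolding \<eta>_def using tau(3)[OF T.A.unit_closed alg_homD(4)[OF emb(1) I1.I_carr[OF that]]] B0[OF emb_I[OF that]]
    by (simp add: TB.tn_zero)
  have "\<tau> (Phi n (gH (HcX 1))) = \<eta> zP \<ominus>\<^bsub>stensor C B\<^esub> c \<otimes>\<^bsub>stensor C B\<^esub> \<eta> zQ"
    unfolding Phi_hom(2)[OF gens(6)[OF n1]] phi_def hc_gen.case \<eta>_def c_def emb(3,4) bD_def[symmetric]
    using bD_carr[OF gens(2)[OF n1]] bD_carr[OF gens(3)[OF n1]] cD_carr[OF n1]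
    by (simp only: tD lin_map_more[OF tD(1) T.D_vspace TB.D_vspace] T.D.mult_closed)
  then have tX: "\<tau> (Phi n (gH (HcX 1))) = twist (stensor C B) \<eta> c z"
    using twist_z[OF TB.D_superalgebra \<eta> c cc cm] by simp
  have "\<tau> (Phi n ?FX) = eval_poly (stensor C B) F (twist (stensor C B) \<eta> c z)"
    using eval_hom[OF HC.superalgebra_axioms TB.D_superalgebra alg_hom_comp[OF tau(1) Phi_hom(1)] X(2), of F] by (simp only: tX)
  also have "\<dots> = twist (stensor C B) \<eta> c (ez F)"
    by (rule eval_hom[OF Z.superalgebra_axioms TB.D_superalgebra twist_hom[OF TB.D_superalgebra \<eta> c cc cm] z_closed(1), symmetric])
  also have "\<dots> = \<zero>\<^bsub>stensor C B\<^esub>"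
    unfolding twist_def using \<eta>0[OF I1h[OF FI]] c by (simp add: TB.D.r_null)
  finally have FX0: "\<tau> (Phi n ?FX) = \<zero>\<^bsub>stensor C B\<^esub>" .
  show "tensor_map C B id (cls B) (Phi n x) = \<zero>\<^bsub>stensor C B\<^esub>" if x: "x \<in> J"
  proof -
    have "\<tau> (Phi n x) = \<zero>\<^bsub>stensor C B\<^esub>"
      by (rule vanish_genideal[OF HC.superalgebra_axioms TB.D_superalgebra alg_hom_comp[OF tau(1) Phi_hom(1)] _ _ x[unfolded J_def]])
        (use FX FX0 in auto)
    then show ?thesis unfolding \<tau>_def .
  qed
  \<comment> \<open>The same twist, now towards the affine Hecke-Clifford algebra.\<close>
  define \<theta> where "\<theta> y = psiH (circle_emb n y)" for y
  have \<theta>: "\<theta> \<in> alg_hom Z HC" unfolding \<theta>_def[abs_def] by (rule alg_hom_comp[OF psiH_hom(1) emb(1)])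
  define d where "d = gH (HcC 1)"
  have d: "d \<in> carrier HC" unfolding d_def by (rule hc_elems(2)[OF n1])
  have dd: "d \<otimes>\<^bsub>HC\<^esub> d = \<one>\<^bsub>HC\<^esub>" unfolding d_def
    by (rule HC.clifford_of_hc[OF HC_relations, unfolded HC.clifford_relations_def, THEN conjunct1, rule_format, OF n1])
  have dm: "\<theta> y \<otimes>\<^bsub>HC\<^esub> d = koszul s True \<odot>\<^bsub>HC\<^esub> (d \<otimes>\<^bsub>HC\<^esub> \<theta> y)" if y: "y \<in> grade Z s" for y s
    using psi_supercomm[OF cC_grade[OF n1] even_mapD[OF emb(2) y]] unfolding psiC_hom(2)[OF n1] \<theta>_def d_def .
  have tw: "twist HC \<theta> d \<in> alg_hom Z HC" "twist HC \<theta> d z = \<theta> zP \<ominus>\<^bsub>HC\<^esub> d \<otimes>\<^bsub>HC\<^esub> \<theta> zQ"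
    by (rule twist_hom[OF HC.superalgebra_axioms \<theta> d dd dm], assumption, rule twist_z[OF HC.superalgebra_axioms \<theta> d dd dm], assumption)
  have tw_flip: "twist HC \<theta> d (Z.flip y) = \<theta> (hcomp Z False y) \<ominus>\<^bsub>HC\<^esub> iu \<odot>\<^bsub>HC\<^esub> (d \<otimes>\<^bsub>HC\<^esub> \<theta> (hcomp Z True y))"
    if "y \<in> carrier Z" for y
    by (rule twist_flip[OF HC.superalgebra_axioms \<theta> d dd dm that])
  define \<kappa> where "\<kappa> = twist HC \<theta> d"
  have xc: "gH (HcX 1) \<otimes>\<^bsub>HC\<^esub> gH (HcC 1) = gH (HcC 1) \<otimes>\<^bsub>HC\<^esub> gH (HcXi 1)"
    by (rule HC_relations[unfolded HC.hc_relations_def, THEN conjunct2, THEN conjunct2, THEN conjunct2, THEN conjunct2, THEN conjunct2, THEN conjunct2, THEN conjunct2, THEN conjunct2, THEN conjunct2, THEN conjunct2, THEN conjunct2, THEN conjunct2, THEN conjunct1, rule_format, OF n1])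
  have "\<kappa> z = psi (SpP 1) \<ominus>\<^bsub>HC\<^esub> gH (HcC 1) \<otimes>\<^bsub>HC\<^esub> psi (SpQ 1)"
    unfolding \<kappa>_def tw(2) unfolding \<theta>_def d_def emb(3,4) psiH_hom(2)[OF gens(2)[OF n1]] psiH_hom(2)[OF gens(3)[OF n1]] ..
  also have "\<dots> = gH (HcX 1)"
    by (rule HC.roundtrip_x(1)[OF d[unfolded d_def] psi_carr[OF gens(2)[OF n1]] psi_carr[OF gens(3)[OF n1]] hc_elems(3,4)[OF n1] dd[unfolded d_def] xc])
      (simp_all add: psi_def)
  finally have kz: "\<kappa> z = gH (HcX 1)" .
  have kF: "\<kappa> (ez F) = ?FX"
    using eval_hom[OF Z.superalgebra_axioms HC.superalgebra_axioms tw(1) z_closed(1), of F] unfolding \<kappa>_def[symmetric] kz .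
  have FXJ: "?FX \<in> J" unfolding J_def by (rule HC.genideal_self'[OF FX])
  have kJ: "\<kappa> y \<in> J" if y: "y \<in> I1" for y
  proof -
    from bspec[OF E y] obtain w where w: "w \<in> carrier Z" "y = w \<otimes>\<^bsub>Z\<^esub> ez F" by (elim bexE)
    have "\<kappa> y = \<kappa> w \<otimes>\<^bsub>HC\<^esub> ?FX"
      unfolding w(2) kF[symmetric] unfolding \<kappa>_def by (rule alg_homD(2)[OF tw(1) w(1) Z.eval_closed[OF z_closed(1)]])
    moreover have "\<kappa> w \<in> carrier HC" unfolding \<kappa>_def by (rule alg_homD(4)[OF tw(1) w(1)])
    ultimately show ?thesis using QA.absorb_l[OF FXJ] by simp
  qed
  have \<theta>J: "\<theta> y \<in> J" if y: "y \<in> I1" for y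
  proof -
    note yc = I1.I_carr[OF y]
    define a b where "a = \<theta> (hcomp Z False y)" and "b = \<theta> (hcomp Z True y)"
    have k: "a \<in> carrier HC" "b \<in> carrier HC" unfolding a_def b_def by (simp_all add: alg_homD(4)[OF \<theta>] yc)
    have fy: "Z.flip y \<in> I1" using iffD1[OF homogeneous_iff_flip[OF idI1] I1] y by simp
    define u where "u = iu \<odot>\<^bsub>HC\<^esub> (d \<otimes>\<^bsub>HC\<^esub> b)"
    have uc: "u \<in> carrier HC" unfolding u_def using k d by simp
    have 1: "\<kappa> y = a \<oplus>\<^bsub>HC\<^esub> u" unfolding \<kappa>_def twist_def a_def b_def u_def ..
    have 2: "\<kappa> (Z.flip y) = a \<ominus>\<^bsub>HC\<^esub> u" unfolding \<kappa>_def tw_flip[OF yc] a_def b_def u_def ..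
    have "\<kappa> y \<oplus>\<^bsub>HC\<^esub> \<kappa> (Z.flip y) = a \<oplus>\<^bsub>HC\<^esub> a"
    proof -
      have "\<kappa> y \<oplus>\<^bsub>HC\<^esub> \<kappa> (Z.flip y) = (a \<oplus>\<^bsub>HC\<^esub> a) \<oplus>\<^bsub>HC\<^esub> (u \<oplus>\<^bsub>HC\<^esub> \<ominus>\<^bsub>HC\<^esub> u)"
        unfolding 1 2 a_minus_def using k uc by (simp add: HC.a_ac HC.r_neg del: HC.r_neg)
      then show ?thesis using k uc by (simp add: HC.r_neg)
    qed
    then have "(1 / 2) \<odot>\<^bsub>HC\<^esub> (a \<oplus>\<^bsub>HC\<^esub> a) \<in> J" using QA.I_smult[OF QA.I_add[OF kJ[OF y] kJ[OF fy]], of "1 / 2"] by simp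
    then have aJ: "a \<in> J" using k by (simp add: HC.smult_r_distr HC.smult_l_distr[symmetric])
    have "u = \<kappa> y \<ominus>\<^bsub>HC\<^esub> a"
    proof -
      have "\<kappa> y \<ominus>\<^bsub>HC\<^esub> a = u \<oplus>\<^bsub>HC\<^esub> (a \<oplus>\<^bsub>HC\<^esub> \<ominus>\<^bsub>HC\<^esub> a)" unfolding 1 a_minus_def using k uc by (simp add: HC.a_ac del: HC.r_neg)
      then show ?thesis using k uc by (simp add: HC.r_neg)
    qed
    then have "u \<in> J" using QA.I_diff[OF kJ[OF y] aJ] by simp
    then have "(- iu) \<odot>\<^bsub>HC\<^esub> (d \<otimes>\<^bsub>HC\<^esub> u) \<in> J" by (rule QA.I_smult[OF QA.absorb_l[OF _ d]])
    moreover have "(- iu) \<odot>\<^bsub>HC\<^esub> (d \<otimes>\<^bsub>HC\<^esub> u) = (- iu * iu) \<odot>\<^bsub>HC\<^esub> ((d \<otimes>\<^bsub>HC\<^esub> d) \<otimes>\<^bsub>HC\<^esub> b)"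
      unfolding u_def using k d by (simp only: HC.smult_mult_r HC.smult_assoc HC.m_assoc HC.mult_closed)
    ultimately have bJ: "b \<in> J" using k iu_square by (simp add: dd)
    have "\<theta> y = a \<oplus>\<^bsub>HC\<^esub> b"
      unfolding a_def b_def using arg_cong[OF Z.hcomp_decomp(2)[OF yc, of False], of \<theta>] yc by (simp add: alg_homD(6)[OF \<theta>])
    then show ?thesis using QA.I_add[OF aJ bJ] by simp
  qed
  show "psiH b \<in> J" if b: "b \<in> I"
  proof -
    have "cls (superquot HC J) (psiH b) = \<zero>\<^bsub>superquot HC J\<^esub>"
    proof (rule vanish_genideal[OF T.B.superalgebra_axioms QA.quot_superalgebra alg_hom_comp[OF QA.cls_alg_hom psiH_hom(1)] sub _ b[unfolded I_def]])
      fix x assume "x \<in> circle_emb n ` I1"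
      then obtain y where y: "y \<in> I1" "x = circle_emb n y" by (elim imageE)
      show "cls (superquot HC J) (psiH x) = \<zero>\<^bsub>superquot HC J\<^esub>"
        using \<theta>J[OF y(1)] QA.cls_zero[OF QA.I_carr[OF \<theta>J[OF y(1)]]] unfolding y(2) \<theta>_def by simp
    qed
    then show ?thesis using QA.cls_zero[OF alg_homD(4)[OF psiH_hom(1) QB.I_carr[OF b]]] by simp
  qed
qed

text \<open>
  The ideal attached to a quotient \<open>B\<close> is the kernel of \<open>x \<mapsto> \<Phi>(x)\<close> followed by the projection to \<open>C \<otimes> B\<close>; it
  depends on \<open>B\<close> alone, not on the ideal chosen to present it.
\<close>

definition hc_partner where
  "hc_partner B = superquot HC {x \<in> carrier HC. tensor_map C B id (cls B) (Phi n x) = \<zero>\<^bsub>stensor C B\<^esub>}"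

text \<open>
  The zero of a quotient algebra is the ideal divided out, so the ideal is recovered from \<open>A\<close>.
\<close>

definition spin_partner where
  "spin_partner A = superquot H {b \<in> carrier H. psiH b \<in> \<zero>\<^bsub>A\<^esub>}"

lemma partners:
  assumes n: "n \<ge> 1" and I1: "homogeneous_ideal I1 Z" and FI: "ez F \<in> I1"
    and E: "\<forall>y\<in>I1. \<exists>w\<in>carrier Z. y = w \<otimes>\<^bsub>Z\<^esub> ez F"
  shows "hc_partner (spin_quotient n I1) = hc_quotient n F" "spin_partner (hc_quotient n F) = spin_quotient n I1"
    "iso_via_Phi n (hc_quotient n F) (spin_quotient n I1)" "iso_via_Psi n (spin_quotient n I1) (hc_quotient n F)"
proof -
  let ?J = "genideal HC {eval_poly HC F (gH (HcX 1))}" and ?I = "genideal H (circle_emb n ` I1)"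
  have A: "hc_quotient n F = superquot HC ?J" and B: "spin_quotient n I1 = superquot H ?I"
    unfolding hc_quotient_def spin_quotient_def gH_def by (rule refl)+
  note m = matching_ideals[OF matching_generators(1-4)[OF n I1 FI E]]
  show "iso_via_Phi n (hc_quotient n F) (spin_quotient n I1)" unfolding A B by (rule m(1))
  show "iso_via_Psi n (spin_quotient n I1) (hc_quotient n F)" unfolding A B by (rule m(2))
  show "hc_partner (spin_quotient n I1) = hc_quotient n F"
    unfolding A B hc_partner_def by (rule arg_cong[OF m(3)[symmetric]])
  have "\<zero>\<^bsub>superquot HC ?J\<^esub> = ?J" by (simp add: superquot_def FactRing_def)
  then show "spin_partner (hc_quotient n F) = spin_quotient n I1"
    unfolding A B spin_partner_def by (simp only:) (rule arg_cong[OF m(4)[symmetric]])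
qed

lemma spin_partners:
  assumes n: "n \<ge> 1" and B: "B \<in> cyclotomic_spin n"
  shows "hc_partner B \<in> cyclotomic_hc n" "spin_partner (hc_partner B) = B" 
    "iso_via_Phi n (hc_partner B) B" "iso_via_Psi n B (hc_partner B)"
proof -
  from B obtain I1 where I1: "homogeneous_ideal I1 Z" "I1 \<noteq> {\<zero>\<^bsub>Z\<^esub>}" and Be: "B = spin_quotient n I1"
    unfolding cyclotomic_spin_def by (elim CollectE exE conjE)
  from admissible_of_homogeneous[OF I1] obtain F where F: "admissible F" "ez F \<in> I1"
    and E: "\<forall>y\<in>I1. \<exists>w\<in>carrier Z. y = w \<otimes>\<^bsub>Z\<^esub> ez F" by (elim exE conjE)
  note p = partners[OF n I1(1) F(2) E]
  show "hc_partner B \<in> cyclotomic_hc n" unfolding Be p(1) cyclotomic_hc_def by (rule CollectI, intro exI conjI, rule refl, rule F(1))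
  show "spin_partner (hc_partner B) = B" unfolding Be p(1,2) ..
  show "iso_via_Phi n (hc_partner B) B" "iso_via_Psi n B (hc_partner B)" unfolding Be p(1) by (rule p(3,4))+
qed

lemma hc_partners:
  assumes n: "n \<ge> 1" and A: "A \<in> cyclotomic_hc n"
  shows "spin_partner A \<in> cyclotomic_spin n" "hc_partner (spin_partner A) = A"
proof -
  from A obtain F where F: "admissible F" and Ae: "A = hc_quotient n F"
    unfolding cyclotomic_hc_def by (elim CollectE exE conjE)
  note h = homogeneous_of_admissible[OF F]
  have m: "ez F \<in> genideal Z {ez F}" by (rule Z.genideal_self'[OF Z.eval_closed[OF z_closed(1)]])
  have E: "\<forall>y\<in>genideal Z {ez F}. \<exists>w\<in>carrier Z. y = w \<otimes>\<^bsub>Z\<^esub> ez F" by (rule ballI, rule h(3))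
  note p = partners[OF n h(1) m E]
  show "spin_partner A \<in> cyclotomic_spin n" unfolding Ae p(2) cyclotomic_spin_def by (rule CollectI, intro exI conjI, rule refl, rule h(1), rule h(2))
  show "hc_partner (spin_partner A) = A" unfolding Ae p(1,2) ..
qed

end

theorem theorem6p4:
  fixes n :: nat
  assumes "n \<ge> 1"
  shows "(\<exists>\<beta>. bij_betw \<beta> (cyclotomic_spin n) (cyclotomic_hc n) \<and>
            (\<forall>B\<in>cyclotomic_spin n. iso_via_Phi n (\<beta> B) B \<and> iso_via_Psi n B (\<beta> B)))
       \<and> (\<forall>A\<in>cyclotomic_hc n. \<exists>B\<in>cyclotomic_spin n. iso_via_Phi n A B)
       \<and> (\<forall>B\<in>cyclotomic_spin n. \<exists>A\<in>cyclotomic_hc n. iso_via_Psi n B A)"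
proof (intro conjI exI ballI)
  let ?\<beta> = "hecke.hc_partner n" and ?\<gamma> = "hecke.spin_partner n"
  note s = hecke.spin_partners[OF assms] and h = hecke.hc_partners[OF assms]
  show "bij_betw ?\<beta> (cyclotomic_spin n) (cyclotomic_hc n)"
    by (rule bij_betw_byWitness[where f' = ?\<gamma>]) (intro ballI image_subsetI, erule s h)+
  show "iso_via_Phi n (?\<beta> B) B" "iso_via_Psi n B (?\<beta> B)" if "B \<in> cyclotomic_spin n" for B
    by (rule s(3,4)[OF that])+
  show "\<exists>B\<in>cyclotomic_spin n. iso_via_Phi n A B" if "A \<in> cyclotomic_hc n" for A
    using s(3)[OF h(1)[OF that]] h(2)[OF that] h(1)[OF that] by (intro bexI[of _ "?\<gamma> A"]) simp_all
  show "\<exists>A\<in>cyclotomic_hc n. iso_via_Psi n B A" if "B \<in> cyclotomic_spin n" for B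
    by (rule bexI[of _ "?\<beta> B"], rule s(4)[OF that], rule s(1)[OF that])
qed

end
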